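(* Assume $\beta^2>\alpha>1$ and $l=c\log n$ with a constant $c$ satisfying $c\log\alpha<1/8$, and let $(H,\sigma)\sim\mathcal H(n,d,p_n,q_n)$ with $l$-th self-avoiding matrix $B^{(l)}$. Then for any $\epsilon>0$, $$\lim_{n\to\infty}\mathbb P_{\mathcal H_n}\Big(\sup_{\|x\|_2=1,\ x^\top(B^{(l)}\mathbf 1)=x^\top(B^{(l)}\sigma)=0}\|B^{(l)}x\|_2\le n^{\epsilon}\alpha^{l/2}\Big)=1.$$
   Context: Fix an integer $d\ge3$ and constants $a\ge b>0$; $p_n=a/\binom{n}{d-1}$, $q_n=b/\binom{n}{d-1}$. Under $\mathcal H(n,d,p_n,q_n)$, $\sigma\in\{-1,+1\}^n$ has i.i.d. uniform entries, and given $\sigma$ each $d$-subset $e\subset[n]$ is independently a hyperedge of the $d$-uniform hypergraph $H$ on $[n]$ with probability $p_n$ if all spins in $e$ agree and $q_n$ otherwise; $\mathbb P_{\mathcal H_n}$ is probability under this law. $\alpha=(d-1)\frac{a+(2^{d-1}-1)b}{2^{d-1}}$, $\beta=(d-1)\frac{a-b}{2^{d-1}}$. $\mathbf 1=(1,\dots,1)\in\mathbb R^n$. A walk of length $l$ is $(i_0,e_1,i_1,\dots,e_l,i_l)$ with hyperedges $e_j$ of $H$, $i_{j-1}\ne i_j$, $\{i_{j-1},i_j\}\subset e_j$; it is self-avoiding if $i_0,\dots,i_l$ are distinct, $e_{j-1}\cap e_j=\{i_{j-1}\}$ for $2\le j\le l$, and $e_j\cap e_k=\emptyset$ whenever $k\ge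 j+2$. $B^{(l)}_{ij}$ is the number of self-avoiding walks of length $l$ in $H$ from $i$ to $j$ for $i\neq j$, and $B^{(l)}_{ii}=0$. *)

theory Defs
  imports "HOL-Analysis.Analysis"
begin

text \<open>Vertex set is {..<n}. Spin vectors are real-valued functions with values in {-1,1}
  on {..<n} (extensional outside). A hypergraph is a set of d-subsets of {..<n}.\<close>

definition dsets :: "nat \<Rightarrow> nat \<Rightarrow> nat set set" where
  "dsets n d = {e. e \<subseteq> {..<n} \<and> card e = d}"

definition hprob :: "real \<Rightarrow> nat \<Rightarrow> nat \<Rightarrow> real" where
  "hprob a d n = a / real (n choose (d - 1))"

definition edge_prob :: "real \<Rightarrow> real \<Rightarrow> nat \<Rightarrow> nat \<Rightarrow> (nat \<Rightarrow> real) \<Rightarrow> nat set \<Rightarrow> real" where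
  "edge_prob a b d n \<sigma> e =
     (if \<forall>i\<in>e. \<forall>j\<in>e. \<sigma> i = \<sigma> j then hprob a d n else hprob b d n)"

definition hsbm_prob :: "nat \<Rightarrow> nat \<Rightarrow> real \<Rightarrow> real \<Rightarrow>
    ((nat \<Rightarrow> real) \<Rightarrow> nat set set \<Rightarrow> bool) \<Rightarrow> real" where
  "hsbm_prob n d a b E =
     (\<Sum>\<sigma>\<in>PiE {..<n} (\<lambda>_. {-1, 1}). \<Sum>H\<in>Pow (dsets n d).
        (1/2) ^ n *
        (\<Prod>e\<in>dsets n d. if e \<in> H then edge_prob a b d n \<sigma> e
                             else 1 - edge_prob a b d n \<sigma> e) *
        (if E \<sigma> H then 1 else 0))"

definition alpha_par :: "nat \<Rightarrow> real \<Rightarrow> real \<Rightarrow> real" where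
  "alpha_par d a b = real (d - 1) * (a + (2 ^ (d - 1) - 1) * b) / 2 ^ (d - 1)"

definition beta_par :: "nat \<Rightarrow> real \<Rightarrow> real \<Rightarrow> real" where
  "beta_par d a b = real (d - 1) * (a - b) / 2 ^ (d - 1)"

text \<open>A walk of length l: vertex list vs = [i_0,...,i_l], edge list es = [e_1,...,e_l]
  (es!k is e_(k+1)).\<close>
definition is_walk :: "nat set set \<Rightarrow> nat \<Rightarrow> nat list \<Rightarrow> nat set list \<Rightarrow> bool" where
  "is_walk H l vs es \<longleftrightarrow> length vs = l + 1 \<and> length es = l \<and>
     (\<forall>k<l. es ! k \<in> H \<and> vs ! k \<noteq> vs ! (k + 1) \<and> {vs ! k, vs ! (k + 1)} \<subseteq> es ! k)"

definition self_avoiding :: "nat set set \<Rightarrow> nat \<Rightarrow> nat list \<Rightarrow> nat set list \<Rightarrow> bool" where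
  "self_avoiding H l vs es \<longleftrightarrow> is_walk H l vs es \<and> distinct vs \<and>
     (\<forall>k. 1 \<le> k \<and> k < l \<longrightarrow> es ! (k - 1) \<inter> es ! k = {vs ! k}) \<and>
     (\<forall>j k. j < l \<and> k < l \<and> j + 2 \<le> k \<longrightarrow> es ! j \<inter> es ! k = {})"

definition saw_mat :: "nat set set \<Rightarrow> nat \<Rightarrow> nat \<Rightarrow> nat \<Rightarrow> real" where
  "saw_mat H l i j = (if i = j then 0 else
     real (card {(vs, es). self_avoiding H l vs es \<and> vs ! 0 = i \<and> vs ! l = j}))"

end

theory Submission
  imports Defs "HOL-Real_Asymp.Real_Asymp"
begin

text \<open>The proof is a moment argument conditional on balanced spins; it avoids couplings with branching
  processes.  Centring the edge indicators one at a time along a walk gives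
  \[ B^{(m)} = \Delta^{(m)} + \sum_{s<m} \bigl(\Delta^{(s)} \bar A B^{(m-1-s)} - \Gamma^{(s,m-1-s)}\bigr), \]
  where \<open>\<Delta>\<close> carries centred weights, \<open>\<Gamma>\<close> collects the concatenations that fail to be self-avoiding, and the
  mean matrix is, up to a small error, \<open>(\<alpha> 1 1\<^sup>T + \<beta> \<sigma> \<sigma>\<^sup>T) / n\<close>.  Traces of high but fixed even powers show that
  \<open>\<parallel>\<Delta>\<^sup>(\<^sup>s\<^sup>)\<parallel> \<le> n\<^sup>\<epsilon> \<alpha>\<^sup>s\<^sup>/\<^sup>2\<close>, and second moments show that \<open>\<Gamma>\<close> is negligible.  All of these moments are reduced to one
  weighted count of families of self-avoiding walks: edges discovered at a single old vertex form a forest, in which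
  self-avoiding walks are determined by their end points, and each other new edge costs a factor of order \<open>1/n\<close>.

  Reading the expansion from the other side, \<open>B\<^sup>(\<^sup>m\<^sup>)1\<close> is close to the sum of the \<open>\<alpha>\<^sup>m\<^sup>-\<^sup>s \<Delta>\<^sup>(\<^sup>s\<^sup>)1\<close>, and likewise for \<open>\<sigma>\<close> and
  \<open>\<beta>\<close>.  Hence orthogonality to \<open>B\<^sup>(\<^sup>l\<^sup>)1\<close> and \<open>B\<^sup>(\<^sup>l\<^sup>)\<sigma>\<close> forces near-orthogonality to \<open>B\<^sup>(\<^sup>m\<^sup>)1\<close> and \<open>B\<^sup>(\<^sup>m\<^sup>)\<sigma>\<close> for every
  \<open>m \<le> l\<close>; here \<open>\<beta>\<^sup>2 > \<alpha>\<close> enters.  Inserting this into the expansion of \<open>B\<^sup>(\<^sup>l\<^sup>)x\<close> gives the bound.\<close>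

section \<open>Self-avoiding walks\<close>

text \<open>A loss of \<open>n ^ \<epsilon>\<close> is allowed, so a moment of fixed order suffices:
  the trace costs a factor of order n, and a high root makes it harmless. The obstacle is to count a
  fixed number of walks of length of order log n with only polylogarithmic loss: once discovered, an
  edge can be reused at no cost, so walks inside the discovered edges must not multiply. The forest
  structure prevents this, and the edges that violate it need an account of their own.

  Balanced spins give every vertex the same mean degree up to an error of order n^(-1/4); powers of
  the degree bound with exponent of order log n then stay within a factor 2 of the powers of
  \<alpha>.

  The exponent 1/8 comes from the concatenation errors. Up to small factors their second moment is
  at most \<alpha>^(2l) / n^(1/2), hence n^(-1/4) when \<alpha>^l is at most n^(1/8); their norm
  n^(-1/8) is then amplified by \<alpha>^l.\<close>

definition verts :: "nat list \<Rightarrow> nat set list \<Rightarrow> nat set" where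
  "verts vs es = set vs \<union> \<Union>(set es)"

text \<open>A recursive form of self-avoidance: the first edge meets everything that comes later,
  vertices and edges alike, only in the next vertex. One condition per step replaces the conditions
  on pairs of edges and permits induction along the walk.\<close>

fun sa :: "nat list \<Rightarrow> nat set list \<Rightarrow> bool" where
  "sa [v] [] = True"
| "sa (v # u # vs) (e # es) =
     (v \<noteq> u \<and> v \<in> e \<and> u \<in> e \<and> e \<inter> verts (u # vs) es = {u} \<and> sa (u # vs) es)"
| "sa _ _ = False"

lemma verts_simps [simp]:
  "verts [v] [] = {v}"
  "verts (v # vs) (e # es) = insert v (e \<union> verts vs es)"
  by (auto simp: verts_def)

lemma sa_length: "sa vs es \<Longrightarrow> length vs = Suc (length es)"
  by (induction vs es rule: sa.induct) auto

lemma sa_Nil_iff: "sa vs [] \<longleftrightarrow> (\<exists>v. vs = [v])"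
  by (cases vs rule: remdups_adj.cases) auto

lemma sa_ConsE:
  assumes "sa vs (e # es)"
  obtains v u vs' where "vs = v # u # vs'" "v \<noteq> u" "v \<in> e" "u \<in> e"
    "e \<inter> verts (u # vs') es = {u}" "sa (u # vs') es"
  using assms by (cases vs rule: remdups_adj.cases) auto

lemma sa_not_Nil: "sa vs es \<Longrightarrow> vs \<noteq> []"
  using sa_length by fastforce

lemma self_avoiding_Suc:
  "self_avoiding H (Suc l) (v # u # vs) (e # es) \<longleftrightarrow>
     e \<in> H \<and> v \<noteq> u \<and> v \<in> e \<and> u \<in> e \<and> v \<notin> set (u # vs) \<and>
     (0 < l \<longrightarrow> e \<inter> es ! 0 = {u}) \<and> (\<forall>k<l. 1 \<le> k \<longrightarrow> e \<inter> es ! k = {}) \<and>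
     self_avoiding H l (u # vs) es" (is "?L \<longleftrightarrow> ?R")
proof -
  have A: "(\<forall>k<Suc l. P k) \<longleftrightarrow> P 0 \<and> (\<forall>k<l. P (Suc k))" for P l
    by (auto simp: less_Suc_eq_0_disj)
  \<comment> \<open>With the bound on \<open>k\<close> outermost and \<open>j\<close> left
    unbounded, \<open>A\<close> and \<open>B\<close> can peel off the first edge.\<close>
  have alt: "self_avoiding H l vs es \<longleftrightarrow> is_walk H l vs es \<and> distinct vs \<and>
     (\<forall>k<l. 1 \<le> k \<longrightarrow> es ! (k - 1) \<inter> es ! k = {vs ! k}) \<and>
     (\<forall>k<l. \<forall>j. j + 2 \<le> k \<longrightarrow> es ! j \<inter> es ! k = {})" for l vs es
  proof -
    have "(\<forall>j k. j < l \<and> k < l \<and> j + 2 \<le> k \<longrightarrow> Q j k) \<longleftrightarrow> (\<forall>k<l. \<forall>j. j + 2 \<le> k \<longrightarrow> Q j k)" for Q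
    proof (intro iffI allI impI)
      fix k j assume "\<forall>j k. j < l \<and> k < l \<and> j + 2 \<le> k \<longrightarrow> Q j k" "k < l" "j + 2 \<le> k"
      moreover have "j < l" using calculation(2,3) by linarith
      ultimately show "Q j k" by blast
    qed blast
    then show ?thesis unfolding self_avoiding_def by auto
  qed
  have w: "is_walk H (Suc l) (v # u # vs) (e # es) \<longleftrightarrow>
      e \<in> H \<and> v \<noteq> u \<and> v \<in> e \<and> u \<in> e \<and> is_walk H l (u # vs) es"
    unfolding is_walk_def A by auto
  have c2: "(\<forall>k<Suc l. 1 \<le> k \<longrightarrow> (e # es) ! (k - 1) \<inter> (e # es) ! k = {(v # u # vs) ! k}) \<longleftrightarrow>
     (0 < l \<longrightarrow> e \<inter> es ! 0 = {u}) \<and> (\<forall>k<l. 1 \<le> k \<longrightarrow> es ! (k - 1) \<inter> es ! k = {(u # vs) ! k})"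
    (is "?l \<longleftrightarrow> ?r")
  proof -
    have "?l \<longleftrightarrow> (\<forall>k<l. (e # es) ! k \<inter> es ! k = {(u # vs) ! k})"
      unfolding A by simp
    also have "\<dots> \<longleftrightarrow> ?r"
      by (cases l) (simp_all add: A)
    finally show ?thesis .
  qed
  have B: "(\<forall>j. P j) \<longleftrightarrow> P 0 \<and> (\<forall>j. P (Suc j))" for P :: "nat \<Rightarrow> bool"
    by (metis not0_implies_Suc)
  have c3: "(\<forall>k<Suc l. \<forall>j. j + 2 \<le> k \<longrightarrow> (e # es) ! j \<inter> (e # es) ! k = {}) \<longleftrightarrow>
     (\<forall>k<l. 1 \<le> k \<longrightarrow> e \<inter> es ! k = {}) \<and> (\<forall>k<l. \<forall>j. j + 2 \<le> k \<longrightarrow> es ! j \<inter> es ! k = {})"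
  proof -
    have "(\<forall>j. Suc j \<le> k \<longrightarrow> (e # es) ! j \<inter> X = {}) \<longleftrightarrow>
        (1 \<le> k \<longrightarrow> e \<inter> X = {}) \<and> (\<forall>j. j + 2 \<le> k \<longrightarrow> es ! j \<inter> X = {})" for k X
      using B[of "\<lambda>j. Suc j \<le> k \<longrightarrow> (e # es) ! j \<inter> X = {}"] by simp
    then show ?thesis unfolding A by (simp add: all_conj_distrib imp_conjR)
  qed
  show ?thesis unfolding alt w c2 c3 by auto
qed

lemma sa_hd_in: "sa (v # vs) (e # es) \<Longrightarrow> v \<in> e"
  by (cases vs) auto

text \<open>The original definition compares edges with edges. That the first edge also avoids later
  vertices follows because every vertex of the tail other than its head lies on an edge of the tail.
  Conversely, edges after the first tail edge cannot contain \<open>u\<close>, since that edge meets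
  the rest only in the vertex following \<open>u\<close>.\<close>

lemma self_avoiding_iff_sa:
  "self_avoiding H l vs es \<longleftrightarrow> sa vs es \<and> length es = l \<and> set es \<subseteq> H"
proof (induction es arbitrary: vs l)
  case Nil
  show ?case
    by (auto simp: self_avoiding_def is_walk_def sa_Nil_iff length_Suc_conv)
next
  case (Cons e es)
  show ?case
  proof (cases "\<exists>v u vs' l'. vs = v # u # vs' \<and> l = Suc l'")
    case False
    have "length vs \<ge> 2 \<Longrightarrow> l \<noteq> 0 \<Longrightarrow> False"
      using False by (cases vs rule: remdups_adj.cases; cases l) simp_all
    then have "\<not> self_avoiding H l vs (e # es)"
      unfolding self_avoiding_def is_walk_def by fastforce
    moreover have "\<not> (sa vs (e # es) \<and> length (e # es) = l)"
      using \<open>length vs \<ge> 2 \<Longrightarrow> l \<noteq> 0 \<Longrightarrow> False\<close> sa_length by fastforce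
    ultimately show ?thesis by blast
  next
    case True
    then obtain v u vs' l' where eq: "vs = v # u # vs'" "l = Suc l'" by blast
    show ?thesis
    proof
      assume L: "self_avoiding H l vs (e # es)"
      note L' = L[unfolded eq self_avoiding_Suc]
      have S: "sa (u # vs') es" "length es = l'" "set es \<subseteq> H"
        using L' Cons.IH by blast+
      have sa': "self_avoiding H l' (u # vs') es" using L' by blast
      have "e \<inter> verts (u # vs') es \<subseteq> {u}"
      proof
        fix x assume x: "x \<in> e \<inter> verts (u # vs') es"
        have ed: "x = u" if "k < l'" "x \<in> es ! k" for k
          using that L' x by (cases "k = 0") auto
        from x consider "x = u" | "x \<in> set vs'" | f where "f \<in> set es" "x \<in> f"
          by (auto simp: verts_def)
        then show "x \<in> {u}"
        proof cases
          case 2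
          then obtain i where i: "i < length vs'" "vs' ! i = x" by (auto simp: in_set_conv_nth)
          have iw: "is_walk H l' (u # vs') es" using sa' by (simp add: self_avoiding_def)
          then have il: "i < l'" using i by (auto simp: is_walk_def)
          then have "{(u # vs') ! i, (u # vs') ! (i + 1)} \<subseteq> es ! i"
            using iw by (auto simp: is_walk_def)
          then have "x \<in> es ! i" using i by simp
          then show ?thesis using ed il by blast
        next
          case 3
          then show ?thesis using ed S(2) by (metis in_set_conv_nth singleton_iff)
        qed simp
      qed
      then have "e \<inter> verts (u # vs') es = {u}" using L' by (auto simp: verts_def)
      then show "sa vs (e # es) \<and> length (e # es) = l \<and> set (e # es) \<subseteq> H"
        using S L' eq by auto
    next
      assume R: "sa vs (e # es) \<and> length (e # es) = l \<and> set (e # es) \<subseteq> H"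
      then have R': "v \<noteq> u" "v \<in> e" "u \<in> e" "e \<inter> verts (u # vs') es = {u}" "sa (u # vs') es"
         "length es = l'" "set es \<subseteq> H" "e \<in> H"
        using eq by auto
      have "self_avoiding H l' (u # vs') es" using R' Cons.IH by blast
      moreover have "v \<notin> set (u # vs')" using R' by (auto simp: verts_def)
      moreover have "e \<inter> es ! 0 = {u}" if l0: "0 < l'"
      proof -
        obtain f fs where es: "es = f # fs" using l0 R'(6) by (cases es) auto
        have "u \<in> f" using R'(5) es sa_hd_in by blast
        then show ?thesis using R'(3,4) es by (auto simp: verts_def)
      qed
      moreover have "e \<inter> es ! k = {}" if k: "k < l'" "1 \<le> k" for k
      proof -
        obtain f fs where es: "es = f # fs" using k R'(6) by (cases es) auto
        have "sa (u # vs') (f # fs)" using R'(5) es by simp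
        then obtain w ws where w: "vs' = w # ws" "u \<noteq> w" "u \<in> f" "w \<in> f" "f \<inter> verts (w # ws) fs = {w}"
          by (rule sa_ConsE) blast
        have "es ! k \<in> set fs" using k es R'(6) by (cases k) auto
        then have "u \<notin> es ! k" using w by (auto simp: verts_def)
        moreover have "e \<inter> es ! k \<subseteq> {u}" using R'(4,6) k by (auto simp: verts_def dest: nth_mem)
        ultimately show ?thesis by blast
      qed
      ultimately show "self_avoiding H l vs (e # es)"
        unfolding eq self_avoiding_Suc using R' by auto
    qed
  qed
qed

lemma sa_distinct_es: "sa vs es \<Longrightarrow> distinct es"
proof (induction vs es rule: sa.induct)
  case (2 v u vs e es)
  have "e \<notin> set es"
  proof
    assume "e \<in> set es"
    then have "e \<subseteq> verts (u # vs) es" by (auto simp: verts_def)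
    then show False using 2 by auto
  qed
  then show ?case using 2 by auto
qed auto

text \<open>For disjoint walks, an edge that joins their ends without giving a self-avoiding walk
  must violate one of the two intersection conditions; this is how the concatenation error is
  bounded later.\<close>

lemma sa_join:
  assumes "sa vs1 es1" "sa vs2 es2" "last vs1 \<in> e" "hd vs2 \<in> e" "last vs1 \<noteq> hd vs2"
    "e \<inter> verts vs1 es1 = {last vs1}" "e \<inter> verts vs2 es2 = {hd vs2}"
    "verts vs1 es1 \<inter> verts vs2 es2 = {}"
  shows "sa (vs1 @ vs2) (es1 @ e # es2)"
  using assms
proof (induction vs1 es1 rule: sa.induct)
  case (1 v)
  obtain y ys where "vs2 = y # ys" using 1(2) sa_not_Nil by (cases vs2) auto
  then show ?case using 1 by auto
next
  case (2 v u vs f es)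
  have IH: "sa ((u # vs) @ vs2) (es @ e # es2)"
    by (rule "2.IH") (use 2 in \<open>auto simp: verts_def\<close>)
  have v: "verts (u # vs @ vs2) (es @ e # es2) = verts (u # vs) es \<union> e \<union> verts vs2 es2"
    by (auto simp: verts_def)
  have l: "last (u # vs) \<in> verts (u # vs) es" unfolding verts_def using last_in_set by blast
  have fe: "f \<inter> e \<subseteq> {last (u # vs)}" using 2 by auto
  have "f \<inter> (verts (u # vs) es \<union> e \<union> verts vs2 es2) = {u}"
    using 2(2,9) fe l by auto
  then show ?case using 2 IH v by auto
qed auto

lemma verts_rev [simp]: "verts (rev vs) (rev es) = verts vs es"
  by (auto simp: verts_def)

lemma sa_rev: "sa vs es \<Longrightarrow> sa (rev vs) (rev es)"
proof (induction vs es rule: sa.induct)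
  case (2 v u vs e es)
  have "v \<notin> verts (u # vs) es" using 2 by auto
  have "sa (rev (u # vs) @ [v]) (rev es @ e # [])"
  proof (rule sa_join)
    have l: "last (rev (u # vs)) = u" by simp
    show "last (rev (u # vs)) \<in> e" "last (rev (u # vs)) \<noteq> hd [v]" using 2 by auto
    show "e \<inter> verts (rev (u # vs)) (rev es) = {last (rev (u # vs))}"
      unfolding verts_rev l using 2 by simp
    show "verts (rev (u # vs)) (rev es) \<inter> verts [v] [] = {}"
      unfolding verts_rev using \<open>v \<notin> verts (u # vs) es\<close> by auto
  qed (use 2 in auto)
  then show ?case by simp
qed auto

lemma sa_split:
  assumes "sa vs (es1 @ e # es2)"
  shows "\<exists>vs1 vs2. vs = vs1 @ vs2 \<and> sa vs1 es1 \<and> sa vs2 es2 \<and> last vs1 \<in> e \<and> hd vs2 \<in> e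
           \<and> last vs1 \<noteq> hd vs2"
  using assms
proof (induction es1 arbitrary: vs)
  case Nil
  then have "sa vs (e # es2)" by simp
  then obtain v u vs' where "vs = v # u # vs'" "v \<noteq> u" "v \<in> e" "u \<in> e" "sa (u # vs') es2"
    by (rule sa_ConsE) blast
  then show ?case by (intro exI[of _ "[v]"] exI[of _ "u # vs'"]) auto
next
  case (Cons f es1)
  then have "sa vs (f # (es1 @ e # es2))" by simp
  then obtain v u vs' where v: "vs = v # u # vs'" "v \<noteq> u" "v \<in> f" "u \<in> f"
    "f \<inter> verts (u # vs') (es1 @ e # es2) = {u}" "sa (u # vs') (es1 @ e # es2)"
    by (rule sa_ConsE) blast
  from Cons.IH[OF v(6)] obtain vs1 vs2 where w: "u # vs' = vs1 @ vs2" "sa vs1 es1" "sa vs2 es2"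
    "last vs1 \<in> e" "hd vs2 \<in> e" "last vs1 \<noteq> hd vs2" by blast
  obtain ws where ws: "vs1 = u # ws" using w(1,2) sa_not_Nil by (cases vs1) auto
  have vv: "vs' = ws @ vs2" using w(1) ws by simp
  have "f \<inter> verts vs1 es1 = {u}" using v(4,5) ws vv by (auto simp: verts_def)
  then have "sa (v # vs1) (f # es1)" using v w ws by auto
  then show ?case using v(1) vv w(3-6) ws by (intro exI[of _ "v # vs1"] exI[of _ vs2]) simp
qed

lemma sa_hd_in_verts: "sa vs es \<Longrightarrow> hd vs \<in> verts vs es"
  using sa_not_Nil by (auto simp: verts_def)

lemma sa_last_in_verts: "sa vs es \<Longrightarrow> last vs \<in> verts vs es"
  using sa_not_Nil by (auto simp: verts_def)

lemma sa_hd_neq_last: "sa vs es \<Longrightarrow> es \<noteq> [] \<Longrightarrow> hd vs \<noteq> last vs"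
proof -
  assume a: "sa vs es" "es \<noteq> []"
  then obtain e es' where es: "es = e # es'" by (cases es) auto
  with a have "sa vs (e # es')" by simp
  then obtain v u vs' where v: "vs = v # u # vs'" "v \<noteq> u" "v \<in> e"
    "e \<inter> verts (u # vs') es' = {u}" "sa (u # vs') es'" by (rule sa_ConsE) blast
  have "last vs \<in> verts (u # vs') es'" using sa_last_in_verts[OF v(5)] v(1) by simp
  moreover have "v \<notin> verts (u # vs') es'" using v by auto
  ultimately show ?thesis using v(1) by force
qed

text \<open>Walks in the complete d-uniform hypergraph: the presence of an edge enters only through
  weights, so that expectations can be exchanged with sums over a fixed finite set. The bound on
  \<open>vs\<close> restricts the walks of length 0 to the vertex set.\<close>

definition saws :: "nat \<Rightarrow> nat \<Rightarrow> nat \<Rightarrow> (nat list \<times> nat set list) set" where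
  "saws n d m = {(vs, es). sa vs es \<and> length es = m \<and> set es \<subseteq> dsets n d \<and> set vs \<subseteq> {..<n}}"

lemma finite_dsets [simp]: "finite (dsets n d)"
  unfolding dsets_def by (rule finite_subset[of _ "Pow {..<n}"]) auto

lemma finite_saws [simp]: "finite (saws n d m)"
proof -
  have "saws n d m \<subseteq> {vs. set vs \<subseteq> {..<n} \<and> length vs = Suc m} \<times> {es. set es \<subseteq> dsets n d \<and> length es = m}"
    by (auto simp: saws_def sa_length)
  then show ?thesis by (rule finite_subset) (intro finite_cartesian_product finite_lists_length_eq finite_lessThan finite_dsets)
qed

lemma saws_rev: "(vs, es) \<in> saws n d m \<Longrightarrow> (rev vs, rev es) \<in> saws n d m"
  by (auto simp: saws_def intro: sa_rev)

lemma saws_verts: "(vs, es) \<in> saws n d m \<Longrightarrow> verts vs es \<subseteq> {..<n}"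
  by (auto simp: saws_def verts_def dsets_def)

lemma sa_set_vs: "sa vs es \<Longrightarrow> es \<noteq> [] \<Longrightarrow> set vs \<subseteq> \<Union>(set es)"
proof (induction vs es rule: sa.induct)
  case (2 v u vs e es)
  then show ?case by (cases "es = []") (auto simp: sa_Nil_iff)
qed auto

text \<open>On the diagonal both sides vanish because a self-avoiding walk with at least one edge
  has distinct ends. At length 0 they would differ there: the trivial walk counts once, but
  \<open>saw_mat\<close> is 0.\<close>

lemma saw_mat_eq_card:
  assumes "H \<subseteq> dsets n d" "i < n" "m > 0"
  shows "saw_mat H m i j =
    real (card {(vs, es) \<in> saws n d m. hd vs = i \<and> last vs = j \<and> set es \<subseteq> H})"
proof -
  have eq: "{(vs, es). self_avoiding H m vs es \<and> vs ! 0 = i \<and> vs ! m = j} =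
    {(vs, es) \<in> saws n d m. hd vs = i \<and> last vs = j \<and> set es \<subseteq> H}"
  proof -
    have "self_avoiding H m vs es \<and> vs ! 0 = i \<and> vs ! m = j \<longleftrightarrow>
       (vs, es) \<in> saws n d m \<and> hd vs = i \<and> last vs = j \<and> set es \<subseteq> H" for vs es
    proof (cases "sa vs es \<and> length es = m \<and> set es \<subseteq> H")
      case True
      then have l: "length vs = Suc m" "vs \<noteq> []" using sa_length sa_not_Nil by auto
      have h: "hd vs = vs ! 0" "last vs = vs ! m" using l by (auto simp: hd_conv_nth last_conv_nth)
      have "es \<noteq> []" using True assms by auto
      then have "set vs \<subseteq> {..<n}" using sa_set_vs[of vs es] True assms(1) unfolding dsets_def by blast
      then show ?thesis using True h assms by (auto simp: self_avoiding_iff_sa saws_def)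
    next
      case False
      then show ?thesis by (auto simp: self_avoiding_iff_sa saws_def)
    qed
    then show ?thesis by auto
  qed
  show ?thesis
  proof (cases "i = j")
    case True
    have e: "{(vs, es) \<in> saws n d m. hd vs = i \<and> last vs = j \<and> set es \<subseteq> H} = {}"
      using True assms sa_hd_neq_last by (auto simp: saws_def)
    show ?thesis unfolding e using True by (simp add: saw_mat_def)
  next
    case False
    then show ?thesis unfolding saw_mat_def eq by simp
  qed
qed

section \<open>Weighted counting of families of walks\<close>

text \<open>The weight of an edge may depend on the vertex from which it is entered;
  \<open>zip\<close> drops the final vertex, which enters no edge.\<close>

definition walkw :: "(nat \<Rightarrow> nat set \<Rightarrow> real) \<Rightarrow> nat list \<Rightarrow> nat set list \<Rightarrow> real" where
  "walkw w vs es = prod_list (map (\<lambda>(v, e). w v e) (zip vs es))"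

lemma walkw_simps [simp]:
  "walkw w vs [] = 1"
  "walkw w (v # vs) (e # es) = w v e * walkw w vs es"
  by (simp_all add: walkw_def)

lemma walkw_nonneg:
  assumes "sa vs es" "set es \<subseteq> D" "\<And>v e. e \<in> D \<Longrightarrow> 0 \<le> w v e"
  shows "0 \<le> walkw w vs es"
  using assms by (induction vs es rule: sa.induct) auto

text \<open>A relaxation of self-avoidance that only forbids using the same edge twice in a row,
  with \<open>f\<close> the edge just used. Having no longer memory, it satisfies a recursion;
  self-avoiding walks qualify because their edges are distinct.\<close>

primrec nbsum :: "nat \<Rightarrow> nat \<Rightarrow> (nat \<Rightarrow> nat set \<Rightarrow> real) \<Rightarrow> nat \<Rightarrow> nat \<Rightarrow> nat set \<Rightarrow> real" where
  "nbsum n d w 0 v f = 1"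
| "nbsum n d w (Suc t) v f =
     (\<Sum>e\<in>{e \<in> dsets n d. v \<in> e \<and> e \<noteq> f}. w v e * (\<Sum>u\<in>e - {v}. nbsum n d w t u e))"

lemma dsets_finite: "e \<in> dsets n d \<Longrightarrow> finite e"
  by (auto simp: dsets_def intro: finite_subset)

lemma nbsum_nonneg:
  assumes "\<And>v e. e \<in> dsets n d \<Longrightarrow> 0 \<le> w v e"
  shows "0 \<le> nbsum n d w t v f"
  by (induction t arbitrary: v f) (auto intro!: sum_nonneg mult_nonneg_nonneg assms)

lemma sum_walkw_le_nbsum:
  assumes w: "\<And>v e. e \<in> dsets n d \<Longrightarrow> 0 \<le> w v e"
  shows "(\<Sum>(vs, es)\<in>{(vs, es) \<in> saws n d t. hd vs = v \<and> (es \<noteq> [] \<longrightarrow> hd es \<noteq> f)}. walkw w vs es)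
          \<le> nbsum n d w t v f"
proof (induction t arbitrary: v f)
  case 0
  have "{(vs, es) \<in> saws n d 0. hd vs = v \<and> (es \<noteq> [] \<longrightarrow> hd es \<noteq> f)} \<subseteq> {([v], [])}"
    by (auto simp: saws_def sa_Nil_iff)
  then have "(\<Sum>(vs, es)\<in>{(vs, es) \<in> saws n d 0. hd vs = v \<and> (es \<noteq> [] \<longrightarrow> hd es \<noteq> f)}. walkw w vs es)
      \<le> (\<Sum>(vs, es)\<in>{([v], [])}. walkw w vs es)"
    by (intro sum_mono2) auto
  then show ?case by simp
next
  case (Suc t)
  let ?X = "\<lambda>t v f. {(vs, es) \<in> saws n d t. hd vs = v \<and> (es \<noteq> [] \<longrightarrow> hd es \<noteq> f)}"
  have fX: "finite (?X t v f)" for t v f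
    by (rule finite_subset[OF _ finite_saws[of n d t]]) auto
  let ?E = "{e \<in> dsets n d. v \<in> e \<and> e \<noteq> f}"
  have fE: "finite ?E" by (rule finite_subset[OF _ finite_dsets[of n d]]) auto
  have fe: "finite (e - {v})" if "e \<in> ?E" for e using that dsets_finite by auto
  have pos: "0 \<le> walkw w (fst y) (snd y)" if "y \<in> saws n d t" for y t
    using that by (auto simp: saws_def intro!: walkw_nonneg[of _ _ "dsets n d"] w)
  have "(\<Sum>(vs, es)\<in>?X (Suc t) v f. walkw w vs es) \<le>
     (\<Sum>(e, u, y)\<in>(SIGMA e:?E. SIGMA u:e - {v}. ?X t u e). w v e * walkw w (fst y) (snd y))"
  proof (rule sum_le_included[where i = "\<lambda>(e, u, y). (v # fst y, e # snd y)"])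
    show "finite (?X (Suc t) v f)" by (rule fX)
    show "finite (SIGMA e:?E. SIGMA u:e - {v}. ?X t u e)"
      using fE fe fX by (intro finite_SigmaI) auto
    show "\<forall>y\<in>SIGMA e:?E. SIGMA u:e - {v}. ?X t u e.
       0 \<le> (case y of (e, u, y) \<Rightarrow> w v e * walkw w (fst y) (snd y))"
    proof
      fix y assume y: "y \<in> (SIGMA e:?E. SIGMA u:e - {v}. ?X t u e)"
      obtain e u z where yy: "y = (e, u, z)" using prod_cases3 by blast
      then have "e \<in> dsets n d" "z \<in> saws n d t" using y by auto
      then show "0 \<le> (case y of (e, u, y) \<Rightarrow> w v e * walkw w (fst y) (snd y))"
        using w pos yy by simp
    qed
    show "\<forall>x\<in>?X (Suc t) v f. \<exists>y\<in>SIGMA e:?E. SIGMA u:e - {v}. ?X t u e.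
       (case y of (e, u, y) \<Rightarrow> (v # fst y, e # snd y)) = x \<and>
       (case x of (vs, es) \<Rightarrow> walkw w vs es) \<le> (case y of (e, u, y) \<Rightarrow> w v e * walkw w (fst y) (snd y))"
    proof
      fix x assume x: "x \<in> ?X (Suc t) v f"
      obtain vs es where xe: "x = (vs, es)" by force
      have s: "sa vs es" "length es = Suc t" "set es \<subseteq> dsets n d" "set vs \<subseteq> {..<n}" "hd vs = v"
         "es \<noteq> [] \<longrightarrow> hd es \<noteq> f"
        using x xe by (auto simp: saws_def)
      obtain e es' where es: "es = e # es'" using s(2) by (cases es) auto
      with s(1) have "sa vs (e # es')" by simp
      then obtain v' u vs' where vs: "vs = v' # u # vs'" "v' \<noteq> u" "v' \<in> e" "u \<in> e"
          "e \<inter> verts (u # vs') es' = {u}" "sa (u # vs') es'" by (rule sa_ConsE) blast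
      have "v' = v" using s(5) vs by simp
      have "(u # vs', es') \<in> saws n d t" using s vs es by (auto simp: saws_def)
      moreover have "es' \<noteq> [] \<longrightarrow> hd es' \<noteq> e"
      proof
        assume "es' \<noteq> []"
        then obtain g gs where g: "es' = g # gs" by (cases es') auto
        have "distinct es" using s(1) sa_distinct_es by blast
        then show "hd es' \<noteq> e" using g es by auto
      qed
      ultimately have "(u # vs', es') \<in> ?X t u e" by simp
      then show "\<exists>y\<in>SIGMA e:?E. SIGMA u:e - {v}. ?X t u e.
       (case y of (e, u, y) \<Rightarrow> (v # fst y, e # snd y)) = x \<and>
       (case x of (vs, es) \<Rightarrow> walkw w vs es) \<le> (case y of (e, u, y) \<Rightarrow> w v e * walkw w (fst y) (snd y))"
        using vs s es xe \<open>v' = v\<close> by (intro bexI[of _ "(e, u, (u # vs', es'))"]) auto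
    qed
  qed
  also have "\<dots> = (\<Sum>e\<in>?E. w v e * (\<Sum>u\<in>e - {v}. \<Sum>y\<in>?X t u e. walkw w (fst y) (snd y)))"
    using fE fe fX by (subst sum.Sigma[symmetric], blast, blast intro: finite_SigmaI,
        intro sum.cong refl, subst sum.Sigma[symmetric]) (auto simp: sum_distrib_left)
  also have "\<dots> \<le> (\<Sum>e\<in>?E. w v e * (\<Sum>u\<in>e - {v}. nbsum n d w t u e))"
    using Suc.IH by (intro sum_mono mult_left_mono) (auto simp: w case_prod_unfold)
  finally show ?case by simp
qed

text \<open>\<open>A\<close> bounds the mean number of ways to continue a walk by one step and will
  be close to \<alpha>. \<open>K / n\<close> bounds the mean number of edges through two given
  vertices, which is the price of hitting a prescribed vertex.\<close>

locale edge_weights =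
  fixes n d :: nat and p :: "nat set \<Rightarrow> real" and A K :: real
  assumes d2: "d \<ge> 2" and n0: "n > 0"
    and p_nonneg: "\<And>e. e \<in> dsets n d \<Longrightarrow> 0 \<le> p e"
    and deg: "\<And>v. v < n \<Longrightarrow> real (d - 1) * (\<Sum>e\<in>{e \<in> dsets n d. v \<in> e}. p e) \<le> A"
    and codeg: "\<And>v x. v \<noteq> x \<Longrightarrow> (\<Sum>e\<in>{e \<in> dsets n d. v \<in> e \<and> x \<in> e}. p e) \<le> K / real n"
    and A1: "A \<ge> 1" and K0: "K \<ge> 0"
begin

text \<open>In the history of an exploration, \<open>V\<close> and \<open>E\<close> are the vertices and edges seen so far, and \<open>Bd\<close> contains the
  edges that met \<open>V\<close> outside the vertex they were reached from; \<open>r\<close> maps every other edge to that vertex.\<close>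

definition hist :: "nat set \<Rightarrow> nat set set \<Rightarrow> nat set set \<Rightarrow> bool" where
  "hist V E Bd \<longleftrightarrow> V \<subseteq> {..<n} \<and> E \<subseteq> dsets n d \<and> \<Union>E \<subseteq> V \<and> Bd \<subseteq> E \<and>
     (\<exists>r. \<forall>e\<in>E - Bd. \<forall>e'\<in>E - Bd. \<forall>x. x \<in> e \<and> x \<in> e' \<and> x \<noteq> r e \<and> x \<noteq> r e' \<longrightarrow> e = e')"

text \<open>An old edge costs nothing more, since its probability has been paid at discovery; a free
  new edge gets \<open>p e / A\<close>, so that all free continuations together weigh at most 1. The
  parameters \<open>\<kappa>\<close> and \<open>\<theta>\<close> allow a discount for reusing bad
  edges and a surcharge for creating them.\<close>

definition stepw :: "nat set \<Rightarrow> nat set set \<Rightarrow> nat set set \<Rightarrow> real \<Rightarrow> real \<Rightarrow> nat \<Rightarrow> nat set \<Rightarrow> real" where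
  "stepw V E Bd \<kappa> \<theta> v e =
     (if e \<in> E then if e \<in> Bd then \<kappa> else 1 else if e \<inter> V \<subseteq> {v} then p e / A else p e * \<theta>)"

lemma dsets_lt: "e \<in> dsets n d \<Longrightarrow> u \<in> e \<Longrightarrow> u < n"
  by (auto simp: dsets_def)

lemma dsets_card: "e \<in> dsets n d \<Longrightarrow> v \<in> e \<Longrightarrow> card (e - {v}) = d - 1"
  by (simp add: dsets_def)

lemma stepw_nonneg: "0 \<le> \<kappa> \<Longrightarrow> 0 \<le> \<theta> \<Longrightarrow> e \<in> dsets n d \<Longrightarrow> 0 \<le> stepw V E Bd \<kappa> \<theta> v e"
  using A1 p_nonneg by (auto simp: stepw_def)

text \<open>Only the forest edges need to be followed explicitly. Free new edges have total weight
  at most 1 and lead to vertices outside \<open>V\<close>, where the bound \<open>x\<close> holds;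
  the bad choices, old or new, have total weight at most \<open>\<zeta>\<close>.\<close>

lemma nbsum_split:
  assumes h: "hist V E Bd" and v: "v < n" and nn: "0 \<le> \<kappa>" "0 \<le> \<theta>"
    and bad: "real (d - 1) * ((\<Sum>e\<in>{e \<in> Bd. v \<in> e}. \<kappa>) +
        (\<Sum>e\<in>{e \<in> dsets n d. v \<in> e \<and> e \<notin> E \<and> \<not> e \<inter> V \<subseteq> {v}}. p e * \<theta>)) \<le> \<zeta>"
    and x: "\<And>u e. u < n \<Longrightarrow> u \<notin> V \<Longrightarrow> nbsum n d (stepw V E Bd \<kappa> \<theta>) t u e \<le> x"
    and Y: "\<And>u e. u < n \<Longrightarrow> nbsum n d (stepw V E Bd \<kappa> \<theta>) t u e \<le> Y"
    and pos: "0 \<le> x" "0 \<le> Y"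
  shows "nbsum n d (stepw V E Bd \<kappa> \<theta>) (Suc t) v f \<le>
     (\<Sum>e\<in>{e \<in> E - Bd. v \<in> e \<and> e \<noteq> f}. \<Sum>u\<in>e - {v}. nbsum n d (stepw V E Bd \<kappa> \<theta>) t u e) + x + \<zeta> * Y"
proof -
  let ?w = "stepw V E Bd \<kappa> \<theta>"
  let ?g = "\<lambda>e. ?w v e * (\<Sum>u\<in>e - {v}. nbsum n d ?w t u e)"
  let ?D = "{e \<in> dsets n d. v \<in> e \<and> e \<noteq> f}"
  let ?F1 = "{e \<in> E - Bd. v \<in> e \<and> e \<noteq> f}"
  let ?F2 = "{e \<in> Bd. v \<in> e}"
  let ?F3 = "{e \<in> dsets n d. v \<in> e \<and> e \<notin> E \<and> e \<inter> V \<subseteq> {v}}"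
  let ?F4 = "{e \<in> dsets n d. v \<in> e \<and> e \<notin> E \<and> \<not> e \<inter> V \<subseteq> {v}}"
  have hE: "E \<subseteq> dsets n d" "Bd \<subseteq> E" using h by (auto simp: hist_def)
  have fin: "finite ?F1" "finite ?F2" "finite ?F3" "finite ?F4"
    by (rule finite_subset[OF _ finite_dsets[of n d]]; use hE in blast)+
  have gpos: "0 \<le> ?g e" if "e \<in> dsets n d" for e
    by (intro mult_nonneg_nonneg sum_nonneg nbsum_nonneg stepw_nonneg nn that)
  have "nbsum n d ?w (Suc t) v f = sum ?g ?D" by simp
  also have "\<dots> \<le> sum ?g (?F1 \<union> (?F2 \<union> (?F3 \<union> ?F4)))"
    using fin gpos hE by (intro sum_mono2) auto
  also have "\<dots> = sum ?g ?F1 + (sum ?g ?F2 + (sum ?g ?F3 + sum ?g ?F4))"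
    using fin hE by (subst sum.union_disjoint; (subst sum.union_disjoint)?; (subst sum.union_disjoint)?) auto
  also have "sum ?g ?F1 = (\<Sum>e\<in>?F1. \<Sum>u\<in>e - {v}. nbsum n d ?w t u e)"
    by (intro sum.cong) (auto simp: stepw_def)
  also have "sum ?g ?F3 \<le> (\<Sum>e\<in>?F3. p e / A * (real (d - 1) * x))"
  proof (intro sum_mono mult_mono)
    fix e assume e: "e \<in> ?F3"
    then show "?w v e \<le> p e / A" by (simp add: stepw_def)
    have "(\<Sum>u\<in>e - {v}. nbsum n d ?w t u e) \<le> real (card (e - {v})) * x"
    proof (rule sum_bounded_above)
      fix u assume u: "u \<in> e - {v}"
      then have "u \<notin> V" "u < n" using e dsets_lt by auto
      then show "nbsum n d ?w t u e \<le> x" by (rule x[rotated])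
    qed
    then show "(\<Sum>u\<in>e - {v}. nbsum n d ?w t u e) \<le> real (d - 1) * x" using e dsets_card by auto
    show "0 \<le> p e / A" using e p_nonneg A1 by auto
  qed (intro sum_nonneg nbsum_nonneg stepw_nonneg nn)
  also have "\<dots> = real (d - 1) * (\<Sum>e\<in>?F3. p e) / A * x"
    by (simp add: sum_distrib_left sum_distrib_right sum_divide_distrib mult_ac)
  also have "\<dots> \<le> real (d - 1) * (\<Sum>e\<in>{e \<in> dsets n d. v \<in> e}. p e) / A * x"
    using pos A1 p_nonneg by (intro mult_right_mono divide_right_mono mult_left_mono sum_mono2) auto
  also have "\<dots> \<le> 1 * x"
    using deg[OF v] A1 pos by (intro mult_right_mono) (auto simp: divide_simps)
  finally have 1: "nbsum n d ?w (Suc t) v f \<le> (\<Sum>e\<in>?F1. \<Sum>u\<in>e - {v}. nbsum n d ?w t u e) +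
     x + (sum ?g ?F2 + sum ?g ?F4)" by simp
  have Ys: "(\<Sum>u\<in>e - {v}. nbsum n d ?w t u e) \<le> real (d - 1) * Y" if "e \<in> dsets n d" "v \<in> e" for e
  proof -
    have "(\<Sum>u\<in>e - {v}. nbsum n d ?w t u e) \<le> real (card (e - {v})) * Y"
      using that Y dsets_lt by (intro sum_bounded_above) auto
    then show ?thesis using that dsets_card by auto
  qed
  have "sum ?g ?F2 \<le> (\<Sum>e\<in>?F2. \<kappa> * (real (d - 1) * Y))"
    using hE nn by (intro sum_mono mult_mono Ys) (auto simp: stepw_def intro!: sum_nonneg nbsum_nonneg stepw_nonneg)
  moreover have "sum ?g ?F4 \<le> (\<Sum>e\<in>?F4. (p e * \<theta>) * (real (d - 1) * Y))"
    using hE nn p_nonneg by (intro sum_mono mult_mono Ys) (auto simp: stepw_def intro!: sum_nonneg nbsum_nonneg stepw_nonneg)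
  moreover have "(\<Sum>e\<in>?F2. \<kappa> * (real (d - 1) * Y)) + (\<Sum>e\<in>?F4. (p e * \<theta>) * (real (d - 1) * Y))
     = real (d - 1) * ((\<Sum>e\<in>?F2. \<kappa>) + (\<Sum>e\<in>?F4. p e * \<theta>)) * Y"
    by (simp add: sum_distrib_left sum_distrib_right algebra_simps)
  moreover have "\<dots> \<le> \<zeta> * Y" using bad pos by (intro mult_right_mono)
  ultimately show ?thesis using 1 by linarith
qed

text \<open>An old edge in \<^term>\<open>E - Bd\<close> was free when it was discovered at its root, so such edges form a forest:
  every vertex is a non-root of at most one of them.  A walk in the forest goes up, possibly sideways once,
  and then down, and descending walks are determined by their end points.\<close>

lemma nbsum_bound:
  assumes h: "hist V E Bd" and nn: "0 \<le> \<kappa>" "0 \<le> \<theta>"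
    and bad: "\<And>v. v < n \<Longrightarrow> real (d - 1) * ((\<Sum>e\<in>{e \<in> Bd. v \<in> e}. \<kappa>) +
        (\<Sum>e\<in>{e \<in> dsets n d. v \<in> e \<and> e \<notin> E \<and> \<not> e \<inter> V \<subseteq> {v}}. p e * \<theta>)) \<le> \<zeta>"
    and z: "0 \<le> \<zeta>" "\<zeta> * ((real (card V) + 1) * (real l + 1) ^ 3) \<le> 1"
    and t: "t \<le> l" and v: "v < n"
  shows "nbsum n d (stepw V E Bd \<kappa> \<theta>) t v f \<le> (real (card V) + 1) * (real t + 1) ^ 3"
proof -
  let ?w = "stepw V E Bd \<kappa> \<theta>"
  let ?S = "nbsum n d ?w"
  let ?c = "real (card V)"
  have hE: "V \<subseteq> {..<n}" "E \<subseteq> dsets n d" "\<Union>E \<subseteq> V" "Bd \<subseteq> E" using h by (auto simp: hist_def)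
  have finV: "finite V" using hE(1) finite_subset by blast
  have finE: "finite E" using hE(2) finite_subset finite_dsets by blast
  obtain r where r: "\<And>e e' x. e \<in> E - Bd \<Longrightarrow> e' \<in> E - Bd \<Longrightarrow> x \<in> e \<Longrightarrow> x \<in> e' \<Longrightarrow> x \<noteq> r e \<Longrightarrow> x \<noteq> r e' \<Longrightarrow> e = e'"
    using h unfolding hist_def by metis
  \<comment> \<open>The parent edge: the only forest edge in which \<open>x\<close> is not the root.
    The default \<open>{}\<close> is not an edge, so it forbids nothing when passed to
    \<open>nbsum\<close>.\<close>
  define pe where "pe x = (if \<exists>e\<in>E - Bd. x \<in> e \<and> x \<noteq> r e then SOME e. e \<in> E - Bd \<and> x \<in> e \<and> x \<noteq> r e else {})" for x
  have pe: "pe x = e" if "e \<in> E - Bd" "x \<in> e" "x \<noteq> r e" for x e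
  proof -
    have "\<exists>e. e \<in> E - Bd \<and> x \<in> e \<and> x \<noteq> r e" using that by blast
    from someI_ex[OF this] show ?thesis using that r unfolding pe_def by (metis (no_types, lifting))
  qed
  have Spos: "0 \<le> ?S t v f" for t v f by (intro nbsum_nonneg stepw_nonneg nn)
  \<comment> \<open>A step to a non-root \<open>u\<close> of a forest edge can only use the edge
    \<open>pe u\<close>. So \<open>u\<close> determines the step, and all such steps together cost
    at most one sum over \<open>V\<close>.\<close>
  have down: "(\<Sum>x\<in>S. ?S t (snd (snd x)) (fst (snd x))) \<le> (\<Sum>u\<in>V. ?S t u (pe u))"
    if S: "finite S" "\<And>v e u. (v, e, u) \<in> S \<Longrightarrow> e \<in> E - Bd \<and> u \<in> e \<and> u \<noteq> r e \<and> v = g e u" for S t g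
  proof (rule sum_le_included[where i = "\<lambda>u. (g (pe u) u, pe u, u)"])
    show "\<forall>x\<in>S. \<exists>y\<in>V. (g (pe y) y, pe y, y) = x \<and> ?S t (snd (snd x)) (fst (snd x)) \<le> ?S t y (pe y)"
    proof
      fix x assume "x \<in> S"
      moreover obtain v e u where x: "x = (v, e, u)" using prod_cases3 by blast
      ultimately have "e \<in> E - Bd" "u \<in> e" "u \<noteq> r e" "v = g e u" using S(2) by blast+
      moreover from this have "pe u = e" by (intro pe)
      moreover have "u \<in> V" using calculation hE by blast
      ultimately show "\<exists>y\<in>V. (g (pe y) y, pe y, y) = x \<and> ?S t (snd (snd x)) (fst (snd x)) \<le> ?S t y (pe y)"
        using x by (intro bexI[of _ u]) auto
    qed
  qed (use S finV Spos in auto)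

  \<comment> \<open>Three bounds proved together: outside the history the growth is linear in t, the
    sum over all descents is quadratic, and an arbitrary start, which may also climb, is
    cubic.\<close>
  have "(\<forall>v<n. v \<notin> V \<longrightarrow> (\<forall>f. ?S t v f \<le> real t + 1)) \<and> (\<Sum>v\<in>V. ?S t v (pe v)) \<le> ?c * (real t + 1)^2 \<and>
     (\<forall>v<n. \<forall>f. ?S t v f \<le> (?c + 1) * (real t + 1) ^ 3)"
    using t
  proof (induction t)
    case 0
    then show ?case by simp
  next
    case (Suc t)
    let ?Y = "(?c + 1) * (real t + 1) ^ 3"
    have IH: "\<And>u f. u < n \<Longrightarrow> u \<notin> V \<Longrightarrow> ?S t u f \<le> real t + 1"
       "(\<Sum>v\<in>V. ?S t v (pe v)) \<le> ?c * (real t + 1)^2" "\<And>u f. u < n \<Longrightarrow> ?S t u f \<le> ?Y"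
      using Suc by auto
    have "?Y \<le> (?c + 1) * (real l + 1) ^ 3"
      using Suc.prems by (intro mult_left_mono power_mono) auto
    \<comment> \<open>With this choice of \<open>\<zeta>\<close> the bad choices add at most 1 per
      step instead of multiplying the count.\<close>
    then have zY: "\<zeta> * ?Y \<le> 1" using z by (meson mult_left_mono order_trans)
    have split: "?S (Suc t) v f \<le> (\<Sum>e\<in>{e \<in> E - Bd. v \<in> e \<and> e \<noteq> f}. \<Sum>u\<in>e - {v}. ?S t u e) + (real t + 2)"
      if "v < n" for v f
    proof -
      have "?S (Suc t) v f \<le> (\<Sum>e\<in>{e \<in> E - Bd. v \<in> e \<and> e \<noteq> f}. \<Sum>u\<in>e - {v}. ?S t u e) + (real t + 1) + \<zeta> * ?Y"
        by (rule nbsum_split[OF h that nn bad[OF that] IH(1) IH(3)]) auto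
      then show ?thesis using zY by linarith
    qed
    have finF: "finite {e \<in> E - Bd. Q e}" "finite (e - {v})" if "e \<in> E" for Q e v
      using finE that hE dsets_finite by auto
    have fe: "finite e" if "e \<in> E" for e using that hE dsets_finite by blast
    have 1: "\<forall>v<n. v \<notin> V \<longrightarrow> (\<forall>f. ?S (Suc t) v f \<le> real (Suc t) + 1)"
    proof (intro allI impI)
      fix v f assume vv: "v < n" "v \<notin> V"
      then have eq: "{e \<in> E - Bd. v \<in> e \<and> e \<noteq> f} = {}" using hE by blast
      show "?S (Suc t) v f \<le> real (Suc t) + 1"
        using split[OF vv(1), of f] unfolding eq by (simp del: nbsum.simps)
    qed
    have 2: "(\<Sum>v\<in>V. ?S (Suc t) v (pe v)) \<le> ?c * (real (Suc t) + 1)^2"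
    proof -
      let ?T = "SIGMA v:V. SIGMA e:{e \<in> E - Bd. v \<in> e \<and> e \<noteq> pe v}. e - {v}"
      have "(\<Sum>v\<in>V. ?S (Suc t) v (pe v)) \<le>
        (\<Sum>v\<in>V. (\<Sum>e\<in>{e \<in> E - Bd. v \<in> e \<and> e \<noteq> pe v}. \<Sum>u\<in>e - {v}. ?S t u e) + (real t + 2))"
        using hE by (intro sum_mono split) auto
      also have "\<dots> = (\<Sum>v\<in>V. (\<Sum>e\<in>{e \<in> E - Bd. v \<in> e \<and> e \<noteq> pe v}. \<Sum>u\<in>e - {v}. ?S t u e)) + ?c * (real t + 2)"
        by (simp add: sum.distrib)
      also have "(\<Sum>v\<in>V. (\<Sum>e\<in>{e \<in> E - Bd. v \<in> e \<and> e \<noteq> pe v}. \<Sum>u\<in>e - {v}. ?S t u e)) =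
         (\<Sum>x\<in>?T. ?S t (snd (snd x)) (fst (snd x)))"
        using finV finE fe by (subst sum.Sigma; (subst sum.Sigma)?) (auto simp: case_prod_unfold)
      also have "\<dots> \<le> (\<Sum>u\<in>V. ?S t u (pe u))"
      proof (rule down[of ?T "\<lambda>e u. r e" t])
        show "finite ?T" using finV finE fe by (intro finite_SigmaI) auto
        fix v e u assume "(v, e, u) \<in> ?T"
        then have "v \<in> V" "e \<in> E - Bd" "v \<in> e" "e \<noteq> pe v" "u \<in> e" "u \<noteq> v" by auto
        then show "e \<in> E - Bd \<and> u \<in> e \<and> u \<noteq> r e \<and> v = r e" using pe by blast
      qed
      also have "\<dots> \<le> ?c * (real t + 1)^2" by (rule IH)
      also have "?c * (real t + 1)^2 + ?c * (real t + 2) \<le> ?c * (real (Suc t) + 1)^2"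
        unfolding distrib_left[symmetric] by (intro mult_left_mono) (auto simp: power2_eq_square algebra_simps)
      finally show ?thesis by simp
    qed
    have 3: "?S (Suc t) v f \<le> (?c + 1) * (real (Suc t) + 1) ^ 3" if vv: "v < n" for v f
    proof -
      let ?T = "SIGMA e:{e \<in> E - Bd. v \<in> e \<and> e \<noteq> f}. e - {v}"
      \<comment> \<open>\<open>?T1\<close> contains the moves up to a root, where the edge must be
        \<open>pe v\<close> and at most one move exists; \<open>?T2\<close> contains the moves
        sideways and down, which \<open>down\<close> controls.\<close>
      let ?T1 = "{x \<in> ?T. snd x = r (fst x)}"
      let ?T2 = "{x \<in> ?T. snd x \<noteq> r (fst x)}"
      have fT: "finite ?T" using finE fe by (intro finite_SigmaI) auto
      have "(\<Sum>e\<in>{e \<in> E - Bd. v \<in> e \<and> e \<noteq> f}. \<Sum>u\<in>e - {v}. ?S t u e) = (\<Sum>x\<in>?T. ?S t (snd x) (fst x))"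
        using finE fe by (subst sum.Sigma) (auto simp: case_prod_unfold)
      also have "?T = ?T1 \<union> ?T2" by blast
      also have "(\<Sum>x\<in>\<dots>. ?S t (snd x) (fst x)) = (\<Sum>x\<in>?T1. ?S t (snd x) (fst x)) + (\<Sum>x\<in>?T2. ?S t (snd x) (fst x))"
        using fT by (intro sum.union_disjoint) auto
      also have "(\<Sum>x\<in>?T1. ?S t (snd x) (fst x)) \<le> ?Y"
      proof -
        have sub: "?T1 \<subseteq> {(pe v, r (pe v))}"
        proof
          fix x assume x: "x \<in> ?T1"
          obtain e u where xe: "x = (e, u)" by force
          then have "e \<in> E - Bd" "v \<in> e" "u \<noteq> v" "u = r e" using x by auto
          then have "pe v = e" using pe by blast
          then show "x \<in> {(pe v, r (pe v))}" using xe \<open>u = r e\<close> by simp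
        qed
        show ?thesis
        proof (cases "?T1 = {}")
          case True
          show ?thesis unfolding True by simp
        next
          case False
          then have eq: "?T1 = {(pe v, r (pe v))}" using sub by blast
          have "(pe v, r (pe v)) \<in> ?T1" by (subst eq) simp
          then have m: "pe v \<in> E" "r (pe v) \<in> pe v" by simp_all
          then have "r (pe v) < n" using hE(2) dsets_lt by blast
          then show ?thesis unfolding eq using IH(3) by simp
        qed
      qed
      also have "(\<Sum>x\<in>?T2. ?S t (snd x) (fst x)) = (\<Sum>x\<in>Pair v ` ?T2. ?S t (snd (snd x)) (fst (snd x)))"
        by (subst sum.reindex) (auto simp: inj_on_def)
      also have "\<dots> \<le> (\<Sum>u\<in>V. ?S t u (pe u))"
      proof (rule down[of "Pair v ` ?T2" "\<lambda>e u. v" t])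
        show "finite (Pair v ` ?T2)"
          by (rule finite_imageI, rule finite_subset[OF _ fT]) blast
        fix v' e u assume "(v', e, u) \<in> Pair v ` ?T2"
        then have "v' = v" "(e, u) \<in> ?T2" by blast+
        then show "e \<in> E - Bd \<and> u \<in> e \<and> u \<noteq> r e \<and> v' = v" by simp
      qed
      also have "\<dots> \<le> ?c * (real t + 1)^2" by (rule IH)
      finally have "?S (Suc t) v f \<le> ?Y + ?c * (real t + 1)^2 + (real t + 2)"
        using split[OF vv, of f] by linarith
      also have "\<dots> \<le> ?Y + (?c + 1) * ((real t + 1)^2 + (real t + 2))"
        by (simp add: algebra_simps power2_eq_square)
      also have "\<dots> \<le> (?c + 1) * (real (Suc t) + 1) ^ 3"
        unfolding distrib_left[symmetric]
        by (intro mult_left_mono) (auto simp: power2_eq_square power3_eq_cube algebra_simps)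
      finally show ?thesis .
    qed
    show ?case using 1 2 3 by blast
  qed
  then show ?thesis using v by blast
qed

definition sawsl :: "nat \<Rightarrow> (nat list \<times> nat set list) set" where
  "sawsl l = (\<Union>t\<le>l. saws n d t)"

lemma finite_sawsl [simp]: "finite (sawsl l)"
  by (simp add: sawsl_def)

lemma single_walk_bound:
  assumes h: "hist V E Bd" and nn: "0 \<le> \<kappa>" "0 \<le> \<theta>"
    and bad: "\<And>v. v < n \<Longrightarrow> real (d - 1) * ((\<Sum>e\<in>{e \<in> Bd. v \<in> e}. \<kappa>) +
        (\<Sum>e\<in>{e \<in> dsets n d. v \<in> e \<and> e \<notin> E \<and> \<not> e \<inter> V \<subseteq> {v}}. p e * \<theta>)) \<le> \<zeta>"
    and z: "0 \<le> \<zeta>" "\<zeta> * ((real (card V) + 1) * (real l + 1) ^ 3) \<le> 1" and v: "v < n"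
  shows "(\<Sum>(vs, es)\<in>{(vs, es) \<in> sawsl l. hd vs = v}. walkw (stepw V E Bd \<kappa> \<theta>) vs es)
     \<le> (real (card V) + 1) * (real l + 1) ^ 4"
proof -
  let ?w = "stepw V E Bd \<kappa> \<theta>"
  have eq: "{(vs, es) \<in> sawsl l. hd vs = v} = (\<Union>t\<in>{..l}. {(vs, es) \<in> saws n d t. hd vs = v})"
    by (auto simp: sawsl_def)
  \<comment> \<open>No edge is empty, so \<open>f = {}\<close> leaves the first edge
    unrestricted.\<close>
  have ne: "{} \<notin> dsets n d" using d2 by (auto simp: dsets_def)
  have e2: "{(vs, es) \<in> saws n d t. hd vs = v} =
     {(vs, es) \<in> saws n d t. hd vs = v \<and> (es \<noteq> [] \<longrightarrow> hd es \<noteq> {})}" for t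
    using ne hd_in_set by (fastforce simp: saws_def)
  have fin: "finite {(vs, es) \<in> saws n d t. hd vs = v}" for t
    by (rule finite_subset[OF _ finite_saws[of n d t]]) auto
  have "(\<Sum>(vs, es)\<in>{(vs, es) \<in> sawsl l. hd vs = v}. walkw ?w vs es) =
     (\<Sum>t\<le>l. \<Sum>(vs, es)\<in>{(vs, es) \<in> saws n d t. hd vs = v}. walkw ?w vs es)"
    unfolding eq by (rule sum.UNION_disjoint) (use fin in \<open>auto simp: saws_def\<close>)
  also have "\<dots> \<le> (\<Sum>t\<le>l. nbsum n d ?w t v {})"
    unfolding e2 by (intro sum_mono sum_walkw_le_nbsum stepw_nonneg nn)
  also have "\<dots> \<le> (\<Sum>t\<le>l. (real (card V) + 1) * (real l + 1) ^ 3)"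
  proof (rule sum_mono)
    fix t assume t: "t \<in> {..l}"
    have "nbsum n d ?w t v {} \<le> (real (card V) + 1) * (real t + 1) ^ 3"
      using t by (intro nbsum_bound[OF h nn bad z _ v]) auto
    also have "\<dots> \<le> (real (card V) + 1) * (real l + 1) ^ 3"
      using t by (intro mult_left_mono power_mono) auto
    finally show "nbsum n d ?w t v {} \<le> (real (card V) + 1) * (real l + 1) ^ 3" .
  qed
  also have "\<dots> = (real (card V) + 1) * (real l + 1) ^ 4" by (simp add: power4_eq_xxxx power3_eq_cube)
  finally show ?thesis .
qed

end

section \<open>Families of walks explored one after another\<close>

definition walk_lists :: "'a set \<Rightarrow> nat \<Rightarrow> 'a list set" where
  "walk_lists S r = {ws. set ws \<subseteq> S \<and> length ws = r}"

lemma walk_lists_0 [simp]: "walk_lists S 0 = {[]}"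
  by (auto simp: walk_lists_def)

lemma finite_walk_lists [simp]: "finite S \<Longrightarrow> finite (walk_lists S r)"
  unfolding walk_lists_def by (rule finite_lists_length_eq)

lemma walk_lists_Suc: "walk_lists S (Suc r) = (\<lambda>(w, ws). w # ws) ` (S \<times> walk_lists S r)"
  unfolding walk_lists_def by (subst lists_length_Suc_eq) (auto simp: image_iff)

lemma sum_walk_lists_Suc:
  assumes "finite S"
  shows "(\<Sum>ws\<in>walk_lists S (Suc r). f ws) = (\<Sum>w\<in>S. \<Sum>ws\<in>walk_lists S r. f (w # ws))"
  unfolding walk_lists_Suc using assms
  by (subst sum.reindex) (auto simp: inj_on_def sum.cartesian_product case_prod_unfold)

lemma sum_UN_le:
  fixes f :: "'b \<Rightarrow> real"
  assumes "finite I" "\<And>i. i \<in> I \<Longrightarrow> finite (S i)" "\<And>i x. i \<in> I \<Longrightarrow> x \<in> S i \<Longrightarrow> 0 \<le> f x"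
  shows "sum f (\<Union>i\<in>I. S i) \<le> (\<Sum>i\<in>I. sum f (S i))"
proof -
  have "sum f (\<Union>i\<in>I. S i) \<le> (\<Sum>y\<in>Sigma I S. f (snd y))"
    using assms by (intro sum_le_included[where i = snd]) auto
  then show ?thesis using assms by (simp add: sum.Sigma case_prod_unfold)
qed

definition edges_of :: "(nat list \<times> nat set list) list \<Rightarrow> nat set set" where
  "edges_of ws = (\<Union>w\<in>set ws. set (snd w))"

lemma edges_of_simps [simp]:
  "edges_of [] = {}" "edges_of (w # ws) = set (snd w) \<union> edges_of ws"
  by (auto simp: edges_of_def)

lemma finite_edges_of [simp]: "finite (edges_of ws)"
  by (auto simp: edges_of_def)

text \<open>The new edges through which a walk collides with the history; the vertex paired with an
  edge by \<open>zip\<close> is its root, where meeting \<open>V\<close> is allowed.\<close>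

definition newbad :: "nat set \<Rightarrow> nat set set \<Rightarrow> nat list \<Rightarrow> nat set list \<Rightarrow> nat set set" where
  "newbad V E vs es = {e. \<exists>v. (v, e) \<in> set (zip vs es) \<and> e \<notin> E \<and> \<not> e \<inter> V \<subseteq> {v}}"

lemma newbad_simps [simp]:
  "newbad V E vs [] = {}"
  "newbad V E (v # vs) (e # es) = (if e \<notin> E \<and> \<not> e \<inter> V \<subseteq> {v} then insert e (newbad V E vs es) else newbad V E vs es)"
  by (auto simp: newbad_def)

lemma newbad_subset: "newbad V E vs es \<subseteq> set es"
  by (auto simp: newbad_def dest: set_zip_rightD)

lemma sa_card_verts:
  assumes "sa vs es" "set es \<subseteq> dsets n d"
  shows "card (verts vs es) \<le> d * length es + 1"
  using assms
proof (induction vs es rule: sa.induct)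
  case (2 v u vs e es)
  have "verts (v # u # vs) (e # es) = e \<union> verts (u # vs) es" using 2 by auto
  also have "card \<dots> \<le> card e + card (verts (u # vs) es)" by (rule card_Un_le)
  also have "card e = d" using 2 by (auto simp: dsets_def)
  also have "card (verts (u # vs) es) \<le> d * length es + 1" using 2 by auto
  finally show ?case by simp
qed auto

lemma sa_zip_root:
  assumes "sa (u # vs) es" "(v, e) \<in> set (zip (u # vs) es)" "u \<in> e"
  shows "v = u"
proof -
  obtain f fs where es: "es = f # fs" using assms(2) by (cases es) auto
  have "sa (u # vs) (f # fs)" using assms es by simp
  then obtain w ws where w: "vs = w # ws" "u \<noteq> w" "u \<in> f" "f \<inter> verts (w # ws) fs = {w}"
    by (rule sa_ConsE) blast
  then have "u \<notin> verts (w # ws) fs" by blast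
  then have "u \<notin> g" if "g \<in> set fs" for g using that unfolding verts_def by blast
  then have "e \<notin> set fs" using assms(3) by blast
  then show ?thesis using assms(2) es w(1) by (auto dest: set_zip_rightD)
qed

text \<open>Two edges of a self-avoiding walk share at most one vertex, and that vertex is the root
  of the later one. So the edges of a single walk already form a forest.\<close>

lemma sa_roots_unique:
  assumes "sa vs es" "(v, e) \<in> set (zip vs es)" "(v', e') \<in> set (zip vs es)"
    "x \<in> e" "x \<in> e'" "x \<noteq> v" "x \<noteq> v'"
  shows "e = e'"
  using assms
proof (induction vs es arbitrary: v e v' e' rule: sa.induct)
  case (2 v0 u vs e0 es)
  have tail: False if "(w, g) \<in> set (zip (u # vs) es)" "x \<in> e0" "x \<in> g" "x \<noteq> w" for w g
  proof -
    have "g \<in> set es" using that(1) by (rule set_zip_rightD)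
    then have "x \<in> verts (u # vs) es" using that by (auto simp: verts_def)
    then have "x = u" using 2(2) that by auto
    then show False using sa_zip_root[of u vs es w g] 2(2) that by auto
  qed
  consider "(v, e) = (v0, e0)" "(v', e') = (v0, e0)"
    | "(v, e) = (v0, e0)" "(v', e') \<in> set (zip (u # vs) es)"
    | "(v', e') = (v0, e0)" "(v, e) \<in> set (zip (u # vs) es)"
    | "(v, e) \<in> set (zip (u # vs) es)" "(v', e') \<in> set (zip (u # vs) es)"
    using 2(3,4) by auto
  then show ?case
  proof cases
    case 4 then show ?thesis using 2 by auto
  qed (use tail 2 in auto)
qed auto

lemma sa_in_zip: "sa vs es \<Longrightarrow> e \<in> set es \<Longrightarrow> \<exists>v. (v, e) \<in> set (zip vs es)"
  using sa_length[of vs es] by (metis in_set_impl_in_set_zip2 le_SucI order_refl length_take take_all zip_Cons1 in_set_zip in_set_conv_nth less_SucI fst_conv snd_conv)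

context edge_weights
begin

lemma stepw_simps:
  "e \<in> E \<Longrightarrow> e \<in> Bd \<Longrightarrow> stepw V E Bd \<kappa> \<theta> v e = \<kappa>"
  "e \<in> E \<Longrightarrow> e \<notin> Bd \<Longrightarrow> stepw V E Bd \<kappa> \<theta> v e = 1"
  "e \<notin> E \<Longrightarrow> e \<inter> V \<subseteq> {v} \<Longrightarrow> stepw V E Bd \<kappa> \<theta> v e = p e / A"
  "e \<notin> E \<Longrightarrow> \<not> e \<inter> V \<subseteq> {v} \<Longrightarrow> stepw V E Bd \<kappa> \<theta> v e = p e * \<theta>"
  by (auto simp: stepw_def)

text \<open>Old edges keep their roots and a new edge takes its entry vertex. A free new edge meets
  \<open>V\<close> at most in its root, so it shares no non-root with an old edge; two new edges are
  covered by \<open>sa_roots_unique\<close>.\<close>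

lemma hist_step:
  assumes h: "hist V E Bd" and w: "(vs, es) \<in> saws n d t"
  shows "hist (V \<union> verts vs es) (E \<union> set es) (Bd \<union> newbad V E vs es)"
proof -
  have s: "sa vs es" "set es \<subseteq> dsets n d" using w by (auto simp: saws_def)
  obtain r where r: "\<And>e e' x. e \<in> E - Bd \<Longrightarrow> e' \<in> E - Bd \<Longrightarrow> x \<in> e \<Longrightarrow> x \<in> e' \<Longrightarrow> x \<noteq> r e \<Longrightarrow> x \<noteq> r e' \<Longrightarrow> e = e'"
    using h unfolding hist_def by metis
  have hE: "V \<subseteq> {..<n}" "E \<subseteq> dsets n d" "\<Union>E \<subseteq> V" "Bd \<subseteq> E" using h by (auto simp: hist_def)
  define r' where "r' e = (if e \<in> E then r e else SOME v. (v, e) \<in> set (zip vs es))" for e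
  have r': "(r' e, e) \<in> set (zip vs es)" if "e \<notin> E" "e \<in> set es" for e
    using someI_ex[OF sa_in_zip[OF s(1) that(2)]] that by (auto simp: r'_def)
  have free: "e \<inter> V \<subseteq> {r' e}" if "e \<notin> E" "e \<in> set es" "e \<notin> newbad V E vs es" for e
    using r'[OF that(1,2)] that unfolding newbad_def by blast
  have uniq: "e = e'" if e: "e \<in> E \<union> set es" "e \<notin> Bd \<union> newbad V E vs es" "e' \<in> E \<union> set es"
      "e' \<notin> Bd \<union> newbad V E vs es" "x \<in> e" "x \<in> e'" "x \<noteq> r' e" "x \<noteq> r' e'" for e e' x
  proof -
    consider "e \<in> E" "e' \<in> E" | "e \<in> E" "e' \<notin> E" | "e \<notin> E" "e' \<in> E" | "e \<notin> E" "e' \<notin> E" by blast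
    then show ?thesis
    proof cases
      case 1 then show ?thesis using e r[of e e' x] by (auto simp: r'_def)
    next
      case 2 then show ?thesis using e free[of e'] hE by blast
    next
      case 3 then show ?thesis using e free[of e] hE by blast
    next
      case 4
      then have "e \<in> set es" "e' \<in> set es" using e by auto
      then show ?thesis using sa_roots_unique[OF s(1) r' r'] 4 e by blast
    qed
  qed
  have "\<exists>r. \<forall>e\<in>(E \<union> set es) - (Bd \<union> newbad V E vs es). \<forall>e'\<in>(E \<union> set es) - (Bd \<union> newbad V E vs es).
     \<forall>x. x \<in> e \<and> x \<in> e' \<and> x \<noteq> r e \<and> x \<noteq> r e' \<longrightarrow> e = e'"
  proof (intro exI[of _ r'] ballI allI impI)
    fix e e' x
    assume a: "e \<in> (E \<union> set es) - (Bd \<union> newbad V E vs es)" "e' \<in> (E \<union> set es) - (Bd \<union> newbad V E vs es)"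
      "x \<in> e \<and> x \<in> e' \<and> x \<noteq> r' e \<and> x \<noteq> r' e'"
    show "e = e'" by (rule uniq[of e e' x]) (use a in simp_all)
  qed
  moreover have "\<Union>(E \<union> set es) \<subseteq> V \<union> verts vs es" using hE by (auto simp: verts_def)
  moreover have "Bd \<union> newbad V E vs es \<subseteq> E \<union> set es" using hE(4) newbad_subset[of V E vs es] by blast
  moreover have "V \<union> verts vs es \<subseteq> {..<n}" "E \<union> set es \<subseteq> dsets n d"
    using hE(1,2) s(2) saws_verts[OF w] by simp_all
  ultimately show ?thesis
    unfolding hist_def by (intro conjI)
qed

text \<open>The weights \<open>tw\<close> are normalised so that the free choices of an edge sum to at most \<open>1\<close>; \<open>cst\<close> restores the
  factor \<open>n\<close> for each unseen starting point and records the gain \<open>1 / \<Theta>\<close> of a walk with a bad new edge.\<close>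

fun tw :: "real \<Rightarrow> nat set \<Rightarrow> nat set set \<Rightarrow> (nat list \<times> nat set list) list \<Rightarrow> real" where
  "tw \<Theta> V E [] = 1"
| "tw \<Theta> V E ((vs, es) # ws) = (if hd vs \<in> V then 1 else 1 / real n) * walkw (stepw V E {} 1 \<Theta>) vs es
     * tw \<Theta> (V \<union> verts vs es) (E \<union> set es) ws"

fun cst :: "real \<Rightarrow> nat set \<Rightarrow> nat set set \<Rightarrow> (nat list \<times> nat set list) list \<Rightarrow> real" where
  "cst \<Theta> V E [] = 1"
| "cst \<Theta> V E ((vs, es) # ws) = (if hd vs \<in> V then 1 else real n) * (if newbad V E vs es \<noteq> {} then 1 / \<Theta> else 1)
     * cst \<Theta> (V \<union> verts vs es) (E \<union> set es) ws"

text \<open>A free new edge turns \<open>p e\<close> into \<open>A\<close> times its weight. For a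
  bad one the factor \<Theta> in the weight leaves a gain \<open>1 / \<Theta>\<close>; only one such
  gain per walk is recorded, and any further gain is bounded by 1.\<close>

lemma prod_le_walkw:
  assumes "sa vs es" "set es \<subseteq> dsets n d" and T: "\<Theta> \<ge> 1"
  shows "(\<Prod>e\<in>set es - E. p e) \<le>
     A ^ card (set es - E) * (if newbad V E vs es \<noteq> {} then 1 / \<Theta> else 1) * walkw (stepw V E {} 1 \<Theta>) vs es"
  using assms(1,2)
proof (induction vs es rule: sa.induct)
  case (2 v u vs e es)
  let ?P = "\<Prod>e\<in>set es - E. p e" and ?C = "A ^ card (set es - E)"
  let ?b = "if newbad V E (u # vs) es \<noteq> {} then 1 / \<Theta> else 1"
  let ?W = "walkw (stepw V E {} 1 \<Theta>) (u # vs) es"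
  have IH: "?P \<le> ?C * ?b * ?W" using 2 by auto
  have e: "e \<in> dsets n d" "e \<notin> set es" using 2 sa_distinct_es[OF 2(2)] by auto
  have pe: "0 \<le> p e" using e p_nonneg by blast
  have W0: "0 \<le> ?W" using 2 T by (intro walkw_nonneg[of _ _ "dsets n d"] stepw_nonneg) auto
  show ?case
  proof (cases "e \<in> E")
    case True
    then have "set (e # es) - E = set es - E" by auto
    then show ?thesis using IH True by (simp add: stepw_simps)
  next
    case False
    then have eq: "set (e # es) - E = insert e (set es - E)" by auto
    have prod: "(\<Prod>e\<in>set (e # es) - E. p e) = p e * ?P" unfolding eq using e by simp
    have card: "A ^ card (set (e # es) - E) = A * ?C" unfolding eq using e by simp
    show ?thesis
    proof (cases "e \<inter> V \<subseteq> {v}")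
      case True
      have "p e * ?P \<le> p e * (?C * ?b * ?W)" using IH pe by (rule mult_left_mono)
      then show ?thesis unfolding prod card using True False A1 by (simp add: stepw_simps mult_ac)
    next
      case bad: False
      have "?b \<le> 1" using T by simp
      then have "?C * ?b * ?W \<le> ?C * 1 * ?W" using A1 W0 by (intro mult_right_mono mult_left_mono) auto
      then have "?P \<le> ?C * ?W" using IH by simp
      then have "p e * ?P \<le> p e * (?C * ?W)" using pe by (rule mult_left_mono)
      also have "\<dots> \<le> A * (p e * (?C * ?W))"
        using A1 pe W0 mult_right_mono[of 1 A "p e * (?C * ?W)"] by auto
      finally show ?thesis unfolding prod card using bad False T by (simp add: stepw_simps mult_ac)
    qed
  qed
qed auto

lemma tw_nonneg:
  assumes "set ws \<subseteq> sawsl l" "\<Theta> \<ge> 0"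
  shows "0 \<le> tw \<Theta> V E ws"
  using assms
proof (induction \<Theta> V E ws rule: tw.induct)
  case (2 \<Theta> V E vs es ws)
  have "0 \<le> walkw (stepw V E {} 1 \<Theta>) vs es"
    using 2 by (intro walkw_nonneg[of _ _ "dsets n d"] stepw_nonneg) (auto simp: sawsl_def saws_def)
  then show ?case using 2 by auto
qed auto

lemma cst_nonneg: "\<Theta> \<ge> 0 \<Longrightarrow> 0 \<le> cst \<Theta> V E ws"
  by (induction \<Theta> V E ws rule: cst.induct) auto

text \<open>The probability of a union of walks: each edge is charged to the first walk that uses
  it, with weights relative to the history at that moment.\<close>

lemma prod_le_tw:
  assumes "set ws \<subseteq> sawsl l" and T: "\<Theta> \<ge> 1"
  shows "(\<Prod>e\<in>edges_of ws - E. p e) \<le> A ^ card (edges_of ws - E) * cst \<Theta> V E ws * tw \<Theta> V E ws"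
  using assms
proof (induction \<Theta> V E ws rule: tw.induct)
  case (2 \<Theta> V E vs es ws)
  have s: "sa vs es" "set es \<subseteq> dsets n d" using 2 by (auto simp: sawsl_def saws_def)
  have ed: "edges_of ws \<subseteq> dsets n d" using 2 by (fastforce simp: sawsl_def saws_def edges_of_def)
  let ?W = "walkw (stepw V E {} 1 \<Theta>) vs es"
  let ?b = "if newbad V E vs es \<noteq> {} then 1 / \<Theta> else 1"
  have eq: "edges_of ((vs, es) # ws) - E = (set es - E) \<union> (edges_of ws - (E \<union> set es))" by auto
  have "(\<Prod>e\<in>edges_of ((vs, es) # ws) - E. p e) = (\<Prod>e\<in>set es - E. p e) * (\<Prod>e\<in>edges_of ws - (E \<union> set es). p e)"
    unfolding eq by (rule prod.union_disjoint) auto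
  also have "\<dots> \<le> (A ^ card (set es - E) * ?b * ?W) *
      (A ^ card (edges_of ws - (E \<union> set es)) * cst \<Theta> (V \<union> verts vs es) (E \<union> set es) ws * tw \<Theta> (V \<union> verts vs es) (E \<union> set es) ws)"
  proof (rule mult_mono)
    show "(\<Prod>e\<in>set es - E. p e) \<le> A ^ card (set es - E) * ?b * ?W"
      using prod_le_walkw s 2 by blast
    show "(\<Prod>e\<in>edges_of ws - (E \<union> set es). p e) \<le> A ^ card (edges_of ws - (E \<union> set es)) *
       cst \<Theta> (V \<union> verts vs es) (E \<union> set es) ws * tw \<Theta> (V \<union> verts vs es) (E \<union> set es) ws"
      using 2 by auto
    show "0 \<le> A ^ card (set es - E) * ?b * ?W"
      using A1 2 s by (intro mult_nonneg_nonneg walkw_nonneg[of _ _ "dsets n d"] stepw_nonneg) auto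
    show "0 \<le> (\<Prod>e\<in>edges_of ws - (E \<union> set es). p e)"
      using ed p_nonneg by (intro prod_nonneg) auto
  qed
  also have "\<dots> = A ^ card (edges_of ((vs, es) # ws) - E) * cst \<Theta> V E ((vs, es) # ws) * tw \<Theta> V E ((vs, es) # ws)"
  proof -
    have "card (edges_of ((vs, es) # ws) - E) = card (set es - E) + card (edges_of ws - (E \<union> set es))"
      unfolding eq by (rule card_Un_disjoint) auto
    then show ?thesis using n0 by (simp add: power_add mult_ac)
  qed
  finally show ?case .
qed simp

text \<open>Each bad edge created now raises the bound for the \<open>r\<close> remaining walks by
  \<open>\<Lambda> ^ r\<close>. That factor is absorbed into a surcharge on bad new edges, weakened
  to \<open>\<Lambda> ^ R\<close> so that it does not depend on \<open>r\<close>. Conversely, one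
  factor \<Lambda> per old bad edge on the walk pays for the discount \<open>1 / \<Lambda>\<close>
  on its reuse.\<close>

lemma walkw_newbad_le:
  assumes "sa vs es" "set es \<subseteq> dsets n d" and L: "\<Lambda> \<ge> 1" and T: "\<Theta> \<ge> 1" and r: "r \<le> R"
  shows "walkw (stepw V E {} 1 \<Theta>) vs es * \<Lambda> ^ (r * card (newbad V E vs es))
     \<le> \<Lambda> ^ card (Bd \<inter> set es) * walkw (stepw V E Bd (1 / \<Lambda>) (\<Theta> * \<Lambda> ^ R)) vs es"
  using assms(1,2)
proof (induction vs es rule: sa.induct)
  case (2 v u vs e es)
  let ?W = "walkw (stepw V E {} 1 \<Theta>) (u # vs) es"
  let ?W' = "walkw (stepw V E Bd (1 / \<Lambda>) (\<Theta> * \<Lambda> ^ R)) (u # vs) es"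
  let ?N = "newbad V E (u # vs) es"
  have IH: "?W * \<Lambda> ^ (r * card ?N) \<le> \<Lambda> ^ card (Bd \<inter> set es) * ?W'" using 2 by auto
  have e: "e \<in> dsets n d" "e \<notin> set es" using 2 sa_distinct_es[OF 2(2)] by auto
  have pe: "0 \<le> p e" using e p_nonneg by blast
  have W0: "0 \<le> ?W" using 2 T by (intro walkw_nonneg[of _ _ "dsets n d"] stepw_nonneg) auto
  have W0': "0 \<le> ?W'" using 2 T L by (intro walkw_nonneg[of _ _ "dsets n d"] stepw_nonneg) auto
  have ins: "Bd \<inter> set (e # es) = (if e \<in> Bd then insert e (Bd \<inter> set es) else Bd \<inter> set es)" by auto
  have cd: "\<Lambda> ^ card (Bd \<inter> set (e # es)) = (if e \<in> Bd then \<Lambda> else 1) * \<Lambda> ^ card (Bd \<inter> set es)"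
    unfolding ins using e by simp
  have L1: "1 \<le> (if e \<in> Bd then \<Lambda> else 1)" using L by auto
  have key: "q * X \<le> (if e \<in> Bd then \<Lambda> else 1) * \<Lambda> ^ card (Bd \<inter> set es) * (q * ?W')"
    if "X \<le> \<Lambda> ^ card (Bd \<inter> set es) * ?W'" "0 \<le> q" for q X
  proof -
    have "q * X \<le> q * (\<Lambda> ^ card (Bd \<inter> set es) * ?W')" using that by (intro mult_left_mono)
    also have "\<dots> \<le> (if e \<in> Bd then \<Lambda> else 1) * (q * (\<Lambda> ^ card (Bd \<inter> set es) * ?W'))"
      using L1 that W0' L mult_right_mono[OF L1, of "q * (\<Lambda> ^ card (Bd \<inter> set es) * ?W')"] by auto
    finally show ?thesis by (simp add: mult_ac)
  qed
  show ?case
  proof (cases "e \<in> E")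
    case True
    then show ?thesis using IH unfolding cd using L by (simp add: stepw_simps mult_ac)
  next
    case False
    show ?thesis
    proof (cases "e \<inter> V \<subseteq> {v}")
      case True
      show ?thesis unfolding cd
        using key[OF IH, of "p e / A"] True False pe A1 by (simp add: stepw_simps mult_ac)
    next
      case bad: False
      have nN: "e \<notin> ?N" using newbad_subset e by blast
      have fN: "finite ?N" using finite_subset[OF newbad_subset] by simp
      have "\<Lambda> ^ (r * card (newbad V E (v # u # vs) (e # es))) = \<Lambda> ^ r * \<Lambda> ^ (r * card ?N)"
        using bad False nN fN by (simp add: power_add)
      moreover have "(p e * \<Theta>) * \<Lambda> ^ r * (?W * \<Lambda> ^ (r * card ?N)) \<le> (p e * \<Theta>) * \<Lambda> ^ R * (?W * \<Lambda> ^ (r * card ?N))"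
        using pe T L r W0 by (intro mult_right_mono mult_left_mono power_increasing) auto
      moreover have "(p e * \<Theta>) * \<Lambda> ^ R * (?W * \<Lambda> ^ (r * card ?N)) \<le>
         (if e \<in> Bd then \<Lambda> else 1) * \<Lambda> ^ card (Bd \<inter> set es) * ((p e * \<Theta> * \<Lambda> ^ R) * ?W')"
        using pe T L by (intro key[OF IH]) auto
      ultimately show ?thesis unfolding cd using bad False by (simp add: stepw_simps mult_ac)
    qed
  qed
qed (use L in auto)

text \<open>At most \<open>M\<close> old edges can be bad, and a new bad edge at \<open>v\<close>
  contains one of at most \<open>M\<close> further explored vertices, each hit with total weight at
  most \<open>K / n\<close>.\<close>

lemma bad_choices_le:
  assumes V: "V \<subseteq> {..<n}" and E: "E \<subseteq> dsets n d" and B: "Bd \<subseteq> E" and v: "v < n"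
    and nn: "0 \<le> \<kappa>" "0 \<le> \<theta>" and M: "card V \<le> M" "card E \<le> M"
  shows "(\<Sum>e\<in>{e \<in> Bd. v \<in> e}. \<kappa>) +
        (\<Sum>e\<in>{e \<in> dsets n d. v \<in> e \<and> e \<notin> E \<and> \<not> e \<inter> V \<subseteq> {v}}. p e * \<theta>)
     \<le> real M * \<kappa> + real M * (K / real n) * \<theta>"
proof -
  have finE: "finite E" using finite_subset[OF E] by simp
  have finV: "finite V" using finite_subset[OF V] by simp
  have "card {e \<in> Bd. v \<in> e} \<le> card E" using B finE by (intro card_mono) auto
  then have 1: "(\<Sum>e\<in>{e \<in> Bd. v \<in> e}. \<kappa>) \<le> real M * \<kappa>" using M nn by (auto intro!: mult_right_mono)
  let ?F = "{e \<in> dsets n d. v \<in> e \<and> e \<notin> E \<and> \<not> e \<inter> V \<subseteq> {v}}"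
  have fd: "finite {e \<in> dsets n d. Q e}" for Q
    by (rule finite_subset[OF _ finite_dsets[of n d]]) auto
  have "(\<Sum>e\<in>?F. p e) \<le> (\<Sum>e\<in>(\<Union>x\<in>V - {v}. {e \<in> dsets n d. v \<in> e \<and> x \<in> e}). p e)"
    using p_nonneg finV fd by (intro sum_mono2) auto
  also have "\<dots> \<le> (\<Sum>x\<in>V - {v}. \<Sum>e\<in>{e \<in> dsets n d. v \<in> e \<and> x \<in> e}. p e)"
    using p_nonneg finV fd by (intro sum_UN_le) auto
  also have "\<dots> \<le> (\<Sum>x\<in>V - {v}. K / real n)" by (intro sum_mono codeg) auto
  also have "\<dots> \<le> real M * (K / real n)"
  proof -
    have "card (V - {v}) \<le> M" using M(1) finV by (meson card_mono Diff_subset order_trans)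
    then show ?thesis using K0 by (auto intro!: mult_right_mono divide_right_mono)
  qed
  finally have "(\<Sum>e\<in>?F. p e) * \<theta> \<le> real M * (K / real n) * \<theta>"
    by (rule mult_right_mono[OF _ nn(2)])
  then have "(\<Sum>e\<in>?F. p e * \<theta>) \<le> real M * (K / real n) * \<theta>"
    by (simp only: sum_distrib_right)
  then show ?thesis using 1 by linarith
qed

text \<open>Bad edges destroy the forest, so a walk might multiply by running through them. The
  remedy is to weigh their reuse by \<open>1 / \<Lambda>\<close>, small enough for the single-walk
  bound, and to pay \<Lambda> once per bad edge and remaining walk. This needs \<Lambda> to beat a
  polynomial in \<open>M\<close> and \<open>l\<close>, while \<open>\<Theta> * \<Lambda> ^ R\<close>
  stays well below n.\<close>

theorem tw_sum_le:
  assumes h: "hist V E Bd" and L: "\<Lambda> \<ge> 1" and T: "\<Theta> \<ge> 1" and r: "r \<le> R"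
    and M: "card V + r * (d * l + 1) \<le> M" "card E + r * l \<le> M"
    and z: "0 \<le> \<zeta>" "real (d - 1) * (real M * (1 / \<Lambda>) + real M * (K / real n) * (\<Theta> * \<Lambda> ^ R)) \<le> \<zeta>"
       "\<zeta> * ((real M + 1) * (real l + 1) ^ 3) \<le> 1"
  shows "(\<Sum>ws\<in>walk_lists (sawsl l) r. tw \<Theta> V E ws) \<le> ((real M + 1) ^ 2 * (real l + 1) ^ 4) ^ r * \<Lambda> ^ (r * card Bd)"
  using h r M
proof (induction r arbitrary: V E Bd)
  case 0
  then show ?case by simp
next
  case (Suc r)
  let ?Z = "(real M + 1) ^ 2 * (real l + 1) ^ 4"
  let ?w' = "stepw V E Bd (1 / \<Lambda>) (\<Theta> * \<Lambda> ^ R)"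
  let ?k = "\<lambda>v. if v \<in> V then 1 else 1 / real n"
  have hE: "V \<subseteq> {..<n}" "E \<subseteq> dsets n d" "\<Union>E \<subseteq> V" "Bd \<subseteq> E" using Suc(2) by (auto simp: hist_def)
  have finE: "finite E" using finite_subset[OF hE(2)] by simp
  have finV: "finite V" using finite_subset[OF hE(1)] by simp
  have cM: "card V \<le> M" "card E \<le> M" using Suc(4,5) by auto
  have Tp: "0 \<le> 1 / \<Lambda>" "0 \<le> \<Theta> * \<Lambda> ^ R" using L T by auto
  \<comment> \<open>The bound for the remaining walks depends on the present walk only through the
    number of its new bad edges, and \<open>walkw_newbad_le\<close> moves this dependence into the
    weight of that walk.\<close>
  have step: "(\<Sum>ws\<in>walk_lists (sawsl l) r. tw \<Theta> V E (w # ws)) \<le>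
     ?Z ^ r * \<Lambda> ^ (Suc r * card Bd) * (?k (hd (fst w)) * walkw ?w' (fst w) (snd w))" if w: "w \<in> sawsl l" for w
  proof -
    obtain vs es where we: "w = (vs, es)" by force
    obtain t where t: "(vs, es) \<in> saws n d t" "t \<le> l" using w we by (auto simp: sawsl_def)
    have s: "sa vs es" "set es \<subseteq> dsets n d" "length es = t" using t by (auto simp: saws_def)
    let ?V = "V \<union> verts vs es" and ?E = "E \<union> set es" and ?B = "Bd \<union> newbad V E vs es"
    let ?W = "walkw (stepw V E {} 1 \<Theta>) vs es"
    have W0: "0 \<le> ?W" using s T by (intro walkw_nonneg[of _ _ "dsets n d"] stepw_nonneg) auto
    have "d * t \<le> d * l" using t by simp
    then have "card ?V \<le> card V + (d * l + 1)"
      using card_Un_le[of V "verts vs es"] sa_card_verts[OF s(1,2), unfolded s(3)] by linarith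
    then have 1: "card ?V + r * (d * l + 1) \<le> M" using Suc(4) by simp
    have "card ?E \<le> card E + l" using card_Un_le[of E "set es"] card_length[of es] s(3) t by linarith
    then have 2: "card ?E + r * l \<le> M" using Suc(5) by simp
    have IH: "(\<Sum>ws\<in>walk_lists (sawsl l) r. tw \<Theta> ?V ?E ws) \<le> ?Z ^ r * \<Lambda> ^ (r * card ?B)"
      by (rule Suc.IH[OF hist_step[OF Suc(2) t(1)] _ 1 2]) (use Suc in auto)
    have fB: "finite Bd" "finite (newbad V E vs es)" using finite_subset[OF hE(4) finE] finite_subset[OF newbad_subset] by simp_all
    have "\<Lambda> ^ (r * card ?B) \<le> \<Lambda> ^ (r * (card Bd + card (newbad V E vs es)))"
      using L card_Un_le by (intro power_increasing mult_le_mono2) auto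
    also have "\<dots> = \<Lambda> ^ (r * card Bd) * \<Lambda> ^ (r * card (newbad V E vs es))"
      by (simp add: power_add distrib_left)
    finally have "?W * \<Lambda> ^ (r * card ?B) \<le> ?W * (\<Lambda> ^ (r * card Bd) * \<Lambda> ^ (r * card (newbad V E vs es)))"
      by (rule mult_left_mono[OF _ W0])
    also have "\<dots> = \<Lambda> ^ (r * card Bd) * (?W * \<Lambda> ^ (r * card (newbad V E vs es)))"
      by (simp only: mult_ac)
    also have "\<dots> \<le> \<Lambda> ^ (r * card Bd) * (\<Lambda> ^ card (Bd \<inter> set es) * walkw ?w' vs es)"
      using L Suc(3) by (intro mult_left_mono walkw_newbad_le s T) auto
    also have "\<dots> \<le> \<Lambda> ^ (r * card Bd) * (\<Lambda> ^ card Bd * walkw ?w' vs es)"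
    proof -
      have "card (Bd \<inter> set es) \<le> card Bd" using fB by (intro card_mono) auto
      moreover have "0 \<le> walkw ?w' vs es" using s Tp by (intro walkw_nonneg[of _ _ "dsets n d"] stepw_nonneg) auto
      ultimately show ?thesis using L by (intro mult_left_mono mult_right_mono power_increasing) auto
    qed
    also have "\<dots> = \<Lambda> ^ (Suc r * card Bd) * walkw ?w' vs es" by (simp add: power_add)
    finally have 3: "?W * \<Lambda> ^ (r * card ?B) \<le> \<Lambda> ^ (Suc r * card Bd) * walkw ?w' vs es" .
    have "(\<Sum>ws\<in>walk_lists (sawsl l) r. tw \<Theta> V E (w # ws)) = ?k (hd vs) * ?W * (\<Sum>ws\<in>walk_lists (sawsl l) r. tw \<Theta> ?V ?E ws)"
      by (simp add: we sum_distrib_left)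
    also have "\<dots> \<le> ?k (hd vs) * ?W * (?Z ^ r * \<Lambda> ^ (r * card ?B))"
      using W0 by (intro mult_left_mono[OF IH]) auto
    also have "\<dots> = ?k (hd vs) * ?Z ^ r * (?W * \<Lambda> ^ (r * card ?B))" by (simp add: mult_ac)
    also have "\<dots> \<le> ?k (hd vs) * ?Z ^ r * (\<Lambda> ^ (Suc r * card Bd) * walkw ?w' vs es)"
      by (intro mult_left_mono[OF 3]) auto
    finally show ?thesis by (simp add: we mult_ac)
  qed
  have z': "\<zeta> * ((real (card V) + 1) * (real l + 1) ^ 3) \<le> 1"
  proof -
    have "\<zeta> * ((real (card V) + 1) * (real l + 1) ^ 3) \<le> \<zeta> * ((real M + 1) * (real l + 1) ^ 3)"
      using z(1) cM by (intro mult_left_mono mult_right_mono) auto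
    then show ?thesis using z by linarith
  qed
  have single: "(\<Sum>(vs, es)\<in>{(vs, es) \<in> sawsl l. hd vs = v}. walkw ?w' vs es) \<le> (real M + 1) * (real l + 1) ^ 4"
    if v: "v < n" for v
  proof -
    have "(\<Sum>(vs, es)\<in>{(vs, es) \<in> sawsl l. hd vs = v}. walkw ?w' vs es) \<le> (real (card V) + 1) * (real l + 1) ^ 4"
    proof (rule single_walk_bound[OF Suc(2) Tp _ z(1) z' v])
      fix v assume v: "v < n"
      have "real (d - 1) * ((\<Sum>e\<in>{e \<in> Bd. v \<in> e}. 1 / \<Lambda>) +
        (\<Sum>e\<in>{e \<in> dsets n d. v \<in> e \<and> e \<notin> E \<and> \<not> e \<inter> V \<subseteq> {v}}. p e * (\<Theta> * \<Lambda> ^ R)))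
        \<le> real (d - 1) * (real M * (1 / \<Lambda>) + real M * (K / real n) * (\<Theta> * \<Lambda> ^ R))"
        using Tp cM v hE by (intro mult_left_mono bad_choices_le) auto
      then show "real (d - 1) * ((\<Sum>e\<in>{e \<in> Bd. v \<in> e}. 1 / \<Lambda>) +
        (\<Sum>e\<in>{e \<in> dsets n d. v \<in> e \<and> e \<notin> E \<and> \<not> e \<inter> V \<subseteq> {v}}. p e * (\<Theta> * \<Lambda> ^ R))) \<le> \<zeta>"
        using z by linarith
    qed
    also have "\<dots> \<le> (real M + 1) * (real l + 1) ^ 4" using cM by (intro mult_right_mono) auto
    finally show ?thesis .
  qed
  \<comment> \<open>A start on the history has weight 1 and a fresh start has weight 1/n; together
    they give one of the two factors \<open>M + 1\<close> per walk.\<close>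
  have ksum: "(\<Sum>v<n. ?k v) \<le> real M + 1"
  proof -
    have "(\<Sum>v<n. ?k v) \<le> (\<Sum>v<n. (if v \<in> V then 1 else 0) + 1 / real n)" by (intro sum_mono) auto
    also have "\<dots> = real (card V) + 1"
      using hE n0 by (simp add: sum.distrib sum.If_cases Int_absorb1)
    finally show ?thesis using cM by linarith
  qed
  have "(\<Sum>ws\<in>walk_lists (sawsl l) (Suc r). tw \<Theta> V E ws) = (\<Sum>w\<in>sawsl l. \<Sum>ws\<in>walk_lists (sawsl l) r. tw \<Theta> V E (w # ws))"
    by (rule sum_walk_lists_Suc) simp
  also have "\<dots> \<le> (\<Sum>w\<in>sawsl l. ?Z ^ r * \<Lambda> ^ (Suc r * card Bd) * (?k (hd (fst w)) * walkw ?w' (fst w) (snd w)))"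
    by (intro sum_mono step)
  also have "\<dots> = ?Z ^ r * \<Lambda> ^ (Suc r * card Bd) * (\<Sum>w\<in>sawsl l. ?k (hd (fst w)) * walkw ?w' (fst w) (snd w))"
    by (rule sum_distrib_left[symmetric])
  also have "(\<Sum>w\<in>sawsl l. ?k (hd (fst w)) * walkw ?w' (fst w) (snd w)) =
     (\<Sum>v<n. \<Sum>w\<in>{w \<in> sawsl l. hd (fst w) = v}. ?k (hd (fst w)) * walkw ?w' (fst w) (snd w))"
  proof (rule sum.group[symmetric])
    show "(\<lambda>w. hd (fst w)) ` sawsl l \<subseteq> {..<n}"
    proof
      fix x assume "x \<in> (\<lambda>w. hd (fst w)) ` sawsl l"
      then obtain vs es t where "(vs, es) \<in> saws n d t" "x = hd vs" by (auto simp: sawsl_def)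
      then show "x \<in> {..<n}"
        using sa_hd_in_verts[of vs es] saws_verts[of vs es n d t] by (auto simp: saws_def)
    qed
  qed auto
  also have "\<dots> = (\<Sum>v<n. ?k v * (\<Sum>(vs, es)\<in>{(vs, es) \<in> sawsl l. hd vs = v}. walkw ?w' vs es))"
    by (intro sum.cong refl) (simp add: sum_distrib_left case_prod_unfold)
  also have "\<dots> \<le> (\<Sum>v<n. ?k v * ((real M + 1) * (real l + 1) ^ 4))"
    by (intro sum_mono mult_left_mono single) auto
  also have "\<dots> = (\<Sum>v<n. ?k v) * ((real M + 1) * (real l + 1) ^ 4)" by (rule sum_distrib_right[symmetric])
  also have "\<dots> \<le> (real M + 1) * ((real M + 1) * (real l + 1) ^ 4)" by (intro mult_right_mono ksum) auto
  also have "?Z ^ r * \<Lambda> ^ (Suc r * card Bd) * ((real M + 1) * ((real M + 1) * (real l + 1) ^ 4)) =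
     ?Z ^ Suc r * \<Lambda> ^ (Suc r * card Bd)" by (simp add: power2_eq_square mult_ac)
  finally show ?case using L by (auto intro: mult_left_mono)
qed

end

section \<open>Moments of signed walk weights\<close>

definition HE :: "nat \<Rightarrow> nat \<Rightarrow> (nat set \<Rightarrow> real) \<Rightarrow> (nat set set \<Rightarrow> real) \<Rightarrow> real" where
  "HE n d p g = (\<Sum>H\<in>Pow (dsets n d). (\<Prod>e\<in>dsets n d. if e \<in> H then p e else 1 - p e) * g H)"

lemma HE_sum: "HE n d p (\<lambda>H. \<Sum>x\<in>S. g x H) = (\<Sum>x\<in>S. HE n d p (g x))"
  unfolding HE_def sum_distrib_left by (rule sum.swap)

lemma HE_cmult: "HE n d p (\<lambda>H. c * g H) = c * HE n d p g"
  unfolding HE_def by (simp add: sum_distrib_left mult_ac)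

lemma HE_cong: "(\<And>H. H \<subseteq> dsets n d \<Longrightarrow> g H = h H) \<Longrightarrow> HE n d p g = HE n d p h"
  unfolding HE_def by (intro sum.cong) auto

lemma HE_mono:
  assumes "\<And>e. e \<in> dsets n d \<Longrightarrow> 0 \<le> p e \<and> p e \<le> 1" "\<And>H. H \<subseteq> dsets n d \<Longrightarrow> g H \<le> h H"
  shows "HE n d p g \<le> HE n d p h"
  unfolding HE_def using assms by (intro sum_mono mult_left_mono prod_nonneg) auto

text \<open>Independence of the edges, read off from the expansion of a product of two-term
  sums.\<close>

lemma HE_prod:
  "HE n d p (\<lambda>H. \<Prod>e\<in>dsets n d. \<phi> e (e \<in> H)) = (\<Prod>e\<in>dsets n d. p e * \<phi> e True + (1 - p e) * \<phi> e False)"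
proof -
  let ?D = "dsets n d"
  have "(\<Prod>e\<in>?D. p e * \<phi> e True + (1 - p e) * \<phi> e False) =
     (\<Sum>H\<in>Pow ?D. (\<Prod>e\<in>H. p e * \<phi> e True) * (\<Prod>e\<in>?D - H. (1 - p e) * \<phi> e False))"
    by (rule prod_add) simp
  also have "\<dots> = (\<Sum>H\<in>Pow ?D. (\<Prod>e\<in>?D. if e \<in> H then p e else 1 - p e) * (\<Prod>e\<in>?D. \<phi> e (e \<in> H)))"
  proof (rule sum.cong)
    fix H assume "H \<in> Pow ?D"
    then have H: "?D = H \<union> (?D - H)" "finite H" by (auto intro: finite_subset)
    have "(\<Prod>e\<in>?D. (if e \<in> H then p e else 1 - p e) * \<phi> e (e \<in> H)) =
       (\<Prod>e\<in>H. (if e \<in> H then p e else 1 - p e) * \<phi> e (e \<in> H)) *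
       (\<Prod>e\<in>?D - H. (if e \<in> H then p e else 1 - p e) * \<phi> e (e \<in> H))"
      by (subst H(1), rule prod.union_disjoint) (use H in auto)
    also have "\<dots> = (\<Prod>e\<in>H. p e * \<phi> e True) * (\<Prod>e\<in>?D - H. (1 - p e) * \<phi> e False)"
      by (intro arg_cong2[of _ _ _ _ "(*)"] prod.cong) auto
    finally show "(\<Prod>e\<in>H. p e * \<phi> e True) * (\<Prod>e\<in>?D - H. (1 - p e) * \<phi> e False) =
       (\<Prod>e\<in>?D. if e \<in> H then p e else 1 - p e) * (\<Prod>e\<in>?D. \<phi> e (e \<in> H))"
      by (simp add: prod.distrib)
  qed simp
  finally show ?thesis unfolding HE_def by simp
qed

lemma HE_const: "HE n d p (\<lambda>H. c) = c"
  using HE_cmult[of n d p c "\<lambda>H. \<Prod>e\<in>dsets n d. 1"] HE_prod[of n d p "\<lambda>_ _. 1"] by simp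

text \<open>\<open>True\<close> selects the centred indicator and \<open>False\<close> the plain
  one. Both occur in one product because the expansion centres only an initial segment of a
  walk.\<close>

definition sgnw :: "(nat set \<Rightarrow> real) \<Rightarrow> nat set set \<Rightarrow> bool \<Rightarrow> nat set \<Rightarrow> real" where
  "sgnw p H \<tau> e = of_bool (e \<in> H) - (if \<tau> then p e else 0)"

lemma prod_list_sgnw_eq:
  assumes "set xs \<subseteq> UNIV \<times> dsets n d"
  shows "(\<Prod>(\<tau>, e)\<leftarrow>xs. sgnw p H \<tau> e) =
     (\<Prod>e\<in>dsets n d. sgnw p H True e ^ count_list xs (True, e) * sgnw p H False e ^ count_list xs (False, e))"
  using assms
proof (induction xs)
  case (Cons x xs)
  obtain \<tau> e where x: "x = (\<tau>, e)" by force
  have e: "e \<in> dsets n d" using Cons x by auto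
  let ?g = "\<lambda>xs f. sgnw p H True f ^ count_list xs (True, f) * sgnw p H False f ^ count_list xs (False, f)"
  have "(\<Prod>f\<in>dsets n d. ?g (x # xs) f) = (\<Prod>f\<in>dsets n d. (if f = e then sgnw p H \<tau> e else 1) * ?g xs f)"
    by (intro prod.cong) (auto simp: x)
  also have "\<dots> = sgnw p H \<tau> e * (\<Prod>f\<in>dsets n d. ?g xs f)"
    using e by (simp add: prod.distrib)
  finally show ?case using Cons x by simp
qed simp

lemma HE_prod_list:
  assumes xs: "set xs \<subseteq> UNIV \<times> dsets n d" and p: "\<And>e. e \<in> dsets n d \<Longrightarrow> 0 \<le> p e \<and> p e \<le> 1"
  shows "\<bar>HE n d p (\<lambda>H. \<Prod>(\<tau>, e)\<leftarrow>xs. sgnw p H \<tau> e)\<bar> \<le> (\<Prod>e\<in>snd ` set xs. p e)"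
    and "HE n d p (\<lambda>H. \<Prod>(\<tau>, e)\<leftarrow>xs. sgnw p H \<tau> e) \<noteq> 0 \<Longrightarrow> (True, e) \<in> set xs \<Longrightarrow> (False, e) \<notin> set xs
          \<Longrightarrow> 2 \<le> count_list xs (True, e)"
proof -
  let ?\<phi> = "\<lambda>e b. (of_bool b - p e) ^ count_list xs (True, e) * of_bool b ^ count_list xs (False, e)"
  let ?m = "\<lambda>e. p e * ?\<phi> e True + (1 - p e) * ?\<phi> e False"
  have "HE n d p (\<lambda>H. \<Prod>(\<tau>, e)\<leftarrow>xs. sgnw p H \<tau> e) = HE n d p (\<lambda>H. \<Prod>e\<in>dsets n d. ?\<phi> e (e \<in> H))"
    using prod_list_sgnw_eq[OF xs] by (intro HE_cong) (simp add: sgnw_def)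
  also have "\<dots> = (\<Prod>e\<in>dsets n d. ?m e)" by (rule HE_prod)
  finally have eq: "HE n d p (\<lambda>H. \<Prod>(\<tau>, e)\<leftarrow>xs. sgnw p H \<tau> e) = (\<Prod>e\<in>dsets n d. ?m e)" .
  have m0: "?m e = 1" if "e \<notin> snd ` set xs" for e
  proof -
    have "(True, e) \<notin> set xs" "(False, e) \<notin> set xs" using that by force+
    then have "count_list xs (True, e) = 0" "count_list xs (False, e) = 0" by (simp_all add: count_list_0_iff)
    then show ?thesis by simp
  qed
  have mle: "\<bar>?m e\<bar> \<le> p e" if e: "e \<in> snd ` set xs" for e
  proof -
    obtain \<tau> where "(\<tau>, e) \<in> set xs" using e by force
    then have "(True, e) \<in> set xs \<or> (False, e) \<in> set xs" by (cases \<tau>) auto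
    then have c: "count_list xs (True, e) \<noteq> 0 \<or> count_list xs (False, e) \<noteq> 0" by (simp add: count_list_0_iff)
    have pe: "0 \<le> p e" "p e \<le> 1" using p xs e by auto
    show ?thesis
    proof (cases "count_list xs (False, e) = 0")
      case False
      have "0 \<le> (1 - p e) ^ count_list xs (True, e)" "(1 - p e) ^ count_list xs (True, e) \<le> 1"
        using pe by (auto intro: power_le_one)
      moreover have "?m e = p e * (1 - p e) ^ count_list xs (True, e)" using False by (simp add: zero_power)
      ultimately show ?thesis using pe by (simp only: abs_mult) (simp add: mult_left_le)
    next
      case True
      then obtain k where k: "count_list xs (True, e) = Suc k" using c by (auto simp: gr0_conv_Suc)
      \<comment> \<open>The centred moment of order \<open>k + 1\<close>. Factoring out
        \<open>p e * (1 - p e)\<close> leaves a bracket whose product with \<open>1 - p e\<close> is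
        at most 1 in absolute value.\<close>
      have eq: "?m e = p e * (1 - p e) * ((1 - p e) ^ k - (- p e) ^ k)"
        using True k by (simp add: algebra_simps)
      have "(1 - p e) * \<bar>(1 - p e) ^ k - (- p e) ^ k\<bar> \<le> 1"
      proof (cases k)
        case (Suc k')
        have "\<bar>(1 - p e) ^ k - (- p e) ^ k\<bar> \<le> \<bar>(1 - p e) ^ k\<bar> + \<bar>(- p e) ^ k\<bar>" by (rule abs_triangle_ineq4)
        also have "\<dots> = (1 - p e) ^ k + p e ^ k" using pe by (simp add: power_abs)
        also have "\<dots> \<le> (1 - p e) * 1 + p e * 1"
          unfolding Suc power_Suc using pe by (intro add_mono mult_left_mono power_le_one) auto
        finally have "\<bar>(1 - p e) ^ k - (- p e) ^ k\<bar> \<le> 1" by simp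
        then show ?thesis using pe mult_mono[of "1 - p e" 1 "\<bar>(1 - p e) ^ k - (- p e) ^ k\<bar>" 1] by simp
      qed simp
      then have "p e * ((1 - p e) * \<bar>(1 - p e) ^ k - (- p e) ^ k\<bar>) \<le> p e * 1" using pe by (intro mult_left_mono)
      then show ?thesis unfolding eq using pe by (simp add: abs_mult mult_ac)
    qed
  qed
  have sub: "snd ` set xs \<subseteq> dsets n d" using xs by auto
  have "\<bar>\<Prod>e\<in>dsets n d. ?m e\<bar> = (\<Prod>e\<in>dsets n d. \<bar>?m e\<bar>)" by (rule abs_prod)
  also have "\<dots> = (\<Prod>e\<in>snd ` set xs. \<bar>?m e\<bar>)"
    by (rule prod.mono_neutral_right) (use sub m0 in auto)
  also have "\<dots> \<le> (\<Prod>e\<in>snd ` set xs. p e)" using mle by (intro prod_mono) auto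
  finally show "\<bar>HE n d p (\<lambda>H. \<Prod>(\<tau>, e)\<leftarrow>xs. sgnw p H \<tau> e)\<bar> \<le> (\<Prod>e\<in>snd ` set xs. p e)" unfolding eq .
  assume nz: "HE n d p (\<lambda>H. \<Prod>(\<tau>, e)\<leftarrow>xs. sgnw p H \<tau> e) \<noteq> 0" and e: "(True, e) \<in> set xs" "(False, e) \<notin> set xs"
  show "2 \<le> count_list xs (True, e)"
  proof (rule ccontr)
    assume "\<not> 2 \<le> count_list xs (True, e)"
    moreover have "count_list xs (True, e) \<noteq> 0" "count_list xs (False, e) = 0" using e by (simp_all add: count_list_0_iff)
    ultimately have "count_list xs (True, e) = 1" "count_list xs (False, e) = 0" by auto
    then have "?m e = 0" by (simp add: algebra_simps)
    moreover have "e \<in> dsets n d" using e xs by auto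
    ultimately have "(\<Prod>e\<in>dsets n d. ?m e) = 0" by (intro prod_zero finite_dsets bexI)
    then show False using nz unfolding eq by blast
  qed
qed

section \<open>Walk matrices, their powers, and chains of walks\<close>

type_synonym walk = "nat list \<times> nat set list"

definition wval :: "(nat set \<Rightarrow> real) \<Rightarrow> bool \<Rightarrow> nat set set \<Rightarrow> walk \<Rightarrow> real" where
  "wval p \<tau> H w = (\<Prod>e\<leftarrow>snd w. sgnw p H \<tau> e)"

definition flat :: "(bool \<times> walk) list \<Rightarrow> (bool \<times> nat set) list" where
  "flat tws = concat (map (\<lambda>(\<tau>, w). map (Pair \<tau>) (snd w)) tws)"

lemma prod_list_wval: "(\<Prod>(\<tau>, w)\<leftarrow>tws. wval p \<tau> H w) = (\<Prod>(\<tau>, e)\<leftarrow>flat tws. sgnw p H \<tau> e)"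
  by (induction tws) (auto simp: flat_def wval_def o_def)

lemma flat_set: "snd ` set (flat tws) = edges_of (map snd tws)"
proof (induction tws)
  case (Cons x tws)
  have "snd ` set (map (Pair (fst x)) (snd (snd x))) = set (snd (snd x))" by (simp add: image_image)
  then show ?case using Cons by (simp add: flat_def image_Un case_prod_unfold)
qed (simp add: flat_def)

text \<open>The matrix \<Delta> of the centred weights for \<open>\<tau> = True\<close>, and the
  self-avoiding matrix B for \<open>\<tau> = False\<close>.\<close>

definition Wm :: "nat \<Rightarrow> nat \<Rightarrow> (nat set \<Rightarrow> real) \<Rightarrow> bool \<Rightarrow> nat \<Rightarrow> nat set set \<Rightarrow> nat \<Rightarrow> nat \<Rightarrow> real" where
  "Wm n d p \<tau> s H i j =
     (\<Sum>w\<in>saws n d s. if hd (fst w) = i \<and> last (fst w) = j then wval p \<tau> H w else 0)"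

primrec mpow :: "nat \<Rightarrow> (nat \<Rightarrow> nat \<Rightarrow> real) \<Rightarrow> nat \<Rightarrow> nat \<Rightarrow> nat \<Rightarrow> real" where
  "mpow n M 0 i j = (if i = j then 1 else 0)"
| "mpow n M (Suc K) i j = (\<Sum>k<n. M i k * mpow n M K k j)"

fun chain :: "nat \<Rightarrow> walk list \<Rightarrow> nat \<Rightarrow> bool" where
  "chain i [] j = (i = j)"
| "chain i (w # ws) j = (hd (fst w) = i \<and> chain (last (fst w)) ws j)"

lemma saws_hd_last:
  assumes "w \<in> saws n d s"
  shows "hd (fst w) < n" "last (fst w) < n" "sa (fst w) (snd w)" "set (snd w) \<subseteq> dsets n d" "length (snd w) = s"
proof -
  have w: "(fst w, snd w) \<in> saws n d s" using assms by simp
  then show s: "sa (fst w) (snd w)" "set (snd w) \<subseteq> dsets n d" "length (snd w) = s"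
    by (simp_all add: saws_def case_prod_unfold)
  show "hd (fst w) < n" using sa_hd_in_verts[OF s(1)] saws_verts[OF w] by blast
  show "last (fst w) < n" using sa_last_in_verts[OF s(1)] saws_verts[OF w] by blast
qed

lemma mpow_Wm:
  "mpow n (Wm n d p \<tau> s H) K i j =
     (\<Sum>ws\<in>walk_lists (saws n d s) K. if chain i ws j then (\<Prod>w\<leftarrow>ws. wval p \<tau> H w) else 0)"
proof (induction K arbitrary: i)
  case (Suc K)
  let ?S = "saws n d s"
  let ?c = "\<lambda>k. \<Sum>ws\<in>walk_lists ?S K. if chain k ws j then (\<Prod>w\<leftarrow>ws. wval p \<tau> H w) else 0"
  have "mpow n (Wm n d p \<tau> s H) (Suc K) i j =
     (\<Sum>k<n. \<Sum>w\<in>?S. (if hd (fst w) = i \<and> last (fst w) = k then wval p \<tau> H w else 0) * ?c k)"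
    by (simp add: Wm_def Suc.IH sum_distrib_right)
  also have "\<dots> = (\<Sum>w\<in>?S. \<Sum>k<n. (if hd (fst w) = i \<and> last (fst w) = k then wval p \<tau> H w else 0) * ?c k)"
    by (rule sum.swap)
  also have "\<dots> = (\<Sum>w\<in>?S. (if hd (fst w) = i then wval p \<tau> H w else 0) * ?c (last (fst w)))"
  proof (rule sum.cong[OF refl])
    fix w assume w: "w \<in> ?S"
    have "(\<Sum>k<n. (if hd (fst w) = i \<and> last (fst w) = k then wval p \<tau> H w else 0) * ?c k) =
       (\<Sum>k<n. if k = last (fst w) then (if hd (fst w) = i then wval p \<tau> H w else 0) * ?c k else 0)"
      by (intro sum.cong) auto
    also have "\<dots> = (if hd (fst w) = i then wval p \<tau> H w else 0) * ?c (last (fst w))"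
      using saws_hd_last[OF w] by (subst sum.delta) auto
    finally show "(\<Sum>k<n. (if hd (fst w) = i \<and> last (fst w) = k then wval p \<tau> H w else 0) * ?c k) =
       (if hd (fst w) = i then wval p \<tau> H w else 0) * ?c (last (fst w))" .
  qed
  also have "\<dots> = (\<Sum>w\<in>?S. \<Sum>ws\<in>walk_lists ?S K. if chain i (w # ws) j then (\<Prod>w\<leftarrow>w # ws. wval p \<tau> H w) else 0)"
    unfolding sum_distrib_left by (intro sum.cong refl) auto
  also have "\<dots> = (\<Sum>ws\<in>walk_lists ?S (Suc K). if chain i ws j then (\<Prod>w\<leftarrow>ws. wval p \<tau> H w) else 0)"
    by (rule sum_walk_lists_Suc[symmetric]) simp
  finally show ?case .
qed simp

lemma sum_walk_lists_append:
  assumes "finite S"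
  shows "(\<Sum>ws\<in>walk_lists S (a + b). f ws) = (\<Sum>ws\<in>walk_lists S a. \<Sum>ws'\<in>walk_lists S b. f (ws @ ws'))"
proof (induction a arbitrary: f)
  case (Suc a)
  then show ?case by (simp add: sum_walk_lists_Suc[OF assms])
qed simp

text \<open>Families in which every walk starts at an explored vertex; such walks never pay the
  factor n for a starting point.\<close>

fun linked :: "nat set \<Rightarrow> walk list \<Rightarrow> bool" where
  "linked V [] = True"
| "linked V (w # ws) = (hd (fst w) \<in> V \<and> linked (V \<union> verts (fst w) (snd w)) ws)"

lemma linked_mono: "linked V ws \<Longrightarrow> V \<subseteq> V' \<Longrightarrow> linked V' ws"
proof (induction V ws arbitrary: V' rule: linked.induct)
  case (2 V w ws)
  then show ?case by (metis linked.simps(2) Un_mono order_refl subsetD)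
qed simp

text \<open>Applied to two chains with the same start \<open>i\<close>: together they cost a single
  free starting point.\<close>

lemma chain_linked:
  assumes "chain i ws j" "i \<in> V" "linked {i} ws'" "set ws \<subseteq> {w. sa (fst w) (snd w)}"
  shows "linked V (ws @ ws')"
proof -
  have "linked V' (ws @ ws')" if "k \<in> V'" "i \<in> V'" "chain k ws j" for k V'
    using that assms(4)
  proof (induction ws arbitrary: k V')
    case Nil
    then show ?case using linked_mono[OF assms(3)] by auto
  next
    case (Cons w ws)
    have "last (fst w) \<in> verts (fst w) (snd w)" using Cons by (auto intro: sa_last_in_verts)
    then show ?case using Cons.IH[of "last (fst w)" "V' \<union> verts (fst w) (snd w)"] Cons.prems by auto
  qed
  then show ?thesis using assms by blast
qed

context edge_weights
begin

lemma cst_linked: "linked V ws \<Longrightarrow> \<Theta> \<ge> 1 \<Longrightarrow> cst \<Theta> V E ws \<le> 1"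
proof (induction \<Theta> V E ws rule: cst.induct)
  case (2 \<Theta> V E vs es ws)
  have "cst \<Theta> (V \<union> verts vs es) (E \<union> set es) ws \<le> 1" "0 \<le> cst \<Theta> (V \<union> verts vs es) (E \<union> set es) ws"
    using 2 by (auto intro!: cst_nonneg)
  then show ?case using 2 mult_mono[of "1 / \<Theta>" 1 "cst \<Theta> (V \<union> verts vs es) (E \<union> set es) ws" 1] by auto
qed simp

lemma cst_linked_Cons:
  assumes "linked (verts (fst w) (snd w)) ws" "\<Theta> \<ge> 1"
  shows "cst \<Theta> {} {} (w # ws) \<le> real n"
proof -
  obtain vs es where w: "w = (vs, es)" by force
  have "cst \<Theta> (verts vs es) (set es) ws \<le> 1" "0 \<le> cst \<Theta> (verts vs es) (set es) ws"
    using assms w by (auto intro!: cst_linked cst_nonneg)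
  moreover have "newbad {} {} vs es = {}" by (auto simp: newbad_def)
  ultimately show ?thesis using w by (simp add: mult_left_le)
qed

end

text \<open>\<open>codeg3\<close> is the extra factor 1/n for a connecting edge that also hits a
  third prescribed vertex; it makes the concatenation error of disjoint walks negligible.\<close>

locale hsbm_weights = edge_weights +
  assumes p_le1: "\<And>e. e \<in> dsets n d \<Longrightarrow> p e \<le> 1"
    and codeg3: "\<And>v x y. v \<noteq> x \<Longrightarrow> v \<noteq> y \<Longrightarrow> x \<noteq> y \<Longrightarrow>
        (\<Sum>e\<in>{e \<in> dsets n d. v \<in> e \<and> x \<in> e \<and> y \<in> e}. p e) \<le> K / (real n)\<^sup>2"
begin

definition wsum :: "real \<Rightarrow> nat \<Rightarrow> nat \<Rightarrow> real" where
  "wsum \<Theta> l r = (\<Sum>ws\<in>walk_lists (sawsl l) r. tw \<Theta> {} {} ws)"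

lemma saws_subset_sawsl: "s \<le> l \<Longrightarrow> saws n d s \<subseteq> sawsl l"
  by (auto simp: sawsl_def)

lemma HE_wval_le:
  assumes ws: "set (map snd tws) \<subseteq> sawsl l" and T: "\<Theta> \<ge> 1"
    and f: "card (edges_of (map snd tws)) \<le> f" and c: "cst \<Theta> {} {} (map snd tws) \<le> c"
  shows "\<bar>HE n d p (\<lambda>H. \<Prod>(\<tau>, w)\<leftarrow>tws. wval p \<tau> H w)\<bar> \<le> A ^ f * c * tw \<Theta> {} {} (map snd tws)"
proof -
  have ed: "edges_of (map snd tws) \<subseteq> dsets n d" using ws by (fastforce simp: sawsl_def saws_def edges_of_def)
  have "\<bar>HE n d p (\<lambda>H. \<Prod>(\<tau>, w)\<leftarrow>tws. wval p \<tau> H w)\<bar> \<le> (\<Prod>e\<in>edges_of (map snd tws). p e)"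
    unfolding prod_list_wval flat_set[symmetric]
  proof (rule HE_prod_list(1))
    show "set (flat tws) \<subseteq> UNIV \<times> dsets n d"
    proof
      fix x assume "x \<in> set (flat tws)"
      then have "snd x \<in> edges_of (map snd tws)" unfolding flat_set[symmetric] by blast
      then show "x \<in> UNIV \<times> dsets n d" using ed by (cases x) auto
    qed
  qed (use p_nonneg p_le1 in auto)
  also have "\<dots> \<le> A ^ card (edges_of (map snd tws)) * cst \<Theta> {} {} (map snd tws) * tw \<Theta> {} {} (map snd tws)"
    using prod_le_tw[OF ws T, of "{}" "{}"] by simp
  also have "\<dots> \<le> A ^ f * c * tw \<Theta> {} {} (map snd tws)"
    using A1 f c T by (intro mult_right_mono mult_mono power_increasing tw_nonneg[OF ws] cst_nonneg) auto
  finally show ?thesis .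
qed

lemma HE_wval_nonzero:
  assumes nz: "HE n d p (\<lambda>H. \<Prod>w\<leftarrow>ws. wval p True H w) \<noteq> 0" and ws: "set ws \<subseteq> sawsl l"
  shows "e \<in> edges_of ws \<Longrightarrow> 2 \<le> count_list (concat (map snd ws)) e"
    and "2 * card (edges_of ws) \<le> length (concat (map snd ws))"
proof -
  let ?xs = "flat (map (Pair True) ws)"
  let ?L = "concat (map snd ws)"
  have ed: "edges_of ws \<subseteq> dsets n d" using ws by (fastforce simp: sawsl_def saws_def edges_of_def)
  have fl: "snd ` set ?xs = edges_of ws" unfolding flat_set by (simp add: o_def)
  have xs: "?xs = map (Pair True) ?L" by (simp add: flat_def map_concat o_def)
  have nz': "HE n d p (\<lambda>H. \<Prod>(\<tau>, e)\<leftarrow>?xs. sgnw p H \<tau> e) \<noteq> 0"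
    using nz unfolding prod_list_wval[symmetric] by (simp add: o_def)
  have sL: "set ?L = edges_of ws" unfolding edges_of_def by simp
  have cnt: "count_list (map (Pair True) L) (True, e) = count_list L e" for L and e :: "nat set"
    by (induction L) auto
  have 2: "2 \<le> count_list ?L e" if e: "e \<in> edges_of ws" for e
  proof -
    have "2 \<le> count_list ?xs (True, e)"
    proof (rule HE_prod_list(2)[OF _ _ nz'])
      show "set ?xs \<subseteq> UNIV \<times> dsets n d"
      proof
        fix x assume "x \<in> set ?xs"
        then have "snd x \<in> edges_of ws" using fl by blast
        then show "x \<in> UNIV \<times> dsets n d" using ed by (cases x) auto
      qed
      show "(True, e) \<in> set ?xs" "(False, e) \<notin> set ?xs" using e sL unfolding xs by auto
    qed (use p_nonneg p_le1 in auto)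
    then show ?thesis unfolding xs cnt .
  qed
  then show "e \<in> edges_of ws \<Longrightarrow> 2 \<le> count_list ?L e" .
  have "(\<Sum>e\<in>edges_of ws. 2) \<le> (\<Sum>e\<in>edges_of ws. count_list ?L e)" by (intro sum_mono 2)
  also have "\<dots> = length ?L" by (rule sum_count_set[OF eq_refl[OF sL]]) simp
  finally show "2 * card (edges_of ws) \<le> length ?L" by simp
qed

lemma length_concat_saws: "set ws \<subseteq> saws n d s \<Longrightarrow> length (concat (map snd ws)) = length ws * s"
  by (induction ws) (auto simp: saws_def)

lemma card_edges_of_le: "card (edges_of ws) \<le> length (concat (map snd ws))"
proof -
  have "edges_of ws = set (concat (map snd ws))" unfolding edges_of_def by simp
  then show ?thesis using card_length by metis
qed

text \<open>The exponent halves for centred weights because every edge then has to be traversed twice.\<close>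

lemma HE_mpow_le:
  assumes s: "s \<le> l" and T: "\<Theta> \<ge> 1" and K: "k > 0"
  shows "HE n d p (\<lambda>H. \<Sum>i<n. \<Sum>j<n. (mpow n (Wm n d p \<tau> s H) k i j)\<^sup>2)
     \<le> A ^ (if \<tau> then k * s else 2 * k * s) * real n * wsum \<Theta> l (2 * k)"
proof -
  let ?S = "saws n d s" and ?f = "if \<tau> then k * s else 2 * k * s"
  let ?L = "walk_lists ?S k"
  let ?v = "\<lambda>H ws. \<Prod>w\<leftarrow>ws. wval p \<tau> H w"
  let ?I = "\<lambda>ws ws'. (\<Sum>i<n. \<Sum>j<n. of_bool (chain i ws j \<and> chain i ws' j)) :: real"
  have fin: "finite ?L" by simp
  have sq: "(\<Sum>i<n. \<Sum>j<n. (mpow n (Wm n d p \<tau> s H) k i j)\<^sup>2) = (\<Sum>ws\<in>?L. \<Sum>ws'\<in>?L. ?I ws ws' * ?v H (ws @ ws'))" for H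
  proof -
    have "(mpow n (Wm n d p \<tau> s H) k i j)\<^sup>2 =
       (\<Sum>ws\<in>?L. \<Sum>ws'\<in>?L. of_bool (chain i ws j \<and> chain i ws' j) * ?v H (ws @ ws'))" for i j
      unfolding mpow_Wm power2_eq_square sum_product by (intro sum.cong refl) auto
    then have "(\<Sum>i<n. \<Sum>j<n. (mpow n (Wm n d p \<tau> s H) k i j)\<^sup>2) =
       (\<Sum>i<n. \<Sum>j<n. \<Sum>ws\<in>?L. \<Sum>ws'\<in>?L. of_bool (chain i ws j \<and> chain i ws' j) * ?v H (ws @ ws'))" by simp
    also have "\<dots> = (\<Sum>i<n. \<Sum>ws\<in>?L. \<Sum>j<n. \<Sum>ws'\<in>?L. of_bool (chain i ws j \<and> chain i ws' j) * ?v H (ws @ ws'))"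
      by (intro sum.cong refl sum.swap)
    also have "\<dots> = (\<Sum>ws\<in>?L. \<Sum>i<n. \<Sum>j<n. \<Sum>ws'\<in>?L. of_bool (chain i ws j \<and> chain i ws' j) * ?v H (ws @ ws'))"
      by (rule sum.swap)
    also have "\<dots> = (\<Sum>ws\<in>?L. \<Sum>i<n. \<Sum>ws'\<in>?L. \<Sum>j<n. of_bool (chain i ws j \<and> chain i ws' j) * ?v H (ws @ ws'))"
      by (intro sum.cong refl sum.swap)
    also have "\<dots> = (\<Sum>ws\<in>?L. \<Sum>ws'\<in>?L. \<Sum>i<n. \<Sum>j<n. of_bool (chain i ws j \<and> chain i ws' j) * ?v H (ws @ ws'))"
      by (intro sum.cong refl sum.swap)
    finally show ?thesis by (simp add: sum_distrib_right)
  qed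
  have "HE n d p (\<lambda>H. \<Sum>i<n. \<Sum>j<n. (mpow n (Wm n d p \<tau> s H) k i j)\<^sup>2) =
     (\<Sum>ws\<in>?L. \<Sum>ws'\<in>?L. ?I ws ws' * HE n d p (\<lambda>H. ?v H (ws @ ws')))"
    unfolding sq by (simp only: HE_sum HE_cmult)
  also have "\<dots> \<le> (\<Sum>ws\<in>?L. \<Sum>ws'\<in>?L. A ^ ?f * real n * tw \<Theta> {} {} (ws @ ws'))"
  proof (intro sum_mono)
    fix ws ws' assume w: "ws \<in> ?L" "ws' \<in> ?L"
    have sub: "set (ws @ ws') \<subseteq> ?S" "length ws = k" "length ws' = k" using w by (auto simp: walk_lists_def)
    have sub': "set (ws @ ws') \<subseteq> sawsl l" using sub saws_subset_sawsl[OF s] by blast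
    obtain w0 r where ws: "ws = w0 # r" using sub(2) K by (cases ws) auto
    obtain w0' r' where ws': "ws' = w0' # r'" using sub(3) K by (cases ws') auto
    have t0: "0 \<le> A ^ ?f * real n * tw \<Theta> {} {} (ws @ ws')"
      using A1 T tw_nonneg[OF sub'] by simp
    have chain_det: "chain i ws j \<Longrightarrow> j = last (fst (last ws))" for i j
    proof -
      have "chain i us j \<Longrightarrow> us \<noteq> [] \<Longrightarrow> j = last (fst (last us))" for us i j
        by (induction us arbitrary: i) auto
      then show "chain i ws j \<Longrightarrow> j = last (fst (last ws))" using ws by blast
    qed
    show "?I ws ws' * HE n d p (\<lambda>H. ?v H (ws @ ws')) \<le> A ^ ?f * real n * tw \<Theta> {} {} (ws @ ws')"
    proof (cases "(\<exists>i j. chain i ws j \<and> chain i ws' j) \<and> HE n d p (\<lambda>H. ?v H (ws @ ws')) \<noteq> 0")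
      case False
      then have "?I ws ws' = 0 \<or> HE n d p (\<lambda>H. ?v H (ws @ ws')) = 0"
        by (auto intro!: sum.neutral)
      then have "?I ws ws' * HE n d p (\<lambda>H. ?v H (ws @ ws')) = 0" by (simp only: mult_eq_0_iff)
      then show ?thesis using t0 by (simp only:)
    next
      case True
      then obtain i j where ij: "chain i ws j" "chain i ws' j" by blast
      have sas: "sa (fst w) (snd w)" if "w \<in> set (ws @ ws')" for w using sub(1) that saws_hd_last(3) by blast
      have i: "i \<in> verts (fst w0) (snd w0)"
        using ij(1) ws sa_hd_in_verts[OF sas, of w0] by auto
      \<comment> \<open>A nonempty chain determines both of its ends, so at most one pair of indices
        contributes.\<close>
      have I1: "?I ws ws' \<le> 1"
      proof -
        have "?I ws ws' \<le> (\<Sum>i'<n. \<Sum>j'<n. if i' = i then if j' = j then 1 else 0 else 0)"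
        proof (intro sum_mono)
          fix i' j'
          have eqs: "i' = i \<and> j' = j" if "chain i' ws j'"
          proof
            show "i' = i" using that ij(1) unfolding ws by simp
            show "j' = j" by (rule trans[OF chain_det[OF that] chain_det[OF ij(1), symmetric]])
          qed
          show "of_bool (chain i' ws j' \<and> chain i' ws' j') \<le>
             (if i' = i then if j' = j then 1 else 0 else 0 :: real)"
          proof (cases "chain i' ws j'")
            case True
            then have "i' = i" "j' = j" using eqs by blast+
            then show ?thesis by simp
          qed simp
        qed
        also have "\<dots> \<le> (\<Sum>i'<n. if i' = i then 1 else 0)" by (intro sum_mono) auto
        also have "\<dots> \<le> 1" by simp
        finally show ?thesis .
      qed
      have I0: "0 \<le> ?I ws ws'" by (intro sum_nonneg) auto
      have "linked {i} (ws' @ [])"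
        by (rule chain_linked[OF ij(2)]) (use sas in auto)
      then have lk: "linked (verts (fst w0) (snd w0)) (r @ ws')"
      proof -
        have "set ws \<subseteq> {w. sa (fst w) (snd w)}" by (intro subsetI CollectI sas) simp
        then have "linked (verts (fst w0) (snd w0)) (ws @ ws')"
          using chain_linked[OF ij(1) i] \<open>linked {i} (ws' @ [])\<close> by simp
        then show ?thesis unfolding ws by simp
      qed
      have c: "cst \<Theta> {} {} (ws @ ws') \<le> real n"
        unfolding ws append_Cons by (rule cst_linked_Cons[OF lk T])
      have len: "length (concat (map snd (ws @ ws'))) = 2 * k * s"
        using length_concat_saws[OF sub(1)] sub(2,3) by simp
      have f: "card (edges_of (ws @ ws')) \<le> ?f"
      proof (cases \<tau>)
        case True
        then show ?thesis using HE_wval_nonzero(2)[OF _ sub'] len \<open>_ \<and> _\<close> by auto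
      next
        case False
        then show ?thesis using card_edges_of_le[of "ws @ ws'"] len by simp
      qed
      have "\<bar>HE n d p (\<lambda>H. ?v H (ws @ ws'))\<bar> \<le> A ^ ?f * real n * tw \<Theta> {} {} (ws @ ws')"
        using HE_wval_le[of "map (Pair \<tau>) (ws @ ws')" l \<Theta> ?f "real n"] sub' T f c by (simp add: o_def)
      then have "?I ws ws' * HE n d p (\<lambda>H. ?v H (ws @ ws')) \<le> ?I ws ws' * (A ^ ?f * real n * tw \<Theta> {} {} (ws @ ws'))"
        using I0 by (intro mult_left_mono) auto
      also have "\<dots> \<le> 1 * (A ^ ?f * real n * tw \<Theta> {} {} (ws @ ws'))"
        using I1 t0 by (rule mult_right_mono)
      finally show ?thesis by simp
    qed
  qed
  also have "\<dots> = A ^ ?f * real n * (\<Sum>ws\<in>walk_lists ?S (k + k). tw \<Theta> {} {} ws)"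
    by (simp add: sum_walk_lists_append sum_distrib_left)
  also have "\<dots> \<le> A ^ ?f * real n * wsum \<Theta> l (2 * k)"
  proof -
    have "walk_lists ?S (2 * k) \<subseteq> walk_lists (sawsl l) (2 * k)"
      using saws_subset_sawsl[OF s] by (auto simp: walk_lists_def)
    then have "(\<Sum>ws\<in>walk_lists ?S (2 * k). tw \<Theta> {} {} ws) \<le> wsum \<Theta> l (2 * k)"
      unfolding wsum_def using T
      by (intro sum_mono2[OF finite_walk_lists[OF finite_sawsl]]) (auto simp: walk_lists_def intro!: tw_nonneg[of _ l])
    then show ?thesis using A1 by (intro mult_left_mono) (auto simp: mult_2)
  qed
  finally show ?thesis .
qed

end

section \<open>Reversal symmetry and the centring expansion\<close>

lemma bij_betw_saws_rev: "bij_betw (\<lambda>w. (rev (fst w), rev (snd w))) (saws n d s) (saws n d s)"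
  by (rule bij_betw_byWitness[where f' = "\<lambda>w. (rev (fst w), rev (snd w))"])
     (auto intro: saws_rev)

lemma sum_saws_rev: "(\<Sum>w\<in>saws n d s. f (rev (fst w), rev (snd w))) = (\<Sum>w\<in>saws n d s. f w)"
  using sum.reindex_bij_betw[OF bij_betw_saws_rev, of f] by simp

lemma prod_list_rev_real: "prod_list (rev xs) = (prod_list xs :: real)"
  by (induction xs) (simp_all add: mult.commute)

lemma wval_rev: "wval p \<tau> H (rev vs, rev es) = wval p \<tau> H (vs, es)"
  by (simp add: wval_def rev_map[symmetric] prod_list_rev_real)

lemma Wm_sym: "Wm n d p \<tau> s H i j = Wm n d p \<tau> s H j i"
proof -
  have "Wm n d p \<tau> s H i j = (\<Sum>w\<in>saws n d s. if hd (rev (fst w)) = i \<and> last (rev (fst w)) = j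
      then wval p \<tau> H (rev (fst w), rev (snd w)) else 0)"
    unfolding Wm_def by (subst sum_saws_rev[symmetric]) simp
  also have "\<dots> = Wm n d p \<tau> s H j i"
    unfolding Wm_def
  proof (rule sum.cong[OF refl])
    fix w assume "w \<in> saws n d s"
    then have "fst w \<noteq> []" using saws_hd_last(3) sa_not_Nil by blast
    then show "(if hd (rev (fst w)) = i \<and> last (rev (fst w)) = j then wval p \<tau> H (rev (fst w), rev (snd w)) else 0) =
      (if hd (fst w) = j \<and> last (fst w) = i then wval p \<tau> H w else 0)"
      using wval_rev[of p \<tau> H "fst w" "snd w"] by (auto simp: hd_rev last_rev)
  qed
  finally show ?thesis .
qed

text \<open>At length 0 the walk matrix is the identity, in contrast to \<open>saw_mat\<close>; the
  recursion for the matrices starts from the identity.\<close>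

lemma Wm_0: "i < n \<Longrightarrow> Wm n d p \<tau> 0 H i j = (if i = j then 1 else 0)"
proof -
  assume i: "i < n"
  have wv: "wval p \<tau> H ([x], []) = 1" for x by (simp add: wval_def)
  have "saws n d 0 = (\<lambda>v. ([v], [])) ` {..<n}" by (auto simp: saws_def sa_Nil_iff)
  then have "Wm n d p \<tau> 0 H i j = (\<Sum>v<n. if v = i \<and> v = j then 1 else 0)"
    unfolding Wm_def by (simp add: sum.reindex inj_on_def wv cong: if_cong)
  also have "\<dots> = (\<Sum>v<n. if v = i then if i = j then 1 else 0 else 0)" by (intro sum.cong) auto
  finally show ?thesis using i by simp
qed

lemma saw_mat_eq_Wm:
  assumes H: "H \<subseteq> dsets n d" and "i < n" "m > 0"
  shows "saw_mat H m i j = Wm n d p False m H i j"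
proof -
  have v: "wval p False H w = (if set (snd w) \<subseteq> H then 1 else 0)" for w
  proof -
    have "(\<Prod>e\<leftarrow>es. sgnw p H False e) = (if set es \<subseteq> H then 1 else 0)" for es
      by (induction es) (auto simp: sgnw_def)
    then show ?thesis by (simp add: wval_def)
  qed
  have eq: "{(vs, es) \<in> saws n d m. hd vs = i \<and> last vs = j \<and> set es \<subseteq> H} =
      {w \<in> saws n d m. hd (fst w) = i \<and> last (fst w) = j \<and> set (snd w) \<subseteq> H}" by auto
  let ?P = "\<lambda>w. hd (fst w) = i \<and> last (fst w) = j \<and> set (snd w) \<subseteq> H"
  have "Wm n d p False m H i j = (\<Sum>w\<in>saws n d m. of_bool (?P w))"
    unfolding Wm_def v by (intro sum.cong refl) auto
  also have "\<dots> = real (card (saws n d m \<inter> {w. ?P w}))" by simp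
  also have "saws n d m \<inter> {w. ?P w} = {w \<in> saws n d m. ?P w}" by blast
  finally show ?thesis unfolding saw_mat_eq_card[OF assms] eq by (rule sym)
qed

text \<open>Replaces the factors one at a time from the left. With \<open>a\<close> plain and
  \<open>b\<close> centred, each term consists of a centred prefix, a single \<open>p e\<close>, and
  a plain suffix.\<close>

lemma telescope_prod_list:
  fixes a b :: "'a \<Rightarrow> real"
  shows "prod_list (map a es) = prod_list (map b es) +
    (\<Sum>s<length es. prod_list (map b (take s es)) * (a (es ! s) - b (es ! s)) * prod_list (map a (drop (Suc s) es)))"
proof (induction es)
  case (Cons e es)
  have "(\<Sum>s<length (e # es). prod_list (map b (take s (e # es))) * (a ((e # es) ! s) - b ((e # es) ! s)) * prod_list (map a (drop (Suc s) (e # es))))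
    = (a e - b e) * prod_list (map a es) +
      b e * (\<Sum>s<length es. prod_list (map b (take s es)) * (a (es ! s) - b (es ! s)) * prod_list (map a (drop (Suc s) es)))"
    by (simp add: sum.lessThan_Suc_shift sum_distrib_left mult_ac del: sum.lessThan_Suc)
  then show ?case using Cons by (simp add: algebra_simps)
qed simp

definition joined :: "walk \<Rightarrow> nat set \<Rightarrow> walk \<Rightarrow> bool" where
  "joined w1 e w2 \<longleftrightarrow> sa (fst w1 @ fst w2) (snd w1 @ e # snd w2)"

definition Ab :: "nat \<Rightarrow> nat \<Rightarrow> (nat set \<Rightarrow> real) \<Rightarrow> nat \<Rightarrow> nat \<Rightarrow> real" where
  "Ab n d p x y = (if x = y then 0 else \<Sum>e\<in>{e \<in> dsets n d. x \<in> e \<and> y \<in> e}. p e)"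

text \<open>The mean number of edges between the end of \<open>w1\<close> and the start of
  \<open>w2\<close> that fail to make the concatenation self-avoiding. It is 0 for equal ends, in
  accordance with the zero diagonal of \<open>Ab\<close>.\<close>

definition conf :: "nat \<Rightarrow> nat \<Rightarrow> (nat set \<Rightarrow> real) \<Rightarrow> walk \<Rightarrow> walk \<Rightarrow> real" where
  "conf n d p w1 w2 = (if last (fst w1) = hd (fst w2) then 0 else
     \<Sum>e\<in>{e \<in> dsets n d. last (fst w1) \<in> e \<and> hd (fst w2) \<in> e \<and> \<not> joined w1 e w2}. p e)"

definition Gm :: "nat \<Rightarrow> nat \<Rightarrow> (nat set \<Rightarrow> real) \<Rightarrow> nat \<Rightarrow> nat \<Rightarrow> nat set set \<Rightarrow> nat \<Rightarrow> nat \<Rightarrow> real" where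
  "Gm n d p s t H i j = (\<Sum>w1\<in>saws n d s. \<Sum>w2\<in>saws n d t.
     if hd (fst w1) = i \<and> last (fst w2) = j then wval p True H w1 * wval p False H w2 * conf n d p w1 w2 else 0)"

text \<open>If every pair of walks could be joined, summing over the middle edge would give the
  product of three matrices; the pairs and edges that do not join are subtracted as
  \<open>Gm\<close>. Since \<open>wval\<close> reads only edges, \<open>undefined\<close> stands in
  for the vertex lists.\<close>

lemma Wm_split_at:
  assumes s: "s < m"
  shows "(\<Sum>w\<in>saws n d m. if hd (fst w) = i \<and> last (fst w) = j then
            wval p True H (undefined, take s (snd w)) * p (snd w ! s) * wval p False H (undefined, drop (Suc s) (snd w)) else 0)
   = (\<Sum>x<n. \<Sum>y<n. Wm n d p True s H i x * Ab n d p x y * Wm n d p False (m - 1 - s) H y j)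
     - Gm n d p s (m - 1 - s) H i j"
proof -
  let ?t = "m - 1 - s"
  let ?S = "saws n d s" and ?T = "saws n d ?t"
  let ?v = "\<lambda>(w1 :: walk) (w2 :: walk). if hd (fst w1) = i \<and> last (fst w2) = j then wval p True H w1 * wval p False H w2 else 0"
  let ?E = "\<lambda>w1 w2. {e \<in> dsets n d. last (fst w1) \<in> e \<and> hd (fst w2) \<in> e \<and> last (fst w1) \<noteq> hd (fst w2) \<and> joined w1 e w2}"
  have fE: "finite (?E w1 w2)" for w1 w2 by (rule finite_subset[OF _ finite_dsets[of n d]]) auto
  have wv: "wval p \<tau> H (x, es) = wval p \<tau> H (y, es)" for \<tau> x y es by (simp add: wval_def)
  have "(\<Sum>w\<in>saws n d m. if hd (fst w) = i \<and> last (fst w) = j then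
            wval p True H (undefined, take s (snd w)) * p (snd w ! s) * wval p False H (undefined, drop (Suc s) (snd w)) else 0)
     = (\<Sum>(w1 :: walk, w2 :: walk, e)\<in>(SIGMA w1:?S. SIGMA w2:?T. ?E w1 w2). ?v w1 w2 * p e)"
  proof (rule sum.reindex_bij_witness[where
        i = "\<lambda>(w1 :: walk, w2 :: walk, e). (fst w1 @ fst w2, snd w1 @ e # snd w2)" and
        j = "\<lambda>w. ((take (Suc s) (fst w), take s (snd w)), (drop (Suc s) (fst w), drop (Suc s) (snd w)), snd w ! s)"])
    fix w assume w: "w \<in> saws n d m"
    obtain vs es where we: "w = (vs, es)" by force
    have sw: "sa vs es" "length es = m" "set es \<subseteq> dsets n d" "set vs \<subseteq> {..<n}" using w we by (auto simp: saws_def)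
    have es: "es = take s es @ es ! s # drop (Suc s) es" using s sw(2) by (simp add: id_take_nth_drop)
    obtain vs1 vs2 where v: "vs = vs1 @ vs2" "sa vs1 (take s es)" "sa vs2 (drop (Suc s) es)" "last vs1 \<in> es ! s"
       "hd vs2 \<in> es ! s" "last vs1 \<noteq> hd vs2"
      using sa_split[of vs "take s es" "es ! s" "drop (Suc s) es"] sw(1) es by metis
    have l1: "length vs1 = Suc s" using sa_length[OF v(2)] s sw(2) by simp
    have t: "take (Suc s) vs = vs1" "drop (Suc s) vs = vs2" using v(1) l1 by auto
    have ne: "vs1 \<noteq> []" "vs2 \<noteq> []" using v(2,3) sa_not_Nil by auto
    show "(case ((take (Suc s) (fst w), take s (snd w)), (drop (Suc s) (fst w), drop (Suc s) (snd w)), snd w ! s) of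
        (w1 :: walk, w2 :: walk, e) \<Rightarrow> (fst w1 @ fst w2, snd w1 @ e # snd w2)) = w"
      using we es by simp
    have m1: "(vs1, take s es) \<in> ?S"
      using v(1,2) s sw set_take_subset[of s es] by (auto simp: saws_def)
    have m2: "(vs2, drop (Suc s) es) \<in> ?T"
      using v(1,3) s sw set_drop_subset[of "Suc s" es] by (auto simp: saws_def)
    have m3: "es ! s \<in> ?E (vs1, take s es) (vs2, drop (Suc s) es)"
      using v sw es s by (auto simp: joined_def)
    show "((take (Suc s) (fst w), take s (snd w)), (drop (Suc s) (fst w), drop (Suc s) (snd w)), snd w ! s)
       \<in> (SIGMA w1:?S. SIGMA w2:?T. ?E w1 w2)"
      using m1 m2 m3 we t by simp
    show "(case ((take (Suc s) (fst w), take s (snd w)), (drop (Suc s) (fst w), drop (Suc s) (snd w)), snd w ! s) of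
        (w1 :: walk, w2 :: walk, e) \<Rightarrow> ?v w1 w2 * p e) =
      (if hd (fst w) = i \<and> last (fst w) = j then
            wval p True H (undefined, take s (snd w)) * p (snd w ! s) * wval p False H (undefined, drop (Suc s) (snd w)) else 0)"
      using we t v(1) ne wv[of True vs1 "take s es" undefined] wv[of False vs2 "drop (Suc s) es" undefined] by simp
  next
    fix b assume b: "b \<in> (SIGMA w1:?S. SIGMA w2:?T. ?E w1 w2)"
    obtain vs1 es1 vs2 es2 e where be: "b = ((vs1, es1), (vs2, es2), e)" by (metis prod_cases3 prod.collapse)
    have B: "sa vs1 es1" "length es1 = s" "set es1 \<subseteq> dsets n d" "set vs1 \<subseteq> {..<n}"
       "sa vs2 es2" "length es2 = ?t" "set es2 \<subseteq> dsets n d" "set vs2 \<subseteq> {..<n}" "e \<in> dsets n d"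
       "sa (vs1 @ vs2) (es1 @ e # es2)"
      using b be by (auto simp: saws_def joined_def)
    have l: "length vs1 = Suc s" using sa_length[OF B(1)] B(2) by simp
    show "((take (Suc s) (fst (case b of (w1 :: walk, w2 :: walk, e) \<Rightarrow> (fst w1 @ fst w2, snd w1 @ e # snd w2))),
           take s (snd (case b of (w1 :: walk, w2 :: walk, e) \<Rightarrow> (fst w1 @ fst w2, snd w1 @ e # snd w2)))),
           (drop (Suc s) (fst (case b of (w1 :: walk, w2 :: walk, e) \<Rightarrow> (fst w1 @ fst w2, snd w1 @ e # snd w2))),
            drop (Suc s) (snd (case b of (w1 :: walk, w2 :: walk, e) \<Rightarrow> (fst w1 @ fst w2, snd w1 @ e # snd w2)))),
           snd (case b of (w1 :: walk, w2 :: walk, e) \<Rightarrow> (fst w1 @ fst w2, snd w1 @ e # snd w2)) ! s) = b"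
      using be l B(2) by (simp add: nth_append)
    show "(case b of (w1 :: walk, w2 :: walk, e) \<Rightarrow> (fst w1 @ fst w2, snd w1 @ e # snd w2)) \<in> saws n d m"
      using be B s by (simp add: saws_def)
  qed
  also have "\<dots> = (\<Sum>w1\<in>?S. \<Sum>w2\<in>?T. ?v w1 w2 * (\<Sum>e\<in>?E w1 w2. p e))"
    by (subst sum.Sigma[symmetric], simp, blast intro: fE finite_SigmaI finite_saws,
        intro sum.cong refl, subst sum.Sigma[symmetric]) (auto simp: sum_distrib_left fE)
  also have "\<dots> = (\<Sum>w1\<in>?S. \<Sum>w2\<in>?T. ?v w1 w2 * (Ab n d p (last (fst w1)) (hd (fst w2)) - conf n d p w1 w2))"
  proof (intro sum.cong refl arg_cong2[of _ _ _ _ "(*)"])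
    fix w1 w2 :: walk
    let ?x = "last (fst w1)" and ?y = "hd (fst w2)"
    show "(\<Sum>e\<in>?E w1 w2. p e) = Ab n d p ?x ?y - conf n d p w1 w2"
    proof (cases "?x = ?y")
      case False
      have "{e \<in> dsets n d. ?x \<in> e \<and> ?y \<in> e} = ?E w1 w2 \<union> {e \<in> dsets n d. ?x \<in> e \<and> ?y \<in> e \<and> \<not> joined w1 e w2}"
        using False by auto
      moreover have "(\<Sum>e\<in>\<dots>. p e) = (\<Sum>e\<in>?E w1 w2. p e) + (\<Sum>e\<in>{e \<in> dsets n d. ?x \<in> e \<and> ?y \<in> e \<and> \<not> joined w1 e w2}. p e)"
        by (rule sum.union_disjoint) (auto intro: finite_subset[OF _ finite_dsets[of n d]])
      ultimately show ?thesis using False by (simp add: Ab_def conf_def)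
    qed (simp add: Ab_def conf_def)
  qed
  also have "\<dots> = (\<Sum>w1\<in>?S. \<Sum>w2\<in>?T. ?v w1 w2 * Ab n d p (last (fst w1)) (hd (fst w2))) - Gm n d p s ?t H i j"
    unfolding Gm_def right_diff_distrib sum_subtractf
    by (intro arg_cong2[of _ _ _ _ "(-)"] sum.cong refl) auto
  also have "(\<Sum>w1\<in>?S. \<Sum>w2\<in>?T. ?v w1 w2 * Ab n d p (last (fst w1)) (hd (fst w2))) =
     (\<Sum>x<n. \<Sum>y<n. Wm n d p True s H i x * Ab n d p x y * Wm n d p False ?t H y j)"
  proof -
    let ?a = "\<lambda>w1 x. if hd (fst w1) = i \<and> last (fst w1) = x then wval p True H w1 else 0"
    let ?b = "\<lambda>w2 y. if hd (fst w2) = y \<and> last (fst w2) = j then wval p False H w2 else 0"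
    have "(\<Sum>x<n. \<Sum>y<n. Wm n d p True s H i x * Ab n d p x y * Wm n d p False ?t H y j) =
      (\<Sum>x<n. \<Sum>y<n. \<Sum>w1\<in>?S. \<Sum>w2\<in>?T. ?a w1 x * Ab n d p x y * ?b w2 y)"
      unfolding Wm_def sum_distrib_left sum_distrib_right by (intro sum.cong refl sum.swap)
    also have "\<dots> = (\<Sum>x<n. \<Sum>w1\<in>?S. \<Sum>y<n. \<Sum>w2\<in>?T. ?a w1 x * Ab n d p x y * ?b w2 y)"
      by (intro sum.cong refl sum.swap)
    also have "\<dots> = (\<Sum>w1\<in>?S. \<Sum>x<n. \<Sum>y<n. \<Sum>w2\<in>?T. ?a w1 x * Ab n d p x y * ?b w2 y)"
      by (rule sum.swap)
    also have "\<dots> = (\<Sum>w1\<in>?S. \<Sum>x<n. \<Sum>w2\<in>?T. \<Sum>y<n. ?a w1 x * Ab n d p x y * ?b w2 y)"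
      by (intro sum.cong refl sum.swap)
    also have "\<dots> = (\<Sum>w1\<in>?S. \<Sum>w2\<in>?T. \<Sum>x<n. \<Sum>y<n. ?a w1 x * Ab n d p x y * ?b w2 y)"
      by (intro sum.cong refl sum.swap)
    also have "\<dots> = (\<Sum>w1\<in>?S. \<Sum>w2\<in>?T. ?v w1 w2 * Ab n d p (last (fst w1)) (hd (fst w2)))"
    proof (intro sum.cong refl)
      fix w1 w2 assume w: "w1 \<in> ?S" "w2 \<in> ?T"
      let ?x = "last (fst w1)" and ?y = "hd (fst w2)"
      have "(\<Sum>x<n. \<Sum>y<n. ?a w1 x * Ab n d p x y * ?b w2 y) =
         (\<Sum>x<n. \<Sum>y<n. if y = ?y then if x = ?x then ?a w1 ?x * Ab n d p ?x ?y * ?b w2 ?y else 0 else 0)"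
        by (intro sum.cong refl) auto
      also have "\<dots> = ?a w1 ?x * Ab n d p ?x ?y * ?b w2 ?y"
        using saws_hd_last[OF w(1)] saws_hd_last[OF w(2)] by (simp add: sum.delta)
      finally show "(\<Sum>x<n. \<Sum>y<n. ?a w1 x * Ab n d p x y * ?b w2 y) = ?v w1 w2 * Ab n d p ?x ?y" by simp
    qed
    finally show ?thesis by simp
  qed
  finally show ?thesis .
qed

theorem Wm_decomposition:
  "Wm n d p False m H i j = Wm n d p True m H i j +
     (\<Sum>s<m. (\<Sum>x<n. \<Sum>y<n. Wm n d p True s H i x * Ab n d p x y * Wm n d p False (m - 1 - s) H y j)
            - Gm n d p s (m - 1 - s) H i j)"
proof -
  let ?c = "\<lambda>w::walk. hd (fst w) = i \<and> last (fst w) = j"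
  let ?g = "\<lambda>s w. wval p True H (undefined, take s (snd w)) * p (snd w ! s) * wval p False H (undefined, drop (Suc s) (snd w))"
  have "Wm n d p False m H i j = (\<Sum>w\<in>saws n d m. if ?c w then wval p True H w + (\<Sum>s<m. ?g s w) else 0)"
    unfolding Wm_def
  proof (rule sum.cong[OF refl])
    fix w assume w: "w \<in> saws n d m"
    have "wval p False H w = wval p True H w + (\<Sum>s<m. ?g s w)"
      using telescope_prod_list[of "sgnw p H False" "snd w" "sgnw p H True"] saws_hd_last(5)[OF w]
      unfolding wval_def by (simp add: sgnw_def)
    then show "(if ?c w then wval p False H w else 0) = (if ?c w then wval p True H w + (\<Sum>s<m. ?g s w) else 0)" by simp
  qed
  also have "\<dots> = (\<Sum>w\<in>saws n d m. (if ?c w then wval p True H w else 0) + (\<Sum>s<m. if ?c w then ?g s w else 0))"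
    by (intro sum.cong) auto
  also have "\<dots> = Wm n d p True m H i j + (\<Sum>s<m. \<Sum>w\<in>saws n d m. if ?c w then ?g s w else 0)"
    unfolding sum.distrib Wm_def by (subst (2) sum.swap) simp
  also have "(\<Sum>s<m. \<Sum>w\<in>saws n d m. if ?c w then ?g s w else 0) =
    (\<Sum>s<m. (\<Sum>x<n. \<Sum>y<n. Wm n d p True s H i x * Ab n d p x y * Wm n d p False (m - 1 - s) H y j)
            - Gm n d p s (m - 1 - s) H i j)"
    by (intro sum.cong refl Wm_split_at) auto
  finally show ?thesis .
qed

section \<open>Second moments of bilinear forms and of the concatenation error\<close>

lemma sum_square_group:
  fixes F :: "'q \<Rightarrow> real"
  assumes "finite P" "finite I" "\<phi> ` P \<subseteq> I"
  shows "(\<Sum>x\<in>I. (\<Sum>q\<in>P. of_bool (\<phi> q = x) * F q)\<^sup>2) = (\<Sum>q\<in>P. \<Sum>q'\<in>P. of_bool (\<phi> q = \<phi> q') * (F q * F q'))"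
proof -
  have "(\<Sum>x\<in>I. (\<Sum>q\<in>P. of_bool (\<phi> q = x) * F q)\<^sup>2) =
     (\<Sum>x\<in>I. \<Sum>q\<in>P. \<Sum>q'\<in>P. (of_bool (\<phi> q = x) * F q) * (of_bool (\<phi> q' = x) * F q'))"
    by (simp add: power2_eq_square sum_product)
  also have "\<dots> = (\<Sum>q\<in>P. \<Sum>x\<in>I. \<Sum>q'\<in>P. (of_bool (\<phi> q = x) * F q) * (of_bool (\<phi> q' = x) * F q'))"
    by (rule sum.swap)
  also have "\<dots> = (\<Sum>q\<in>P. \<Sum>q'\<in>P. \<Sum>x\<in>I. (of_bool (\<phi> q = x) * F q) * (of_bool (\<phi> q' = x) * F q'))"
    by (intro sum.cong refl sum.swap)
  also have "\<dots> = (\<Sum>q\<in>P. \<Sum>q'\<in>P. of_bool (\<phi> q = \<phi> q') * (F q * F q'))"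
  proof (intro sum.cong refl)
    fix q q' assume q: "q \<in> P" "q' \<in> P"
    have "(\<Sum>x\<in>I. (of_bool (\<phi> q = x) * F q) * (of_bool (\<phi> q' = x) * F q')) =
       (\<Sum>x\<in>I. if x = \<phi> q then of_bool (\<phi> q = \<phi> q') * (F q * F q') else 0)"
      by (intro sum.cong) auto
    also have "\<dots> = of_bool (\<phi> q = \<phi> q') * (F q * F q')"
      using assms q by (subst sum.delta) auto
    finally show "(\<Sum>x\<in>I. (of_bool (\<phi> q = x) * F q) * (of_bool (\<phi> q' = x) * F q')) =
      of_bool (\<phi> q = \<phi> q') * (F q * F q')" .
  qed
  finally show ?thesis .
qed

lemma sum_pairs: "(\<Sum>q\<in>A \<times> B. h (fst q) (snd q)) = (\<Sum>a\<in>A. \<Sum>b\<in>B. h a b)"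
  by (simp add: sum.cartesian_product case_prod_unfold)

lemma count_list_distinct: "distinct xs \<Longrightarrow> count_list xs x \<le> 1"
  by (induction xs) (auto simp: count_list_0_iff)

text \<open>The first edge of the walk that meets \<open>V\<close> is entered from a vertex outside
  \<open>V\<close>. So it is not an old edge, and it meets \<open>V\<close> away from its
  root.\<close>

lemma newbad_hit:
  assumes "sa vs es" "hd vs \<notin> V" "verts vs es \<inter> V \<noteq> {}" "\<Union>E \<subseteq> V"
  shows "newbad V E vs es \<noteq> {}"
  using assms
proof (induction vs es rule: sa.induct)
  case (2 v u vs e es)
  show ?case
  proof (cases "e \<inter> V = {}")
    case True
    then have "hd (u # vs) \<notin> V" "verts (u # vs) es \<inter> V \<noteq> {}" using 2 by auto
    then have "newbad V E (u # vs) es \<noteq> {}" using 2 by auto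
    then show ?thesis by auto
  next
    case False
    have "e \<notin> E" "\<not> e \<inter> V \<subseteq> {v}" using 2 False by auto
    then show ?thesis by simp
  qed
qed auto

context hsbm_weights
begin

text \<open>No condition on end points ties the two walks of the square together, which would cost
  n^2. Centring does: the first edge of the second walk must also lie on the first walk, so the
  second walk starts there and only one factor n is paid. This needs a walk with at least one
  edge.\<close>

lemma HE_bilinear_le:
  assumes s: "s \<le> l" "0 < s" and T: "\<Theta> \<ge> 1"
    and fg: "\<And>i. i < n \<Longrightarrow> \<bar>f i\<bar> \<le> 1" "\<And>i. i < n \<Longrightarrow> \<bar>g i\<bar> \<le> 1"
  shows "HE n d p (\<lambda>H. (\<Sum>i<n. \<Sum>j<n. f i * Wm n d p True s H i j * g j)\<^sup>2) \<le> A ^ s * real n * wsum \<Theta> l 2"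
proof -
  let ?S = "saws n d s"
  let ?c = "\<lambda>w::walk. f (hd (fst w)) * g (last (fst w))"
  let ?v = "\<lambda>H w. wval p True H w"
  have b: "(\<Sum>i<n. \<Sum>j<n. f i * Wm n d p True s H i j * g j) = (\<Sum>w\<in>?S. ?c w * ?v H w)" for H
  proof -
    have "(\<Sum>i<n. \<Sum>j<n. f i * Wm n d p True s H i j * g j) =
      (\<Sum>i<n. \<Sum>j<n. \<Sum>w\<in>?S. f i * (if hd (fst w) = i \<and> last (fst w) = j then ?v H w else 0) * g j)"
      by (simp add: Wm_def sum_distrib_left sum_distrib_right)
    also have "\<dots> = (\<Sum>i<n. \<Sum>w\<in>?S. \<Sum>j<n. f i * (if hd (fst w) = i \<and> last (fst w) = j then ?v H w else 0) * g j)"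
      by (intro sum.cong refl sum.swap)
    also have "\<dots> = (\<Sum>w\<in>?S. \<Sum>i<n. \<Sum>j<n. f i * (if hd (fst w) = i \<and> last (fst w) = j then ?v H w else 0) * g j)"
      by (rule sum.swap)
    also have "\<dots> = (\<Sum>w\<in>?S. ?c w * ?v H w)"
    proof (rule sum.cong[OF refl])
      fix w assume w: "w \<in> ?S"
      have "(\<Sum>i<n. \<Sum>j<n. f i * (if hd (fst w) = i \<and> last (fst w) = j then ?v H w else 0) * g j) =
        (\<Sum>i<n. \<Sum>j<n. if j = last (fst w) then if i = hd (fst w) then ?c w * ?v H w else 0 else 0)"
        by (intro sum.cong refl) auto
      also have "\<dots> = ?c w * ?v H w" using saws_hd_last[OF w] by (simp add: sum.delta)
      finally show "(\<Sum>i<n. \<Sum>j<n. f i * (if hd (fst w) = i \<and> last (fst w) = j then ?v H w else 0) * g j) = ?c w * ?v H w" .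
    qed
    finally show ?thesis .
  qed
  have sq: "(\<Sum>i<n. \<Sum>j<n. f i * Wm n d p True s H i j * g j)\<^sup>2 =
     (\<Sum>w\<in>?S. \<Sum>w'\<in>?S. (?c w * ?c w') * (\<Prod>w\<leftarrow>[w, w']. ?v H w))" for H
    unfolding b power2_eq_square sum_product by (intro sum.cong refl) (simp add: mult_ac)
  have c1: "\<bar>?c w\<bar> \<le> 1" if "w \<in> ?S" for w
    using fg saws_hd_last[OF that] mult_mono[of "\<bar>f (hd (fst w))\<bar>" 1 "\<bar>g (last (fst w))\<bar>" 1] by (simp add: abs_mult)
  have "HE n d p (\<lambda>H. (\<Sum>i<n. \<Sum>j<n. f i * Wm n d p True s H i j * g j)\<^sup>2) =
     (\<Sum>w\<in>?S. \<Sum>w'\<in>?S. (?c w * ?c w') * HE n d p (\<lambda>H. \<Prod>w\<leftarrow>[w, w']. ?v H w))"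
    unfolding sq by (simp only: HE_sum HE_cmult)
  also have "\<dots> \<le> (\<Sum>w\<in>?S. \<Sum>w'\<in>?S. A ^ s * real n * tw \<Theta> {} {} [w, w'])"
  proof (intro sum_mono)
    fix w w' assume w: "w \<in> ?S" "w' \<in> ?S"
    let ?h = "HE n d p (\<lambda>H. \<Prod>w\<leftarrow>[w, w']. ?v H w)"
    have sub: "set [w, w'] \<subseteq> ?S" using w by simp
    have sub': "set [w, w'] \<subseteq> sawsl l" using sub saws_subset_sawsl[OF s(1)] by blast
    have "\<bar>?h\<bar> \<le> A ^ s * real n * tw \<Theta> {} {} [w, w']"
    proof (cases "?h = 0")
      case True
      then show ?thesis using A1 T tw_nonneg[OF sub'] by simp
    next
      case False
      note nz = HE_wval_nonzero[OF False sub']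
      have "hd (fst w') \<in> verts (fst w) (snd w)"
      proof -
        have s': "sa (fst w') (snd w')" "length (snd w') = s" using saws_hd_last[OF w(2)] by auto
        then obtain e es where es: "snd w' = e # es" using s(2) by (cases "snd w'") auto
        then obtain v vs where vs: "fst w' = v # vs" using s'(1) sa_not_Nil by (cases "fst w'") auto
        have ve: "v \<in> e" using sa_hd_in s'(1) vs es by metis
        have "e \<in> edges_of [w, w']" using es by simp
        then have "2 \<le> count_list (snd w) e + count_list (snd w') e" using nz(1)[of e] by simp
        moreover have "count_list (snd w') e \<le> 1" by (rule count_list_distinct[OF sa_distinct_es[OF s'(1)]])
        ultimately have "count_list (snd w) e \<noteq> 0" by linarith
        then have "e \<in> set (snd w)" by (simp add: count_list_0_iff)
        then show ?thesis using ve vs by (auto simp: verts_def)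
      qed
      then have c: "cst \<Theta> {} {} [w, w'] \<le> real n" by (intro cst_linked_Cons) (use T in auto)
      have f: "card (edges_of [w, w']) \<le> s"
        using nz(2) length_concat_saws[OF sub] by simp
      show ?thesis
        using HE_wval_le[of "map (Pair True) [w, w']" l \<Theta> s "real n"] sub' T c f by simp
    qed
    have "\<bar>?c w * ?c w'\<bar> \<le> 1"
      using c1[OF w(1)] c1[OF w(2)] mult_mono[of "\<bar>?c w\<bar>" 1 "\<bar>?c w'\<bar>" 1] by (simp add: abs_mult)
    have "(?c w * ?c w') * ?h \<le> \<bar>(?c w * ?c w') * ?h\<bar>" by (rule abs_ge_self)
    also have "\<dots> = \<bar>?c w * ?c w'\<bar> * \<bar>?h\<bar>" by (rule abs_mult)
    also have "\<dots> \<le> 1 * \<bar>?h\<bar>"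
      by (rule mult_right_mono[OF \<open>\<bar>?c w * ?c w'\<bar> \<le> 1\<close>]) simp
    finally have "(?c w * ?c w') * ?h \<le> \<bar>?h\<bar>" by simp
    with \<open>\<bar>?h\<bar> \<le> _\<close> show "(?c w * ?c w') * ?h \<le> A ^ s * real n * tw \<Theta> {} {} [w, w']" by linarith
  qed
  also have "\<dots> = A ^ s * real n * (\<Sum>ws\<in>walk_lists ?S 2. tw \<Theta> {} {} ws)"
    by (simp add: numeral_2_eq_2 sum_walk_lists_Suc sum_distrib_left)
  also have "\<dots> \<le> A ^ s * real n * wsum \<Theta> l 2"
  proof -
    have "walk_lists ?S 2 \<subseteq> walk_lists (sawsl l) 2"
      using saws_subset_sawsl[OF s(1)] by (auto simp: walk_lists_def)
    then have "(\<Sum>ws\<in>walk_lists ?S 2. tw \<Theta> {} {} ws) \<le> wsum \<Theta> l 2"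
      unfolding wsum_def using T
      by (intro sum_mono2[OF finite_walk_lists[OF finite_sawsl]]) (auto simp: walk_lists_def intro!: tw_nonneg[of _ l])
    then show ?thesis using A1 by (intro mult_left_mono) auto
  qed
  finally show ?thesis .
qed

lemma sawsl_props:
  assumes "w \<in> sawsl l"
  shows "sa (fst w) (snd w)" "length (snd w) \<le> l" "set (snd w) \<subseteq> dsets n d"
proof -
  obtain t where t: "w \<in> saws n d t" "t \<le> l" using assms by (auto simp: sawsl_def)
  show "sa (fst w) (snd w)" "length (snd w) \<le> l" "set (snd w) \<subseteq> dsets n d"
    using saws_hd_last(3-5)[OF t(1)] t(2) by simp_all
qed

lemma conf_nonneg: "0 \<le> conf n d p w1 w2"
  unfolding conf_def using p_nonneg by (auto intro!: sum_nonneg)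

lemma conf_le: "conf n d p w1 w2 \<le> K / real n"
proof (cases "last (fst w1) = hd (fst w2)")
  case True
  then show ?thesis using K0 by (simp add: conf_def)
next
  case False
  have "conf n d p w1 w2 \<le> (\<Sum>e\<in>{e \<in> dsets n d. last (fst w1) \<in> e \<and> hd (fst w2) \<in> e}. p e)"
    unfolding conf_def using False p_nonneg by (auto intro!: sum_mono2)
  also have "\<dots> \<le> K / real n" by (rule codeg[OF False])
  finally show ?thesis .
qed

text \<open>If the two walks are disjoint, an edge of \<^term>\<open>conf n d p w1 w2\<close> has to contain a third vertex of one of them.\<close>

lemma conf_le_disjoint:
  assumes w: "w1 \<in> sawsl l" "w2 \<in> sawsl l"
    and dis: "verts (fst w1) (snd w1) \<inter> verts (fst w2) (snd w2) = {}"
  shows "conf n d p w1 w2 \<le> 2 * (real d * real l + 1) * (K / (real n)\<^sup>2)"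
proof -
  let ?x = "last (fst w1)" and ?y = "hd (fst w2)"
  let ?V1 = "verts (fst w1) (snd w1)" and ?V2 = "verts (fst w2) (snd w2)"
  have s: "sa (fst w1) (snd w1)" "sa (fst w2) (snd w2)" "length (snd w1) \<le> l" "length (snd w2) \<le> l"
    "set (snd w1) \<subseteq> dsets n d" "set (snd w2) \<subseteq> dsets n d"
    using sawsl_props[OF w(1)] sawsl_props[OF w(2)] by blast+
  have xy: "?x \<in> ?V1" "?y \<in> ?V2" using s sa_last_in_verts sa_hd_in_verts by blast+
  then have neq: "?x \<noteq> ?y" using dis by auto
  let ?Z = "(?V1 \<union> ?V2) - {?x, ?y}"
  have fin: "finite ?V1" "finite ?V2"
  proof -
    have "finite e" if "e \<in> set (snd w1) \<union> set (snd w2)" for e using that s(5,6) dsets_finite[of e n d] by blast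
    then show "finite ?V1" "finite ?V2" by (auto simp: verts_def)
  qed
  have cd: "card ?Z \<le> 2 * (d * l + 1)"
  proof -
    have "card ?V1 \<le> d * length (snd w1) + 1" "card ?V2 \<le> d * length (snd w2) + 1"
      using sa_card_verts s by blast+
    moreover have "d * length (snd w1) \<le> d * l" "d * length (snd w2) \<le> d * l" using s by auto
    ultimately have "card ?V1 \<le> d * l + 1" "card ?V2 \<le> d * l + 1" by linarith+
    have "card ?Z \<le> card (?V1 \<union> ?V2)" using fin by (intro card_mono) auto
    also have "\<dots> \<le> card ?V1 + card ?V2" by (rule card_Un_le)
    also have "\<dots> \<le> (d * l + 1) + (d * l + 1)"
      by (rule add_mono[OF \<open>card ?V1 \<le> d * l + 1\<close> \<open>card ?V2 \<le> d * l + 1\<close>])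
    finally show ?thesis by simp
  qed
  have sub: "{e \<in> dsets n d. ?x \<in> e \<and> ?y \<in> e \<and> \<not> joined w1 e w2} \<subseteq> (\<Union>z\<in>?Z. {e \<in> dsets n d. ?x \<in> e \<and> ?y \<in> e \<and> z \<in> e})"
  proof
    fix e assume e: "e \<in> {e \<in> dsets n d. ?x \<in> e \<and> ?y \<in> e \<and> \<not> joined w1 e w2}"
    have "\<not> (e \<inter> ?V1 = {?x} \<and> e \<inter> ?V2 = {?y})"
      using sa_join[OF s(1,2) _ _ neq _ _ dis] e unfolding joined_def by blast
    then obtain z where "z \<in> e" "z \<in> ?V1 \<union> ?V2" "z \<noteq> ?x" "z \<noteq> ?y" using e xy dis by blast
    then show "e \<in> (\<Union>z\<in>?Z. {e \<in> dsets n d. ?x \<in> e \<and> ?y \<in> e \<and> z \<in> e})" using e by blast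
  qed
  have fd: "finite {e \<in> dsets n d. Q e}" for Q
    by (rule finite_subset[OF _ finite_dsets[of n d]]) auto
  have "conf n d p w1 w2 \<le> (\<Sum>e\<in>(\<Union>z\<in>?Z. {e \<in> dsets n d. ?x \<in> e \<and> ?y \<in> e \<and> z \<in> e}). p e)"
    unfolding conf_def using neq sub p_nonneg fin fd by (auto intro!: sum_mono2)
  also have "\<dots> \<le> (\<Sum>z\<in>?Z. \<Sum>e\<in>{e \<in> dsets n d. ?x \<in> e \<and> ?y \<in> e \<and> z \<in> e}. p e)"
    using fin fd p_nonneg by (intro sum_UN_le) auto
  also have "\<dots> \<le> (\<Sum>z\<in>?Z. K / (real n)\<^sup>2)"
    using neq by (intro sum_mono codeg3) auto
  also have "\<dots> = real (card ?Z) * (K / (real n)\<^sup>2)" by simp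
  also have "\<dots> \<le> real (2 * (d * l + 1)) * (K / (real n)\<^sup>2)"
    using K0 by (intro mult_right_mono of_nat_mono[OF cd]) simp
  finally show ?thesis by (simp add: algebra_simps)
qed

text \<open>If \<open>w1\<close> and \<open>w2\<close> are disjoint, \<open>conf\<close> is of order
  l / n^2 and the cost of \<open>w2\<close> is at most n. If they meet, \<open>conf\<close> is only
  of order 1/n, but then \<open>w2\<close> starts on the history at cost 1, or it enters the history
  through a bad edge and gains \<open>1 / \<Theta>\<close>.\<close>

lemma conf_cost_le:
  assumes w: "w1 \<in> sawsl l" "w1' \<in> sawsl l" "w2 \<in> sawsl l"
    and T: "\<Theta> \<ge> 1" "2 * (real d * real l + 1) * \<Theta> \<le> real n"
  defines "V \<equiv> verts (fst w1) (snd w1) \<union> verts (fst w1') (snd w1')"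
    and "E \<equiv> set (snd w1) \<union> set (snd w1')"
  shows "conf n d p w1 w2 * ((if hd (fst w2) \<in> V then 1 else real n) *
     (if newbad V E (fst w2) (snd w2) \<noteq> {} then 1 / \<Theta> else 1)) \<le> K / \<Theta>"
proof -
  let ?c = "(if hd (fst w2) \<in> V then 1 else real n) * (if newbad V E (fst w2) (snd w2) \<noteq> {} then 1 / \<Theta> else 1)"
  have "1 * \<Theta> \<le> 2 * (real d * real l + 1) * \<Theta>" using T by (intro mult_right_mono) auto
  then have Tn: "\<Theta> \<le> real n" using T by linarith
  have s2: "sa (fst w2) (snd w2)" using sawsl_props[OF w(3)] by blast
  have c0: "0 \<le> ?c" using T by auto
  show ?thesis
  proof (cases "verts (fst w1) (snd w1) \<inter> verts (fst w2) (snd w2) = {}")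
    case True
    have "?c \<le> real n"
    proof -
      have "?c \<le> real n * 1" using T n0 by (intro mult_mono) auto
      then show ?thesis by simp
    qed
    then have "conf n d p w1 w2 * ?c \<le> 2 * (real d * real l + 1) * (K / (real n)\<^sup>2) * real n"
    proof (rule mult_mono[OF conf_le_disjoint[OF w(1,3) True] _ _ c0])
      show "0 \<le> 2 * (real d * real l + 1) * (K / (real n)\<^sup>2)" using K0 by simp
    qed
    also have "\<dots> = 2 * (real d * real l + 1) * K / real n" by (simp add: power2_eq_square)
    also have "\<dots> \<le> K / \<Theta>"
      using T n0 K0 mult_left_mono[OF T(2) K0] by (simp add: divide_simps mult_ac)
    finally show ?thesis .
  next
    case False
    have "?c \<le> real n / \<Theta>"
    proof (cases "hd (fst w2) \<in> V")
      case True
      then have "?c \<le> 1" using T by auto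
      also have "1 \<le> real n / \<Theta>" using T Tn by simp
      finally show ?thesis .
    next
      case nV: False
      have "\<Union>E \<subseteq> V" unfolding E_def V_def verts_def by blast
      moreover have "verts (fst w2) (snd w2) \<inter> V \<noteq> {}" using False unfolding V_def by blast
      ultimately have "newbad V E (fst w2) (snd w2) \<noteq> {}" using newbad_hit[OF s2 nV] by blast
      then show ?thesis using nV by simp
    qed
    then have "conf n d p w1 w2 * ?c \<le> (K / real n) * (real n / \<Theta>)"
      using conf_le conf_nonneg K0 c0 by (intro mult_mono) auto
    also have "\<dots> = K / \<Theta>" using n0 by simp
    finally show ?thesis .
  qed
qed

text \<open>The four walks of the square are explored in the order \<open>w1\<close>,
  \<open>w1'\<close>, \<open>w2\<close>, reversed \<open>w2'\<close>. Equal row indices make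
  \<open>w1'\<close> start on \<open>w1\<close>, and equal column indices make the reversed
  \<open>w2'\<close> start on \<open>w2\<close>. So only \<open>w1\<close> and \<open>w2\<close> can
  cost n: the first cost is cancelled by one factor \<open>conf\<close> of order 1/n, and the second
  is turned into \<open>K / \<Theta>\<close> by \<open>conf_cost_le\<close>.\<close>

lemma HE_Gm_le:
  assumes st: "s \<le> l" "t \<le> l" and T: "\<Theta> \<ge> 1" "2 * (real d * real l + 1) * \<Theta> \<le> real n"
  shows "HE n d p (\<lambda>H. \<Sum>i<n. \<Sum>j<n. (Gm n d p s t H i j)\<^sup>2) \<le> A ^ (2 * (s + t)) * (K\<^sup>2 / \<Theta>) * wsum \<Theta> l 4"
proof -
  let ?S = "saws n d s" and ?T = "saws n d t" and ?Z = "sawsl l"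
  let ?\<phi> = "\<lambda>q :: walk \<times> walk. (hd (fst (fst q)), last (fst (snd q)))"
  let ?F = "\<lambda>H q. wval p True H (fst q) * wval p False H (snd q) * conf n d p (fst q) (snd q)"
  let ?r = "\<lambda>w :: walk. (rev (fst w), rev (snd w))"
  let ?L = "\<lambda>w1 w1' w2 w2'. [(True, w1), (True, w1'), (False, w2), (False, ?r w2')]"
  have G: "Gm n d p s t H i j = (\<Sum>q\<in>?S \<times> ?T. of_bool (?\<phi> q = (i, j)) * ?F H q)" for H i j
    unfolding Gm_def sum.cartesian_product by (intro sum.cong refl) auto
  have sq: "(\<Sum>i<n. \<Sum>j<n. (Gm n d p s t H i j)\<^sup>2) =
     (\<Sum>q\<in>?S \<times> ?T. \<Sum>q'\<in>?S \<times> ?T. of_bool (?\<phi> q = ?\<phi> q') * (?F H q * ?F H q'))" for H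
  proof -
    have "(\<Sum>i<n. \<Sum>j<n. (Gm n d p s t H i j)\<^sup>2) =
      (\<Sum>x\<in>{..<n} \<times> {..<n}. (\<Sum>q\<in>?S \<times> ?T. of_bool (?\<phi> q = x) * ?F H q)\<^sup>2)"
      unfolding G sum.cartesian_product by (intro sum.cong refl) auto
    also have "\<dots> = (\<Sum>q\<in>?S \<times> ?T. \<Sum>q'\<in>?S \<times> ?T. of_bool (?\<phi> q = ?\<phi> q') * (?F H q * ?F H q'))"
    proof (rule sum_square_group)
      show "?\<phi> ` (?S \<times> ?T) \<subseteq> {..<n} \<times> {..<n}" using saws_hd_last(1)[of _ n d s] saws_hd_last(2)[of _ n d t] by auto
    qed auto
    finally show ?thesis .
  qed
  let ?c = "\<lambda>q q'. of_bool (?\<phi> q = ?\<phi> q') * (conf n d p (fst q) (snd q) * conf n d p (fst q') (snd q'))"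
  let ?h = "\<lambda>q q'. HE n d p (\<lambda>H. \<Prod>(\<tau>, w)\<leftarrow>?L (fst q) (fst q') (snd q) (snd q'). wval p \<tau> H w)"
  let ?C = "A ^ (2 * (s + t)) * (K\<^sup>2 / \<Theta>)"
  have "HE n d p (\<lambda>H. \<Sum>i<n. \<Sum>j<n. (Gm n d p s t H i j)\<^sup>2) =
      HE n d p (\<lambda>H. \<Sum>q\<in>?S \<times> ?T. \<Sum>q'\<in>?S \<times> ?T. ?c q q' *
         (\<Prod>(\<tau>, w)\<leftarrow>?L (fst q) (fst q') (snd q) (snd q'). wval p \<tau> H w))"
    unfolding sq using wval_rev[of p False] by (intro HE_cong sum.cong refl) (simp add: mult_ac)
  also have "\<dots> = (\<Sum>q\<in>?S \<times> ?T. \<Sum>q'\<in>?S \<times> ?T. ?c q q' * ?h q q')"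
    by (simp only: HE_sum HE_cmult)
  also have "\<dots> \<le> (\<Sum>q\<in>?S \<times> ?T. \<Sum>q'\<in>?S \<times> ?T. ?C * tw \<Theta> {} {} [fst q, fst q', snd q, ?r (snd q')])"
  proof (intro sum_mono)
    fix q q' assume q: "q \<in> ?S \<times> ?T" "q' \<in> ?S \<times> ?T"
    obtain w1 w2 where qe: "q = (w1, w2)" by (cases q)
    obtain w1' w2' where qe': "q' = (w1', w2')" by (cases q')
    have w: "w1 \<in> ?S" "w2 \<in> ?T" "w1' \<in> ?S" "w2' \<in> ?T" "?r w2' \<in> ?T"
      using q qe qe' saws_rev[of "fst w2'" "snd w2'"] by auto
    have wl: "w1 \<in> ?Z" "w2 \<in> ?Z" "w1' \<in> ?Z" "?r w2' \<in> ?Z"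
      using w saws_subset_sawsl st by blast+
    let ?ws = "[w1, w1', w2, ?r w2']"
    have sub: "set (map snd (?L w1 w1' w2 w2')) \<subseteq> ?Z" using wl by simp
    have t0: "0 \<le> tw \<Theta> {} {} ?ws" using tw_nonneg[of ?ws l \<Theta>] sub T by simp
    show "?c q q' * ?h q q' \<le> ?C * tw \<Theta> {} {} [fst q, fst q', snd q, ?r (snd q')]"
    proof (cases "?\<phi> q = ?\<phi> q'")
      case False
      then have "?c q q' = 0" by simp
      moreover have "0 \<le> ?C * tw \<Theta> {} {} ?ws" using t0 A1 T by simp
      ultimately show ?thesis using qe qe' by (simp only: mult_zero_left fst_conv snd_conv)
    next
      case True
      have ends: "hd (fst w1) = hd (fst w1')" "last (fst w2) = last (fst w2')" using True qe qe' by auto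
      let ?V = "verts (fst w1) (snd w1) \<union> verts (fst w1') (snd w1')"
      let ?E = "set (snd w1) \<union> set (snd w1')"
      let ?c2 = "(if hd (fst w2) \<in> ?V then 1 else real n) * (if newbad ?V ?E (fst w2) (snd w2) \<noteq> {} then 1 / \<Theta> else 1)"
      have c20: "0 \<le> ?c2" using T by auto
      have h1: "hd (fst w1') \<in> verts (fst w1) (snd w1)"
        using sa_hd_in_verts saws_hd_last(3)[OF w(1)] ends by metis
      have ne2: "fst w2' \<noteq> []" using saws_hd_last(3)[OF w(4)] sa_not_Nil by blast
      have h2: "hd (rev (fst w2')) \<in> verts (fst w2) (snd w2)"
        using sa_last_in_verts[OF saws_hd_last(3)[OF w(2)]] ends ne2 by (simp add: hd_rev)
      have cst: "cst \<Theta> {} {} (map snd (?L w1 w1' w2 w2')) \<le> real n * ?c2"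
      proof -
        let ?b1 = "if newbad (verts (fst w1) (snd w1)) (set (snd w1)) (fst w1') (snd w1') \<noteq> {} then 1 / \<Theta> else 1"
        let ?b2 = "if newbad (?V \<union> verts (fst w2) (snd w2)) (?E \<union> set (snd w2)) (rev (fst w2')) (rev (snd w2')) \<noteq> {} then 1 / \<Theta> else 1"
        have nb: "newbad {} {} vs es = {}" for vs es by (auto simp: newbad_def)
        have W: "cst \<Theta> V E (w # ws) = (if hd (fst w) \<in> V then 1 else real n) *
            (if newbad V E (fst w) (snd w) \<noteq> {} then 1 / \<Theta> else 1) *
            cst \<Theta> (V \<union> verts (fst w) (snd w)) (E \<union> set (snd w)) ws" for V E w ws
          by (cases w) simp
        have "cst \<Theta> {} {} (map snd (?L w1 w1' w2 w2')) = real n * (?b1 * (?c2 * ?b2))"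
          using h1 h2 by (simp add: W nb del: cst.simps(2))
        also have "\<dots> \<le> real n * (1 * (?c2 * 1))"
          using T c20 by (intro mult_left_mono mult_mono) auto
        finally show ?thesis by simp
      qed
      have f: "card (edges_of (map snd (?L w1 w1' w2 w2'))) \<le> 2 * (s + t)"
        using card_edges_of_le[of "map snd (?L w1 w1' w2 w2')"] saws_hd_last(5)[OF w(1)] saws_hd_last(5)[OF w(2)]
          saws_hd_last(5)[OF w(3)] saws_hd_last(5)[OF w(4)] by simp
      have H: "\<bar>?h q q'\<bar> \<le> A ^ (2 * (s + t)) * (real n * ?c2) * tw \<Theta> {} {} ?ws"
        using HE_wval_le[OF sub T(1) f cst] qe qe' by simp
      have "?c q q' * ?h q q' \<le> ?c q q' * \<bar>?h q q'\<bar>"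
        using conf_nonneg by (intro mult_left_mono) auto
      also have "\<dots> \<le> conf n d p w1 w2 * conf n d p w1' w2' * (A ^ (2 * (s + t)) * (real n * ?c2) * tw \<Theta> {} {} ?ws)"
      proof -
        have "?c q q' = conf n d p w1 w2 * conf n d p w1' w2'" using ends qe qe' by simp
        moreover have "0 \<le> conf n d p w1 w2 * conf n d p w1' w2'" using conf_nonneg by simp
        ultimately show ?thesis using mult_left_mono[OF H] by (simp only:)
      qed
      also have "\<dots> = (conf n d p w1 w2 * ?c2) * (conf n d p w1' w2' * real n) * (A ^ (2 * (s + t)) * tw \<Theta> {} {} ?ws)"
        by (simp only: mult_ac)
      also have "\<dots> \<le> (K / \<Theta>) * (K / real n * real n) * (A ^ (2 * (s + t)) * tw \<Theta> {} {} ?ws)"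
        using conf_cost_le[OF wl(1,3,2) T] conf_le conf_nonneg c20 t0 A1 K0 T
        by (intro mult_right_mono mult_mono mult_nonneg_nonneg) auto
      also have "\<dots> = ?C * tw \<Theta> {} {} ?ws" using n0 by (simp add: power2_eq_square)
      finally show ?thesis using qe qe' by simp
    qed
  qed
  also have "\<dots> = ?C * (\<Sum>w1\<in>?S. \<Sum>w2\<in>?T. \<Sum>w1'\<in>?S. \<Sum>w2'\<in>?T. tw \<Theta> {} {} [w1, w1', w2, ?r w2'])"
  proof -
    have "(\<Sum>q\<in>?S \<times> ?T. \<Sum>q'\<in>?S \<times> ?T. ?C * tw \<Theta> {} {} [fst q, fst q', snd q, ?r (snd q')]) =
       (\<Sum>w1\<in>?S. \<Sum>w2\<in>?T. \<Sum>q'\<in>?S \<times> ?T. ?C * tw \<Theta> {} {} [w1, fst q', w2, ?r (snd q')])"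
      by (rule sum_pairs[where h = "\<lambda>w1 w2. \<Sum>q'\<in>?S \<times> ?T. ?C * tw \<Theta> {} {} [w1, fst q', w2, ?r (snd q')]"])
    also have "\<dots> = (\<Sum>w1\<in>?S. \<Sum>w2\<in>?T. \<Sum>w1'\<in>?S. \<Sum>w2'\<in>?T. ?C * tw \<Theta> {} {} [w1, w1', w2, ?r w2'])"
    proof (intro sum.cong refl)
      fix w1 w2
      show "(\<Sum>q'\<in>?S \<times> ?T. ?C * tw \<Theta> {} {} [w1, fst q', w2, ?r (snd q')]) =
         (\<Sum>w1'\<in>?S. \<Sum>w2'\<in>?T. ?C * tw \<Theta> {} {} [w1, w1', w2, ?r w2'])"
        by (rule sum_pairs[where h = "\<lambda>a b. ?C * tw \<Theta> {} {} [w1, a, w2, ?r b]"])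
    qed
    finally show ?thesis by (simp only: sum_distrib_left)
  qed
  also have "(\<Sum>w1\<in>?S. \<Sum>w2\<in>?T. \<Sum>w1'\<in>?S. \<Sum>w2'\<in>?T. tw \<Theta> {} {} [w1, w1', w2, ?r w2']) =
     (\<Sum>w1\<in>?S. \<Sum>w2\<in>?T. \<Sum>w1'\<in>?S. \<Sum>v\<in>?T. tw \<Theta> {} {} [w1, w1', w2, v])"
  proof (rule sum.cong[OF refl], rule sum.cong[OF refl], rule sum.cong[OF refl])
    fix w1 w2 w1'
    show "(\<Sum>w2'\<in>?T. tw \<Theta> {} {} [w1, w1', w2, ?r w2']) = (\<Sum>v\<in>?T. tw \<Theta> {} {} [w1, w1', w2, v])"
      by (rule sum_saws_rev[where f = "\<lambda>v. tw \<Theta> {} {} [w1, w1', w2, v]"])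
  qed
  also have "\<dots> = (\<Sum>w1\<in>?S. \<Sum>w1'\<in>?S. \<Sum>w2\<in>?T. \<Sum>v\<in>?T. tw \<Theta> {} {} [w1, w1', w2, v])"
    by (intro sum.cong refl sum.swap)
  finally have step: "HE n d p (\<lambda>H. \<Sum>i<n. \<Sum>j<n. (Gm n d p s t H i j)\<^sup>2) \<le>
      ?C * (\<Sum>w1\<in>?S. \<Sum>w1'\<in>?S. \<Sum>w2\<in>?T. \<Sum>v\<in>?T. tw \<Theta> {} {} [w1, w1', w2, v])" .
  have "(\<Sum>w1\<in>?S. \<Sum>w1'\<in>?S. \<Sum>w2\<in>?T. \<Sum>v\<in>?T. tw \<Theta> {} {} [w1, w1', w2, v]) \<le> wsum \<Theta> l 4"
  proof -
    have SZ: "?S \<subseteq> ?Z" "?T \<subseteq> ?Z" using saws_subset_sawsl st by blast+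
    have pos: "0 \<le> tw \<Theta> {} {} [w1, w2, w3, w4]" if "w1 \<in> ?Z" "w2 \<in> ?Z" "w3 \<in> ?Z" "w4 \<in> ?Z" for w1 w2 w3 w4
      using that T by (intro tw_nonneg[of _ l]) auto
    have "(\<Sum>w1\<in>?S. \<Sum>w1'\<in>?S. \<Sum>w2\<in>?T. \<Sum>v\<in>?T. tw \<Theta> {} {} [w1, w1', w2, v]) \<le>
       (\<Sum>w1\<in>?S. \<Sum>w1'\<in>?S. \<Sum>w2\<in>?T. \<Sum>v\<in>?Z. tw \<Theta> {} {} [w1, w1', w2, v])"
      using SZ by (intro sum_mono sum_mono2 pos) auto
    also have "\<dots> \<le> (\<Sum>w1\<in>?S. \<Sum>w1'\<in>?S. \<Sum>w2\<in>?Z. \<Sum>v\<in>?Z. tw \<Theta> {} {} [w1, w1', w2, v])"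
      using SZ by (intro sum_mono sum_mono2 sum_nonneg pos) auto
    also have "\<dots> \<le> (\<Sum>w1\<in>?S. \<Sum>w1'\<in>?Z. \<Sum>w2\<in>?Z. \<Sum>v\<in>?Z. tw \<Theta> {} {} [w1, w1', w2, v])"
      using SZ by (intro sum_mono sum_mono2 sum_nonneg pos) auto
    also have "\<dots> \<le> (\<Sum>w1\<in>?Z. \<Sum>w1'\<in>?Z. \<Sum>w2\<in>?Z. \<Sum>v\<in>?Z. tw \<Theta> {} {} [w1, w1', w2, v])"
      using SZ by (intro sum_mono sum_mono2 sum_nonneg pos) auto
    also have "\<dots> = wsum \<Theta> l 4"
      by (simp add: wsum_def numeral_eq_Suc sum_walk_lists_Suc del: tw.simps)
    finally show ?thesis .
  qed
  then have "?C * (\<Sum>w1\<in>?S. \<Sum>w1'\<in>?S. \<Sum>w2\<in>?T. \<Sum>v\<in>?T. tw \<Theta> {} {} [w1, w1', w2, v]) \<le> ?C * wsum \<Theta> l 4"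
    using A1 T by (intro mult_left_mono) auto
  then show ?thesis by (rule order_trans[OF step])
qed

end

section \<open>From operator bounds to the orthogonal complement\<close>

lemma linear_recurrence_le:
  fixes a :: "nat \<Rightarrow> real"
  assumes "\<And>m. m < l \<Longrightarrow> \<bar>a (Suc m) - \<theta> * a m\<bar> \<le> \<epsilon>" "\<bar>a 0 - c\<bar> \<le> \<epsilon>" "1 \<le> \<theta>" "\<theta> \<le> \<alpha>" "m \<le> l"
  shows "\<bar>a m - c * \<theta> ^ m\<bar> \<le> (real m + 1) * \<alpha> ^ m * \<epsilon>"
  using assms(5)
proof (induction m)
  case (Suc m)
  have e0: "0 \<le> \<epsilon>" using assms(2) by linarith
  have IH: "\<bar>a m - c * \<theta> ^ m\<bar> \<le> (real m + 1) * \<alpha> ^ m * \<epsilon>" using Suc by simp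
  have "\<bar>a (Suc m) - c * \<theta> ^ Suc m\<bar> = \<bar>(a (Suc m) - \<theta> * a m) + \<theta> * (a m - c * \<theta> ^ m)\<bar>"
    by (simp add: algebra_simps)
  also have "\<dots> \<le> \<epsilon> + \<theta> * \<bar>a m - c * \<theta> ^ m\<bar>"
    using assms(1)[of m] Suc.prems assms(3) abs_triangle_ineq[of "a (Suc m) - \<theta> * a m" "\<theta> * (a m - c * \<theta> ^ m)"]
    by (simp add: abs_mult)
  also have "\<dots> \<le> 1 * \<epsilon> + \<alpha> * ((real m + 1) * \<alpha> ^ m * \<epsilon>)"
    using IH assms(3,4) e0 by (intro add_mono mult_mono) auto
  also have "\<dots> \<le> \<alpha> ^ Suc m * \<epsilon> + \<alpha> * ((real m + 1) * \<alpha> ^ m * \<epsilon>)"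
    using assms(3,4) e0 by (intro add_mono mult_right_mono one_le_power) auto
  also have "\<dots> = (real (Suc m) + 1) * \<alpha> ^ Suc m * \<epsilon>" by (simp add: algebra_simps)
  finally show ?case .
qed (use assms in auto)

text \<open>\<open>dB\<close> and \<open>dD\<close> stand for the bilinear forms of B and \<Delta>,
  \<open>N\<close> for the Euclidean norm, \<open>u\<close> and \<open>t\<close> for the all-ones
  vector and \<sigma> divided by the square root of n, and \<open>r\<close> for the square root of
  \<alpha>. What follows is scalar arithmetic with these inequalities; \<rho> is an error level that
  survives amplification by \<open>\<alpha> ^ l\<close>.\<close>

locale spectral_forms =
  fixes dB dD :: "nat \<Rightarrow> 'v \<Rightarrow> 'v \<Rightarrow> real" and N :: "'v \<Rightarrow> real" and u t :: 'v
    and \<alpha> \<beta> r \<eta> \<delta> \<epsilon> \<rho> :: real and l :: nat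
  assumes dec: "\<And>m f z. m \<le> l \<Longrightarrow> \<bar>dB m f z - dD m f z - (\<Sum>s<m. \<alpha> * dB (m - 1 - s) u z * dD s f u
        + \<beta> * dB (m - 1 - s) t z * dD s f t)\<bar> \<le> \<epsilon> * N f * N z"
    and dD_le: "\<And>s f z. s \<le> l \<Longrightarrow> \<bar>dD s f z\<bar> \<le> \<eta> * r ^ s * N f * N z"
    and dB_le: "\<And>m f z. m \<le> l \<Longrightarrow> \<bar>dB m f z\<bar> \<le> \<eta> * \<alpha> ^ m * N f * N z"
    and dB_sym: "\<And>m f z. m \<le> l \<Longrightarrow> dB m f z = dB m z f"
    and N: "\<And>f. 0 \<le> N f" "N u = 1" "N t = 1"
    and small: "\<And>s f z. 1 \<le> s \<Longrightarrow> s \<le> l \<Longrightarrow> f \<in> {u, t} \<Longrightarrow> z \<in> {u, t} \<Longrightarrow> \<bar>dD s f z\<bar> \<le> \<delta>"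
    and zero: "dD 0 u u = 1" "dD 0 t t = 1" "\<bar>dD 0 u t\<bar> \<le> \<delta>" "\<bar>dD 0 t u\<bar> \<le> \<delta>"
    and par: "1 \<le> r" "r ^ 2 = \<alpha>" "r \<le> \<beta>" "\<beta> \<le> \<alpha>" "1 \<le> \<eta>"
    and eps: "0 \<le> \<epsilon>" "(2 * \<alpha> + 1) * (real l + 1) * \<eta> * \<alpha> ^ l * \<delta> \<le> \<epsilon>" "\<alpha> ^ l * \<epsilon> \<le> \<rho>"
begin

lemma par': "1 \<le> \<alpha>" "1 \<le> \<beta>" "r \<le> \<alpha>" "0 \<le> \<delta>"
  using par zero by auto

lemma delta_le: "\<delta> + 2 * \<alpha> * (real l * (\<eta> * \<alpha> ^ l * \<delta>)) \<le> \<epsilon>"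
proof -
  have "1 * 1 \<le> \<eta> * \<alpha> ^ l" using par par' by (intro mult_mono one_le_power) auto
  then have "1 * \<delta> \<le> \<eta> * \<alpha> ^ l * \<delta>" using par' by (intro mult_right_mono) auto
  then have "\<delta> + 2 * \<alpha> * (real l * (\<eta> * \<alpha> ^ l * \<delta>)) \<le> (1 + 2 * \<alpha> * real l) * (\<eta> * \<alpha> ^ l * \<delta>)"
    by (simp add: algebra_simps)
  also have "\<dots> \<le> ((2 * \<alpha> + 1) * (real l + 1)) * (\<eta> * \<alpha> ^ l * \<delta>)"
    using par par' by (intro mult_right_mono) (auto simp: algebra_simps)
  also have "\<dots> \<le> \<epsilon>" using eps by (simp add: mult_ac)
  finally show ?thesis .
qed

text \<open>In the expansion, the term with \<open>s = 0\<close> reproduces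
  \<open>\<theta> * dB m f z\<close>, because \<open>dD 0\<close> is the scalar product and
  \<open>u\<close>, \<open>t\<close> are almost orthonormal. Every other term contains some
  \<open>dD s\<close> between \<open>u\<close> and \<open>t\<close>, which is small.\<close>

lemma step:
  assumes z: "z \<in> {u, t}" and f: "f = u \<and> \<theta> = \<alpha> \<or> f = t \<and> \<theta> = \<beta>" and m: "m < l"
  shows "\<bar>dB (Suc m) f z - \<theta> * dB m f z\<bar> \<le> 2 * \<epsilon>"
proof -
  let ?g = "\<lambda>s. \<alpha> * dB (m - s) u z * dD s f u + \<beta> * dB (m - s) t z * dD s f t"
  have fz: "f \<in> {u, t}" "N f = 1" "N z = 1" using f z N by auto
  have B: "\<bar>dB k f' z\<bar> \<le> \<eta> * \<alpha> ^ l" if "k \<le> l" "f' \<in> {u, t}" for k f'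
  proof -
    have "\<bar>dB k f' z\<bar> \<le> \<eta> * \<alpha> ^ k" using dB_le[OF that(1), of f' z] that(2) fz N by auto
    also have "\<dots> \<le> \<eta> * \<alpha> ^ l" using par par' that by (intro mult_left_mono power_increasing) auto
    finally show ?thesis .
  qed
  have T: "\<bar>\<gamma> * dB (m - s) f' z * q\<bar> \<le> \<alpha> * (\<eta> * \<alpha> ^ l * \<delta>)"
    if "\<bar>q\<bar> \<le> \<delta>" "\<gamma> \<in> {\<alpha>, \<beta>}" "f' \<in> {u, t}" for \<gamma> f' q s
  proof -
    have "\<bar>\<gamma>\<bar> * (\<bar>dB (m - s) f' z\<bar> * \<bar>q\<bar>) \<le> \<alpha> * (\<eta> * \<alpha> ^ l * \<delta>)"
      using that B[of "m - s" f'] m par par' by (intro mult_mono) auto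
    then show ?thesis by (simp add: abs_mult mult.assoc)
  qed
  have g: "\<bar>?g (Suc s)\<bar> \<le> 2 * \<alpha> * (\<eta> * \<alpha> ^ l * \<delta>)" if "s < m" for s
  proof -
    have "\<bar>dD (Suc s) f u\<bar> \<le> \<delta>" "\<bar>dD (Suc s) f t\<bar> \<le> \<delta>" using small[of "Suc s" f] that m fz by auto
    then have "\<bar>\<alpha> * dB (m - Suc s) u z * dD (Suc s) f u\<bar> \<le> \<alpha> * (\<eta> * \<alpha> ^ l * \<delta>)"
      "\<bar>\<beta> * dB (m - Suc s) t z * dD (Suc s) f t\<bar> \<le> \<alpha> * (\<eta> * \<alpha> ^ l * \<delta>)"
      by (auto intro!: T)
    then show ?thesis by linarith
  qed
  have "\<bar>\<Sum>s<m. ?g (Suc s)\<bar> \<le> (\<Sum>s<m. 2 * \<alpha> * (\<eta> * \<alpha> ^ l * \<delta>))"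
    using g by (intro order_trans[OF sum_abs] sum_mono) auto
  then have S: "\<bar>\<Sum>s<m. ?g (Suc s)\<bar> \<le> real m * (2 * \<alpha> * (\<eta> * \<alpha> ^ l * \<delta>))" by simp
  have g0: "\<bar>?g 0 - \<theta> * dB m f z\<bar> \<le> 2 * \<alpha> * (\<eta> * \<alpha> ^ l * \<delta>)"
  proof -
    have nn: "0 \<le> \<alpha> * (\<eta> * \<alpha> ^ l * \<delta>)" using par par' by auto
    show ?thesis
    proof (cases "f = u \<and> \<theta> = \<alpha>")
      case True
      have "\<bar>\<beta> * dB (m - 0) t z * dD 0 u t\<bar> \<le> \<alpha> * (\<eta> * \<alpha> ^ l * \<delta>)" by (rule T) (use zero in auto)
      then show ?thesis using True zero(1) nn by simp
    next
      case False
      then have ft: "f = t" "\<theta> = \<beta>" using f by auto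
      have "\<bar>\<alpha> * dB (m - 0) u z * dD 0 t u\<bar> \<le> \<alpha> * (\<eta> * \<alpha> ^ l * \<delta>)" by (rule T) (use zero in auto)
      then show ?thesis using ft zero(2) nn by simp
    qed
  qed
  have "\<bar>dB (Suc m) f z - dD (Suc m) f z - (\<Sum>s<Suc m. ?g s)\<bar> \<le> \<epsilon>"
    using dec[of "Suc m" f z] m fz by simp
  then have d: "\<bar>dB (Suc m) f z - dD (Suc m) f z - (?g 0 + (\<Sum>s<m. ?g (Suc s)))\<bar> \<le> \<epsilon>"
    unfolding sum.lessThan_Suc_shift by simp
  have "\<bar>dD (Suc m) f z\<bar> \<le> \<delta>" using small[of "Suc m" f z] m fz z by simp
  then have "\<bar>dB (Suc m) f z - \<theta> * dB m f z\<bar> \<le> \<epsilon> + \<delta> + 2 * \<alpha> * (\<eta> * \<alpha> ^ l * \<delta>) + real m * (2 * \<alpha> * (\<eta> * \<alpha> ^ l * \<delta>))"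
    using d S g0 by linarith
  also have "\<dots> = \<epsilon> + (\<delta> + 2 * \<alpha> * ((real m + 1) * (\<eta> * \<alpha> ^ l * \<delta>)))" by (simp add: algebra_simps)
  also have "\<dots> \<le> \<epsilon> + (\<delta> + 2 * \<alpha> * (real l * (\<eta> * \<alpha> ^ l * \<delta>)))"
    using m par par' by (intro add_left_mono mult_left_mono mult_right_mono) auto
  also have "\<dots> \<le> \<epsilon> + \<epsilon>" using delta_le by simp
  finally show ?thesis by simp
qed

text \<open>\<open>c1\<close> and \<open>c2\<close> are the ideal values of the scalar products of
  \<open>z\<close> with \<open>u\<close> and \<open>t\<close>, so that both choices of
  \<open>z\<close> share one statement. Between \<open>u\<close> and \<open>t\<close> the matrix B
  thus acts almost diagonally.\<close>

lemma scalar_bounds: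
  assumes z: "z = u \<and> c1 = 1 \<and> c2 = 0 \<or> z = t \<and> c1 = 0 \<and> c2 = 1" and m: "m \<le> l"
  shows "\<bar>dB m u z - c1 * \<alpha> ^ m\<bar> \<le> (real m + 1) * \<alpha> ^ m * (2 * \<epsilon>)"
    and "\<bar>dB m t z - c2 * \<beta> ^ m\<bar> \<le> (real m + 1) * \<alpha> ^ m * (2 * \<epsilon>)"
proof -
  have "0 \<le> \<alpha> * (real l * (\<eta> * \<alpha> ^ l * \<delta>))" using par par' by auto
  then have d: "\<delta> \<le> \<epsilon>" using delta_le by linarith
  have zz: "z \<in> {u, t}" "N z = 1" using z N by auto
  have 0: "\<bar>dB 0 f z - dD 0 f z\<bar> \<le> \<epsilon>" if "f \<in> {u, t}" for f
    using dec[of 0 f z] that N zz by auto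
  show "\<bar>dB m u z - c1 * \<alpha> ^ m\<bar> \<le> (real m + 1) * \<alpha> ^ m * (2 * \<epsilon>)"
  proof (rule linear_recurrence_le[OF _ _ _ _ m])
    show "\<bar>dB 0 u z - c1\<bar> \<le> 2 * \<epsilon>" using 0[of u] zero z d eps by auto
  qed (use par' step[OF zz(1)] in auto)
  show "\<bar>dB m t z - c2 * \<beta> ^ m\<bar> \<le> (real m + 1) * \<alpha> ^ m * (2 * \<epsilon>)"
  proof (rule linear_recurrence_le[OF _ _ _ _ m])
    show "\<bar>dB 0 t z - c2\<bar> \<le> 2 * \<epsilon>" using 0[of t] zero z d eps by auto
  qed (use par par' step[OF zz(1)] in auto)
qed

text \<open>By \<open>scalar_bounds\<close> only the direction \<open>z\<close> survives in the sum,
  and \<open>\<theta> * dB (m - 1 - s) z z\<close> becomes \<open>\<theta> ^ (m - s)\<close>. The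
  replacement error is multiplied by at most \<open>\<alpha> ^ l\<close> up to polynomial factors in
  \<open>l\<close>, which \<rho> accounts for.\<close>

lemma expansion:
  assumes z: "z = u \<and> \<theta> = \<alpha> \<or> z = t \<and> \<theta> = \<beta>" and m: "m \<le> l" and x: "N x \<le> 1"
  shows "\<bar>dB m x z - (\<Sum>s\<le>m. \<theta> ^ (m - s) * dD s x z)\<bar> \<le> 5 * (real l + 1) ^ 2 * \<eta> * \<rho>"
proof -
  obtain c1 c2 :: real where c: "z = u \<and> \<theta> = \<alpha> \<and> c1 = 1 \<and> c2 = 0 \<or> z = t \<and> \<theta> = \<beta> \<and> c1 = 0 \<and> c2 = 1"
    using z by (metis)
  let ?y = "\<lambda>k. dB k u z - c1 * \<alpha> ^ k" and ?w = "\<lambda>k. dB k t z - c2 * \<beta> ^ k"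
  let ?g = "\<lambda>s. \<alpha> * dB (m - 1 - s) u z * dD s x u + \<beta> * dB (m - 1 - s) t z * dD s x t"
  let ?h = "\<lambda>s. \<alpha> * ?y (m - 1 - s) * dD s x u + \<beta> * ?w (m - 1 - s) * dD s x t"
  have zz: "N z = 1" using z N by auto
  have gh: "?g s = ?h s + \<theta> ^ (m - s) * dD s x z" if s: "s < m" for s
  proof -
    have ms: "m - s = Suc (m - 1 - s)" using s by simp
    show ?thesis using c unfolding ms by (auto simp: algebra_simps)
  qed
  have hle: "\<bar>?h s\<bar> \<le> 4 * (real l + 1) * \<eta> * (\<alpha> ^ l * \<epsilon>)" if s: "s < m" for s
  proof -
    have D: "\<bar>dD s x f\<bar> \<le> \<eta> * \<alpha> ^ s" if "N f = 1" for f
    proof -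
      have "\<bar>dD s x f\<bar> \<le> \<eta> * r ^ s * N x * N f" using dD_le s m by auto
      also have "\<dots> \<le> \<eta> * r ^ s * 1 * 1" using x that par N by (intro mult_mono mult_nonneg_nonneg) auto
      also have "\<dots> \<le> \<eta> * \<alpha> ^ s" using par par' by (auto intro!: power_mono)
      finally show ?thesis .
    qed
    have c': "z = u \<and> c1 = 1 \<and> c2 = 0 \<or> z = t \<and> c1 = 0 \<and> c2 = 1" using c by auto
    have k: "m - 1 - s \<le> l" using m by simp
    have T: "\<bar>\<gamma> * q * dD s x f\<bar> \<le> 2 * (real l + 1) * \<eta> * (\<alpha> ^ l * \<epsilon>)"
      if q: "\<bar>q\<bar> \<le> (real (m - 1 - s) + 1) * \<alpha> ^ (m - 1 - s) * (2 * \<epsilon>)" and g: "\<gamma> \<in> {\<alpha>, \<beta>}" and f: "N f = 1" for \<gamma> q f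
    proof -
      have "\<bar>\<gamma> * q * dD s x f\<bar> = \<bar>\<gamma>\<bar> * (\<bar>q\<bar> * \<bar>dD s x f\<bar>)" by (simp add: abs_mult)
      also have "\<dots> \<le> \<alpha> * (((real (m - 1 - s) + 1) * \<alpha> ^ (m - 1 - s) * (2 * \<epsilon>)) * (\<eta> * \<alpha> ^ s))"
        using q g D[OF f] par par' eps by (intro mult_mono) auto
      also have "\<dots> = (real (m - 1 - s) + 1) * (2 * \<epsilon>) * \<eta> * \<alpha> ^ (Suc ((m - 1 - s) + s))"
        by (simp add: power_add mult_ac)
      also have "\<dots> \<le> (real l + 1) * (2 * \<epsilon>) * \<eta> * \<alpha> ^ l"
        using k s m par par' eps by (intro mult_mono power_increasing) auto
      finally show ?thesis by (simp add: mult_ac)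
    qed
    have "\<bar>\<alpha> * ?y (m - 1 - s) * dD s x u\<bar> \<le> 2 * (real l + 1) * \<eta> * (\<alpha> ^ l * \<epsilon>)"
      by (rule T[OF scalar_bounds(1)[OF c' k]]) (use N in auto)
    moreover have "\<bar>\<beta> * ?w (m - 1 - s) * dD s x t\<bar> \<le> 2 * (real l + 1) * \<eta> * (\<alpha> ^ l * \<epsilon>)"
      by (rule T[OF scalar_bounds(2)[OF c' k]]) (use N in auto)
    ultimately show ?thesis by linarith
  qed
  have "(\<Sum>s\<le>m. \<theta> ^ (m - s) * dD s x z) = dD m x z + (\<Sum>s<m. \<theta> ^ (m - s) * dD s x z)"
    by (simp add: lessThan_Suc_atMost[symmetric])
  moreover have "(\<Sum>s<m. ?g s) = (\<Sum>s<m. ?h s) + (\<Sum>s<m. \<theta> ^ (m - s) * dD s x z)"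
    unfolding sum.distrib[symmetric] by (intro sum.cong refl gh) auto
  moreover have "\<bar>dB m x z - dD m x z - (\<Sum>s<m. ?g s)\<bar> \<le> \<epsilon>"
  proof -
    have "\<epsilon> * N x * N z \<le> \<epsilon> * 1 * 1" using x zz eps N by (intro mult_mono) auto
    then show ?thesis using dec[OF m, of x z] by linarith
  qed
  moreover have "\<bar>\<Sum>s<m. ?h s\<bar> \<le> real l * (4 * (real l + 1) * \<eta> * (\<alpha> ^ l * \<epsilon>))"
  proof -
    have "\<bar>\<Sum>s<m. ?h s\<bar> \<le> (\<Sum>s<m. 4 * (real l + 1) * \<eta> * (\<alpha> ^ l * \<epsilon>))"
      using hle by (intro order_trans[OF sum_abs] sum_mono) auto
    also have "\<dots> = real m * (4 * (real l + 1) * \<eta> * (\<alpha> ^ l * \<epsilon>))" by simp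
    also have "\<dots> \<le> real l * (4 * (real l + 1) * \<eta> * (\<alpha> ^ l * \<epsilon>))"
      using m par par' eps by (intro mult_right_mono) auto
    finally show ?thesis .
  qed
  ultimately have 1: "\<bar>dB m x z - (\<Sum>s\<le>m. \<theta> ^ (m - s) * dD s x z)\<bar> \<le> \<epsilon> + real l * (4 * (real l + 1) * \<eta> * (\<alpha> ^ l * \<epsilon>))"
    by linarith
  have r0: "0 \<le> \<alpha> ^ l * \<epsilon>" using par' eps by auto
  have "1 * \<epsilon> \<le> \<alpha> ^ l * \<epsilon>" using par' eps by (intro mult_right_mono one_le_power) auto
  also have "\<dots> \<le> (real l + 1) ^ 2 * \<eta> * (\<alpha> ^ l * \<epsilon>)"
  proof -
    have "1 * 1 \<le> (real l + 1) ^ 2 * \<eta>" using par by (intro mult_mono one_le_power) auto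
    then have "1 * (\<alpha> ^ l * \<epsilon>) \<le> (real l + 1) ^ 2 * \<eta> * (\<alpha> ^ l * \<epsilon>)" using r0 by (intro mult_right_mono) auto
    then show ?thesis by simp
  qed
  moreover have "real l * (4 * (real l + 1) * \<eta> * (\<alpha> ^ l * \<epsilon>)) \<le> 4 * (real l + 1) ^ 2 * \<eta> * (\<alpha> ^ l * \<epsilon>)"
  proof -
    have "real l * (4 * (real l + 1) * \<eta> * (\<alpha> ^ l * \<epsilon>)) \<le> (real l + 1) * (4 * (real l + 1) * \<eta> * (\<alpha> ^ l * \<epsilon>))"
      using par par' eps by (intro mult_right_mono) auto
    then show ?thesis by (simp add: power2_eq_square mult_ac)
  qed
  ultimately have "\<epsilon> + real l * (4 * (real l + 1) * \<eta> * (\<alpha> ^ l * \<epsilon>)) \<le> 5 * (real l + 1) ^ 2 * \<eta> * (\<alpha> ^ l * \<epsilon>)"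
    by linarith
  also have "\<dots> \<le> 5 * (real l + 1) ^ 2 * \<eta> * \<rho>"
    using eps par by (intro mult_left_mono) auto
  finally show ?thesis using 1 by linarith
qed

text \<open>Testing the expansion of \<open>dB l x z\<close>, which vanishes, against that of \<open>dB m x z\<close> cancels all terms
  with \<open>s \<le> m\<close>; the others decay because \<^term>\<open>r \<le> \<theta>\<close>.\<close>

lemma orthogonal_bound:
  assumes z: "z = u \<and> \<theta> = \<alpha> \<or> z = t \<and> \<theta> = \<beta>" and m: "m \<le> l" and x: "N x \<le> 1" and orth: "dB l z x = 0"
  shows "\<bar>dB m z x\<bar> \<le> 2 * (5 * (real l + 1) ^ 2 * \<eta> * \<rho>) + real l * \<eta> * r ^ m"
proof -
  let ?\<omega> = "5 * (real l + 1) ^ 2 * \<eta> * \<rho>"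
  let ?S = "\<lambda>m. \<Sum>s\<le>m. \<theta> ^ (m - s) * dD s x z"
  let ?T = "\<Sum>s\<in>{m<..l}. \<theta> ^ (l - s) * dD s x z"
  have th: "1 \<le> \<theta>" "r \<le> \<theta>" using z par par' by auto
  have zz: "N z = 1" using z N by auto
  have Sl: "?S l = \<theta> ^ (l - m) * ?S m + ?T"
  proof -
    have "{..l} = {..m} \<union> {m<..l}" using m by auto
    then have "?S l = (\<Sum>s\<in>{..m} \<union> {m<..l}. \<theta> ^ (l - s) * dD s x z)" by simp
    also have "\<dots> = (\<Sum>s\<le>m. \<theta> ^ (l - s) * dD s x z) + ?T"
      by (rule sum.union_disjoint) auto
    also have "(\<Sum>s\<le>m. \<theta> ^ (l - s) * dD s x z) = \<theta> ^ (l - m) * ?S m"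
      unfolding sum_distrib_left
    proof (rule sum.cong[OF refl])
      fix s assume "s \<in> {..m}"
      then have "l - s = (l - m) + (m - s)" using m by auto
      then show "\<theta> ^ (l - s) * dD s x z = \<theta> ^ (l - m) * (\<theta> ^ (m - s) * dD s x z)"
        by (simp add: power_add)
    qed
    finally show ?thesis .
  qed
  have sym: "dB l x z = 0" "dB m x z = dB m z x" using orth dB_sym m by auto
  have 1: "\<bar>?S l\<bar> \<le> ?\<omega>" using expansion[OF z _ x, of l] sym by simp
  have 2: "\<bar>dB m z x - ?S m\<bar> \<le> ?\<omega>" using expansion[OF z m x] sym by simp
  have P: "1 \<le> \<theta> ^ (l - m)" using th by (rule_tac one_le_power)
  have T: "\<bar>?T\<bar> \<le> \<theta> ^ (l - m) * (real l * \<eta> * r ^ m)"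
  proof -
    have "\<bar>?T\<bar> \<le> (\<Sum>s\<in>{m<..l}. \<theta> ^ (l - m) * (\<eta> * r ^ m))"
    proof (intro order_trans[OF sum_abs] sum_mono)
      fix s assume s: "s \<in> {m<..l}"
      have "\<bar>dD s x z\<bar> \<le> \<eta> * r ^ s * N x * N z" using dD_le s by auto
      also have "\<dots> \<le> \<eta> * r ^ s * 1 * 1" using x zz par N by (intro mult_mono mult_nonneg_nonneg) auto
      finally have d: "\<bar>dD s x z\<bar> \<le> \<eta> * r ^ s" by simp
      have "\<bar>\<theta> ^ (l - s) * dD s x z\<bar> = \<theta> ^ (l - s) * \<bar>dD s x z\<bar>" using th by (simp add: abs_mult)
      also have "\<dots> \<le> \<theta> ^ (l - s) * (\<eta> * r ^ s)" using d th by (intro mult_left_mono) auto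
      also have "\<dots> = \<theta> ^ (l - s) * r ^ (s - m) * (\<eta> * r ^ m)"
        using s by (simp add: power_add[symmetric] mult_ac)
      also have "\<dots> \<le> \<theta> ^ (l - s) * \<theta> ^ (s - m) * (\<eta> * r ^ m)"
        using th par by (intro mult_right_mono mult_left_mono power_mono) auto
      also have "\<dots> = \<theta> ^ (l - m) * (\<eta> * r ^ m)" using s by (simp add: power_add[symmetric])
      finally show "\<bar>\<theta> ^ (l - s) * dD s x z\<bar> \<le> \<theta> ^ (l - m) * (\<eta> * r ^ m)" .
    qed
    also have "\<dots> = real (l - m) * (\<theta> ^ (l - m) * (\<eta> * r ^ m))" by simp
    also have "\<dots> \<le> real l * (\<theta> ^ (l - m) * (\<eta> * r ^ m))"
      using th par by (intro mult_right_mono) auto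
    finally show ?thesis by (simp add: mult_ac)
  qed
  have w0: "0 \<le> ?\<omega>" using 1 by linarith
  have "\<theta> ^ (l - m) * \<bar>?S m\<bar> = \<bar>\<theta> ^ (l - m) * ?S m\<bar>" using th by (simp add: abs_mult)
  also have "\<dots> = \<bar>?S l - ?T\<bar>" using Sl by simp
  also have "\<dots> \<le> ?\<omega> + \<theta> ^ (l - m) * (real l * \<eta> * r ^ m)" using 1 T by linarith
  also have "\<dots> \<le> \<theta> ^ (l - m) * ?\<omega> + \<theta> ^ (l - m) * (real l * \<eta> * r ^ m)"
    using mult_right_mono[OF P w0] by simp
  finally have "\<theta> ^ (l - m) * \<bar>?S m\<bar> \<le> \<theta> ^ (l - m) * (?\<omega> + real l * \<eta> * r ^ m)" by (simp add: distrib_left)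
  then have "\<bar>?S m\<bar> \<le> ?\<omega> + real l * \<eta> * r ^ m" using P by (simp add: mult_le_cancel_left)
  then show ?thesis using 2 by linarith
qed

text \<open>In each term of the expansion of \<open>dB l f x\<close>, orthogonality makes
  \<open>dB (l - 1 - s) u x\<close> of order \<open>r ^ (l - 1 - s)\<close>, and
  \<open>dD s f u\<close> is of order \<open>r ^ s\<close>. The product has the same order for every
  \<open>s\<close>, so the sum costs only a factor \<open>l\<close>.\<close>

theorem restricted_bound:
  assumes x: "N x \<le> 1" and orth: "dB l u x = 0" "dB l t x = 0"
  shows "\<bar>dB l f x\<bar> \<le>
     (\<eta> + 2 * \<alpha> * real l * (10 * (real l + 1) ^ 2 * \<eta> * \<rho> + real l * \<eta>) * \<eta> + \<rho>) * r ^ l * N f"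
proof -
  let ?C = "10 * (real l + 1) ^ 2 * \<eta> * \<rho> + real l * \<eta>"
  let ?g = "\<lambda>s. \<alpha> * dB (l - 1 - s) u x * dD s f u + \<beta> * dB (l - 1 - s) t x * dD s f t"
  have "0 \<le> \<alpha> ^ l * \<epsilon>" using par' eps by auto
  then have rho: "0 \<le> \<rho>" using eps by linarith
  have bnd: "\<bar>\<gamma> * dB (l - 1 - s) z x * dD s f z\<bar> \<le> \<alpha> * (?C * \<eta> * r ^ l * N f)"
    if g: "\<gamma> \<in> {\<alpha>, \<beta>}" and z: "z = u \<and> \<theta> = \<alpha> \<or> z = t \<and> \<theta> = \<beta>" and s: "s < l" for \<gamma> z s \<theta>
  proof -
    have o: "dB l z x = 0" and Nz: "N z = 1" using z orth N by auto
    have r1: "1 \<le> r ^ (l - 1 - s)" using par by (simp add: one_le_power)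
    have "\<bar>dB (l - 1 - s) z x\<bar> \<le> 2 * (5 * (real l + 1) ^ 2 * \<eta> * \<rho>) + real l * \<eta> * r ^ (l - 1 - s)"
      by (rule orthogonal_bound[OF z _ x o]) simp
    also have "\<dots> \<le> (10 * (real l + 1) ^ 2 * \<eta> * \<rho>) * r ^ (l - 1 - s) + real l * \<eta> * r ^ (l - 1 - s)"
      using mult_left_mono[OF r1, of "10 * (real l + 1) ^ 2 * \<eta> * \<rho>"] rho par by simp
    also have "\<dots> = ?C * r ^ (l - 1 - s)" by (simp add: distrib_right)
    finally have B: "\<bar>dB (l - 1 - s) z x\<bar> \<le> ?C * r ^ (l - 1 - s)" .
    have D: "\<bar>dD s f z\<bar> \<le> \<eta> * r ^ s * N f" using dD_le[of s f z] s Nz by simp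
    have "\<bar>\<gamma> * dB (l - 1 - s) z x * dD s f z\<bar> = \<bar>\<gamma>\<bar> * (\<bar>dB (l - 1 - s) z x\<bar> * \<bar>dD s f z\<bar>)" by (simp add: abs_mult)
    also have "\<dots> \<le> \<alpha> * ((?C * r ^ (l - 1 - s)) * (\<eta> * r ^ s * N f))"
      using g par par' B D rho by (intro mult_mono mult_nonneg_nonneg add_nonneg_nonneg) auto
    also have "\<dots> = \<alpha> * (?C * \<eta> * r ^ (l - 1) * N f)"
      using s by (simp add: power_add[symmetric] mult_ac)
    also have "\<dots> \<le> \<alpha> * (?C * \<eta> * r ^ l * N f)"
      using par par' rho N by (intro mult_left_mono mult_right_mono power_increasing mult_nonneg_nonneg add_nonneg_nonneg) auto
    finally show ?thesis .
  qed
  have g: "\<bar>?g s\<bar> \<le> 2 * \<alpha> * (?C * \<eta> * r ^ l * N f)" if "s < l" for s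
    using bnd[of \<alpha> u \<alpha> s] bnd[of \<beta> t \<beta> s] that by auto
  have S: "\<bar>\<Sum>s<l. ?g s\<bar> \<le> real l * (2 * \<alpha> * (?C * \<eta> * r ^ l * N f))"
  proof -
    have "\<bar>\<Sum>s<l. ?g s\<bar> \<le> (\<Sum>s<l. 2 * \<alpha> * (?C * \<eta> * r ^ l * N f))"
      using g by (intro order_trans[OF sum_abs] sum_mono) auto
    then show ?thesis by simp
  qed
  have "\<eta> * r ^ l * N f * N x \<le> \<eta> * r ^ l * N f * 1" using x par N by (intro mult_left_mono) auto
  then have D: "\<bar>dD l f x\<bar> \<le> \<eta> * r ^ l * N f" using dD_le[of l f x] by simp
  have E: "\<epsilon> * N f * N x \<le> \<rho> * r ^ l * N f"
  proof -
    have "1 * \<epsilon> \<le> \<alpha> ^ l * \<epsilon>" using par' eps by (intro mult_right_mono one_le_power) auto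
    then have "\<epsilon> \<le> \<rho>" using eps by linarith
    have "\<epsilon> * N f * N x \<le> \<epsilon> * N f * 1" using x eps N by (intro mult_left_mono) auto
    also have "\<dots> = \<epsilon> * 1 * N f" by simp
    also have "\<dots> \<le> \<rho> * r ^ l * N f"
      using \<open>\<epsilon> \<le> \<rho>\<close> par rho N by (intro mult_right_mono mult_mono one_le_power) auto
    finally show ?thesis .
  qed
  have "\<bar>dB l f x\<bar> \<le> \<eta> * r ^ l * N f + real l * (2 * \<alpha> * (?C * \<eta> * r ^ l * N f)) + \<rho> * r ^ l * N f"
    using dec[of l f x] S D E by linarith
  also have "\<dots> = (\<eta> + 2 * \<alpha> * real l * ?C * \<eta> + \<rho>) * r ^ l * N f" by (simp add: algebra_simps)
  finally show ?thesis .
qed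

end

section \<open>Norms and bilinear forms of finite matrices\<close>

definition nrm :: "nat \<Rightarrow> (nat \<Rightarrow> real) \<Rightarrow> real" where
  "nrm n x = L2_set x {..<n}"

definition mv :: "nat \<Rightarrow> (nat \<Rightarrow> nat \<Rightarrow> real) \<Rightarrow> (nat \<Rightarrow> real) \<Rightarrow> nat \<Rightarrow> real" where
  "mv n M x i = (\<Sum>j<n. M i j * x j)"

definition bil :: "nat \<Rightarrow> (nat \<Rightarrow> nat \<Rightarrow> real) \<Rightarrow> (nat \<Rightarrow> real) \<Rightarrow> (nat \<Rightarrow> real) \<Rightarrow> real" where
  "bil n M f z = (\<Sum>i<n. \<Sum>j<n. f i * M i j * z j)"

definition frob :: "nat \<Rightarrow> (nat \<Rightarrow> nat \<Rightarrow> real) \<Rightarrow> real" where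
  "frob n M = (\<Sum>i<n. \<Sum>j<n. (M i j)\<^sup>2)"

lemma nrm_nonneg [simp]: "0 \<le> nrm n x"
  by (simp add: nrm_def)

lemma nrm_sq: "(nrm n x)\<^sup>2 = (\<Sum>i<n. (x i)\<^sup>2)"
  by (simp add: nrm_def L2_set_def sum_nonneg)

lemma dot_le_nrm: "\<bar>\<Sum>i<n. f i * g i\<bar> \<le> nrm n f * nrm n g"
proof -
  have "\<bar>\<Sum>i<n. f i * g i\<bar> \<le> (\<Sum>i<n. \<bar>f i\<bar> * \<bar>g i\<bar>)"
    by (rule order_trans[OF sum_abs]) (simp add: abs_mult)
  then show ?thesis using L2_set_mult_ineq[of f g "{..<n}"] by (simp add: nrm_def)
qed

lemma bil_mv: "bil n M f z = (\<Sum>i<n. f i * mv n M z i)"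
  by (simp add: bil_def mv_def sum_distrib_left mult.assoc)

lemma bil_sym:
  assumes "\<And>i j. i < n \<Longrightarrow> j < n \<Longrightarrow> M i j = M j i"
  shows "bil n M f z = bil n M z f"
proof -
  have "bil n M f z = (\<Sum>j<n. \<Sum>i<n. f i * M i j * z j)" unfolding bil_def by (rule sum.swap)
  also have "\<dots> = bil n M z f" unfolding bil_def using assms by (intro sum.cong refl) (auto simp: mult_ac)
  finally show ?thesis .
qed

lemma nrm_mv_le_frob: "nrm n (mv n M x) \<le> sqrt (frob n M) * nrm n x"
proof -
  have "(nrm n (mv n M x))\<^sup>2 \<le> frob n M * (nrm n x)\<^sup>2"
  proof -
    have "(mv n M x i)\<^sup>2 \<le> (\<Sum>j<n. (M i j)\<^sup>2) * (nrm n x)\<^sup>2" for i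
    proof -
      have "\<bar>mv n M x i\<bar> \<le> nrm n (M i) * nrm n x" unfolding mv_def by (rule dot_le_nrm)
      then have "(mv n M x i)\<^sup>2 \<le> (nrm n (M i) * nrm n x)\<^sup>2" by (metis abs_ge_zero power2_abs power_mono)
      then show ?thesis by (simp add: power_mult_distrib nrm_sq)
    qed
    then show ?thesis unfolding nrm_sq[of n "mv n M x"] frob_def sum_distrib_right by (intro sum_mono)
  qed
  then have "sqrt ((nrm n (mv n M x))\<^sup>2) \<le> sqrt (frob n M * (nrm n x)\<^sup>2)" by (rule real_sqrt_le_mono)
  then show ?thesis by (simp add: real_sqrt_mult)
qed

lemma bil_le_nrm_mv: "\<bar>bil n M f z\<bar> \<le> nrm n f * nrm n (mv n M z)"
  unfolding bil_mv by (rule dot_le_nrm)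

lemma frob_nonneg: "0 \<le> frob n M"
  by (simp add: frob_def sum_nonneg)

lemma bil_le_frob:
  assumes "frob n M \<le> C\<^sup>2" "0 \<le> C"
  shows "\<bar>bil n M f z\<bar> \<le> C * nrm n f * nrm n z"
proof -
  have "sqrt (frob n M) \<le> C" using assms real_le_lsqrt frob_nonneg by blast
  then have "nrm n (mv n M z) \<le> C * nrm n z"
    using nrm_mv_le_frob[of n M z] by (meson mult_right_mono nrm_nonneg order_trans)
  then have "nrm n f * nrm n (mv n M z) \<le> nrm n f * (C * nrm n z)" by (rule mult_left_mono) simp
  then show ?thesis using bil_le_nrm_mv[of n M f z] by (simp add: mult_ac)
qed

lemma nrm_mv_le_of_bil:
  assumes "\<And>f. \<bar>bil n M f z\<bar> \<le> C * nrm n f" "0 \<le> C"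
  shows "nrm n (mv n M z) \<le> C"
proof -
  have "(nrm n (mv n M z))\<^sup>2 = bil n M (mv n M z) z"
    by (simp only: bil_mv nrm_sq) (simp only: power2_eq_square)
  also have "\<dots> \<le> C * nrm n (mv n M z)" using assms(1)[of "mv n M z"] by linarith
  finally have "nrm n (mv n M z) * nrm n (mv n M z) \<le> C * nrm n (mv n M z)" by (simp add: power2_eq_square)
  then show ?thesis using assms(2) nrm_nonneg[of n "mv n M z"]
    by (metis linorder_not_less mult_less_cancel_right order_le_less_trans order.strict_iff_order order_less_imp_le)
qed

lemma nrm_cong: "(\<And>i. i < n \<Longrightarrow> x i = y i) \<Longrightarrow> nrm n x = nrm n y"
  unfolding nrm_def by (rule L2_set_cong) auto

lemma mv_funpow: "i < n \<Longrightarrow> (mv n M ^^ a) x i = mv n (mpow n M a) x i"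
proof (induction a arbitrary: i)
  case 0
  then show ?case by (simp add: mv_def if_distrib[of "\<lambda>y. y * _"] cong: if_cong)
next
  case (Suc a)
  have "(mv n M ^^ Suc a) x i = (\<Sum>k<n. M i k * (mv n M ^^ a) x k)"
    by (simp only: funpow.simps o_apply) (rule mv_def)
  also have "\<dots> = (\<Sum>k<n. M i k * mv n (mpow n M a) x k)"
    using Suc.IH by (intro sum.cong refl) simp
  also have "\<dots> = (\<Sum>k<n. \<Sum>j<n. M i k * mpow n M a k j * x j)"
    by (simp add: mv_def sum_distrib_left mult.assoc)
  also have "\<dots> = (\<Sum>j<n. \<Sum>k<n. M i k * mpow n M a k j * x j)" by (rule sum.swap)
  also have "\<dots> = mv n (mpow n M (Suc a)) x i" by (simp add: mv_def sum_distrib_right)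
  finally show ?case .
qed

text \<open>For symmetric matrices, \<open>\<parallel>M x\<parallel>\<^sup>2 \<le> \<parallel>x\<parallel> \<parallel>M\<^sup>2 x\<parallel>\<close>; iterating this reduces the operator norm to a Frobenius norm
  of a high power without any spectral theory.\<close>

lemma bil_le_mpow:
  assumes sym: "\<And>i j. i < n \<Longrightarrow> j < n \<Longrightarrow> M i j = M j i"
    and F: "frob n (mpow n M (2 ^ k)) \<le> (C ^ (2 ^ k))\<^sup>2" and C: "0 \<le> C"
  shows "\<bar>bil n M f z\<bar> \<le> C * nrm n f * nrm n z"
proof -
  let ?dot = "\<lambda>x y. \<Sum>i<n. x i * y i"
  have sa: "?dot (mv n M x) y = ?dot x (mv n M y)" for x y
    using bil_sym[OF sym, where f = x and z = y] unfolding bil_mv by (simp add: mult.commute)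
  have it: "?dot ((mv n M ^^ a) x) ((mv n M ^^ b) y) = ?dot x ((mv n M ^^ (a + b)) y)" for a b x y
  proof (induction a arbitrary: b)
    case (Suc a)
    have "?dot ((mv n M ^^ Suc a) x) ((mv n M ^^ b) y) = ?dot ((mv n M ^^ a) x) ((mv n M ^^ Suc b) y)"
      by (simp add: sa)
    also have "\<dots> = ?dot x ((mv n M ^^ (a + Suc b)) y)" by (rule Suc.IH)
    finally show ?case by simp
  qed simp
  have sq: "(nrm n ((mv n M ^^ a) z))\<^sup>2 \<le> nrm n z * nrm n ((mv n M ^^ (2 * a)) z)" for a
  proof -
    have "(nrm n ((mv n M ^^ a) z))\<^sup>2 = ?dot ((mv n M ^^ a) z) ((mv n M ^^ a) z)"
      by (simp only: nrm_sq) (simp only: power2_eq_square)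
    also have "\<dots> = ?dot z ((mv n M ^^ (2 * a)) z)" unfolding it by (simp add: mult_2)
    also have "\<dots> \<le> nrm n z * nrm n ((mv n M ^^ (2 * a)) z)" using dot_le_nrm abs_le_D1 by blast
    finally show ?thesis .
  qed
  have "nrm n (mv n M z) \<le> C * nrm n z"
  proof (cases "nrm n z = 0")
    case True
    then have "nrm n (mv n M z) \<le> 0" using nrm_mv_le_frob[of n M z] by simp
    then show ?thesis using True by simp
  next
    case False
    then have z: "0 < nrm n z" using nrm_nonneg[of n z] by linarith
    \<comment> \<open>The extra factor \<open>nrm n z\<close> makes both sides homogeneous of the
      same degree in \<open>z\<close>; the inequality can then be squared, and one factor cancelled,
      at each doubling.\<close>
    have pow: "nrm n (mv n M z) ^ (2 ^ j) * nrm n z \<le> nrm n z ^ (2 ^ j) * nrm n ((mv n M ^^ (2 ^ j)) z)" for j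
    proof (induction j)
      case (Suc j)
      have "(nrm n (mv n M z) ^ (2 ^ Suc j) * nrm n z) * nrm n z = (nrm n (mv n M z) ^ (2 ^ j) * nrm n z)\<^sup>2"
        by (simp add: power2_eq_square power_mult[symmetric] mult_2 power_add mult_ac)
      also have "\<dots> \<le> (nrm n z ^ (2 ^ j) * nrm n ((mv n M ^^ (2 ^ j)) z))\<^sup>2"
        by (rule power_mono[OF Suc]) simp
      also have "\<dots> = nrm n z ^ (2 ^ Suc j) * (nrm n ((mv n M ^^ (2 ^ j)) z))\<^sup>2"
        by (simp add: power2_eq_square power_mult[symmetric] mult_2 power_add mult_ac)
      also have "\<dots> \<le> nrm n z ^ (2 ^ Suc j) * (nrm n z * nrm n ((mv n M ^^ (2 ^ Suc j)) z))"
        using sq[of "2 ^ j"] by (intro mult_left_mono) auto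
      also have "\<dots> = (nrm n z ^ (2 ^ Suc j) * nrm n ((mv n M ^^ (2 ^ Suc j)) z)) * nrm n z"
        by (simp only: mult_ac)
      finally show ?case using z by (rule mult_right_le_imp_le)
    qed simp
    have "nrm n ((mv n M ^^ (2 ^ k)) z) = nrm n (mv n (mpow n M (2 ^ k)) z)"
      by (intro nrm_cong mv_funpow)
    also have "\<dots> \<le> sqrt (frob n (mpow n M (2 ^ k))) * nrm n z" by (rule nrm_mv_le_frob)
    also have "\<dots> \<le> C ^ (2 ^ k) * nrm n z"
      using F C by (intro mult_right_mono real_le_lsqrt frob_nonneg) auto
    finally have it: "nrm n ((mv n M ^^ (2 ^ k)) z) \<le> C ^ (2 ^ k) * nrm n z" .
    have "nrm n (mv n M z) ^ (2 ^ k) * nrm n z \<le> nrm n z ^ (2 ^ k) * nrm n ((mv n M ^^ (2 ^ k)) z)"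
      by (rule pow)
    also have "\<dots> \<le> nrm n z ^ (2 ^ k) * (C ^ (2 ^ k) * nrm n z)"
      by (rule mult_left_mono[OF it]) simp
    finally have "nrm n (mv n M z) ^ (2 ^ k) * nrm n z \<le> (nrm n z ^ (2 ^ k) * C ^ (2 ^ k)) * nrm n z"
      by (simp only: mult.assoc)
    then have "nrm n (mv n M z) ^ (2 ^ k) \<le> nrm n z ^ (2 ^ k) * C ^ (2 ^ k)"
      using z by (rule mult_right_le_imp_le)
    also have "\<dots> = (C * nrm n z) ^ (2 ^ k)" by (simp add: power_mult_distrib mult.commute)
    finally show ?thesis using C z by (simp add: power_mono_iff)
  qed
  then have "nrm n f * nrm n (mv n M z) \<le> nrm n f * (C * nrm n z)" by (rule mult_left_mono) simp
  then show ?thesis using bil_le_nrm_mv[of n M f z] by (simp add: mult_ac)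
qed

lemma bil_scale: "bil n M (\<lambda>i. c * f i) (\<lambda>i. c' * z i) = c * c' * bil n M f z"
  by (simp add: bil_def sum_distrib_left mult_ac)

lemma bil_product:
  "(\<Sum>i<n. \<Sum>j<n. f i * (\<Sum>x<n. \<Sum>y<n. D i x * P x y * B y j) * z j) =
     bil n P (\<lambda>x. \<Sum>i<n. f i * D i x) (mv n B z)"
proof -
  have "(\<Sum>i<n. \<Sum>j<n. f i * (\<Sum>x<n. \<Sum>y<n. D i x * P x y * B y j) * z j) =
     (\<Sum>i<n. \<Sum>j<n. \<Sum>x<n. \<Sum>y<n. f i * D i x * P x y * B y j * z j)"
    by (simp add: sum_distrib_left sum_distrib_right mult_ac)
  also have "\<dots> = (\<Sum>i<n. \<Sum>x<n. \<Sum>j<n. \<Sum>y<n. f i * D i x * P x y * B y j * z j)"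
    by (intro sum.cong refl sum.swap)
  also have "\<dots> = (\<Sum>x<n. \<Sum>i<n. \<Sum>j<n. \<Sum>y<n. f i * D i x * P x y * B y j * z j)"
    by (rule sum.swap)
  also have "\<dots> = (\<Sum>x<n. \<Sum>i<n. \<Sum>y<n. \<Sum>j<n. f i * D i x * P x y * B y j * z j)"
    by (intro sum.cong refl sum.swap)
  also have "\<dots> = (\<Sum>x<n. \<Sum>y<n. \<Sum>i<n. \<Sum>j<n. f i * D i x * P x y * B y j * z j)"
    by (intro sum.cong refl sum.swap)
  also have "\<dots> = bil n P (\<lambda>x. \<Sum>i<n. f i * D i x) (mv n B z)"
    unfolding bil_def mv_def by (simp add: sum_distrib_left sum_distrib_right mult_ac)
  finally show ?thesis .
qed

text \<open>Three kinds of conditions, each bounding a nonnegative sum or square by a threshold so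
  that Markov's inequality applies directly: operator norms through Frobenius norms of high powers,
  forms of \<Delta> between the all-ones vector and \<sigma>, and concatenation errors.\<close>

definition good :: "nat \<Rightarrow> nat \<Rightarrow> (nat set \<Rightarrow> real) \<Rightarrow> (nat \<Rightarrow> real) \<Rightarrow> nat \<Rightarrow> nat \<Rightarrow> real \<Rightarrow> real \<Rightarrow> real \<Rightarrow> real \<Rightarrow> nat set set \<Rightarrow> bool" where
  "good n d p \<sigma> k l \<eta> \<alpha> \<delta> \<gamma> H \<longleftrightarrow>
     (\<forall>s\<le>l. \<forall>\<tau>. frob n (mpow n (Wm n d p \<tau> s H) (2 ^ k)) \<le> ((\<eta> * (if \<tau> then sqrt \<alpha> else \<alpha>) ^ s) ^ (2 ^ k))\<^sup>2) \<and>
     (\<forall>s\<in>{1..l}. \<forall>f\<in>{\<lambda>_. 1, \<sigma>}. \<forall>g\<in>{\<lambda>_. 1, \<sigma>}. (bil n (Wm n d p True s H) f g)\<^sup>2 \<le> (real n * \<delta>)\<^sup>2) \<and>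
     (\<forall>s\<le>l. \<forall>t\<le>l. s + t \<le> l \<longrightarrow> frob n (Gm n d p s t H) \<le> \<gamma>\<^sup>2)"

definition spectral_const :: "nat \<Rightarrow> real \<Rightarrow> real \<Rightarrow> real \<Rightarrow> real" where
  "spectral_const l \<alpha> \<eta> \<rho> = \<eta> + 2 * \<alpha> * real l * (10 * (real l + 1) ^ 2 * \<eta> * \<rho> + real l * \<eta>) * \<eta> + \<rho>"

text \<open>The deterministic half: on the good event the matrices satisfy
  \<open>spectral_forms\<close>. The error level there combines \<delta>' for the distance of the
  mean matrix from its rank-two model, \<gamma> for the concatenation errors, and \<delta> for the
  forms between the all-ones vector and \<sigma>.\<close>

lemma good_norm_bound:
  assumes H: "H \<subseteq> dsets n d" and n0: "n > 0" and l0: "l > 0"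
    and G: "good n d p \<sigma> k l \<eta> \<alpha> \<delta> \<gamma> H"
    and sg: "\<And>i. i < n \<Longrightarrow> \<sigma> i \<in> {-1, 1}" "\<bar>\<Sum>i<n. \<sigma> i\<bar> \<le> real n * \<delta>"
    and R: "frob n (\<lambda>x y. Ab n d p x y - (\<alpha> + \<beta> * \<sigma> x * \<sigma> y) / real n) \<le> \<delta>'\<^sup>2"
    and pos: "0 \<le> \<gamma>" "0 \<le> \<delta>" "0 \<le> \<delta>'" "1 \<le> \<eta>"
    and par: "1 \<le> \<alpha>" "\<alpha> \<le> \<beta>\<^sup>2" "0 \<le> \<beta>" "\<beta> \<le> \<alpha>"
    and rho: "\<alpha> ^ l * (real l * (\<eta>\<^sup>2 * \<alpha> ^ l * \<delta>' + \<gamma>) + (2 * \<alpha> + 1) * (real l + 1) * \<eta> * \<alpha> ^ l * \<delta>) \<le> \<rho>"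
    and x: "sqrt (\<Sum>i<n. (x i)\<^sup>2) = 1"
    and orth: "(\<Sum>i<n. x i * (\<Sum>j<n. saw_mat H l i j)) = 0" "(\<Sum>i<n. x i * (\<Sum>j<n. saw_mat H l i j * \<sigma> j)) = 0"
  shows "sqrt (\<Sum>i<n. (\<Sum>j<n. saw_mat H l i j * x j)\<^sup>2) \<le> spectral_const l \<alpha> \<eta> \<rho> * sqrt \<alpha> ^ l"
proof -
  let ?c = "1 / sqrt (real n)"
  let ?u = "\<lambda>i. ?c * (1::real)" and ?t = "\<lambda>i. ?c * \<sigma> i"
  let ?B = "\<lambda>m. Wm n d p False m H" and ?D = "\<lambda>s. Wm n d p True s H"
  let ?R = "\<lambda>x y. Ab n d p x y - (\<alpha> + \<beta> * \<sigma> x * \<sigma> y) / real n"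
  let ?N = "nrm n"
  let ?\<epsilon> = "real l * (\<eta>\<^sup>2 * \<alpha> ^ l * \<delta>' + \<gamma>) + (2 * \<alpha> + 1) * (real l + 1) * \<eta> * \<alpha> ^ l * \<delta>"
  have c2: "?c * ?c = 1 / real n" by (simp add: real_sqrt_mult_self)
  have r1: "1 \<le> sqrt \<alpha>" using par by simp
  have e1: "0 \<le> real l * (\<eta>\<^sup>2 * \<alpha> ^ l * \<delta>' + \<gamma>)" and e2: "0 \<le> (2 * \<alpha> + 1) * (real l + 1) * \<eta> * \<alpha> ^ l * \<delta>"
    using pos par by simp_all
  have Dle: "\<bar>bil n (?D s) f z\<bar> \<le> \<eta> * sqrt \<alpha> ^ s * ?N f * ?N z" if "s \<le> l" for s f z
  proof (rule bil_le_mpow[where k = k])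
    have "frob n (mpow n (Wm n d p True s H) (2 ^ k)) \<le> ((\<eta> * (if True then sqrt \<alpha> else \<alpha>) ^ s) ^ (2 ^ k))\<^sup>2"
      using G that unfolding good_def by blast
    then show "frob n (mpow n (?D s) (2 ^ k)) \<le> ((\<eta> * sqrt \<alpha> ^ s) ^ (2 ^ k))\<^sup>2" by simp
  qed (use pos par in \<open>auto intro: Wm_sym\<close>)
  have Ble: "\<bar>bil n (?B s) f z\<bar> \<le> \<eta> * \<alpha> ^ s * ?N f * ?N z" if "s \<le> l" for s f z
  proof (rule bil_le_mpow[where k = k])
    have "frob n (mpow n (Wm n d p False s H) (2 ^ k)) \<le> ((\<eta> * (if False then sqrt \<alpha> else \<alpha>) ^ s) ^ (2 ^ k))\<^sup>2"
      using G that unfolding good_def by blast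
    then show "frob n (mpow n (?B s) (2 ^ k)) \<le> ((\<eta> * \<alpha> ^ s) ^ (2 ^ k))\<^sup>2" by simp
  qed (use pos par in \<open>auto intro: Wm_sym\<close>)
  have bsym: "bil n (Wm n d p \<tau> s H) f z = bil n (Wm n d p \<tau> s H) z f" for \<tau> s f z
    by (rule bil_sym) (rule Wm_sym)
  have Dn: "?N (\<lambda>x. \<Sum>i<n. f i * ?D s i x) \<le> \<eta> * sqrt \<alpha> ^ s * ?N f" if "s \<le> l" for s f
  proof -
    have "(\<lambda>x. \<Sum>i<n. f i * ?D s i x) = mv n (?D s) f"
      by (rule ext) (simp add: mv_def Wm_sym[of n d p True s H] mult.commute)
    moreover have "?N (mv n (?D s) f) \<le> \<eta> * sqrt \<alpha> ^ s * ?N f"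
    proof (rule nrm_mv_le_of_bil)
      show "\<bar>bil n (?D s) g f\<bar> \<le> \<eta> * sqrt \<alpha> ^ s * ?N f * ?N g" for g using Dle[OF that, of g f] by (simp add: mult_ac)
    qed (use pos par in auto)
    ultimately show ?thesis by simp
  qed
  have Bn: "?N (mv n (?B m) z) \<le> \<eta> * \<alpha> ^ m * ?N z" if "m \<le> l" for m z
  proof (rule nrm_mv_le_of_bil)
    show "\<bar>bil n (?B m) g z\<bar> \<le> \<eta> * \<alpha> ^ m * ?N z * ?N g" for g using Ble[OF that, of g z] by (simp add: mult_ac)
  qed (use pos par in auto)
  have Gle: "\<bar>bil n (Gm n d p s t H) f z\<bar> \<le> \<gamma> * ?N f * ?N z" if "s + t \<le> l" for s t f z
    using G that pos unfolding good_def by (intro bil_le_frob) auto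
  \<comment> \<open>One term of the centring expansion. The rank-two model of the mean matrix splits
    into products of forms in \<open>u\<close> and \<open>t\<close>, while the remainder
    \<open>?R\<close> is tested against \<Delta> applied to \<open>f\<close> and B applied to
    \<open>z\<close>, whose norms are under control.\<close>
  have tm: "\<bar>bil n (\<lambda>i j. (\<Sum>x<n. \<Sum>y<n. ?D s i x * Ab n d p x y * ?B m' y j) - Gm n d p s m' H i j) f z
      - (\<alpha> * bil n (?B m') ?u z * bil n (?D s) f ?u + \<beta> * bil n (?B m') ?t z * bil n (?D s) f ?t)\<bar>
      \<le> (\<eta>\<^sup>2 * \<alpha> ^ l * \<delta>' + \<gamma>) * ?N f * ?N z" if sm: "s + m' \<le> l" for s m' f z
  proof -
    let ?a = "\<lambda>x. \<Sum>i<n. f i * ?D s i x" and ?b = "mv n (?B m') z"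
    have au: "bil n (?D s) f (\<lambda>x. ?c * h x) = ?c * (\<Sum>x<n. ?a x * h x)" for h
    proof -
      have "bil n (?D s) f (\<lambda>x. ?c * h x) = (\<Sum>x<n. \<Sum>i<n. f i * ?D s i x * (?c * h x))"
        unfolding bil_def by (rule sum.swap)
      then show ?thesis by (simp add: sum_distrib_left sum_distrib_right mult_ac)
    qed
    have bu: "bil n (?B m') (\<lambda>x. ?c * h x) z = ?c * (\<Sum>y<n. h y * ?b y)" for h
      unfolding bil_mv by (simp add: sum_distrib_left mult_ac)
    have "bil n (\<lambda>i j. (\<Sum>x<n. \<Sum>y<n. ?D s i x * Ab n d p x y * ?B m' y j) - Gm n d p s m' H i j) f z
       = bil n (Ab n d p) ?a ?b - bil n (Gm n d p s m' H) f z"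
      unfolding bil_product[symmetric] bil_def[of n "Gm n d p s m' H"]
        bil_def[of n "\<lambda>i j. (\<Sum>x<n. \<Sum>y<n. ?D s i x * Ab n d p x y * ?B m' y j) - Gm n d p s m' H i j"]
      by (simp add: sum_subtractf[symmetric] algebra_simps)
    moreover have "bil n (Ab n d p) ?a ?b = bil n ?R ?a ?b + (\<alpha> * bil n (?B m') ?u z * bil n (?D s) f ?u + \<beta> * bil n (?B m') ?t z * bil n (?D s) f ?t)"
    proof -
      have p1: "bil n (?B m') ?u z * bil n (?D s) f ?u = (1 / real n) * ((\<Sum>x<n. ?a x) * (\<Sum>y<n. ?b y))"
        unfolding au bu c2[symmetric] by (simp only: mult_ac mult_1_right mult_1_left)
      have p2: "bil n (?B m') ?t z * bil n (?D s) f ?t = (1 / real n) * ((\<Sum>x<n. ?a x * \<sigma> x) * (\<Sum>y<n. \<sigma> y * ?b y))"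
        unfolding au bu c2[symmetric] by (simp only: mult_ac)
      have "bil n (Ab n d p) ?a ?b = (\<Sum>x<n. \<Sum>y<n. ?a x * ?R x y * ?b y + (\<alpha> * (1 / real n * (?a x * ?b y)) + \<beta> * (1 / real n * ((?a x * \<sigma> x) * (\<sigma> y * ?b y)))))"
        unfolding bil_def by (intro sum.cong refl) (simp add: divide_simps algebra_simps)
      also have "\<dots> = bil n ?R ?a ?b + (\<alpha> * (1 / real n * ((\<Sum>x<n. ?a x) * (\<Sum>y<n. ?b y))) + \<beta> * (1 / real n * ((\<Sum>x<n. ?a x * \<sigma> x) * (\<Sum>y<n. \<sigma> y * ?b y))))"
        unfolding bil_def[of n ?R] sum_product by (simp only: sum.distrib sum_distrib_left[symmetric])
      finally show ?thesis unfolding p1[symmetric] p2[symmetric] by (simp only: mult.assoc)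
    qed
    moreover have "\<bar>bil n ?R ?a ?b\<bar> \<le> \<eta>\<^sup>2 * \<alpha> ^ l * \<delta>' * ?N f * ?N z"
    proof -
      have "\<bar>bil n ?R ?a ?b\<bar> \<le> \<delta>' * ?N ?a * ?N ?b" by (rule bil_le_frob[OF R pos(3)])
      also have "\<dots> \<le> \<delta>' * (\<eta> * sqrt \<alpha> ^ s * ?N f) * (\<eta> * \<alpha> ^ m' * ?N z)"
        using Dn[of s f] Bn[of m' z] sm pos par by (intro mult_mono mult_nonneg_nonneg) auto
      also have "\<dots> = \<eta>\<^sup>2 * (sqrt \<alpha> ^ s * \<alpha> ^ m') * \<delta>' * ?N f * ?N z" by (simp add: power2_eq_square mult_ac)
      also have "\<dots> \<le> \<eta>\<^sup>2 * \<alpha> ^ l * \<delta>' * ?N f * ?N z"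
      proof -
        have "sqrt \<alpha> ^ s * \<alpha> ^ m' \<le> \<alpha> ^ s * \<alpha> ^ m'"
          using par by (intro mult_right_mono power_mono real_le_lsqrt) (auto simp: power2_eq_square mult_left_le)
        also have "\<dots> \<le> \<alpha> ^ l" unfolding power_add[symmetric] using sm par by (intro power_increasing)
        finally show ?thesis using pos by (intro mult_right_mono mult_left_mono) auto
      qed
      finally show ?thesis .
    qed
    moreover have "\<bar>bil n (Gm n d p s m' H) f z\<bar> \<le> \<gamma> * ?N f * ?N z" by (rule Gle[OF sm])
    ultimately show ?thesis by (simp add: algebra_simps)
  qed
  have uu: "(\<Sum>i<n. (\<sigma> i)\<^sup>2) = real n"
  proof -
    have "(\<sigma> i)\<^sup>2 = 1" if "i < n" for i using sg(1)[OF that] by auto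
    then have "(\<Sum>i<n. (\<sigma> i)\<^sup>2) = (\<Sum>i<n. 1)" by (intro sum.cong) auto
    then show ?thesis by simp
  qed
  have D0: "bil n (?D 0) f z = (\<Sum>i<n. f i * z i)" for f z
  proof -
    have "bil n (?D 0) f z = (\<Sum>i<n. \<Sum>j<n. if j = i then f i * z i else 0)"
      unfolding bil_def by (intro sum.cong refl) (auto simp: Wm_0)
    then show ?thesis by simp
  qed
  interpret spectral_forms "\<lambda>m. bil n (?B m)" "\<lambda>m. bil n (?D m)" ?N ?u ?t \<alpha> \<beta> "sqrt \<alpha>" \<eta> \<delta> ?\<epsilon> \<rho> l
  proof
    fix m f z assume m: "m \<le> l"
    let ?T = "\<lambda>s i j. (\<Sum>x<n. \<Sum>y<n. ?D s i x * Ab n d p x y * ?B (m - 1 - s) y j) - Gm n d p s (m - 1 - s) H i j"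
    let ?g = "\<lambda>s. \<alpha> * bil n (?B (m - 1 - s)) ?u z * bil n (?D s) f ?u + \<beta> * bil n (?B (m - 1 - s)) ?t z * bil n (?D s) f ?t"
    have "bil n (?B m) f z = (\<Sum>i<n. \<Sum>j<n. f i * ?D m i j * z j + (\<Sum>s<m. f i * ?T s i j * z j))"
      unfolding bil_def by (subst Wm_decomposition) (simp only: sum_distrib_left sum_distrib_right distrib_left distrib_right)
    also have "\<dots> = bil n (?D m) f z + (\<Sum>i<n. \<Sum>j<n. \<Sum>s<m. f i * ?T s i j * z j)"
      by (simp only: sum.distrib bil_def)
    also have "(\<Sum>i<n. \<Sum>j<n. \<Sum>s<m. f i * ?T s i j * z j) = (\<Sum>i<n. \<Sum>s<m. \<Sum>j<n. f i * ?T s i j * z j)"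
      by (intro sum.cong refl sum.swap)
    also have "\<dots> = (\<Sum>s<m. bil n (?T s) f z)" unfolding bil_def by (rule sum.swap)
    finally have E: "bil n (?B m) f z - bil n (?D m) f z - (\<Sum>s<m. ?g s) = (\<Sum>s<m. bil n (?T s) f z - ?g s)"
      by (simp add: sum_subtractf)
    have "\<bar>\<Sum>s<m. bil n (?T s) f z - ?g s\<bar> \<le> (\<Sum>s<m. (\<eta>\<^sup>2 * \<alpha> ^ l * \<delta>' + \<gamma>) * ?N f * ?N z)"
      using m by (intro order_trans[OF sum_abs] sum_mono tm) auto
    also have "\<dots> = real m * ((\<eta>\<^sup>2 * \<alpha> ^ l * \<delta>' + \<gamma>) * ?N f * ?N z)" by simp
    also have "\<dots> \<le> real l * ((\<eta>\<^sup>2 * \<alpha> ^ l * \<delta>' + \<gamma>) * ?N f * ?N z)"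
      using m pos par by (intro mult_right_mono) auto
    also have "\<dots> = real l * (\<eta>\<^sup>2 * \<alpha> ^ l * \<delta>' + \<gamma>) * (?N f * ?N z)" by (simp only: mult_ac)
    also have "\<dots> \<le> ?\<epsilon> * (?N f * ?N z)" using e2 by (intro mult_right_mono) auto
    finally show "\<bar>bil n (?B m) f z - bil n (?D m) f z - (\<Sum>s<m. ?g s)\<bar> \<le> ?\<epsilon> * ?N f * ?N z"
      unfolding E by (simp only: mult.assoc)
  next
    show "?N ?u = 1" "?N ?t = 1"
      using n0 uu by (simp_all add: nrm_def L2_set_def power_divide sum_divide_distrib[symmetric])
    fix s f z assume s: "1 \<le> s" "s \<le> l" and f: "f \<in> {?u, ?t}" "z \<in> {?u, ?t}"
    have "\<exists>h\<in>{\<lambda>_. 1, \<sigma>}. \<exists>g\<in>{\<lambda>_. 1, \<sigma>}. f = (\<lambda>i. ?c * h i) \<and> z = (\<lambda>i. ?c * g i)" using f by auto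
    then obtain h g where hg: "h \<in> {\<lambda>_. 1, \<sigma>}" "g \<in> {\<lambda>_. 1, \<sigma>}" "f = (\<lambda>i. ?c * h i)" "z = (\<lambda>i. ?c * g i)" by blast
    have "(bil n (?D s) h g)\<^sup>2 \<le> (real n * \<delta>)\<^sup>2" using G hg s unfolding good_def by auto
    then have "\<bar>bil n (?D s) h g\<bar> \<le> real n * \<delta>" using pos by (simp add: abs_le_square_iff[symmetric])
    then have "\<bar>(1 / real n) * bil n (?D s) h g\<bar> \<le> \<delta>" using n0 by (simp add: abs_mult divide_simps mult.commute)
    then show "\<bar>bil n (?D s) f z\<bar> \<le> \<delta>" unfolding hg bil_scale c2 .
  next
    have dd: "\<bar>\<Sum>i<n. \<sigma> i\<bar> / real n \<le> \<delta>" using sg(2) n0 by (simp add: divide_simps mult.commute)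
    show "bil n (?D 0) ?u ?u = 1" "bil n (?D 0) ?t ?t = 1"
      using n0 uu by (simp_all add: D0 power2_eq_square[symmetric] sum_divide_distrib[symmetric] power_divide)
    have "bil n (?D 0) ?u ?t = (\<Sum>i<n. \<sigma> i) / real n" "bil n (?D 0) ?t ?u = (\<Sum>i<n. \<sigma> i) / real n"
      using n0 by (simp_all add: D0 sum_divide_distrib[symmetric])
    then show "\<bar>bil n (?D 0) ?u ?t\<bar> \<le> \<delta>" "\<bar>bil n (?D 0) ?t ?u\<bar> \<le> \<delta>" using dd by simp_all
    show "sqrt \<alpha> \<le> \<beta>" using par by (intro real_le_lsqrt) auto
    show "0 \<le> ?\<epsilon>" using e1 e2 by linarith
    show "(2 * \<alpha> + 1) * (real l + 1) * \<eta> * \<alpha> ^ l * \<delta> \<le> ?\<epsilon>" using e1 by linarith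
  qed (use Dle Ble bsym par r1 pos rho in auto)
  have saw: "saw_mat H l i j = ?B l i j" if "i < n" for i j
    by (rule saw_mat_eq_Wm[OF H that l0])
  have Nx: "?N x = 1" using x by (simp add: nrm_def L2_set_def)
  have o: "bil n (?B l) ?u x = 0" "bil n (?B l) ?t x = 0"
  proof -
    have "bil n (?B l) x h = (\<Sum>i<n. x i * (\<Sum>j<n. saw_mat H l i j * h j))" for h
      unfolding bil_mv mv_def by (intro sum.cong refl arg_cong2[of _ _ _ _ "(*)"]) (simp add: saw)
    from this[of "\<lambda>_. 1"] this[of \<sigma>] have "bil n (?B l) x (\<lambda>i. 1) = 0" "bil n (?B l) x \<sigma> = 0"
      using orth by simp_all
    then have "bil n (?B l) (\<lambda>i. 1 * x i) (\<lambda>i. ?c * 1) = 0" "bil n (?B l) (\<lambda>i. 1 * x i) (\<lambda>i. ?c * \<sigma> i) = 0"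
      unfolding bil_scale by simp_all
    then show "bil n (?B l) ?u x = 0" "bil n (?B l) ?t x = 0" using bsym[of False l x] by simp_all
  qed
  have "?N (mv n (?B l) x) \<le> spectral_const l \<alpha> \<eta> \<rho> * sqrt \<alpha> ^ l"
  proof (rule nrm_mv_le_of_bil)
    show "\<bar>bil n (?B l) f x\<bar> \<le> spectral_const l \<alpha> \<eta> \<rho> * sqrt \<alpha> ^ l * ?N f" for f
      using restricted_bound[OF _ o, of f] Nx unfolding spectral_const_def by simp
    have "0 \<le> \<alpha> ^ l * ?\<epsilon>" using e1 e2 par by simp
    then have "0 \<le> \<rho>" using rho by linarith
    then show "0 \<le> spectral_const l \<alpha> \<eta> \<rho> * sqrt \<alpha> ^ l"
      unfolding spectral_const_def using pos par by simp
  qed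
  moreover have "?N (mv n (?B l) x) = sqrt (\<Sum>i<n. (\<Sum>j<n. saw_mat H l i j * x j)\<^sup>2)"
    unfolding nrm_def L2_set_def mv_def
    by (intro arg_cong[of _ _ sqrt] sum.cong refl arg_cong[of _ _ "\<lambda>y. y\<^sup>2"]) (simp add: saw)
  ultimately show ?thesis by simp
qed

section \<open>Union bound over the failure events\<close>

lemma mem_sum_ge:
  fixes f :: "'a \<Rightarrow> real"
  assumes "finite S" "\<And>x. x \<in> S \<Longrightarrow> 0 \<le> f x" "y \<in> S" "c \<le> f y"
  shows "c \<le> sum f S"
  using member_le_sum[OF assms(3,2,1)] assms(4) by (meson Diff_iff order_trans)

context hsbm_weights
begin

text \<open>The indicator of failure is at most the sum of all controlled quantities divided by
  their thresholds. The three summands of the bound come from the three kinds of conditions in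
  \<open>good\<close>.\<close>

lemma HE_bad_le:
  assumes T: "\<Theta> \<ge> 1" "2 * (real d * real l + 1) * \<Theta> \<le> real n"
    and W: "\<And>r. r \<in> {2 * 2 ^ k, 2, 4} \<Longrightarrow> wsum \<Theta> l r \<le> W0"
    and A: "\<alpha> \<le> A" "(A / \<alpha>) ^ (2 * 2 ^ k * l) \<le> 2" "1 \<le> \<alpha>"
    and pos: "0 < \<eta>" "0 < \<delta>" "0 < \<gamma>"
    and sg: "\<And>i. i < n \<Longrightarrow> \<bar>\<sigma> i\<bar> \<le> 1"
  shows "HE n d p (\<lambda>H. of_bool (\<not> good n d p \<sigma> k l \<eta> \<alpha> \<delta> \<gamma> H)) \<le>
     4 * (real l + 1) * real n * W0 / \<eta> ^ (2 * 2 ^ k) + 8 * real l * \<alpha> ^ l * W0 / (real n * \<delta>\<^sup>2)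
     + 2 * (real l + 1)\<^sup>2 * \<alpha> ^ (2 * l) * K\<^sup>2 * W0 / (\<Theta> * \<gamma>\<^sup>2)"
proof -
  let ?Kk = "2 ^ k :: nat"
  let ?c1 = "\<lambda>\<tau> s. ((\<eta> * (if \<tau> then sqrt \<alpha> else \<alpha>) ^ s) ^ ?Kk)\<^sup>2"
  let ?X1 = "\<lambda>\<tau> s H. (\<Sum>i<n. \<Sum>j<n. (mpow n (Wm n d p \<tau> s H) ?Kk i j)\<^sup>2)"
  let ?X2 = "\<lambda>s f g H. (\<Sum>i<n. \<Sum>j<n. f i * Wm n d p True s H i j * g j)\<^sup>2"
  let ?X3 = "\<lambda>s t H. (\<Sum>i<n. \<Sum>j<n. (Gm n d p s t H i j)\<^sup>2)"
  let ?c2 = "(real n * \<delta>)\<^sup>2" and ?c3 = "\<gamma>\<^sup>2"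
  let ?FS = "{\<lambda>_. 1, \<sigma>}"
  let ?P = "{(s, t). s \<le> l \<and> t \<le> l \<and> s + t \<le> l}"
  let ?S1 = "\<lambda>H. \<Sum>s\<le>l. \<Sum>\<tau>\<in>UNIV. inverse (?c1 \<tau> s) * ?X1 \<tau> s H"
  let ?S2 = "\<lambda>H. \<Sum>s\<in>{1..l}. \<Sum>f\<in>?FS. \<Sum>g\<in>?FS. inverse ?c2 * ?X2 s f g H"
  let ?S3 = "\<lambda>H. \<Sum>x\<in>?P. inverse ?c3 * ?X3 (fst x) (snd x) H"
  have finP: "finite ?P" by (rule finite_subset[of _ "{..l} \<times> {..l}"]) auto
  have c1: "0 < ?c1 \<tau> s" for \<tau> s using pos A(3) by auto
  have c2: "0 < ?c2" using pos n0 by simp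
  have c3: "0 < ?c3" using pos by simp
  have X0: "0 \<le> ?X1 \<tau> s H" "0 \<le> ?X2 s f g H" "0 \<le> ?X3 s t H" for \<tau> s t f g H
    by (auto intro!: sum_nonneg)
  have S0: "0 \<le> ?S1 H" "0 \<le> ?S2 H" "0 \<le> ?S3 H" for H
    using c1 c2 c3 X0 by (auto intro!: sum_nonneg mult_nonneg_nonneg simp: less_imp_le)
  have markov: "1 \<le> inverse c * X" if "\<not> X \<le> c" "0 < c" for c X :: real
    using that by (simp add: field_simps)
  have "of_bool (\<not> good n d p \<sigma> k l \<eta> \<alpha> \<delta> \<gamma> H) \<le> ?S1 H + ?S2 H + ?S3 H" for H
  proof (cases "good n d p \<sigma> k l \<eta> \<alpha> \<delta> \<gamma> H")
    case True
    then show ?thesis using S0[of H] by simp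
  next
    case False
    then consider s \<tau> where "s \<le> l" "\<not> ?X1 \<tau> s H \<le> ?c1 \<tau> s"
      | s f g where "s \<in> {1..l}" "f \<in> ?FS" "g \<in> ?FS" "\<not> ?X2 s f g H \<le> ?c2"
      | s t where "s \<le> l" "t \<le> l" "s + t \<le> l" "\<not> ?X3 s t H \<le> ?c3"
      unfolding good_def frob_def bil_def by blast
    then have "1 \<le> ?S1 H \<or> 1 \<le> ?S2 H \<or> 1 \<le> ?S3 H"
    proof cases
      case 1
      have "1 \<le> ?S1 H"
      proof (rule mem_sum_ge[of _ _ s])
        show "1 \<le> (\<Sum>\<tau>\<in>UNIV. inverse (?c1 \<tau> s) * ?X1 \<tau> s H)"
          by (rule mem_sum_ge[of _ _ \<tau>]) (use 1 markov c1 X0 less_imp_le[OF c1] in \<open>auto simp del: UNIV_bool\<close>)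
      qed (use 1 c1 X0 less_imp_le[OF c1] in \<open>auto intro!: sum_nonneg mult_nonneg_nonneg simp del: UNIV_bool\<close>)
      then show ?thesis by blast
    next
      case 2
      have "1 \<le> ?S2 H"
      proof (rule mem_sum_ge[of _ _ s])
        show "1 \<le> (\<Sum>f\<in>?FS. \<Sum>g\<in>?FS. inverse ?c2 * ?X2 s f g H)"
        proof (rule mem_sum_ge[of _ _ f])
          show "1 \<le> (\<Sum>g\<in>?FS. inverse ?c2 * ?X2 s f g H)"
            by (rule mem_sum_ge[of _ _ g]) (use 2 markov c2 in auto)
        qed (use 2 in \<open>auto intro!: sum_nonneg\<close>)
      qed (use 2 in \<open>auto intro!: sum_nonneg\<close>)
      then show ?thesis by blast
    next
      case 3
      have "1 \<le> ?S3 H"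
        by (rule mem_sum_ge[of _ _ "(s, t)"]) (use 3 markov c3 finP X0 in \<open>auto intro!: sum_nonneg mult_nonneg_nonneg\<close>)
      then show ?thesis by blast
    qed
    then show ?thesis using S0[of H] False by auto
  qed
  then have "HE n d p (\<lambda>H. of_bool (\<not> good n d p \<sigma> k l \<eta> \<alpha> \<delta> \<gamma> H)) \<le> HE n d p (\<lambda>H. ?S1 H + ?S2 H + ?S3 H)"
    using p_nonneg p_le1 by (intro HE_mono) auto
  also have "\<dots> = HE n d p ?S1 + HE n d p ?S2 + HE n d p ?S3"
    unfolding HE_def by (simp only: distrib_left sum.distrib)
  also have "HE n d p ?S1 = (\<Sum>s\<le>l. \<Sum>\<tau>\<in>UNIV. inverse (?c1 \<tau> s) * HE n d p (?X1 \<tau> s))"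
    by (simp only: HE_sum HE_cmult)
  also have "HE n d p ?S2 = (\<Sum>s\<in>{1..l}. \<Sum>f\<in>?FS. \<Sum>g\<in>?FS. inverse ?c2 * HE n d p (?X2 s f g))"
    by (simp only: HE_sum HE_cmult)
  also have "HE n d p ?S3 = (\<Sum>x\<in>?P. inverse ?c3 * HE n d p (?X3 (fst x) (snd x)))"
    by (simp only: HE_sum HE_cmult)
  finally have main: "HE n d p (\<lambda>H. of_bool (\<not> good n d p \<sigma> k l \<eta> \<alpha> \<delta> \<gamma> H)) \<le>
     (\<Sum>s\<le>l. \<Sum>\<tau>\<in>UNIV. inverse (?c1 \<tau> s) * HE n d p (?X1 \<tau> s)) +
     (\<Sum>s\<in>{1..l}. \<Sum>f\<in>?FS. \<Sum>g\<in>?FS. inverse ?c2 * HE n d p (?X2 s f g)) +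
     (\<Sum>x\<in>?P. inverse ?c3 * HE n d p (?X3 (fst x) (snd x)))" .
  have W0: "0 \<le> W0"
  proof -
    have "0 \<le> wsum \<Theta> l 2" unfolding wsum_def using T by (intro sum_nonneg tw_nonneg[of _ l]) (auto simp: walk_lists_def)
    then show ?thesis using W[of 2] by simp
  qed
  have Aal: "1 \<le> A / \<alpha>" using A by simp
  \<comment> \<open>The moments are bounded in terms of \<open>A\<close>, the thresholds in terms of
    \<alpha>; at the lengths in question the exchange costs a factor 2.\<close>
  have Apow: "A ^ m \<le> 2 * \<alpha> ^ m" if "m \<le> 2 * ?Kk * l" for m
  proof -
    have "(A / \<alpha>) ^ m \<le> (A / \<alpha>) ^ (2 * ?Kk * l)" using Aal that by (intro power_increasing)
    then have "(A / \<alpha>) ^ m \<le> 2" using A by linarith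
    then show ?thesis using A by (simp add: power_divide divide_simps)
  qed
  have K1: "1 \<le> ?Kk" by simp
  have t1: "inverse (?c1 \<tau> s) * HE n d p (?X1 \<tau> s) \<le> 2 * real n * W0 / \<eta> ^ (2 * ?Kk)" if s: "s \<le> l" for s \<tau>
  proof -
    let ?f = "if \<tau> then ?Kk * s else 2 * ?Kk * s"
    have "HE n d p (?X1 \<tau> s) \<le> A ^ ?f * real n * wsum \<Theta> l (2 * ?Kk)" by (rule HE_mpow_le[OF s T(1)]) simp
    also have "\<dots> \<le> (2 * \<alpha> ^ ?f) * real n * W0"
    proof -
      have "?f \<le> 2 * ?Kk * l" using s by (auto intro: mult_le_mono)
      then show ?thesis using Apow W[of "2 * ?Kk"] A W0 A1 T
        by (intro mult_mono Apow) (auto intro!: sum_nonneg tw_nonneg[of _ l] simp: wsum_def walk_lists_def)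
    qed
    finally have 1: "HE n d p (?X1 \<tau> s) \<le> (2 * \<alpha> ^ ?f) * real n * W0" .
    have 2: "?c1 \<tau> s = \<eta> ^ (2 * ?Kk) * \<alpha> ^ ?f"
    proof (cases \<tau>)
      case True
      have "((\<eta> * sqrt \<alpha> ^ s) ^ ?Kk)\<^sup>2 = (\<eta> ^ ?Kk)\<^sup>2 * ((sqrt \<alpha>)\<^sup>2) ^ (s * ?Kk)"
        by (simp add: power_mult_distrib power_mult[symmetric] mult_ac)
      then show ?thesis using True A by (simp add: power_mult[symmetric] mult_ac)
    next
      case False
      then show ?thesis by (simp add: power_mult_distrib power_mult[symmetric] mult_ac)
    qed
    have "inverse (?c1 \<tau> s) * HE n d p (?X1 \<tau> s) \<le> inverse (?c1 \<tau> s) * ((2 * \<alpha> ^ ?f) * real n * W0)"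
      using 1 c1[of \<tau> s] by (intro mult_left_mono) (auto simp: less_imp_le)
    also have "\<dots> = 2 * real n * W0 / \<eta> ^ (2 * ?Kk)"
      unfolding 2 using pos A by (simp add: field_simps)
    finally show ?thesis .
  qed
  have B1: "(\<Sum>s\<le>l. \<Sum>\<tau>\<in>UNIV. inverse (?c1 \<tau> s) * HE n d p (?X1 \<tau> s)) \<le> 4 * (real l + 1) * real n * W0 / \<eta> ^ (2 * ?Kk)"
  proof -
    have "(\<Sum>s\<le>l. \<Sum>\<tau>\<in>UNIV. inverse (?c1 \<tau> s) * HE n d p (?X1 \<tau> s)) \<le> (\<Sum>s\<le>l. \<Sum>\<tau>\<in>(UNIV :: bool set). 2 * real n * W0 / \<eta> ^ (2 * ?Kk))"
      by (intro sum_mono t1) auto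
    also have "\<dots> = 4 * (real l + 1) * real n * W0 / \<eta> ^ (2 * ?Kk)" by (simp add: algebra_simps)
    finally show ?thesis .
  qed
  have B2: "(\<Sum>s\<in>{1..l}. \<Sum>f\<in>?FS. \<Sum>g\<in>?FS. inverse ?c2 * HE n d p (?X2 s f g)) \<le> 8 * real l * \<alpha> ^ l * W0 / (real n * \<delta>\<^sup>2)"
  proof -
    let ?b = "inverse ?c2 * ((2 * \<alpha> ^ l) * real n * W0)"
    have b0: "0 \<le> ?b" using A W0 by simp
    have one: "inverse ?c2 * HE n d p (?X2 s f g) \<le> ?b" if s: "s \<in> {1..l}" and fg: "f \<in> ?FS" "g \<in> ?FS" for s f g
    proof -
      have "HE n d p (?X2 s f g) \<le> A ^ s * real n * wsum \<Theta> l 2"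
        using s fg sg by (intro HE_bilinear_le[OF _ _ T(1)]) auto
      also have "\<dots> \<le> (2 * \<alpha> ^ l) * real n * W0"
      proof -
        have "1 * l \<le> 2 * ?Kk * l" using K1 by (intro mult_le_mono1) simp
        then have "l \<le> 2 * ?Kk * l" by (simp only: mult_1)
        moreover have "s \<le> l" using s by simp
        ultimately have "s \<le> 2 * ?Kk * l" by (rule order_trans[rotated])
        then have "A ^ s \<le> 2 * \<alpha> ^ s" by (rule Apow)
        also have "\<dots> \<le> 2 * \<alpha> ^ l" using s A by (auto intro: power_increasing)
        finally show ?thesis using W[of 2] A W0 T
          by (intro mult_mono) (auto intro!: sum_nonneg tw_nonneg[of _ l] simp: wsum_def walk_lists_def)
      qed
      finally show ?thesis using c2 by (intro mult_left_mono) auto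
    qed
    have cFS: "real (card ?FS) \<le> 2" by (cases "\<sigma> = (\<lambda>_. 1)") (auto simp: card_insert_if)
    have "(\<Sum>s\<in>{1..l}. \<Sum>f\<in>?FS. \<Sum>g\<in>?FS. inverse ?c2 * HE n d p (?X2 s f g)) \<le> (\<Sum>s\<in>{1..l}. \<Sum>f\<in>?FS. \<Sum>g\<in>?FS. ?b)"
      by (intro sum_mono one)
    also have "\<dots> = real l * (real (card ?FS) * (real (card ?FS) * ?b))" by (simp only: sum_constant card_atLeastAtMost) simp
    also have "\<dots> \<le> real l * (2 * (2 * ?b))" using cFS W0 A by (intro mult_mono mult_nonneg_nonneg) auto
    also have "\<dots> = 8 * real l * \<alpha> ^ l * W0 / (real n * \<delta>\<^sup>2)"
      using n0 pos by (simp add: field_simps power2_eq_square)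
    finally show ?thesis .
  qed
  have B3: "(\<Sum>x\<in>?P. inverse ?c3 * HE n d p (?X3 (fst x) (snd x))) \<le> 2 * (real l + 1)\<^sup>2 * \<alpha> ^ (2 * l) * K\<^sup>2 * W0 / (\<Theta> * \<gamma>\<^sup>2)"
  proof -
    let ?b = "inverse ?c3 * ((2 * \<alpha> ^ (2 * l)) * (K\<^sup>2 / \<Theta>) * W0)"
    have b0: "0 \<le> ?b" using A W0 T by simp
    have one: "inverse ?c3 * HE n d p (?X3 (fst x) (snd x)) \<le> ?b" if x: "x \<in> ?P" for x
    proof -
      obtain s t where st: "x = (s, t)" "s \<le> l" "t \<le> l" "s + t \<le> l" using x by auto
      have "HE n d p (?X3 s t) \<le> A ^ (2 * (s + t)) * (K\<^sup>2 / \<Theta>) * wsum \<Theta> l 4"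
        using st T by (intro HE_Gm_le) auto
      also have "\<dots> \<le> (2 * \<alpha> ^ (2 * l)) * (K\<^sup>2 / \<Theta>) * W0"
      proof -
        have "2 * (s + t) \<le> 2 * l" using st by simp
        have "2 * (s + t) \<le> 2 * l * 1" using st by simp
        also have "\<dots> \<le> 2 * l * ?Kk" using K1 by (rule mult_le_mono2)
        also have "\<dots> = 2 * ?Kk * l" by (simp only: mult_ac)
        finally have le: "2 * (s + t) \<le> 2 * ?Kk * l" .
        have "A ^ (2 * (s + t)) \<le> 2 * \<alpha> ^ (2 * (s + t))" by (rule Apow[OF le])
        also have "\<dots> \<le> 2 * \<alpha> ^ (2 * l)" using \<open>2 * (s + t) \<le> 2 * l\<close> A by (intro mult_left_mono power_increasing) auto
        finally show ?thesis using W[of 4] A W0 T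
          by (intro mult_mono) (auto intro!: sum_nonneg tw_nonneg[of _ l] simp: wsum_def walk_lists_def)
      qed
      finally show ?thesis using c3 st by (intro mult_left_mono) auto
    qed
    have "card ?P \<le> card ({..l} \<times> {..l})" by (rule card_mono) auto
    then have "real (card ?P) \<le> real ((l + 1) * (l + 1))" by (intro of_nat_mono) simp
    then have cP: "real (card ?P) \<le> (real l + 1)\<^sup>2" by (simp add: power2_eq_square algebra_simps)
    have "(\<Sum>x\<in>?P. inverse ?c3 * HE n d p (?X3 (fst x) (snd x))) \<le> (\<Sum>x\<in>?P. ?b)" by (intro sum_mono one)
    also have "\<dots> = real (card ?P) * ?b" by (rule sum_constant)
    also have "\<dots> \<le> (real l + 1)\<^sup>2 * ?b" using cP b0 by (rule mult_right_mono)
    also have "\<dots> = 2 * (real l + 1)\<^sup>2 * \<alpha> ^ (2 * l) * K\<^sup>2 * W0 / (\<Theta> * \<gamma>\<^sup>2)"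
      using T pos by (simp add: field_simps)
    finally show ?thesis .
  qed
  show ?thesis using main B1 B2 B3 by linarith
qed

end

section \<open>Binomial estimates for edge counts\<close>

lemma power_diff_prod_le:
  fixes z :: "nat \<Rightarrow> real"
  assumes "\<And>i. i < k \<Longrightarrow> \<bar>z i\<bar> \<le> 1" "\<bar>x\<bar> \<le> 1" "\<And>i. i < k \<Longrightarrow> \<bar>z i - x\<bar> \<le> \<epsilon>"
  shows "\<bar>(\<Prod>i<k. z i) - x ^ k\<bar> \<le> real k * \<epsilon>"
proof -
  have "norm ((\<Prod>i<k. z i) - (\<Prod>i<k. x)) \<le> (\<Sum>i<k. norm (z i - x))"
    using assms by (intro norm_prod_diff) auto
  also have "\<dots> \<le> (\<Sum>i<k. \<epsilon>)" using assms by (intro sum_mono) auto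
  finally show ?thesis by simp
qed

text \<open>With \<open>k = d - 2\<close> this is n times the number of edges through two given
  vertices inside a set of size \<open>N\<close>, in the normalisation of \<open>hprob\<close>. The
  product form exposes factors close to N/n.\<close>

lemma binomial_ratio:
  assumes "Suc k \<le> n"
  shows "real n * real ((N - 2) choose k) / real (n choose Suc k) =
     real (Suc k) * (\<Prod>i<k. real (N - 2 - i) / real (n - 1 - i))"
proof -
  have ff: "real (m choose k) * fact k = (\<Prod>i<k. real (m - i))" for m k
  proof (induction k arbitrary: m)
    case (Suc k)
    show ?case
    proof (cases m)
      case (Suc m')
      have "real (Suc m' choose Suc k) * fact (Suc k) = real (Suc m') * (real (m' choose k) * fact k)"
      proof -
        have "Suc k * (Suc m' choose Suc k) = Suc m' * (m' choose k)" by (metis Suc_times_binomial_eq mult.commute)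
        then have "real (Suc k) * real (Suc m' choose Suc k) = real (Suc m') * real (m' choose k)"
          by (metis of_nat_mult)
        then show ?thesis by (simp add: mult_ac)
      qed
      also have "\<dots> = (\<Prod>i<Suc k. real (Suc m' - i))"
        by (simp only: Suc.IH prod.lessThan_Suc_shift) simp
      finally show ?thesis using Suc by simp
    qed (simp add: prod.lessThan_Suc_shift del: prod.lessThan_Suc)
  qed simp
  have n1: "real (n choose Suc k) * fact (Suc k) = real n * (\<Prod>i<k. real (n - 1 - i))"
    unfolding ff by (subst prod.lessThan_Suc_shift) simp
  have nz: "(\<Prod>i<k. real (n - 1 - i)) \<noteq> 0" using assms by auto
  have np: "real (n choose Suc k) \<noteq> 0" "real n \<noteq> 0" using assms by auto
  have gen1: "a * b / c = a * (b * f) * S / (c * (S * f))" if "c \<noteq> 0" "f \<noteq> 0" "S \<noteq> 0" for a b c f S :: real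
    using that by (simp add: field_simps)
  have gen2: "a * P * S / (a * Q) = S * (P / Q)" if "a \<noteq> 0" for a P Q S :: real
    using that by simp
  have "real n * real ((N - 2) choose k) / real (n choose Suc k) =
     real n * (real ((N - 2) choose k) * fact k) * real (Suc k) / (real (n choose Suc k) * fact (Suc k))"
    unfolding fact_Suc by (rule gen1) (use np in auto)
  also have "\<dots> = real (Suc k) * ((\<Prod>i<k. real (N - 2 - i)) / (\<Prod>i<k. real (n - 1 - i)))"
    unfolding ff[of "N - 2"] n1 by (rule gen2[OF np(2)])
  also have "\<dots> = real (Suc k) * (\<Prod>i<k. real (N - 2 - i) / real (n - 1 - i))"
    by (simp add: prod_dividef)
  finally show ?thesis .
qed

text \<open>Used with \<open>x = 1\<close> for all edges and with \<open>x = 1 / 2\<close> for the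
  edges inside one spin class. All factors are at most 1, so the deviations of the \<open>k\<close>
  factors from \<open>x\<close> simply add up.\<close>

lemma binomial_ratio_approx:
  assumes n: "2 * (k + 2) \<le> n" and N: "N \<le> n" "k + 2 \<le> N" and x: "0 \<le> x" "x \<le> 1"
    and D: "\<bar>real N - x * real n\<bar> \<le> D"
  shows "\<bar>real n * real ((N - 2) choose k) / real (n choose Suc k) - real (Suc k) * x ^ k\<bar>
     \<le> real (Suc k) * (real k * (2 * (D + real k + 2) / real n))"
proof -
  have D0: "0 \<le> D" using D by linarith
  have z: "\<bar>real (N - 2 - i) / real (n - 1 - i)\<bar> \<le> 1"
    "\<bar>real (N - 2 - i) / real (n - 1 - i) - x\<bar> \<le> 2 * (D + real k + 2) / real n" if i: "i < k" for i
  proof -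
    have p: "real (n - 1 - i) = real n - 1 - real i" "real (N - 2 - i) = real N - 2 - real i"
      using i n N by (auto simp: of_nat_diff)
    have den: "real n / 2 \<le> real (n - 1 - i)" "0 < real (n - 1 - i)" using p i n by auto
    show "\<bar>real (N - 2 - i) / real (n - 1 - i)\<bar> \<le> 1" using den p N by (simp add: divide_simps)
    have "real (N - 2 - i) / real (n - 1 - i) - x = (real (N - 2 - i) - x * real (n - 1 - i)) / real (n - 1 - i)"
      using den by (simp add: field_simps)
    moreover have "\<bar>real (N - 2 - i) - x * real (n - 1 - i)\<bar> \<le> D + real k + 2"
    proof -
      have "real (N - 2 - i) - x * real (n - 1 - i) = (real N - x * real n) - (2 + real i) + x * (1 + real i)"
        unfolding p by (simp add: algebra_simps)
      moreover have "0 \<le> x * (1 + real i)" "x * (1 + real i) \<le> 1 + real i"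
        using x mult_right_mono[OF x(2), of "1 + real i"] by simp_all
      ultimately show ?thesis using D i by linarith
    qed
    ultimately have "\<bar>real (N - 2 - i) / real (n - 1 - i) - x\<bar> \<le> (D + real k + 2) / real (n - 1 - i)"
      using den by (simp add: divide_right_mono)
    also have "\<dots> \<le> (D + real k + 2) / (real n / 2)"
      using den D0 n by (intro divide_left_mono) auto
    finally show "\<bar>real (N - 2 - i) / real (n - 1 - i) - x\<bar> \<le> 2 * (D + real k + 2) / real n" by (simp add: field_simps)
  qed
  have "\<bar>(\<Prod>i<k. real (N - 2 - i) / real (n - 1 - i)) - x ^ k\<bar> \<le> real k * (2 * (D + real k + 2) / real n)"
    using z x by (intro power_diff_prod_le) auto
  then have "real (Suc k) * \<bar>(\<Prod>i<k. real (N - 2 - i) / real (n - 1 - i)) - x ^ k\<bar> \<le> real (Suc k) * (real k * (2 * (D + real k + 2) / real n))"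
    by (intro mult_left_mono) auto
  then show ?thesis
    using n by (subst binomial_ratio) (auto simp: abs_mult right_diff_distrib[symmetric])
qed

lemma card_dsets_containing:
  assumes "T \<subseteq> S" "S \<subseteq> {..<n}" "card T \<le> d"
  shows "card {e \<in> dsets n d. T \<subseteq> e \<and> e \<subseteq> S} = (card S - card T) choose (d - card T)"
proof -
  have fS: "finite S" using assms(2) finite_subset by blast
  have fT: "finite T" using assms(1) fS finite_subset by blast
  have "bij_betw (\<lambda>e. e - T) {e \<in> dsets n d. T \<subseteq> e \<and> e \<subseteq> S} {f. f \<subseteq> S - T \<and> card f = d - card T}"
  proof (rule bij_betw_byWitness[where f' = "\<lambda>f. f \<union> T"])
    show "(\<lambda>e. e - T) ` {e \<in> dsets n d. T \<subseteq> e \<and> e \<subseteq> S} \<subseteq> {f. f \<subseteq> S - T \<and> card f = d - card T}"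
      using fT by (auto simp: dsets_def card_Diff_subset)
    show "(\<lambda>f. f \<union> T) ` {f. f \<subseteq> S - T \<and> card f = d - card T} \<subseteq> {e \<in> dsets n d. T \<subseteq> e \<and> e \<subseteq> S}"
    proof
      fix e assume "e \<in> (\<lambda>f. f \<union> T) ` {f. f \<subseteq> S - T \<and> card f = d - card T}"
      then obtain f where f: "f \<subseteq> S - T" "card f = d - card T" "e = f \<union> T" by blast
      have "card (f \<union> T) = card f + card T"
        using f fS fT by (intro card_Un_disjoint) (auto intro: finite_subset)
      then show "e \<in> {e \<in> dsets n d. T \<subseteq> e \<and> e \<subseteq> S}" using f assms by (auto simp: dsets_def)
    qed
  qed auto
  then have "card {e \<in> dsets n d. T \<subseteq> e \<and> e \<subseteq> S} = card {f. f \<subseteq> S - T \<and> card f = d - card T}"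
    by (rule bij_betw_same_card)
  also have "\<dots> = card (S - T) choose (d - card T)" using fS by (intro n_subsets) auto
  also have "card (S - T) = card S - card T" using assms(1) fT by (rule card_Diff_subset[rotated])
  finally show ?thesis .
qed

section \<open>The stochastic block model\<close>

text \<open>An edge through \<open>i\<close> has constant spin iff it lies in the spin class of
  \<open>i\<close>. So every edge gets weight \<open>hprob b d n\<close>, and the edges inside that
  class get the difference on top; there are none if \<open>T\<close> has mixed spins.\<close>

lemma sum_edge_prob_containing:
  assumes T: "T \<subseteq> {..<n}" "card T \<le> d" "T \<noteq> {}" and i: "i \<in> T"
  shows "(\<Sum>e\<in>{e \<in> dsets n d. T \<subseteq> e}. edge_prob a b d n \<sigma> e) =
     hprob b d n * real ((n - card T) choose (d - card T)) +
     (if \<forall>j\<in>T. \<sigma> j = \<sigma> i then (hprob a d n - hprob b d n) *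
        real ((card {v\<in>{..<n}. \<sigma> v = \<sigma> i} - card T) choose (d - card T)) else 0)"
proof -
  let ?S = "{v\<in>{..<n}. \<sigma> v = \<sigma> i}"
  let ?F = "{e \<in> dsets n d. T \<subseteq> e}"
  have fF: "finite ?F" by (rule finite_subset[OF _ finite_dsets[of n d]]) auto
  have mono: "(\<forall>u\<in>e. \<forall>v\<in>e. \<sigma> u = \<sigma> v) \<longleftrightarrow> e \<subseteq> ?S" if "e \<in> ?F" for e
  proof -
    have "i \<in> e" "e \<subseteq> {..<n}" using that i by (auto simp: dsets_def)
    show ?thesis
    proof
      assume "\<forall>u\<in>e. \<forall>v\<in>e. \<sigma> u = \<sigma> v"
      then show "e \<subseteq> ?S" using \<open>i \<in> e\<close> \<open>e \<subseteq> {..<n}\<close> by blast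
    next
      assume "e \<subseteq> ?S"
      then have "\<sigma> u = \<sigma> i" if "u \<in> e" for u using that by blast
      then show "\<forall>u\<in>e. \<forall>v\<in>e. \<sigma> u = \<sigma> v" by simp
    qed
  qed
  have "(\<Sum>e\<in>?F. edge_prob a b d n \<sigma> e) = (\<Sum>e\<in>?F. hprob b d n + (hprob a d n - hprob b d n) * of_bool (e \<subseteq> ?S))"
    by (intro sum.cong refl) (auto simp: edge_prob_def mono)
  also have "\<dots> = hprob b d n * real (card ?F) + (hprob a d n - hprob b d n) * real (card (?F \<inter> {e. e \<subseteq> ?S}))"
    using fF by (simp add: sum.distrib sum_distrib_left[symmetric])
  also have "card ?F = (n - card T) choose (d - card T)"
  proof -
    have "?F = {e \<in> dsets n d. T \<subseteq> e \<and> e \<subseteq> {..<n}}" by (auto simp: dsets_def)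
    then show ?thesis using card_dsets_containing[OF T(1) order_refl T(2)] by simp
  qed
  also have "?F \<inter> {e. e \<subseteq> ?S} = {e \<in> dsets n d. T \<subseteq> e \<and> e \<subseteq> ?S}" by auto
  finally have eq: "(\<Sum>e\<in>?F. edge_prob a b d n \<sigma> e) = hprob b d n * real ((n - card T) choose (d - card T)) +
     (hprob a d n - hprob b d n) * real (card {e \<in> dsets n d. T \<subseteq> e \<and> e \<subseteq> ?S})" .
  show ?thesis
  proof (cases "\<forall>j\<in>T. \<sigma> j = \<sigma> i")
    case True
    then have "card {e \<in> dsets n d. T \<subseteq> e \<and> e \<subseteq> ?S} = (card ?S - card T) choose (d - card T)"
      using T by (intro card_dsets_containing) auto
    then show ?thesis unfolding eq using True by simp
  next
    case False
    then have c0: "{e \<in> dsets n d. T \<subseteq> e \<and> e \<subseteq> ?S} = {}" by auto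
    show ?thesis unfolding eq c0 if_not_P[OF False] by simp
  qed
qed

lemma spin_class_card:
  assumes "\<And>i. i < n \<Longrightarrow> \<sigma> i \<in> {-1, 1 :: real}" "s \<in> {-1, 1}"
  shows "real (card {v\<in>{..<n}. \<sigma> v = s}) = (real n + s * (\<Sum>i<n. \<sigma> i)) / 2"
proof -
  have "real (card {v\<in>{..<n}. \<sigma> v = s}) = (\<Sum>v<n. if \<sigma> v = s then 1 else 0)"
    by (simp add: sum.If_cases Int_def)
  also have "\<dots> = (\<Sum>v<n. (1 + s * \<sigma> v) / 2)"
  proof (rule sum.cong[OF refl])
    fix v assume "v \<in> {..<n}"
    then have "\<sigma> v = -1 \<or> \<sigma> v = 1" using assms(1)[of v] by simp
    then show "(if \<sigma> v = s then 1 else 0) = (1 + s * \<sigma> v) / 2" using assms(2) by auto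
  qed
  also have "\<dots> = (real n + s * (\<Sum>i<n. \<sigma> i)) / 2"
    by (simp add: sum_divide_distrib[symmetric] sum.distrib sum_distrib_left)
  finally show ?thesis .
qed

text \<open>The mean matrix is modelled by \<alpha> plus \<beta> times the product of two spins,
  over n. So \<alpha> - \<beta> must be the value for unequal spins, and 2 \<beta> the surplus for
  equal ones.\<close>

lemma alpha_beta_eqs:
  assumes "d \<ge> 2"
  shows "alpha_par d a b - beta_par d a b = real (d - 1) * b"
    and "2 * beta_par d a b = (a - b) * (real (d - 1) * (1 / 2) ^ (d - 2))"
proof -
  obtain k where k: "d = Suc (Suc k)" using assms by (metis add_2_eq_Suc le_Suc_ex)
  show "alpha_par d a b - beta_par d a b = real (d - 1) * b"
    unfolding alpha_par_def beta_par_def diff_divide_distrib[symmetric] by (simp add: field_simps)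
  show "2 * beta_par d a b = (a - b) * (real (d - 1) * (1 / 2) ^ (d - 2))"
    unfolding beta_par_def k by (simp add: field_simps power_one_over)
qed

lemma Ab_approx:
  assumes d: "d \<ge> 3" and ab: "a \<ge> b" "b > 0" and n: "2 * d \<le> n"
    and sg: "\<And>i. i < n \<Longrightarrow> \<sigma> i \<in> {-1, 1}" "\<bar>\<Sum>i<n. \<sigma> i\<bar> \<le> 2 * D" "real d + D \<le> real n / 2"
    and ij: "i < n" "j < n" "i \<noteq> j"
  shows "\<bar>Ab n d (edge_prob a b d n \<sigma>) i j - (alpha_par d a b + beta_par d a b * \<sigma> i * \<sigma> j) / real n\<bar>
     \<le> (2 * a * (real d)\<^sup>2 * (D + real d) / real n) / real n"
proof -
  define k where "k = d - 2"
  have k: "d = k + 2" "d - 1 = Suc k" "d - 2 = k" using d by (auto simp: k_def)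
  have D0: "0 \<le> D" using sg(2) by linarith
  have nr: "0 < real n" using n d by simp
  let ?al = "alpha_par d a b" and ?be = "beta_par d a b"
  let ?C = "real (n choose Suc k)"
  let ?N = "card {v\<in>{..<n}. \<sigma> v = \<sigma> i}"
  let ?err = "real (Suc k) * (real k * (2 * (D + real k + 2) / real n))"
  let ?q1 = "real n * real ((n - 2) choose k) / ?C" and ?q2 = "real n * real ((?N - 2) choose k) / ?C"
  have T: "{e \<in> dsets n d. i \<in> e \<and> j \<in> e} = {e \<in> dsets n d. {i, j} \<subseteq> e}" by auto
  have si: "\<sigma> i \<in> {-1, 1}" "\<sigma> j \<in> {-1, 1}" using sg ij by auto
  have "Ab n d (edge_prob a b d n \<sigma>) i j = hprob b d n * real ((n - 2) choose k) +
     (if \<sigma> j = \<sigma> i then (hprob a d n - hprob b d n) * real ((?N - 2) choose k) else 0)"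
  proof -
    have cT: "card {i, j} = 2" using ij by simp
    have "(\<Sum>e\<in>{e \<in> dsets n d. {i, j} \<subseteq> e}. edge_prob a b d n \<sigma> e) =
       hprob b d n * real ((n - card {i, j}) choose (d - card {i, j})) +
       (if \<forall>v\<in>{i, j}. \<sigma> v = \<sigma> i then (hprob a d n - hprob b d n) * real ((?N - card {i, j}) choose (d - card {i, j})) else 0)"
      using ij d cT by (intro sum_edge_prob_containing) auto
    moreover have "(\<forall>v\<in>{i, j}. \<sigma> v = \<sigma> i) \<longleftrightarrow> \<sigma> j = \<sigma> i" by simp
    ultimately show ?thesis unfolding Ab_def T cT k(3) if_not_P[OF ij(3)] by (simp only:)
  qed
  then have Ab: "real n * Ab n d (edge_prob a b d n \<sigma>) i j = b * ?q1 + (if \<sigma> j = \<sigma> i then (a - b) * ?q2 else 0)"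
    unfolding hprob_def k by (simp add: algebra_simps diff_divide_distrib)
  have q1: "\<bar>?q1 - real (Suc k) * 1 ^ k\<bar> \<le> ?err"
    by (rule binomial_ratio_approx) (use n k D0 in auto)
  have N: "real ?N = (real n + \<sigma> i * (\<Sum>i<n. \<sigma> i)) / 2" by (rule spin_class_card[OF sg(1) si(1)])
  have sN: "\<bar>\<sigma> i * (\<Sum>i<n. \<sigma> i)\<bar> \<le> 2 * D" using si sg(2) by auto
  have q2: "\<bar>?q2 - real (Suc k) * (1 / 2) ^ k\<bar> \<le> ?err"
  proof (rule binomial_ratio_approx)
    show "\<bar>real ?N - 1 / 2 * real n\<bar> \<le> D" using N sN by (simp add: abs_le_iff)
    have "real (k + 2) \<le> real ?N" using N sN sg(3) k by (simp add: abs_le_iff)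
    then show "k + 2 \<le> ?N" by linarith
    have "?N \<le> card {..<n}" by (rule card_mono) auto
    then show "?N \<le> n" by simp
  qed (use n k in auto)
  have e0: "0 \<le> ?err" using D0 by simp
  have main: "\<bar>real n * Ab n d (edge_prob a b d n \<sigma>) i j - (?al + ?be * \<sigma> i * \<sigma> j)\<bar> \<le> a * ?err"
  proof (cases "\<sigma> j = \<sigma> i")
    case False
    then have ss: "\<sigma> i * \<sigma> j = -1" using si by auto
    have "real n * Ab n d (edge_prob a b d n \<sigma>) i j - (?al + ?be * \<sigma> i * \<sigma> j) = b * (?q1 - real (Suc k) * 1 ^ k)"
    proof -
      have "real n * Ab n d (edge_prob a b d n \<sigma>) i j = b * ?q1" using Ab False by simp
      moreover have "?be * \<sigma> i * \<sigma> j = - ?be" using ss by (simp add: mult.assoc)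
      moreover have "?al - ?be = real (Suc k) * b" using alpha_beta_eqs(1)[of d a b, unfolded k(2)] d by linarith
      ultimately show ?thesis by (simp add: right_diff_distrib mult.commute)
    qed
    then have "\<bar>real n * Ab n d (edge_prob a b d n \<sigma>) i j - (?al + ?be * \<sigma> i * \<sigma> j)\<bar> = b * \<bar>?q1 - real (Suc k) * 1 ^ k\<bar>"
      using ab by (simp add: abs_mult)
    also have "\<dots> \<le> a * ?err" using q1 ab e0 by (intro mult_mono) auto
    finally show ?thesis .
  next
    case True
    then have ss: "\<sigma> i * \<sigma> j = 1" using si by auto
    have "?al + ?be * (\<sigma> i * \<sigma> j) = (?al - ?be) + 2 * ?be" unfolding ss by simp
    also have "\<dots> = b * real (Suc k) + (a - b) * (real (Suc k) * (1 / 2) ^ k)"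
      using alpha_beta_eqs[of d a b] d k by (simp add: mult.commute)
    finally have "real n * Ab n d (edge_prob a b d n \<sigma>) i j - (?al + ?be * \<sigma> i * \<sigma> j) =
       b * (?q1 - real (Suc k) * 1 ^ k) + (a - b) * (?q2 - real (Suc k) * (1 / 2) ^ k)"
    proof -
      assume "?al + ?be * (\<sigma> i * \<sigma> j) = b * real (Suc k) + (a - b) * (real (Suc k) * (1 / 2) ^ k)"
      moreover have "real n * Ab n d (edge_prob a b d n \<sigma>) i j = b * ?q1 + (a - b) * ?q2" using Ab True by simp
      ultimately show ?thesis by (simp add: right_diff_distrib mult.assoc)
    qed
    also have "\<bar>\<dots>\<bar> \<le> b * \<bar>?q1 - real (Suc k) * 1 ^ k\<bar> + (a - b) * \<bar>?q2 - real (Suc k) * (1 / 2) ^ k\<bar>"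
      using ab by (intro order_trans[OF abs_triangle_ineq]) (simp add: abs_mult)
    also have "\<dots> \<le> b * ?err + (a - b) * ?err" using q1 q2 ab by (intro add_mono mult_left_mono) auto
    also have "\<dots> = a * ?err"
    proof -
      have "b * e + (a - b) * e = a * e" for e by (simp add: left_diff_distrib)
      then show ?thesis .
    qed
    finally show ?thesis .
  qed
  have "?err = real (Suc k) * real k * (2 * (D + real k + 2) / real n)" by simp
  also have "\<dots> \<le> real d * real d * (2 * (D + real d) / real n)"
    using k nr D0 by (intro mult_mono divide_right_mono) auto
  finally have "a * ?err \<le> a * (real d * real d * (2 * (D + real d) / real n))" using ab by (intro mult_left_mono) auto
  then have "\<bar>real n * Ab n d (edge_prob a b d n \<sigma>) i j - (?al + ?be * \<sigma> i * \<sigma> j)\<bar> \<le> 2 * a * (real d)\<^sup>2 * (D + real d) / real n"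
    using main by (simp add: power2_eq_square mult_ac)
  then have "\<bar>real n * Ab n d (edge_prob a b d n \<sigma>) i j - (?al + ?be * \<sigma> i * \<sigma> j)\<bar> / real n \<le> (2 * a * (real d)\<^sup>2 * (D + real d) / real n) / real n"
    using nr by (intro divide_right_mono) auto
  moreover have "\<bar>real n * Ab n d (edge_prob a b d n \<sigma>) i j - (?al + ?be * \<sigma> i * \<sigma> j)\<bar> / real n =
     \<bar>Ab n d (edge_prob a b d n \<sigma>) i j - (?al + ?be * \<sigma> i * \<sigma> j) / real n\<bar>"
  proof -
    have "\<bar>real n * x - y\<bar> / real n = \<bar>x - y / real n\<bar>" for x y :: real
    proof -
      have "x - y / real n = (real n * x - y) / real n" using nr by (simp add: field_simps)
      then show ?thesis using nr by simp
    qed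
    then show ?thesis .
  qed
  ultimately show ?thesis by simp
qed

text \<open>Compares the normalisation of \<open>hprob\<close> with a count smaller by a factor of
  order n^2; it yields both the decay in \<open>codeg3\<close> and the bound of \<open>hprob\<close>
  by 1.\<close>

lemma binomial_two_step:
  assumes "d \<ge> 3" "d \<le> n"
  shows "real (n choose (d - 1)) * (real (d - 1) * real (d - 2)) = real n * real (n - 1) * real ((n - 2) choose (d - 3))"
proof -
  have "d = Suc (Suc (Suc (d - 3)))" "n = Suc (Suc (n - 2))" using assms by linarith+
  then obtain k m where k: "d = Suc (Suc (Suc k))" and m: "n = Suc (Suc m)" by blast
  have 1: "Suc (Suc k) * (Suc (Suc m) choose Suc (Suc k)) = Suc (Suc m) * (Suc m choose Suc k)"
    by (metis Suc_times_binomial_eq mult.commute)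
  have 2: "Suc k * (Suc m choose Suc k) = Suc m * (m choose k)"
    by (metis Suc_times_binomial_eq mult.commute)
  have "(Suc (Suc m) choose Suc (Suc k)) * (Suc (Suc k) * Suc k) = Suc (Suc m) * Suc m * (m choose k)"
    using 1 2 by (metis mult.assoc mult.commute)
  then have "real ((Suc (Suc m) choose Suc (Suc k)) * (Suc (Suc k) * Suc k)) = real (Suc (Suc m) * Suc m * (m choose k))" by (rule arg_cong)
  moreover have "d - 1 = Suc (Suc k)" "d - 2 = Suc k" "d - 3 = k" "n - 1 = Suc m" "n - 2 = m"
    using k m by simp_all
  ultimately show ?thesis by (simp only: m of_nat_mult)
qed

lemma edge_prob_le: "a \<ge> b \<Longrightarrow> edge_prob a b d n \<sigma> e \<le> hprob a d n"
  by (auto simp: edge_prob_def hprob_def divide_right_mono)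

lemma edge_prob_nonneg: "a \<ge> b \<Longrightarrow> b > 0 \<Longrightarrow> 0 \<le> edge_prob a b d n \<sigma> e"
  by (auto simp: edge_prob_def hprob_def)

lemma hprob_le_1:
  assumes "d \<ge> 3" "d \<le> n" "a * (real d)\<^sup>2 \<le> real (n - 1)"
  shows "hprob a d n \<le> 1"
proof -
  have "1 \<le> (n - 2) choose (d - 3)" using assms by (simp add: Suc_leI)
  then have "real n * real (n - 1) * 1 \<le> real n * real (n - 1) * real ((n - 2) choose (d - 3))"
    by (intro mult_left_mono) auto
  also have "\<dots> = real (n choose (d - 1)) * (real (d - 1) * real (d - 2))"
    using binomial_two_step[of d n] assms by simp
  also have "\<dots> \<le> real (n choose (d - 1)) * (real d)\<^sup>2"
    unfolding power2_eq_square by (intro mult_left_mono mult_mono) auto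
  finally have C1: "real (n - 1) * real n \<le> real (n choose (d - 1)) * (real d)\<^sup>2" by (simp add: mult.commute)
  have "a * (real d)\<^sup>2 \<le> real (n - 1) * 1" using assms by simp
  also have "\<dots> \<le> real (n - 1) * real n" using assms by (intro mult_left_mono) auto
  also note C1
  finally have "a \<le> real (n choose (d - 1))" using assms by simp
  moreover have "0 < real (n choose (d - 1))" using assms by simp
  ultimately show ?thesis by (simp add: hprob_def)
qed

text \<open>The degree bound exceeds \<alpha> by two errors: the spin imbalance, which acts through
  \<beta>, and the error \<open>E\<close> in the entries of the mean matrix.\<close>

lemma hsbm_weights_edge_prob:
  assumes d: "d \<ge> 3" and ab: "a \<ge> b" "b > 0" and n: "2 * d \<le> n" "a * (real d)\<^sup>2 \<le> real (n - 1)"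
    and sg: "\<And>i. i < n \<Longrightarrow> \<sigma> i \<in> {-1, 1}" "\<bar>\<Sum>i<n. \<sigma> i\<bar> \<le> 2 * D" "real d + D \<le> real n / 2"
    and E: "2 * a * (real d)\<^sup>2 * (D + real d) / real n \<le> E" "E \<le> 1"
    and al: "1 \<le> alpha_par d a b"
  shows "hsbm_weights n d (edge_prob a b d n \<sigma>)
     (alpha_par d a b + 2 * beta_par d a b * D / real n + E)
     (alpha_par d a b + beta_par d a b + 1 + 2 * a * (real d)\<^sup>2)"
proof -
  let ?p = "edge_prob a b d n \<sigma>" and ?al = "alpha_par d a b" and ?be = "beta_par d a b"
  let ?K = "?al + ?be + 1 + 2 * a * (real d)\<^sup>2"
  have D0: "0 \<le> D" using sg(2) by linarith
  have nr: "0 < real n" "n > 1" using n d by auto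
  have E0: "0 \<le> E" using E D0 ab by (smt (verit) divide_nonneg_nonneg mult_nonneg_nonneg of_nat_0_le_iff zero_le_power2)
  have be: "0 \<le> ?be" "?be \<le> ?al"
  proof -
    show "0 \<le> ?be" using ab by (simp add: beta_par_def)
    have "0 \<le> real (d - 1) * b" using ab by simp
    then show "?be \<le> ?al" using alpha_beta_eqs(1)[of d a b] d by linarith
  qed
  have a0: "0 < a" using ab by simp
  have approx: "\<bar>Ab n d ?p i j - (?al + ?be * \<sigma> i * \<sigma> j) / real n\<bar> \<le> E / real n"
    if "i < n" "j < n" "i \<noteq> j" for i j
    using Ab_approx[OF d ab n(1) sg that] E(1) nr by (meson divide_right_mono less_imp_le order_trans)
  have ch: "(d - 1) * (d - 2) \<le> d * d" by (intro mult_mono) auto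
  have C0: "0 < real (n choose (d - 1))" using n d by simp
  have p1: "hprob a d n \<le> 1" using d n by (intro hprob_le_1) auto
  show ?thesis
  proof
    show "d \<ge> 2" "n > 0" using d nr by auto
    show "0 \<le> ?p e" for e using edge_prob_nonneg ab by blast
    show "?p e \<le> 1" for e using edge_prob_le[OF ab(1), of d n \<sigma> e] p1 by simp
    show "?al + 2 * ?be * D / real n + E \<ge> 1" using al be D0 E0 nr by (smt (verit) divide_nonneg_nonneg mult_nonneg_nonneg of_nat_0_le_iff)
    show "0 \<le> ?K" using be al a0 by (smt (verit) mult_nonneg_nonneg zero_le_power2)
    have Kn: "(?al + ?be + E) / real n \<le> ?K / real n"
    proof (rule divide_right_mono)
      have "0 \<le> 2 * a * (real d)\<^sup>2" using a0 by simp
      then show "?al + ?be + E \<le> ?K" using E(2) by linarith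
    qed simp
    have Abp: "(\<Sum>e\<in>{e \<in> dsets n d. v \<in> e \<and> x \<in> e}. ?p e) = Ab n d ?p v x" if "v \<noteq> x" for v x
      using that by (simp add: Ab_def)
    show "(\<Sum>e\<in>{e \<in> dsets n d. v \<in> e \<and> x \<in> e}. ?p e) \<le> ?K / real n" if vx: "v \<noteq> x" for v x
    proof (cases "v < n \<and> x < n")
      case True
      have "\<sigma> v * \<sigma> x \<le> 1" using sg(1)[of v] sg(1)[of x] True by auto
      then have "?be * (\<sigma> v * \<sigma> x) \<le> ?be * 1" using be by (intro mult_left_mono)
      then have "(?al + ?be * \<sigma> v * \<sigma> x) / real n + E / real n \<le> (?al + ?be + E) / real n"
        unfolding add_divide_distrib[symmetric] using nr by (intro divide_right_mono) (auto simp: mult.assoc)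
      moreover have "Ab n d ?p v x \<le> (?al + ?be * \<sigma> v * \<sigma> x) / real n + E / real n"
        using approx[of v x] True vx by (simp add: abs_le_iff)
      ultimately show ?thesis using Kn unfolding Abp[OF vx] by linarith
    next
      case False
      then have em: "{e \<in> dsets n d. v \<in> e \<and> x \<in> e} = {}" by (auto simp: dsets_def)
      show ?thesis unfolding em using \<open>0 \<le> ?K\<close> by simp
    qed
    show "real (d - 1) * (\<Sum>e\<in>{e \<in> dsets n d. v \<in> e}. ?p e) \<le> ?al + 2 * ?be * D / real n + E" if v: "v < n" for v
    proof -
      let ?F = "{e \<in> dsets n d. v \<in> e}"
      have fF: "finite ?F" by (rule finite_subset[OF _ finite_dsets[of n d]]) auto
      \<comment> \<open>An edge at \<open>v\<close> has \<open>d - 1\<close> further vertices, so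
        the scaled degree is a row sum of \<open>Ab\<close>.\<close>
      have "real (d - 1) * (\<Sum>e\<in>?F. ?p e) = (\<Sum>e\<in>?F. \<Sum>x\<in>{..<n} - {v}. if x \<in> e then ?p e else 0)"
      proof -
        have "(\<Sum>x\<in>{..<n} - {v}. if x \<in> e then ?p e else 0) = real (d - 1) * ?p e" if e: "e \<in> ?F" for e
        proof -
          have "({..<n} - {v}) \<inter> {x. x \<in> e} = e - {v}" using e by (auto simp: dsets_def)
          moreover have "card (e - {v}) = d - 1" using e by (simp add: dsets_def)
          ultimately show ?thesis by (simp add: sum.If_cases)
        qed
        then show ?thesis by (simp add: sum_distrib_left)
      qed
      also have "\<dots> = (\<Sum>x\<in>{..<n} - {v}. \<Sum>e\<in>?F. if x \<in> e then ?p e else 0)" by (rule sum.swap)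
      also have "\<dots> = (\<Sum>x\<in>{..<n} - {v}. Ab n d ?p v x)"
      proof (rule sum.cong[OF refl])
        fix x assume x: "x \<in> {..<n} - {v}"
        have "?F \<inter> {e. x \<in> e} = {e \<in> dsets n d. v \<in> e \<and> x \<in> e}" by auto
        then show "(\<Sum>e\<in>?F. if x \<in> e then ?p e else 0) = Ab n d ?p v x"
          using x fF by (simp add: Ab_def sum.If_cases)
      qed
      also have "\<dots> \<le> (\<Sum>x\<in>{..<n} - {v}. (?al + ?be * \<sigma> v * \<sigma> x) / real n + E / real n)"
      proof (rule sum_mono)
        fix x assume "x \<in> {..<n} - {v}"
        then have "\<bar>Ab n d ?p v x - (?al + ?be * \<sigma> v * \<sigma> x) / real n\<bar> \<le> E / real n" by (intro approx v) auto
        then show "Ab n d ?p v x \<le> (?al + ?be * \<sigma> v * \<sigma> x) / real n + E / real n" by linarith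
      qed
      \<comment> \<open>Adding the diagonal term, which is nonnegative because a spin squares to 1,
        completes the row and makes the full sum of spins appear.\<close>
      also have "\<dots> \<le> (\<Sum>x<n. (?al + ?be * \<sigma> v * \<sigma> x) / real n + E / real n)"
      proof (rule sum_mono2)
        fix x assume "x \<in> {..<n} - ({..<n} - {v})"
        then have "x = v" by auto
        then have "\<sigma> v * \<sigma> x = 1" using sg(1)[OF v] by auto
        then show "0 \<le> (?al + ?be * \<sigma> v * \<sigma> x) / real n + E / real n" using be E0 by (simp add: mult.assoc)
      qed auto
      also have "\<dots> = ?al + ?be * (\<sigma> v * (\<Sum>x<n. \<sigma> x)) / real n + E"
        using nr by (simp add: sum.distrib sum_divide_distrib[symmetric] sum_distrib_left add_divide_distrib mult.assoc)
      also have "\<dots> \<le> ?al + 2 * ?be * D / real n + E"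
      proof -
        have "\<sigma> v * (\<Sum>x<n. \<sigma> x) \<le> 2 * D" using sg(1)[OF v] sg(2) by auto
        then have "?be * (\<sigma> v * (\<Sum>x<n. \<sigma> x)) \<le> ?be * (2 * D)" using be by (intro mult_left_mono)
        then have "?be * (\<sigma> v * (\<Sum>x<n. \<sigma> x)) / real n \<le> ?be * (2 * D) / real n" by (intro divide_right_mono) auto
        then show ?thesis by (simp add: mult_ac)
      qed
      finally show ?thesis .
    qed
    show "(\<Sum>e\<in>{e \<in> dsets n d. v \<in> e \<and> x \<in> e \<and> y \<in> e}. ?p e) \<le> ?K / (real n)\<^sup>2"
      if vxy: "v \<noteq> x" "v \<noteq> y" "x \<noteq> y" for v x y
    proof (cases "v < n \<and> x < n \<and> y < n")
      case True
      let ?F = "{e \<in> dsets n d. {v, x, y} \<subseteq> e \<and> e \<subseteq> {..<n}}"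
      have eq: "{e \<in> dsets n d. v \<in> e \<and> x \<in> e \<and> y \<in> e} = ?F" by (auto simp: dsets_def)
      have cF: "card ?F = (n - 3) choose (d - 3)"
        using card_dsets_containing[of "{v, x, y}" "{..<n}" n d] True vxy d by (simp add: card_insert_if numeral_3_eq_3)
      have "(\<Sum>e\<in>?F. ?p e) \<le> (\<Sum>e\<in>?F. hprob a d n)" by (intro sum_mono edge_prob_le ab)
      also have "\<dots> = real ((n - 3) choose (d - 3)) * hprob a d n" using cF by simp
      also have "\<dots> \<le> real ((n - 2) choose (d - 3)) * hprob a d n"
      proof (rule mult_right_mono)
        have "n - 3 \<le> n - 2" by simp
        then show "real ((n - 3) choose (d - 3)) \<le> real ((n - 2) choose (d - 3))"
          by (intro of_nat_mono binomial_right_mono)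
        show "0 \<le> hprob a d n" using a0 by (simp add: hprob_def)
      qed
      also have "\<dots> \<le> 2 * a * (real d)\<^sup>2 / (real n)\<^sup>2"
      proof -
        have "real n \<le> 2 * real (n - 1)" using nr by (simp add: of_nat_diff)
        then have "(real n)\<^sup>2 * real ((n - 2) choose (d - 3)) \<le> 2 * (real n * real (n - 1) * real ((n - 2) choose (d - 3)))"
          unfolding power2_eq_square
          using mult_left_mono[of "real n" "2 * real (n - 1)" "real n * real ((n - 2) choose (d - 3))"] by (simp add: mult_ac)
        also have "\<dots> = 2 * (real (n choose (d - 1)) * (real (d - 1) * real (d - 2)))" using binomial_two_step[of d n] d n by simp
        also have "\<dots> \<le> 2 * (real (n choose (d - 1)) * (real d)\<^sup>2)"
          using ch by (intro mult_left_mono) (auto simp: power2_eq_square simp flip: of_nat_mult)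
        finally have "(real n)\<^sup>2 * real ((n - 2) choose (d - 3)) * a \<le> 2 * (real (n choose (d - 1)) * (real d)\<^sup>2) * a"
          using a0 by (intro mult_right_mono) auto
        then show ?thesis using C0 nr unfolding hprob_def by (simp add: divide_simps mult_ac)
      qed
      also have "\<dots> \<le> ?K / (real n)\<^sup>2" using be al by (intro divide_right_mono) auto
      finally show ?thesis unfolding eq .
    next
      case False
      then have em: "{e \<in> dsets n d. v \<in> e \<and> x \<in> e \<and> y \<in> e} = {}" by (auto simp: dsets_def)
      show ?thesis unfolding em using \<open>0 \<le> ?K\<close> by simp
    qed
  qed
qed

text \<open>About n^2 off-diagonal entries of size E/n contribute E^2, but the n diagonal entries of
  size c/n only c^2/n. So it is harmless that \<open>Ab\<close> vanishes on the diagonal while its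
  rank-two model does not.\<close>

lemma frob_remainder_le:
  assumes R: "\<And>i j. i < n \<Longrightarrow> j < n \<Longrightarrow> i \<noteq> j \<Longrightarrow> \<bar>R i j\<bar> \<le> E / real n"
    and diag: "\<And>i. i < n \<Longrightarrow> \<bar>R i i\<bar> \<le> c / real n" and pos: "0 \<le> E" "0 \<le> c" "n > 0"
  shows "frob n R \<le> (E + c / sqrt (real n))\<^sup>2"
proof -
  have "frob n R \<le> (\<Sum>i<n. \<Sum>j<n. (E / real n)\<^sup>2 + (if j = i then (c / real n)\<^sup>2 else 0))"
    unfolding frob_def
  proof (intro sum_mono)
    fix i j assume ij: "i \<in> {..<n}" "j \<in> {..<n}"
    show "(R i j)\<^sup>2 \<le> (E / real n)\<^sup>2 + (if j = i then (c / real n)\<^sup>2 else 0)"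
    proof (cases "j = i")
      case True
      have "(R i j)\<^sup>2 \<le> (c / real n)\<^sup>2" using diag[of i] ij True by (metis abs_ge_zero lessThan_iff power2_abs power_mono)
      also have "\<dots> \<le> (E / real n)\<^sup>2 + (c / real n)\<^sup>2" by simp
      finally show ?thesis unfolding True by (simp only: simp_thms if_True)
    next
      case False
      have "(R i j)\<^sup>2 \<le> (E / real n)\<^sup>2" using R[of i j] ij False by (metis abs_ge_zero lessThan_iff power2_abs power_mono)
      then show ?thesis using False by simp
    qed
  qed
  also have "\<dots> = real n * (real n * (E / real n)\<^sup>2) + real n * (c / real n)\<^sup>2" by (simp add: sum.distrib distrib_left)
  also have "\<dots> = E\<^sup>2 + c\<^sup>2 / real n" using pos by (simp add: field_simps power2_eq_square)
  also have "\<dots> = E\<^sup>2 + (c / sqrt (real n))\<^sup>2" by (simp add: power_divide)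
  also have "\<dots> \<le> (E + c / sqrt (real n))\<^sup>2" using pos by (simp add: power2_sum)
  finally show ?thesis .
qed

subsection \<open>Balance of the spins\<close>

lemma sum_spin_square:
  "(\<Sum>\<sigma>\<in>PiE {..<n} (\<lambda>_. {-1, 1 :: real}). (\<Sum>i<n. \<sigma> i)\<^sup>2) = real n * 2 ^ n"
proof -
  let ?P = "PiE {..<n} (\<lambda>_. {-1, 1 :: real})"
  have card: "real (card ?P) = 2 ^ n" by (simp add: card_PiE)
  have val: "\<sigma> i = -1 \<or> \<sigma> i = 1" if "\<sigma> \<in> ?P" "i < n" for \<sigma> i using that by (auto simp: PiE_iff)
  have off: "(\<Sum>\<sigma>\<in>?P. \<sigma> i * \<sigma> j) = 0" if ij: "i < n" "j < n" "i \<noteq> j" for i j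
  proof -
    \<comment> \<open>Flipping the spin \<open>i\<close> is an involution that reverses the sign of
      the summand.\<close>
    let ?f = "\<lambda>\<sigma> :: nat \<Rightarrow> real. \<sigma>(i := - \<sigma> i)"
    have img: "?f \<sigma> \<in> ?P" if "\<sigma> \<in> ?P" for \<sigma>
      using that ij val[OF that, of i] by (auto simp: PiE_iff extensional_def)
    have "(\<Sum>\<sigma>\<in>?P. \<sigma> i * \<sigma> j) = (\<Sum>\<sigma>\<in>?P. - (\<sigma> i * \<sigma> j))"
      by (rule sum.reindex_bij_witness[where i = ?f and j = ?f]) (use img ij in auto)
    then show ?thesis by (simp add: sum_negf)
  qed
  have "(\<Sum>\<sigma>\<in>?P. (\<Sum>i<n. \<sigma> i)\<^sup>2) = (\<Sum>\<sigma>\<in>?P. \<Sum>i<n. \<Sum>j<n. \<sigma> i * \<sigma> j)"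
    by (simp add: power2_eq_square sum_product)
  also have "\<dots> = (\<Sum>i<n. \<Sum>\<sigma>\<in>?P. \<Sum>j<n. \<sigma> i * \<sigma> j)" by (rule sum.swap)
  also have "\<dots> = (\<Sum>i<n. \<Sum>j<n. \<Sum>\<sigma>\<in>?P. \<sigma> i * \<sigma> j)" by (intro sum.cong refl sum.swap)
  also have "\<dots> = (\<Sum>i<n. \<Sum>j<n. if j = i then 2 ^ n else 0)"
  proof (intro sum.cong refl)
    fix i j assume ij: "i \<in> {..<n}" "j \<in> {..<n}"
    show "(\<Sum>\<sigma>\<in>?P. \<sigma> i * \<sigma> j) = (if j = i then 2 ^ n else 0)"
    proof (cases "j = i")
      case True
      have "(\<Sum>\<sigma>\<in>?P. \<sigma> i * \<sigma> j) = (\<Sum>\<sigma>\<in>?P. 1)"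
      proof (rule sum.cong[OF refl])
        fix \<sigma> assume "\<sigma> \<in> ?P"
        then have "\<sigma> i = -1 \<or> \<sigma> i = 1" using ij(1) val[of \<sigma> i] by simp
        then show "\<sigma> i * \<sigma> j = 1" unfolding True by (elim disjE) simp_all
      qed
      then show ?thesis using True card by simp
    qed (use off ij in auto)
  qed
  also have "\<dots> = real n * 2 ^ n" by simp
  finally show ?thesis .
qed

lemma hsbm_prob_eq_HE:
  "hsbm_prob n d a b Ev = (\<Sum>\<sigma>\<in>PiE {..<n} (\<lambda>_. {-1, 1}). (1/2) ^ n * HE n d (edge_prob a b d n \<sigma>) (\<lambda>H. of_bool (Ev \<sigma> H)))"
  unfolding hsbm_prob_def HE_def sum_distrib_left by (intro sum.cong refl) (simp add: mult.assoc)

text \<open>Unbalanced spins are handled by Chebyshev's inequality: there the failure probability,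
  at most 1, is bounded by the squared imbalance over its squared threshold, and
  \<open>sum_spin_square\<close> gives the mean.\<close>

lemma hsbm_prob_bounds:
  assumes p: "\<And>\<sigma> e. e \<in> dsets n d \<Longrightarrow> 0 \<le> edge_prob a b d n \<sigma> e \<and> edge_prob a b d n \<sigma> e \<le> 1"
    and D: "D > 0"
    and bal: "\<And>\<sigma>. \<sigma> \<in> PiE {..<n} (\<lambda>_. {-1, 1}) \<Longrightarrow> \<bar>\<Sum>i<n. \<sigma> i\<bar> \<le> 2 * D \<Longrightarrow>
        HE n d (edge_prob a b d n \<sigma>) (\<lambda>H. of_bool (\<not> Ev \<sigma> H)) \<le> \<epsilon>"
    and eps: "0 \<le> \<epsilon>"
  shows "hsbm_prob n d a b Ev \<le> 1" and "1 - \<epsilon> - real n / (2 * D)\<^sup>2 \<le> hsbm_prob n d a b Ev"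
proof -
  let ?P = "PiE {..<n} (\<lambda>_. {-1, 1 :: real})"
  let ?E = "\<lambda>\<sigma>. HE n d (edge_prob a b d n \<sigma>) (\<lambda>H. of_bool (Ev \<sigma> H))"
  let ?N = "\<lambda>\<sigma>. HE n d (edge_prob a b d n \<sigma>) (\<lambda>H. of_bool (\<not> Ev \<sigma> H))"
  have finP: "finite ?P" by (intro finite_PiE) auto
  have card: "(\<Sum>\<sigma>\<in>?P. (1/2) ^ n) = (1 :: real)"
    by (simp add: card_PiE power_one_over)
  have EN: "?E \<sigma> = 1 - ?N \<sigma>" for \<sigma>
  proof -
    have "?E \<sigma> + ?N \<sigma> = HE n d (edge_prob a b d n \<sigma>) (\<lambda>H. of_bool (Ev \<sigma> H) + of_bool (\<not> Ev \<sigma> H))"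
      unfolding HE_def by (simp only: distrib_left sum.distrib)
    also have "\<dots> = HE n d (edge_prob a b d n \<sigma>) (\<lambda>H. 1)" by (intro HE_cong) auto
    finally show ?thesis by (simp add: HE_const)
  qed
  have N01: "0 \<le> ?N \<sigma>" "?N \<sigma> \<le> 1" for \<sigma>
  proof -
    have "HE n d (edge_prob a b d n \<sigma>) (\<lambda>_. 0) \<le> ?N \<sigma>" "?N \<sigma> \<le> HE n d (edge_prob a b d n \<sigma>) (\<lambda>_. 1)"
      by (rule HE_mono; use p in auto)+
    then show "0 \<le> ?N \<sigma>" "?N \<sigma> \<le> 1" by (simp_all add: HE_const)
  qed
  have eq: "hsbm_prob n d a b Ev = 1 - (\<Sum>\<sigma>\<in>?P. (1/2) ^ n * ?N \<sigma>)"
    unfolding hsbm_prob_eq_HE EN right_diff_distrib sum_subtractf using card by simp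
  show "hsbm_prob n d a b Ev \<le> 1" unfolding eq using N01 by (simp add: sum_nonneg)
  have "?N \<sigma> \<le> \<epsilon> + (\<Sum>i<n. \<sigma> i)\<^sup>2 / (2 * D)\<^sup>2" if s: "\<sigma> \<in> ?P" for \<sigma>
  proof (cases "\<bar>\<Sum>i<n. \<sigma> i\<bar> \<le> 2 * D")
    case True
    then show ?thesis using bal[OF s] by (simp add: add_increasing2)
  next
    case False
    then have "(2 * D)\<^sup>2 \<le> \<bar>\<Sum>i<n. \<sigma> i\<bar>\<^sup>2" using D by (intro power_mono) auto
    then have "1 \<le> (\<Sum>i<n. \<sigma> i)\<^sup>2 / (2 * D)\<^sup>2" using D by simp
    then show ?thesis using N01(2)[of \<sigma>] eps by linarith
  qed
  then have "(\<Sum>\<sigma>\<in>?P. (1/2) ^ n * ?N \<sigma>) \<le> (\<Sum>\<sigma>\<in>?P. (1/2) ^ n * (\<epsilon> + (\<Sum>i<n. \<sigma> i)\<^sup>2 / (2 * D)\<^sup>2))"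
    by (intro sum_mono mult_left_mono) auto
  also have "\<dots> = (\<Sum>\<sigma>\<in>?P. (1/2) ^ n) * \<epsilon> + (1/2) ^ n * (\<Sum>\<sigma>\<in>?P. (\<Sum>i<n. \<sigma> i)\<^sup>2) / (2 * D)\<^sup>2"
    by (simp only: distrib_left sum.distrib sum_distrib_right sum_distrib_left sum_divide_distrib times_divide_eq_right)
  also have "\<dots> = \<epsilon> + real n / (2 * D)\<^sup>2" unfolding card sum_spin_square by (simp add: power_one_over)
  finally show "1 - \<epsilon> - real n / (2 * D)\<^sup>2 \<le> hsbm_prob n d a b Ev" unfolding eq by linarith
qed

text \<open>Non-emptiness matters because the supremum of the empty set of reals is unspecified.\<close>

lemma orthogonal_unit_vector_exists:
  fixes f g :: "nat \<Rightarrow> real"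
  assumes "n \<ge> 3"
  shows "\<exists>x. sqrt (\<Sum>i<n. (x i)\<^sup>2) = 1 \<and> (\<Sum>i<n. x i * f i) = 0 \<and> (\<Sum>i<n. x i * g i) = 0"
proof -
  \<comment> \<open>The first three coordinates suffice: two linear conditions on them leave a
    nonzero solution, which is extended by 0.\<close>
  let ?v = "\<lambda>h :: nat \<Rightarrow> real. vector [h 0, h 1, h 2] :: real ^ 3"
  have "dim {?v f, ?v g} \<le> card {?v f, ?v g}" by (intro dim_le_card') auto
  also have "\<dots> \<le> 2" by (simp add: card_insert_if)
  finally have "dim {?v f, ?v g} < DIM(real ^ 3)" by simp
  then obtain y :: "real ^ 3" where y: "y \<noteq> 0" "\<And>w. w \<in> span {?v f, ?v g} \<Longrightarrow> orthogonal y w"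
    using orthogonal_to_subspace_exists by blast
  have o: "orthogonal y (?v f)" "orthogonal y (?v g)" by (auto intro!: y(2) span_base)
  define z where "z i = (if i = 0 then y $ 1 else if i = 1 then y $ 2 else if i = 2 then y $ 3 else 0)" for i :: nat
  have s3: "(\<Sum>i<n. z i * h i) = y $ 1 * h 0 + y $ 2 * h 1 + y $ 3 * h 2" for h
  proof -
    have "(\<Sum>i<n. z i * h i) = (\<Sum>i<3. z i * h i)"
      using assms by (intro sum.mono_neutral_right) (auto simp: z_def)
    then show ?thesis by (simp add: eval_nat_numeral z_def)
  qed
  have zf: "(\<Sum>i<n. z i * f i) = 0" "(\<Sum>i<n. z i * g i) = 0"
    using o unfolding s3 orthogonal_def inner_vec_def sum_3 by simp_all
  have zn: "(\<Sum>i<n. (z i)\<^sup>2) = (y $ 1)\<^sup>2 + (y $ 2)\<^sup>2 + (y $ 3)\<^sup>2"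
    using s3[of z] by (simp add: power2_eq_square z_def)
  have "(\<Sum>i<n. (z i)\<^sup>2) \<noteq> 0"
  proof
    assume "(\<Sum>i<n. (z i)\<^sup>2) = 0"
    then have "(y $ 1)\<^sup>2 = 0" "(y $ 2)\<^sup>2 = 0" "(y $ 3)\<^sup>2 = 0"
      using zn zero_le_power2[of "y $ 1"] zero_le_power2[of "y $ 2"] zero_le_power2[of "y $ 3"] by linarith+
    then have "y = 0" by (simp add: vec_eq_iff forall_3)
    then show False using y by simp
  qed
  then have pos: "0 < (\<Sum>i<n. (z i)\<^sup>2)" by (metis less_le sum_nonneg zero_le_power2)
  let ?r = "sqrt (\<Sum>i<n. (z i)\<^sup>2)"
  have r: "0 < ?r" "?r\<^sup>2 = (\<Sum>i<n. (z i)\<^sup>2)" using pos by auto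
  have "(\<Sum>i<n. (z i / ?r)\<^sup>2) = (\<Sum>i<n. (z i)\<^sup>2) / ?r\<^sup>2" by (simp only: power_divide sum_divide_distrib)
  also have "\<dots> = 1" unfolding r(2) using pos by simp
  finally have "sqrt (\<Sum>i<n. (z i / ?r)\<^sup>2) = 1" by simp
  moreover have "(\<Sum>i<n. z i / ?r * h i) = (\<Sum>i<n. z i * h i) / ?r" for h
    by (simp add: sum_divide_distrib)
  ultimately show ?thesis using zf by (intro exI[of _ "\<lambda>i. z i / ?r"]) simp
qed

text \<open>\<open>M\<close> bounds the numbers of vertices and edges that \<open>r\<close> walks
  can explore. The value of \<open>\<Lambda>\<close> makes the reuse of bad edges cost at most
  \<open>\<zeta> / 2\<close>, and hypothesis \<open>big\<close> gives the other half to new bad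
  edges.\<close>

lemma (in hsbm_weights) wsum_le:
  assumes r: "r \<le> R" "1 \<le> R" and T: "\<Theta> \<ge> 1"
    and big: "K * \<Theta> * (4 * (real R)\<^sup>2 * (real d) ^ 3 * (real l + 1) ^ 5) ^ (R + 1) \<le> real n"
  shows "wsum \<Theta> l r \<le> (4 * (real R)\<^sup>2 * (real d)\<^sup>2 * (real l + 1) ^ 6) ^ R"
proof -
  define M where "M = R * d * (l + 1)"
  define L where "L = real l + 1"
  define \<Lambda> where "\<Lambda> = 4 * (real R)\<^sup>2 * (real d) ^ 3 * L ^ 5"
  define \<zeta> where "\<zeta> = 1 / ((real M + 1) * L ^ 3)"
  have L1: "1 \<le> L" by (simp add: L_def)
  have Rd: "1 \<le> real R" "1 \<le> real d" using r d2 by auto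
  have M: "real M = real R * real d * L" by (simp add: M_def L_def algebra_simps)
  have RdL: "1 \<le> real R * real d * L"
  proof -
    have "1 * 1 * 1 \<le> real R * real d * L" using Rd L1 by (intro mult_mono) auto
    then show ?thesis by simp
  qed
  have M1: "real M + 1 \<le> 2 * (real R * real d * L)" using M RdL by linarith
  have M0: "0 < real M" using M RdL by linarith
  have La: "2 * real d * real M * ((real M + 1) * L ^ 3) \<le> \<Lambda>"
  proof -
    have "2 * real d * real M * ((real M + 1) * L ^ 3) \<le> 2 * real d * real M * ((2 * (real R * real d * L)) * L ^ 3)"
      using M1 L1 by (intro mult_left_mono mult_right_mono) auto
    also have "\<dots> = \<Lambda>" unfolding M \<Lambda>_def by (simp add: power2_eq_square eval_nat_numeral mult_ac)
    finally show ?thesis .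
  qed
  have MLpos: "0 < (real M + 1) * L ^ 3" using L1 M0 by simp
  have La1: "1 \<le> \<Lambda>"
  proof -
    have "1 * 1 * 1 * 1 \<le> 4 * (real R)\<^sup>2 * (real d) ^ 3 * L ^ 5"
      using Rd L1 by (intro mult_mono one_le_power) auto
    then show ?thesis by (simp add: \<Lambda>_def)
  qed
  have "wsum \<Theta> l r \<le> ((real M + 1) ^ 2 * (real l + 1) ^ 4) ^ r * \<Lambda> ^ (r * card ({} :: nat set set))"
    unfolding wsum_def
  proof (rule tw_sum_le[where R = R and \<zeta> = \<zeta>])
    show "hist {} {} {}" by (auto simp: hist_def)
    have "d * l + 1 \<le> d * (l + 1)" using d2 by simp
    then have "r * (d * l + 1) \<le> R * (d * (l + 1))" using r by (intro mult_le_mono)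
    then show "card ({} :: nat set) + r * (d * l + 1) \<le> M" by (simp only: M_def mult.assoc card.empty add_0)
    have "1 * l \<le> d * (l + 1)" using d2 by (intro mult_le_mono) auto
    then have "r * l \<le> R * (d * (l + 1))" using r by (intro mult_le_mono) auto
    then show "card ({} :: nat set set) + r * l \<le> M" by (simp only: M_def mult.assoc card.empty add_0)
    show "0 \<le> \<zeta>" using MLpos by (simp add: \<zeta>_def)
    show "\<zeta> * ((real M + 1) * (real l + 1) ^ 3) \<le> 1" using MLpos by (simp add: \<zeta>_def L_def)
    have dM: "real (d - 1) * real M \<le> \<Lambda> * (\<zeta> / 2)"
    proof -
      have "real (d - 1) * real M \<le> real d * real M" by (intro mult_right_mono) auto
      also have "\<dots> = (2 * real d * real M * ((real M + 1) * L ^ 3)) * (\<zeta> / 2)" unfolding \<zeta>_def using MLpos by (simp add: field_simps)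
      also have "\<dots> \<le> \<Lambda> * (\<zeta> / 2)" using La \<open>0 \<le> \<zeta>\<close> by (intro mult_right_mono) auto
      finally show ?thesis .
    qed
    have 1: "real (d - 1) * (real M * (1 / \<Lambda>)) \<le> \<zeta> / 2"
      using dM La1 by (simp add: divide_simps mult_ac)
    have 2: "real (d - 1) * (real M * (K / real n) * (\<Theta> * \<Lambda> ^ R)) \<le> \<zeta> / 2"
    proof -
      have "real (d - 1) * (real M * (K / real n) * (\<Theta> * \<Lambda> ^ R)) = (real (d - 1) * real M) * (K * \<Theta> * \<Lambda> ^ R / real n)"
        by simp
      also have "\<dots> \<le> (\<Lambda> * (\<zeta> / 2)) * (K * \<Theta> * \<Lambda> ^ R / real n)"
        using dM K0 T La1 by (intro mult_right_mono) auto
      also have "\<dots> = (\<zeta> / 2) * (K * \<Theta> * \<Lambda> ^ (R + 1) / real n)" by simp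
      also have "\<dots> \<le> (\<zeta> / 2) * 1"
        using big n0 \<open>0 \<le> \<zeta>\<close> by (intro mult_left_mono) (auto simp: \<Lambda>_def L_def)
      finally show ?thesis by simp
    qed
    show "real (d - 1) * (real M * (1 / \<Lambda>) + real M * (K / real n) * (\<Theta> * \<Lambda> ^ R)) \<le> \<zeta>"
      using 1 2 by (simp only: distrib_left)
  qed (use La1 T r in auto)
  also have "\<dots> = ((real M + 1) ^ 2 * L ^ 4) ^ r" by (simp add: L_def)
  also have "\<dots> \<le> ((real M + 1) ^ 2 * L ^ 4) ^ R"
  proof (rule power_increasing[OF r(1)])
    have "1 * 1 \<le> (real M + 1) ^ 2 * L ^ 4" using L1 M0 by (intro mult_mono one_le_power) auto
    then show "1 \<le> (real M + 1) ^ 2 * L ^ 4" by simp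
  qed
  also have "\<dots> \<le> ((2 * (real R * real d * L)) ^ 2 * L ^ 4) ^ R"
    using M1 M0 L1 by (intro power_mono mult_right_mono) auto
  also have "(2 * (real R * real d * L)) ^ 2 * L ^ 4 = 4 * (real R)\<^sup>2 * (real d)\<^sup>2 * L ^ 6"
    by (simp add: power2_eq_square eval_nat_numeral mult_ac)
  finally show ?thesis by (simp only: L_def)
qed

section \<open>Asymptotics\<close>

definition saw_event :: "real \<Rightarrow> real \<Rightarrow> nat \<Rightarrow> nat \<Rightarrow> (nat \<Rightarrow> real) \<Rightarrow> nat set set \<Rightarrow> bool" where
  "saw_event \<epsilon> \<alpha> n l \<sigma> H \<longleftrightarrow>
     Sup {sqrt (\<Sum>i<n. (\<Sum>j<n. saw_mat H l i j * x j)\<^sup>2) | x :: nat \<Rightarrow> real.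
            sqrt (\<Sum>i<n. (x i)\<^sup>2) = 1 \<and>
            (\<Sum>i<n. x i * (\<Sum>j<n. saw_mat H l i j)) = 0 \<and>
            (\<Sum>i<n. x i * (\<Sum>j<n. saw_mat H l i j * \<sigma> j)) = 0}
     \<le> real n powr \<epsilon> * sqrt \<alpha> ^ l"

lemma saw_eventI:
  assumes "n \<ge> 3"
    and "\<And>x. sqrt (\<Sum>i<n. (x i)\<^sup>2) = 1 \<Longrightarrow> (\<Sum>i<n. x i * (\<Sum>j<n. saw_mat H l i j)) = 0 \<Longrightarrow>
       (\<Sum>i<n. x i * (\<Sum>j<n. saw_mat H l i j * \<sigma> j)) = 0 \<Longrightarrow>
       sqrt (\<Sum>i<n. (\<Sum>j<n. saw_mat H l i j * x j)\<^sup>2) \<le> real n powr \<epsilon> * sqrt \<alpha> ^ l"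
  shows "saw_event \<epsilon> \<alpha> n l \<sigma> H"
  unfolding saw_event_def
proof (rule cSup_least)
  show "{sqrt (\<Sum>i<n. (\<Sum>j<n. saw_mat H l i j * x j)\<^sup>2) | x :: nat \<Rightarrow> real.
            sqrt (\<Sum>i<n. (x i)\<^sup>2) = 1 \<and>
            (\<Sum>i<n. x i * (\<Sum>j<n. saw_mat H l i j)) = 0 \<and>
            (\<Sum>i<n. x i * (\<Sum>j<n. saw_mat H l i j * \<sigma> j)) = 0} \<noteq> {}"
    using orthogonal_unit_vector_exists[OF assms(1), of "\<lambda>i. \<Sum>j<n. saw_mat H l i j" "\<lambda>i. \<Sum>j<n. saw_mat H l i j * \<sigma> j"]
    by blast
qed (use assms(2) in blast)

text \<open>The length \<open>l n\<close> can be 0, for small \<open>n\<close> or for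
  \<open>c\<close> not positive. The matrix is then zero, while \<open>Wm\<close> is the identity,
  so this case is treated apart.\<close>

lemma saw_mat_0: "saw_mat H 0 i j = 0"
proof (cases "i = j")
  case False
  then have e: "{(vs, es). self_avoiding H 0 vs es \<and> vs ! 0 = i \<and> vs ! 0 = j} = {}" by auto
  show ?thesis unfolding saw_mat_def e by simp
qed (simp add: saw_mat_def)

lemma saw_event_0: "n \<ge> 3 \<Longrightarrow> saw_event \<epsilon> \<alpha> n 0 \<sigma> H"
  by (rule saw_eventI) (simp_all add: saw_mat_0)

lemma power_le_two:
  assumes "0 \<le> y" "real m * y \<le> 1 / 2"
  shows "(1 + y) ^ m \<le> 2"
proof -
  have "(1 + y) ^ m \<le> exp y ^ m" using assms by (intro power_mono exp_ge_add_one_self) auto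
  also have "\<dots> = exp (real m * y)" by (simp add: exp_of_nat_mult)
  also have "\<dots> \<le> 2" using exp_bound_lemma[of "real m * y"] assms by simp
  finally show ?thesis .
qed

lemma spectral_const_le:
  assumes "1 \<le> \<alpha>" "1 \<le> \<eta>" "0 \<le> C" and rho: "\<rho> = C * (real l + 1) * \<eta>\<^sup>2"
  shows "spectral_const l \<alpha> \<eta> \<rho> \<le> (1 + 20 * \<alpha> * C + 2 * \<alpha> + C) * (real l + 1) ^ 4 * \<eta> ^ 4"
proof -
  let ?L = "real l + 1"
  have L: "1 \<le> ?L" "real l \<le> ?L" by auto
  have pw: "\<eta> ^ i \<le> \<eta> ^ 4" "?L ^ i \<le> ?L ^ 4" if "i \<le> 4" for i
    using that assms L by (auto intro!: power_increasing)
  have 1: "\<eta> \<le> ?L ^ 4 * \<eta> ^ 4"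
    using mult_mono[of 1 "?L ^ 4" "\<eta> ^ 1" "\<eta> ^ 4"] pw[of 1] pw(2)[of 0] assms by simp
  have "2 * \<alpha> * real l * (10 * ?L ^ 2 * \<eta> * \<rho> + real l * \<eta>) * \<eta> =
     20 * \<alpha> * C * (real l * (?L ^ 2 * ?L) * \<eta> ^ 4) + 2 * \<alpha> * (real l * real l * \<eta> ^ 2)"
    unfolding rho by (simp add: eval_nat_numeral algebra_simps)
  moreover have "20 * \<alpha> * C * (real l * (?L ^ 2 * ?L) * \<eta> ^ 4) \<le> 20 * \<alpha> * C * (?L * (?L ^ 2 * ?L) * \<eta> ^ 4)"
    using assms L by (intro mult_left_mono mult_right_mono) auto
  moreover have "?L * (?L ^ 2 * ?L) = ?L ^ 4" by (simp add: eval_nat_numeral)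
  moreover have "2 * \<alpha> * (real l * real l * \<eta> ^ 2) \<le> 2 * \<alpha> * (?L ^ 4 * \<eta> ^ 4)"
  proof -
    have "real l * real l \<le> ?L ^ 2" unfolding power2_eq_square using L by (intro mult_mono) auto
    then have "real l * real l \<le> ?L ^ 4" using pw(2)[of 2] by simp
    then show ?thesis using assms pw(1)[of 2] by (intro mult_left_mono mult_mono) auto
  qed
  moreover have "\<rho> \<le> C * (?L ^ 4 * \<eta> ^ 4)"
    unfolding rho mult.assoc using assms pw(1)[of 2] pw(2)[of 1] by (intro mult_left_mono mult_mono) auto
  ultimately have "spectral_const l \<alpha> \<eta> \<rho> \<le> ?L ^ 4 * \<eta> ^ 4 + 20 * \<alpha> * C * (?L ^ 4 * \<eta> ^ 4)
      + 2 * \<alpha> * (?L ^ 4 * \<eta> ^ 4) + C * (?L ^ 4 * \<eta> ^ 4)"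
    unfolding spectral_const_def using 1 by simp
  also have "\<dots> = (1 + 20 * \<alpha> * C + 2 * \<alpha> + C) * ?L ^ 4 * \<eta> ^ 4" by (simp add: algebra_simps)
  finally show ?thesis .
qed

text \<open>\<open>P1\<close> to \<open>P7\<close> ask polynomials in \<open>l\<close> to be
  dominated by small powers of n, which holds eventually for \<open>l\<close> of order log n. The
  exponent 8 \<epsilon> is the sum of 4 \<epsilon> from the fourth power of \<eta> in
  \<open>spectral_const_le\<close> and 4 \<epsilon> from \<open>P7\<close>.\<close>

lemma balanced_bound:
  fixes a b \<epsilon> :: real and n d l k R :: nat
  defines "\<alpha> \<equiv> alpha_par d a b" and "\<beta> \<equiv> beta_par d a b" and "X \<equiv> real n"
  defines "CE \<equiv> 4 * a * (real d)\<^sup>2"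
  defines "C5 \<equiv> 2 * \<beta> + CE" and "C7 \<equiv> (CE + \<alpha> + \<beta>) + 1 + 2 * (2 * \<alpha> + 1)"
  defines "K \<equiv> \<alpha> + \<beta> + 1 + 2 * a * (real d)\<^sup>2"
  defines "W0 \<equiv> (4 * (real R)\<^sup>2 * (real d)\<^sup>2 * (real l + 1) ^ 6) ^ R"
  assumes d: "d \<ge> 3" and ab: "a \<ge> b" "b > 0" and al: "\<beta>\<^sup>2 > \<alpha>" "\<alpha> > 1"
    and e0: "0 < \<epsilon>" "1 \<le> 2 ^ k * \<epsilon>" and R: "R = max (2 * 2 ^ k) 4"
    and n: "2 * d \<le> n" "a * (real d)\<^sup>2 \<le> real (n - 1)" "real d + X powr (3/4) \<le> X / 2" "real d \<le> X powr (3/4)"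
      "CE * X powr (- 1/4) \<le> 1"
    and l: "l > 0" "\<alpha> ^ l \<le> X powr (1/8)"
    and P1: "2 * (real d * real l + 1) \<le> X powr (1/2)"
    and P2: "K * (4 * (real R)\<^sup>2 * (real d) ^ 3 * (real l + 1) ^ 5) ^ (R + 1) \<le> X powr (1/2)"
    and P3: "4 * 2 ^ k * real l * C5 \<le> X powr (1/4)"
    and P4: "4 * (real l + 1) * W0 \<le> X powr (1/2)"
    and P5: "2 * real l * W0 \<le> X powr (1/8)"
    and P6: "2 * (real l + 1)\<^sup>2 * K\<^sup>2 * W0 \<le> X powr \<epsilon>"
    and P7: "(1 + 20 * \<alpha> * C7 + 2 * \<alpha> + C7) * (real l + 1) ^ 4 \<le> X powr (4 * \<epsilon>)"
    and sg: "\<And>i. i < n \<Longrightarrow> \<sigma> i \<in> {-1, 1}" "\<bar>\<Sum>i<n. \<sigma> i\<bar> \<le> 2 * X powr (3/4)"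
  shows "HE n d (edge_prob a b d n \<sigma>) (\<lambda>H. of_bool (\<not> saw_event (8 * \<epsilon>) \<alpha> n l \<sigma> H)) \<le>
     X powr (- 1/2) + X powr (- 1/4) + X powr (- \<epsilon>)"
proof -
  let ?p = "edge_prob a b d n \<sigma>"
  \<comment> \<open>The exponent 3/4 leaves Chebyshev's inequality an error of order n^(-1/2) and
    keeps the relative imbalance at n^(-1/4), small enough to survive a number of steps of order log
    n.\<close>
  let ?D = "X powr (3/4)" and ?E = "CE * X powr (- 1/4)"
  let ?A = "\<alpha> + 2 * \<beta> * ?D / X + ?E"
  \<comment> \<open>\<open>?\<delta>\<close> is the relative imbalance \<open>2 * ?D / n\<close>.
    With \<open>?\<Theta>\<close> the square root of n, the second moment of the concatenation error
    is at most n^(-1/4) up to small factors, and the square of \<open>?\<gamma>\<close> exceeds this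
    by a factor n^(2 \<epsilon>).\<close>
  let ?\<eta> = "X powr \<epsilon>" and ?\<Theta> = "X powr (1/2)" and ?\<delta> = "2 * X powr (- 1/4)" and ?\<gamma> = "X powr (\<epsilon> - 1/8)"
  let ?\<delta>' = "(CE + \<alpha> + \<beta>) * X powr (- 1/4)"
  let ?\<rho> = "C7 * (real l + 1) * ?\<eta>\<^sup>2"
  have X1: "1 \<le> X" and X0: "0 < X" and n3: "n \<ge> 3" "n > 0" using n(1) d by (auto simp: X_def)
  have pw: "X powr u * X powr v = X powr (u + v)" for u v by (simp add: powr_add)
  have pwX: "X = X powr 1" using X0 by simp
  have DX: "?D / X = X powr (- 1/4)"
    using X0 powr_diff[of X "3/4" 1] by simp
  have be: "0 \<le> \<beta>" "\<beta> \<le> \<alpha>"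
  proof -
    show "0 \<le> \<beta>" using ab by (simp add: beta_par_def \<beta>_def)
    have "0 \<le> real (d - 1) * b" using ab by simp
    then show "\<beta> \<le> \<alpha>" using alpha_beta_eqs(1)[of d a b] d unfolding \<alpha>_def \<beta>_def by linarith
  qed
  have CE0: "0 \<le> CE" using ab by (simp add: CE_def)
  have E: "2 * a * (real d)\<^sup>2 * (?D + real d) / real n \<le> ?E"
  proof -
    have "2 * a * (real d)\<^sup>2 * (?D + real d) \<le> 2 * a * (real d)\<^sup>2 * (2 * ?D)"
      using n(4) ab by (intro mult_left_mono) auto
    then have "2 * a * (real d)\<^sup>2 * (?D + real d) / X \<le> 2 * a * (real d)\<^sup>2 * (2 * ?D) / X"
      using X0 by (intro divide_right_mono) auto
    also have "\<dots> = CE * (?D / X)" by (simp add: CE_def)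
    finally show ?thesis unfolding DX unfolding X_def .
  qed
  interpret hsbm_weights n d ?p ?A K
    unfolding \<alpha>_def \<beta>_def K_def X_def
    by (rule hsbm_weights_edge_prob[OF d ab n(1,2) sg(1)]) (use sg(2) n E al in \<open>auto simp: X_def \<alpha>_def\<close>)
  have Th: "?\<Theta> \<ge> 1" using X1 by (simp add: ge_one_powr_ge_zero)
  have ThX: "?\<Theta> * ?\<Theta> = X" unfolding pw using X0 by simp
  have T2: "2 * (real d * real l + 1) * ?\<Theta> \<le> real n"
    using mult_right_mono[OF P1, of ?\<Theta>] ThX by (simp add: X_def)
  have W: "wsum ?\<Theta> l r \<le> W0" if "r \<in> {2 * 2 ^ k, 2, 4}" for r
    unfolding W0_def
  proof (rule wsum_le)
    show "r \<le> R" "1 \<le> R" using that unfolding R by auto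
    have "K * ?\<Theta> * (4 * (real R)\<^sup>2 * (real d) ^ 3 * (real l + 1) ^ 5) ^ (R + 1) =
       (K * (4 * (real R)\<^sup>2 * (real d) ^ 3 * (real l + 1) ^ 5) ^ (R + 1)) * ?\<Theta>" by (simp only: mult_ac)
    also have "\<dots> \<le> ?\<Theta> * ?\<Theta>" by (rule mult_right_mono[OF P2]) simp
    finally show "K * ?\<Theta> * (4 * (real R)\<^sup>2 * (real d) ^ 3 * (real l + 1) ^ 5) ^ (R + 1) \<le> real n"
      unfolding ThX unfolding X_def .
  qed (rule Th)
  have A_eq: "?A = \<alpha> + C5 * X powr (- 1/4)"
  proof -
    have e: "2 * \<beta> * ?D / X = 2 * \<beta> * X powr (- 1/4)" unfolding DX[symmetric] by simp
    show ?thesis unfolding e C5_def by (simp add: algebra_simps)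
  qed
  have C50: "0 \<le> C5" using be CE0 by (simp add: C5_def)
  have Apow: "(?A / \<alpha>) ^ (2 * 2 ^ k * l) \<le> 2"
  proof -
    have "?A / \<alpha> = 1 + C5 * X powr (- 1/4) / \<alpha>" unfolding A_eq using al by (simp add: field_simps)
    also have "\<dots> \<le> 1 + C5 * X powr (- 1/4)"
    proof -
      have "C5 * X powr (- 1/4) / \<alpha> \<le> C5 * X powr (- 1/4) / 1"
        using al C50 by (intro divide_left_mono) auto
      then show ?thesis by simp
    qed
    finally have "(?A / \<alpha>) ^ (2 * 2 ^ k * l) \<le> (1 + C5 * X powr (- 1/4)) ^ (2 * 2 ^ k * l)"
      unfolding A_eq using al C50 by (intro power_mono) auto
    also have "\<dots> \<le> 2"
    proof (rule power_le_two)
      have "4 * 2 ^ k * real l * C5 * X powr (- 1/4) \<le> X powr (1/4) * X powr (- 1/4)"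
        by (rule mult_right_mono[OF P3]) simp
      also have "\<dots> = 1" unfolding pw using X0 by simp
      finally show "real (2 * 2 ^ k * l) * (C5 * X powr (- 1/4)) \<le> 1 / 2" by (simp add: mult_ac)
    qed (use C50 in simp)
    finally show ?thesis .
  qed
  have W00: "0 \<le> W0" by (simp add: W0_def)
  have K00: "0 \<le> K" by (rule K0)
  have bad: "HE n d ?p (\<lambda>H. of_bool (\<not> good n d ?p \<sigma> k l ?\<eta> \<alpha> ?\<delta> ?\<gamma> H)) \<le>
     4 * (real l + 1) * real n * W0 / ?\<eta> ^ (2 * 2 ^ k) + 8 * real l * \<alpha> ^ l * W0 / (real n * ?\<delta>\<^sup>2)
     + 2 * (real l + 1)\<^sup>2 * \<alpha> ^ (2 * l) * K\<^sup>2 * W0 / (?\<Theta> * ?\<gamma>\<^sup>2)"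
  proof (rule HE_bad_le[OF Th T2 W _ Apow])
    show "\<alpha> \<le> ?A" unfolding A_eq using C50 by simp
    show "\<bar>\<sigma> i\<bar> \<le> 1" if "i < n" for i using sg(1)[OF that] by auto
  qed (use al X0 in auto)
  have t1: "4 * (real l + 1) * real n * W0 / ?\<eta> ^ (2 * 2 ^ k) \<le> X powr (- 1/2)"
  proof -
    \<comment> \<open>By the choice of \<open>k\<close>, this power of \<open>?\<eta>\<close> is at
      least n^2 and beats the factor n from the trace.\<close>
    have "2 \<le> \<epsilon> * real (2 * 2 ^ k)" using e0 by (simp add: mult_ac)
    then have "X powr 2 \<le> X powr (\<epsilon> * real (2 * 2 ^ k))" using X1 by (rule powr_mono)
    also have "\<dots> = ?\<eta> powr real (2 * 2 ^ k)" by (rule powr_powr[symmetric])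
    also have "\<dots> = ?\<eta> ^ (2 * 2 ^ k)" using X0 by (intro powr_realpow) simp
    finally have e: "X powr 2 \<le> ?\<eta> ^ (2 * 2 ^ k)" .
    have "4 * (real l + 1) * real n * W0 / ?\<eta> ^ (2 * 2 ^ k) = (4 * (real l + 1) * W0) * X / ?\<eta> ^ (2 * 2 ^ k)"
      by (simp add: X_def)
    also have "\<dots> \<le> X powr (1/2) * X / X powr 2"
      using P4 e X0 W00 by (intro frac_le mult_right_mono) auto
    also have "\<dots> = X powr (- 1/2)"
    proof -
      have "X powr (1/2) * X / X powr 2 = X powr (1/2) * X powr 1 / X powr 2" using X0 by simp
      also have "\<dots> = X powr (- 1/2)" by (simp only: powr_add[symmetric] powr_diff[symmetric]) simp
      finally show ?thesis .
    qed
    finally show ?thesis .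
  qed
  have t2: "8 * real l * \<alpha> ^ l * W0 / (real n * ?\<delta>\<^sup>2) \<le> X powr (- 1/4)"
  proof -
    have "X * ?\<delta>\<^sup>2 = 4 * (X powr 1 * (X powr (- 1/4) * X powr (- 1/4)))" using X0 by (simp add: power2_eq_square)
    also have "\<dots> = 4 * X powr (1/2)" by (simp only: powr_add[symmetric]) simp
    finally have den: "X * ?\<delta>\<^sup>2 = 4 * X powr (1/2)" .
    have "8 * real l * \<alpha> ^ l * W0 / (real n * ?\<delta>\<^sup>2) = (2 * real l * W0) * \<alpha> ^ l / X powr (1/2)"
      unfolding X_def[symmetric] den by simp
    also have "\<dots> \<le> X powr (1/8) * X powr (1/8) / X powr (1/2)"
      using P5 l al W00 by (intro divide_right_mono mult_mono) auto
    also have "\<dots> = X powr (- 1/4)" by (simp only: powr_add[symmetric] powr_diff[symmetric]) simp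
    finally show ?thesis .
  qed
  have al2: "\<alpha> ^ (2 * l) \<le> X powr (1/4)"
  proof -
    have "\<alpha> ^ (2 * l) = \<alpha> ^ l * \<alpha> ^ l" by (simp add: mult_2 power_add)
    also have "\<dots> \<le> X powr (1/8) * X powr (1/8)" using l al by (intro mult_mono) auto
    also have "\<dots> = X powr (1/4)" by (simp only: powr_add[symmetric]) simp
    finally show ?thesis .
  qed
  have t3: "2 * (real l + 1)\<^sup>2 * \<alpha> ^ (2 * l) * K\<^sup>2 * W0 / (?\<Theta> * ?\<gamma>\<^sup>2) \<le> X powr (- \<epsilon>)"
  proof -
    have "?\<Theta> * ?\<gamma>\<^sup>2 = X powr (1/2) * (X powr (\<epsilon> - 1/8) * X powr (\<epsilon> - 1/8))" by (simp add: power2_eq_square)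
    also have "\<dots> = X powr (1/4 + 2 * \<epsilon>)" by (simp only: powr_add[symmetric]) (simp add: algebra_simps)
    finally have den: "?\<Theta> * ?\<gamma>\<^sup>2 = X powr (1/4 + 2 * \<epsilon>)" .
    have "2 * (real l + 1)\<^sup>2 * \<alpha> ^ (2 * l) * K\<^sup>2 * W0 / (?\<Theta> * ?\<gamma>\<^sup>2) =
       (2 * (real l + 1)\<^sup>2 * K\<^sup>2 * W0) * \<alpha> ^ (2 * l) / X powr (1/4 + 2 * \<epsilon>)"
      unfolding den by (simp add: mult_ac)
    also have "\<dots> \<le> X powr \<epsilon> * X powr (1/4) / X powr (1/4 + 2 * \<epsilon>)"
      using P6 al2 al W00 by (intro divide_right_mono mult_mono) auto
    also have "\<dots> = X powr (- \<epsilon>)" by (simp only: powr_add[symmetric] powr_diff[symmetric]) simp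
    finally show ?thesis .
  qed
  have eta1: "1 \<le> ?\<eta>" using X1 e0 by (simp add: ge_one_powr_ge_zero)
  have C70: "0 \<le> C7" using CE0 be al by (simp add: C7_def)
  have rho: "\<alpha> ^ l * (real l * (?\<eta>\<^sup>2 * \<alpha> ^ l * ?\<delta>' + ?\<gamma>) + (2 * \<alpha> + 1) * (real l + 1) * ?\<eta> * \<alpha> ^ l * ?\<delta>) \<le> ?\<rho>"
  proof -
    have s2: "\<alpha> ^ (2 * l) * X powr (- 1/4) \<le> 1"
    proof -
      have "\<alpha> ^ (2 * l) * X powr (- 1/4) \<le> X powr (1/4) * X powr (- 1/4)" by (rule mult_right_mono[OF al2]) simp
      also have "\<dots> = 1" unfolding pw using X0 by simp
      finally show ?thesis .
    qed
    \<comment> \<open>The bound n^(1/8) on \<open>\<alpha> ^ l\<close> is exhausted here: it exactly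
      cancels the n^(-1/8) in \<open>?\<gamma>\<close>.\<close>
    have s1: "\<alpha> ^ l * ?\<gamma> \<le> ?\<eta>"
    proof -
      have "\<alpha> ^ l * ?\<gamma> \<le> X powr (1/8) * ?\<gamma>" by (rule mult_right_mono[OF l(2)]) simp
      also have "\<dots> = ?\<eta>" unfolding pw by simp
      finally show ?thesis .
    qed
    have ee: "?\<eta> \<le> ?\<eta>\<^sup>2" using eta1 by (simp add: self_le_power)
    have "\<alpha> ^ l * (real l * (?\<eta>\<^sup>2 * \<alpha> ^ l * ?\<delta>' + ?\<gamma>) + (2 * \<alpha> + 1) * (real l + 1) * ?\<eta> * \<alpha> ^ l * ?\<delta>) =
      real l * (?\<eta>\<^sup>2 * (CE + \<alpha> + \<beta>) * (\<alpha> ^ (2 * l) * X powr (- 1/4)) + \<alpha> ^ l * ?\<gamma>)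
       + (2 * \<alpha> + 1) * (real l + 1) * ?\<eta> * 2 * (\<alpha> ^ (2 * l) * X powr (- 1/4))"
    proof -
      have gen: "s * (m * (h * s * (q * x) + g) + A' * L * e * s * (2 * x)) = m * (h * q * (s * s * x) + s * g) + A' * L * e * 2 * (s * s * x)"
        for s m h q x g A' L e :: real by (simp add: algebra_simps)
      have "\<alpha> ^ (2 * l) = \<alpha> ^ l * \<alpha> ^ l" by (simp only: mult_2 power_add)
      then show ?thesis by (simp only: gen)
    qed
    also have "\<dots> \<le> (real l + 1) * (?\<eta>\<^sup>2 * (CE + \<alpha> + \<beta>) * 1 + ?\<eta>\<^sup>2) + (2 * \<alpha> + 1) * (real l + 1) * ?\<eta>\<^sup>2 * 2 * 1"
    proof (rule add_mono)
      show "real l * (?\<eta>\<^sup>2 * (CE + \<alpha> + \<beta>) * (\<alpha> ^ (2 * l) * X powr (- 1/4)) + \<alpha> ^ l * ?\<gamma>)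
         \<le> (real l + 1) * (?\<eta>\<^sup>2 * (CE + \<alpha> + \<beta>) * 1 + ?\<eta>\<^sup>2)"
        using s1 s2 ee CE0 al be by (intro mult_mono add_mono mult_left_mono) auto
      show "(2 * \<alpha> + 1) * (real l + 1) * ?\<eta> * 2 * (\<alpha> ^ (2 * l) * X powr (- 1/4))
         \<le> (2 * \<alpha> + 1) * (real l + 1) * ?\<eta>\<^sup>2 * 2 * 1"
        using s2 ee al by (intro mult_mono) auto
    qed
    also have "\<dots> = ?\<rho>" by (simp add: C7_def algebra_simps)
    finally show ?thesis .
  qed
  have frob: "frob n (\<lambda>x y. Ab n d ?p x y - (\<alpha> + \<beta> * \<sigma> x * \<sigma> y) / real n) \<le> ?\<delta>'\<^sup>2"
  proof -
    have "frob n (\<lambda>x y. Ab n d ?p x y - (\<alpha> + \<beta> * \<sigma> x * \<sigma> y) / real n) \<le> (?E + (\<alpha> + \<beta>) / sqrt (real n))\<^sup>2"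
    proof (rule frob_remainder_le)
      fix i j assume ij: "i < n" "j < n" "i \<noteq> j"
      have "\<bar>Ab n d ?p i j - (\<alpha> + \<beta> * \<sigma> i * \<sigma> j) / real n\<bar> \<le> (2 * a * (real d)\<^sup>2 * (?D + real d) / real n) / real n"
        unfolding \<alpha>_def \<beta>_def
        by (rule Ab_approx[OF d ab n(1) sg(1) _ _ ij]) (use sg(2) n(3) in \<open>auto simp: X_def\<close>)
      also have "\<dots> \<le> ?E / real n" using E by (rule divide_right_mono) simp
      finally show "\<bar>Ab n d ?p i j - (\<alpha> + \<beta> * \<sigma> i * \<sigma> j) / real n\<bar> \<le> ?E / real n" .
    next
      fix i assume i: "i < n"
      have "\<sigma> i * \<sigma> i = 1" using sg(1)[OF i] by auto
      then show "\<bar>Ab n d ?p i i - (\<alpha> + \<beta> * \<sigma> i * \<sigma> i) / real n\<bar> \<le> (\<alpha> + \<beta>) / real n"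
        using be al by (simp add: Ab_def mult.assoc)
    qed (use CE0 be al n3 in auto)
    also have "\<dots> \<le> ?\<delta>'\<^sup>2"
    proof (rule power_mono)
      have "(\<alpha> + \<beta>) / sqrt (real n) = (\<alpha> + \<beta>) * X powr (- 1/2)"
      proof -
        have "- 1/2 = - (1/2 :: real)" by simp
        then have "X powr (- 1/2) = inverse (X powr (1/2))" by (simp only: powr_minus)
        also have "X powr (1/2) = sqrt (real n)" unfolding X_def by (rule powr_half_sqrt) simp
        finally show ?thesis by (simp only: divide_inverse)
      qed
      also have "\<dots> \<le> (\<alpha> + \<beta>) * X powr (- 1/4)"
        using X1 be al by (intro mult_left_mono powr_mono) auto
      finally show "?E + (\<alpha> + \<beta>) / sqrt (real n) \<le> ?\<delta>'" by (simp add: algebra_simps)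
      show "0 \<le> ?E + (\<alpha> + \<beta>) / sqrt (real n)" using CE0 be al by simp
    qed
    finally show ?thesis .
  qed
  have ev: "saw_event (8 * \<epsilon>) \<alpha> n l \<sigma> H" if H: "H \<subseteq> dsets n d" and g: "good n d ?p \<sigma> k l ?\<eta> \<alpha> ?\<delta> ?\<gamma> H" for H
  proof (rule saw_eventI[OF n3(1)])
    fix x :: "nat \<Rightarrow> real"
    assume x: "sqrt (\<Sum>i<n. (x i)\<^sup>2) = 1" "(\<Sum>i<n. x i * (\<Sum>j<n. saw_mat H l i j)) = 0"
       "(\<Sum>i<n. x i * (\<Sum>j<n. saw_mat H l i j * \<sigma> j)) = 0"
    have dl: "\<bar>\<Sum>i<n. \<sigma> i\<bar> \<le> real n * ?\<delta>"
    proof -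
      have "real n * ?\<delta> = 2 * (X powr 1 * X powr (- 1/4))" using X0 by (simp add: X_def)
      also have "\<dots> = 2 * ?D" by (simp only: powr_add[symmetric]) simp
      finally show ?thesis using sg(2) by simp
    qed
    have "sqrt (\<Sum>i<n. (\<Sum>j<n. saw_mat H l i j * x j)\<^sup>2) \<le> spectral_const l \<alpha> ?\<eta> ?\<rho> * sqrt \<alpha> ^ l"
      by (rule good_norm_bound[OF H n3(2) l(1) g sg(1) dl frob _ _ _ eta1 _ _ _ _ rho x])
         (use CE0 be al in auto)
    also have "\<dots> \<le> real n powr (8 * \<epsilon>) * sqrt \<alpha> ^ l"
    proof (rule mult_right_mono)
      have "spectral_const l \<alpha> ?\<eta> ?\<rho> \<le> (1 + 20 * \<alpha> * C7 + 2 * \<alpha> + C7) * (real l + 1) ^ 4 * ?\<eta> ^ 4"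
        using al eta1 C70 by (intro spectral_const_le) auto
      also have "\<dots> \<le> X powr (4 * \<epsilon>) * ?\<eta> ^ 4" by (rule mult_right_mono[OF P7]) simp
      also have "?\<eta> ^ 4 = X powr (4 * \<epsilon>)" using X0 by (simp add: powr_power mult.commute)
      also have "X powr (4 * \<epsilon>) * X powr (4 * \<epsilon>) = X powr (4 * \<epsilon> + 4 * \<epsilon>)" by (rule pw)
      also have "\<dots> = real n powr (8 * \<epsilon>)" by (simp add: X_def)
      finally show "spectral_const l \<alpha> ?\<eta> ?\<rho> \<le> real n powr (8 * \<epsilon>)" .
    qed (use al in simp)
    finally show "sqrt (\<Sum>i<n. (\<Sum>j<n. saw_mat H l i j * x j)\<^sup>2) \<le> real n powr (8 * \<epsilon>) * sqrt \<alpha> ^ l" .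
  qed
  have "HE n d ?p (\<lambda>H. of_bool (\<not> saw_event (8 * \<epsilon>) \<alpha> n l \<sigma> H)) \<le>
     HE n d ?p (\<lambda>H. of_bool (\<not> good n d ?p \<sigma> k l ?\<eta> \<alpha> ?\<delta> ?\<gamma> H))"
    using ev p_nonneg p_le1 by (intro HE_mono) auto
  then show ?thesis using bad t1 t2 t3 by linarith
qed

lemma polylog_le_powr:
  fixes c C e :: real and l :: "nat \<Rightarrow> nat"
  assumes l: "\<And>n. l n = nat \<lfloor>c * ln (real n)\<rfloor>" and e: "e > 0"
  shows "eventually (\<lambda>n. C * (real (l n) + 1) ^ j \<le> real n powr e) sequentially"
proof -
  \<comment> \<open>The exponent is shared equally among the constant and the \<open>j\<close>
    factors of the power.\<close>
  define e' where "e' = e / (real j + 1)"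
  define c1 where "c1 = \<bar>c\<bar> + 1"
  have "e' + e' * real j = e' * (real j + 1)" by (simp add: algebra_simps)
  also have "\<dots> = e" by (simp add: e'_def)
  finally have e': "e' > 0" "e' + e' * real j = e" using e by (auto simp: e'_def)
  have c1: "c1 > 0" by (simp add: c1_def)
  have 1: "eventually (\<lambda>n::nat. c1 * ln (real n) + 1 \<le> real n powr e') sequentially"
    using e' c1 by real_asymp
  have 2: "eventually (\<lambda>n::nat. \<bar>C\<bar> + 1 \<le> real n powr e') sequentially"
  proof -
    have "filterlim (\<lambda>n::nat. real n powr e') at_top sequentially" using e' by real_asymp
    then show ?thesis by (simp add: filterlim_at_top)
  qed
  show ?thesis using 1 2 eventually_ge_at_top[of 1]
  proof eventually_elim
    case (elim n)
    have ln0: "0 \<le> ln (real n)" using elim by simp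
    have "real (l n) \<le> c1 * ln (real n)"
    proof -
      have "c * ln (real n) \<le> c1 * ln (real n)" using ln0 by (intro mult_right_mono) (auto simp: c1_def)
      moreover have "0 \<le> c1 * ln (real n)" using ln0 c1 by simp
      \<comment> \<open>\<open>nat\<close> sends a negative floor to 0, hence the maximum.\<close>
      moreover have "real (l n) \<le> max 0 (c * ln (real n))"
        unfolding l by (cases "0 \<le> \<lfloor>c * ln (real n)\<rfloor>") (auto simp: le_max_iff_disj)
      ultimately show ?thesis by linarith
    qed
    then have L: "real (l n) + 1 \<le> real n powr e'" using elim by linarith
    have "C * (real (l n) + 1) ^ j \<le> (\<bar>C\<bar> + 1) * (real (l n) + 1) ^ j" by (intro mult_right_mono) auto
    also have "\<dots> \<le> real n powr e' * (real n powr e') ^ j"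
      using elim L by (intro mult_mono power_mono) auto
    also have "\<dots> = real n powr e"
      using elim e'(2) by (simp add: powr_power powr_add[symmetric] mult.commute)
    finally show ?case .
  qed
qed

lemma power_l_le_powr:
  assumes "\<alpha> \<ge> 1" "c * ln \<alpha> \<le> 1 / 8" "n \<ge> 1"
  shows "\<alpha> ^ nat \<lfloor>c * ln (real n)\<rfloor> \<le> real n powr (1 / 8)"
proof (cases "0 < \<lfloor>c * ln (real n)\<rfloor>")
  case False
  then show ?thesis using assms by (simp add: ge_one_powr_ge_zero)
next
  case True
  let ?l = "nat \<lfloor>c * ln (real n)\<rfloor>"
  have "\<alpha> ^ ?l = exp (real ?l * ln \<alpha>)" using assms by (simp add: exp_of_nat_mult)
  also have "\<dots> \<le> exp (c * ln (real n) * ln \<alpha>)"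
    using True assms by (intro iffD2[OF exp_le_cancel_iff] mult_right_mono) auto
  also have "\<dots> = exp (ln (real n) * (c * ln \<alpha>))" by (simp only: mult_ac)
  also have "\<dots> \<le> exp (ln (real n) * (1 / 8))"
    using assms by (intro iffD2[OF exp_le_cancel_iff] mult_left_mono) auto
  also have "\<dots> = real n powr (1 / 8)" using assms by (simp add: powr_def)
  finally show ?thesis .
qed

lemma hsbm_prob_saw_event:
  fixes d :: nat and a b c \<epsilon> :: real and l :: "nat \<Rightarrow> nat"
  assumes d: "d \<ge> 3" and ab: "a \<ge> b" "b > 0"
    and al: "beta_par d a b ^ 2 > alpha_par d a b" "alpha_par d a b > 1"
    and c: "c * ln (alpha_par d a b) < 1 / 8"
    and l: "\<And>n. l n = nat \<lfloor>c * ln (real n)\<rfloor>"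
    and eps: "\<epsilon> > 0"
  shows "(\<lambda>n. hsbm_prob n d a b (saw_event (8 * \<epsilon>) (alpha_par d a b) n (l n))) \<longlonglongrightarrow> 1"
proof -
  let ?\<alpha> = "alpha_par d a b" and ?\<beta> = "beta_par d a b"
  obtain k :: nat where k: "1 \<le> 2 ^ k * \<epsilon>"
  proof -
    obtain k :: nat where "1 / \<epsilon> < 2 ^ k" using real_arch_pow[of 2 "1 / \<epsilon>"] by auto
    then show thesis using eps by (intro that[of k]) (simp add: field_simps)
  qed
  define R :: nat where "R = max (2 * 2 ^ k) 4"
  define CE where "CE = 4 * a * (real d)\<^sup>2"
  define C5 where "C5 = 2 * ?\<beta> + CE"
  define C7 where "C7 = (CE + ?\<alpha> + ?\<beta>) + 1 + 2 * (2 * ?\<alpha> + 1)"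
  define K where "K = ?\<alpha> + ?\<beta> + 1 + 2 * a * (real d)\<^sup>2"
  define err where "err n = real n powr (- 1/2) + real n powr (- 1/4) + real n powr (- \<epsilon>)" for n :: nat
  define W1 where "W1 = (4 * (real R)\<^sup>2 * (real d)\<^sup>2) ^ R"
  have W1: "(4 * (real R)\<^sup>2 * (real d)\<^sup>2 * L ^ 6) ^ R = W1 * L ^ (6 * R)" for L :: real
    by (simp add: W1_def power_mult_distrib power_mult)
  have a0: "0 < a" using ab by simp
  have be0: "0 \<le> ?\<beta>" using ab by (simp add: beta_par_def)
  have C50: "0 \<le> C5" using a0 be0 by (simp add: C5_def CE_def)
  note pl = polylog_le_powr[OF l]
  have ex: "(0::real) < 1/2" "(0::real) < 1/4" "(0::real) < 1/8" "0 < \<epsilon>" "0 < 4 * \<epsilon>" using eps by simp_all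
  have asym: "eventually (\<lambda>n::nat. a * (real d)\<^sup>2 \<le> real n - 1) sequentially"
    "eventually (\<lambda>n::nat. real d + real n powr (3/4) \<le> real n / 2) sequentially"
    "eventually (\<lambda>n::nat. real d \<le> real n powr (3/4)) sequentially"
    "eventually (\<lambda>n::nat. CE * real n powr (- 1/4) \<le> 1) sequentially"
    by real_asymp+
  have main: "eventually (\<lambda>n. hsbm_prob n d a b (saw_event (8 * \<epsilon>) ?\<alpha> n (l n)) \<le> 1 \<and>
      1 - err n - real n / (2 * real n powr (3/4))\<^sup>2 \<le> hsbm_prob n d a b (saw_event (8 * \<epsilon>) ?\<alpha> n (l n))) sequentially"
    using asym eventually_ge_at_top[of "2 * d"]
      pl[OF ex(1), where C = "2 * real d + 2" and j = 1]
      pl[OF ex(1), where C = "K * (4 * (real R)\<^sup>2 * (real d) ^ 3) ^ (R + 1)" and j = "5 * (R + 1)"]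
      pl[OF ex(2), where C = "4 * 2 ^ k * C5" and j = 1]
      pl[OF ex(1), where C = "4 * W1" and j = "6 * R + 1"] pl[OF ex(3), where C = "2 * W1" and j = "6 * R + 1"]
      pl[OF ex(4), where C = "2 * K\<^sup>2 * W1" and j = "6 * R + 2"]
      pl[OF ex(5), where C = "1 + 20 * ?\<alpha> * C7 + 2 * ?\<alpha> + C7" and j = 4]
  proof eventually_elim
    case (elim n)
    let ?L = "real (l n) + 1" and ?D = "real n powr (3/4)"
    let ?W0 = "(4 * (real R)\<^sup>2 * (real d)\<^sup>2 * ?L ^ 6) ^ R"
    have n1: "n \<ge> 3" "n \<ge> 1" using elim(5) d by auto
    have err0: "0 \<le> err n" by (simp add: err_def)
    have W0: "0 \<le> W1" by (simp add: W1_def)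
    have bal: "HE n d (edge_prob a b d n \<sigma>) (\<lambda>H. of_bool (\<not> saw_event (8 * \<epsilon>) ?\<alpha> n (l n) \<sigma> H)) \<le> err n"
      if s: "\<sigma> \<in> PiE {..<n} (\<lambda>_. {-1, 1})" and b: "\<bar>\<Sum>i<n. \<sigma> i\<bar> \<le> 2 * ?D" for \<sigma>
    proof (cases "l n = 0")
      case True
      then have "(\<lambda>H. of_bool (\<not> saw_event (8 * \<epsilon>) ?\<alpha> n (l n) \<sigma> H)) = (\<lambda>H. 0 :: real)"
        using saw_event_0[OF n1(1)] by simp
      then show ?thesis using err0 by (simp add: HE_const)
    next
      case False
      show ?thesis unfolding err_def
      proof (rule balanced_bound[where k = k and R = R])
        show "d \<ge> 3" "a \<ge> b" "b > 0" "?\<beta>\<^sup>2 > ?\<alpha>" "?\<alpha> > 1" "0 < \<epsilon>" "1 \<le> 2 ^ k * \<epsilon>" "R = max (2 * 2 ^ k) 4"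
          by (fact d ab al eps k R_def)+
        show "2 * d \<le> n" by (fact elim)
        show "a * (real d)\<^sup>2 \<le> real (n - 1)" using elim(1) n1 by (simp add: of_nat_diff)
        show "real d + real n powr (3/4) \<le> real n / 2" "real d \<le> real n powr (3/4)" by (fact elim)+
        show "4 * a * (real d)\<^sup>2 * real n powr (- 1/4) \<le> 1" using elim(4) by (simp only: CE_def)
        show "l n > 0" using False by simp
        show "?\<alpha> ^ l n \<le> real n powr (1/8)" unfolding l using power_l_le_powr[of ?\<alpha> c n] al c n1 by simp
        have "2 * (real d * real (l n) + 1) \<le> (2 * real d + 2) * ?L ^ 1" by (simp add: algebra_simps)
        then show "2 * (real d * real (l n) + 1) \<le> real n powr (1/2)" using elim(6) by linarith
        have "(4 * (real R)\<^sup>2 * (real d) ^ 3 * ?L ^ 5) ^ (R + 1) = (4 * (real R)\<^sup>2 * (real d) ^ 3) ^ (R + 1) * ?L ^ (5 * (R + 1))"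
          by (simp only: power_mult_distrib power_mult)
        then show "(?\<alpha> + ?\<beta> + 1 + 2 * a * (real d)\<^sup>2) * (4 * (real R)\<^sup>2 * (real d) ^ 3 * ?L ^ 5) ^ (R + 1) \<le> real n powr (1/2)"
          using elim(7) by (simp only: K_def mult.assoc)
        have "4 * 2 ^ k * real (l n) * C5 \<le> 4 * 2 ^ k * C5 * ?L ^ 1" using C50 by (simp add: algebra_simps)
        then have "4 * 2 ^ k * real (l n) * C5 \<le> real n powr (1/4)" using elim(8) by linarith
        then show "4 * 2 ^ k * real (l n) * (2 * ?\<beta> + 4 * a * (real d)\<^sup>2) \<le> real n powr (1/4)" by (simp only: C5_def CE_def)
        have "4 * ?L * ?W0 = 4 * W1 * ?L ^ (6 * R + 1)" unfolding W1 by (simp add: mult_ac)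
        then show "4 * ?L * ?W0 \<le> real n powr (1/2)" using elim(9) by linarith
        have "2 * real (l n) * ?W0 \<le> 2 * ?L * ?W0" unfolding W1 using W0 by (intro mult_right_mono) auto
        also have "\<dots> = 2 * W1 * ?L ^ (6 * R + 1)" unfolding W1 by (simp add: mult_ac)
        finally show "2 * real (l n) * ?W0 \<le> real n powr (1/8)" using elim(10) by linarith
        have "2 * ?L\<^sup>2 * K\<^sup>2 * ?W0 = 2 * K\<^sup>2 * W1 * ?L ^ (6 * R + 2)" unfolding W1 by (simp add: power_add mult_ac power2_eq_square)
        then have "2 * ?L\<^sup>2 * K\<^sup>2 * ?W0 \<le> real n powr \<epsilon>" using elim(11) by linarith
        then show "2 * ?L\<^sup>2 * (?\<alpha> + ?\<beta> + 1 + 2 * a * (real d)\<^sup>2)\<^sup>2 * ?W0 \<le> real n powr \<epsilon>" by (simp only: K_def)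
        show "(1 + 20 * ?\<alpha> * (4 * a * (real d)\<^sup>2 + ?\<alpha> + ?\<beta> + 1 + 2 * (2 * ?\<alpha> + 1)) + 2 * ?\<alpha> +
            (4 * a * (real d)\<^sup>2 + ?\<alpha> + ?\<beta> + 1 + 2 * (2 * ?\<alpha> + 1))) * ?L ^ 4 \<le> real n powr (4 * \<epsilon>)"
          using elim(12) by (simp only: C7_def CE_def)
        show "\<sigma> i \<in> {-1, 1}" if "i < n" for i using s that by auto
      qed (fact b)
    qed
    have p01: "0 \<le> edge_prob a b d n \<sigma> e \<and> edge_prob a b d n \<sigma> e \<le> 1" if "e \<in> dsets n d" for \<sigma> e
    proof -
      have "a * (real d)\<^sup>2 \<le> real (n - 1)" using elim(1) n1 by (simp add: of_nat_diff)
      then have "hprob a d n \<le> 1" using d elim(5) by (intro hprob_le_1) auto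
      then have "edge_prob a b d n \<sigma> e \<le> 1" using edge_prob_le[OF ab(1), of d n \<sigma> e] by simp
      then show ?thesis using edge_prob_nonneg ab by blast
    qed
    have D0: "0 < ?D" using n1 by simp
    show ?case
      using hsbm_prob_bounds[OF p01 D0 bal err0] by blast
  qed
  have lim: "(\<lambda>n. 1 - err n - real n / (2 * real n powr (3/4))\<^sup>2) \<longlonglongrightarrow> 1"
  proof -
    have pw: "(\<lambda>n. real n powr (- s)) \<longlonglongrightarrow> 0" if "s > 0" for s :: real
      using that by (intro tendsto_neg_powr filterlim_real_sequentially) auto
    have "(\<lambda>n::nat. real n / (2 * real n powr (3/4))\<^sup>2) \<longlonglongrightarrow> 0" by real_asymp
    then have "(\<lambda>n. 1 - (real n powr (- (1/2)) + real n powr (- (1/4)) + real n powr (- \<epsilon>)) - real n / (2 * real n powr (3/4))\<^sup>2)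
      \<longlonglongrightarrow> 1 - (0 + 0 + 0) - 0"
      by (intro tendsto_diff tendsto_add tendsto_const pw) (use eps in auto)
    then show ?thesis by (simp add: err_def)
  qed
  show ?thesis
  proof (rule tendsto_sandwich[OF _ _ lim tendsto_const])
    show "eventually (\<lambda>n. 1 - err n - real n / (2 * real n powr (3/4))\<^sup>2 \<le> hsbm_prob n d a b (saw_event (8 * \<epsilon>) ?\<alpha> n (l n))) sequentially"
      using main by eventually_elim blast
    show "eventually (\<lambda>n. hsbm_prob n d a b (saw_event (8 * \<epsilon>) ?\<alpha> n (l n)) \<le> 1) sequentially"
      using main by eventually_elim blast
  qed
qed

theorem theorem4p6:
  fixes d :: nat and a b c \<epsilon> :: real and l :: "nat \<Rightarrow> nat"
  assumes "d \<ge> 3" and "a \<ge> b" and "b > 0"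
    and "beta_par d a b ^ 2 > alpha_par d a b" and "alpha_par d a b > 1"
    and "c * ln (alpha_par d a b) < 1 / 8"
    and "\<And>n. l n = nat \<lfloor>c * ln (real n)\<rfloor>"
    and "\<epsilon> > 0"
  shows "(\<lambda>n. hsbm_prob n d a b (\<lambda>\<sigma> H.
            Sup {sqrt (\<Sum>i<n. (\<Sum>j<n. saw_mat H (l n) i j * x j)\<^sup>2) | x :: nat \<Rightarrow> real.
                   sqrt (\<Sum>i<n. (x i)\<^sup>2) = 1 \<and>
                   (\<Sum>i<n. x i * (\<Sum>j<n. saw_mat H (l n) i j)) = 0 \<and>
                   (\<Sum>i<n. x i * (\<Sum>j<n. saw_mat H (l n) i j * \<sigma> j)) = 0}
            \<le> real n powr \<epsilon> * sqrt (alpha_par d a b) ^ (l n)))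
         \<longlonglongrightarrow> 1"
proof -
  \<comment> \<open>Rescaling \<epsilon> absorbs the factor 8 lost in
    \<open>balanced_bound\<close>.\<close>
  have "(\<lambda>n. hsbm_prob n d a b (saw_event (8 * (\<epsilon> / 8)) (alpha_par d a b) n (l n))) \<longlonglongrightarrow> 1"
    by (rule hsbm_prob_saw_event[where c = c]) (use assms in auto)
  then show ?thesis by (simp add: saw_event_def[abs_def])
qed

end
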